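(* Let $p$ be a prime and $q$ a prime power. For every integer $r\geq0$, $$F^{\mathrm{Sp}}_{r+1}(p,q,x)=\frac{\exp\Big(\sum_{n\geq1}(q^n+1)_p^r\frac{x^n}{2n}\Big)}{\exp\Big(\sum_{n\geq1}(q^n-1)_p^r\frac{x^n}{2n}\Big)}$$ as formal power series in $x$.
   Context: For a natural number $m$, $m_p$ denotes the $p$-part of $m$ (the largest power of $p$ dividing $m$). For a prime power $q$ and $n\geq1$, $\mathrm{Sp}_{2n}(q)$ is the isometry group of $\mathbf{F}_q^{2n}$ with the nondegenerate alternating form $\langle u,v\rangle=\sum_{i=1}^n(u_iv_{-i}-u_{-i}v_i)$, acting on the poset $\mathrm{L}^*_{2n}(\mathbf{F}_q)$ of nonzero proper totally isotropic subspaces. $\widetilde{\chi}$ is the reduced Euler characteristic of (the order complex of) a poset and $C_\Pi(A)$ the subposet of $A$-fixed elements. For $r\geq1$, the $r$th $p$-primary equivariant reduced Euler characteristic is $$\widetilde{\chi}^p_r(\mathrm{Sp}_{2n}(q))=\frac{1}{|\mathrm{Sp}_{2n}(q)|}\sum_{(X_1,\dots,X_r)}\widetilde{\chi}\big(C_{\mathrm{L}^*_{2n}(\mathbf{F}_q)}(\langle X_1,\dots,X_r\rangle)\big),$$ the sum running over all commuting $r$-tuples of elements of $\mathrm{Sp}_{2n}(q)$ such that $X_2,\dots,X_r$ have $p$-power order (equivalently, homomorphisms $\mathbf{Z}\times\mathbf{Z}_p^{r-1}\to\mathrm{Sp}_{2n}(q)$, $\mathbf{Z}_p$ the $p$-adic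 integers). Define $F^{\mathrm{Sp}}_r(p,q,x)=1-\sum_{n\geq1}\widetilde{\chi}^p_r(\mathrm{Sp}_{2n}(q))x^n$. *)

theory Defs
  imports
    "HOL-Computational_Algebra.Computational_Algebra"
    "HOL-Library.Cardinality"
    "HOL-Algebra.Generated_Groups"
    "HOL-Algebra.Multiplicative_Group"
    "Jordan_Normal_Form.VS_Connect"
begin

text \<open>
  The field \<open>F\<^sub>q\<close> is a type \<open>'a\<close> of class \<^class>\<open>field\<close> and \<^class>\<open>finite\<close> with \<open>q\<close> elements, and
  \<open>F\<^sub>q\<^sup>2\<^sup>n\<close> is \<open>carrier_vec (2 * n)\<close>. For \<open>1 \<le> i \<le> n\<close> the coordinate \<open>u\<^sub>i\<close> is stored at position
  \<open>i - 1\<close> and the coordinate \<open>u\<^sub>-\<^sub>i\<close> at position \<open>n + i - 1\<close>.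
\<close>

definition sp_form :: "nat \<Rightarrow> 'a :: field vec \<Rightarrow> 'a vec \<Rightarrow> 'a" where
  "sp_form n u v = (\<Sum>i<n. u $ i * v $ (n + i) - u $ (n + i) * v $ i)"

definition Sp :: "'a :: field itself \<Rightarrow> nat \<Rightarrow> 'a mat monoid" where
  "Sp ty n =
     \<lparr> carrier = {A \<in> carrier_mat (2 * n) (2 * n). invertible_mat A \<and>
         (\<forall>u \<in> carrier_vec (2 * n). \<forall>v \<in> carrier_vec (2 * n).
            sp_form n (A *\<^sub>v u) (A *\<^sub>v v) = sp_form n u v)},
       monoid.mult = (*),
       one = 1\<^sub>m (2 * n) \<rparr>"

text \<open>The poset \<open>L\<^sup>*\<^sub>2\<^sub>n(F\<^sub>q)\<close>, ordered by inclusion.\<close>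

definition isotropic_subspaces :: "'a :: field itself \<Rightarrow> nat \<Rightarrow> 'a vec set set" where
  "isotropic_subspaces ty n =
     {W. VectorSpace.subspace class_ring W (module_vec ty (2 * n)) \<and>
         W \<noteq> {0\<^sub>v (2 * n)} \<and> W \<noteq> carrier_vec (2 * n) \<and>
         (\<forall>u \<in> W. \<forall>v \<in> W. sp_form n u v = 0)}"

text \<open>
  Reduced Euler characteristic of the order complex of a finite set \<open>P\<close> of sets ordered by inclusion:
  a nonempty chain \<open>C\<close> is a simplex of dimension \<open>card C - 1\<close>. The empty poset has value \<open>-1\<close>.
\<close>

definition reduced_euler_char :: "'b set set \<Rightarrow> int" where
  "reduced_euler_char P =
     (\<Sum>C | subset.chain P C \<and> C \<noteq> {}. (-1) ^ (card C - 1)) - 1"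

text \<open>\<open>C\<^sub>\<Pi>(A)\<close> for a set \<open>A\<close> of matrices acting on a poset \<open>\<Pi>\<close> of sets of vectors.\<close>

definition fixed_subposet :: "'a :: field vec set set \<Rightarrow> 'a mat set \<Rightarrow> 'a vec set set" where
  "fixed_subposet P A = {W \<in> P. \<forall>X \<in> A. (\<lambda>v. X *\<^sub>v v) ` W = W}"

text \<open>The \<open>r\<close>-tuples \<open>(X\<^sub>1, \<dots>, X\<^sub>r)\<close> are lists; \<open>X\<^sub>1\<close> is not required to have \<open>p\<close>-power order.\<close>

definition commuting_tuples :: "('g, 'm) monoid_scheme \<Rightarrow> nat \<Rightarrow> nat \<Rightarrow> 'g list set" where
  "commuting_tuples G p r =
     {Xs. length Xs = r \<and> set Xs \<subseteq> carrier G \<and>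
          (\<forall>X \<in> set Xs. \<forall>Y \<in> set Xs. X \<otimes>\<^bsub>G\<^esub> Y = Y \<otimes>\<^bsub>G\<^esub> X) \<and>
          (\<forall>X \<in> set (tl Xs). \<exists>k. group.ord G X = p ^ k)}"

definition equivariant_euler_char ::
    "'a :: {field, finite} itself \<Rightarrow> nat \<Rightarrow> nat \<Rightarrow> nat \<Rightarrow> rat" where
  "equivariant_euler_char ty p r n =
     (\<Sum>Xs \<in> commuting_tuples (Sp ty n) p r.
        of_int (reduced_euler_char
          (fixed_subposet (isotropic_subspaces ty n) (generate (Sp ty n) (set Xs)))))
     / of_nat (order (Sp ty n))"

definition F_Sp :: "'a :: {field, finite} itself \<Rightarrow> nat \<Rightarrow> nat \<Rightarrow> rat fps" where
  "F_Sp ty p r = 1 - Abs_fps (\<lambda>n. if n = 0 then 0 else equivariant_euler_char ty p r n)"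

definition p_part :: "nat \<Rightarrow> nat \<Rightarrow> nat" where
  "p_part p m = p ^ multiplicity p m"

text \<open>
  \<open>exp f\<close> as a formal power series. Composition \<open>oo\<close> is substitution only when \<open>f\<close> has constant term \<open>0\<close>.
\<close>

definition exp_fps :: "rat fps \<Rightarrow> rat fps" where
  "exp_fps f = fps_exp 1 oo f"

end

(*
The sum over commuting tuples (A, Y_1, ..., Y_r) is evaluated by letting A run through the stabiliser of
the remaining tuple and of a flag of invariant isotropic subspaces; by orbit counting the coefficient of
x^n is the alternating sum of the numbers of isometry classes of symplectic spaces of dimension 2n with
commuting isometries Y_i and a flag of k invariant isotropic subspaces.

If p does not divide q, replace the p-power order condition by Y_i^P = 1 for a large power P of p. The
tuple then makes the space a semisimple module over the ring of Frobenius-equivariant functions on the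
characters z in L^r, z_i^P = 1, L the algebraic closure. Splitting off hyperbolic planes and unitary lines
shows that such flagged modules are classified by multiplicities g_1, ..., g_k (nonzero, one for each flag
step) and m (of the remaining symplectic space, invariant under inversion of z, even at z = 1/z). Hence the
series is the sum of H (1 - G)^k, that is H / G, where G and H count multiplicities g and m by total
value. The logarithmic derivatives of G and H count the z with z^(q^j) = z and z^(q^j) = 1/z, and these
numbers are (q^j - 1)_p^r and (q^j + 1)_p^r.

If p divides q, a nontrivial unipotent Y among the Y_i makes the poset of fixed subspaces contractible:
retract W to the intersection with K = ker (Y - 1), then to the sum with the intersection of K and im (Y - 1).
What remains is the sum for r = 0, which does not involve p and was found to vanish with another prime.
*)
theory Submission
  imports
    Defs
    "HOL-Algebra.Algebraic_Closure_Type"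
    "HOL-Library.Function_Algebras"
    "HOL-Library.Product_Plus"
begin

subsection \<open>The Frobenius map on an algebraic closure\<close>

text \<open>The unrestricted entry A is spent on orbit counting, so r + 1 entries on the left give
  r-th powers on the right. Working with points z and Frobenius avoids splitting the ring into
  fields: linear algebra over a factor becomes a statement about values at one point of an orbit,
  and multiplicities are read off from cardinalities. The classification is a Witt theorem with
  flags. Characteristic two shapes it: the form is required to be alternating as well as skew,
  nothing in the field is divided by 2, and om (c w) w vanishes for symmetric c because c is a norm.
  A unitary line fills one orbit while the other blocks fill two, so 2 x H' = (N + M) H beside x G'
  = N G, with N and M the series of the two point counts. Hence F = H / G satisfies 2 x F' = (M - N)
  F, the source of the denominators 2n. No single P serves all n: it must be a multiple of the
  p-power orders in Sp_2n(q) and bound q^j + 1 for j up to n. So every coefficient is compared with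
  its own P. In the defining characteristic the right-hand side is 1, since q^n + 1 and q^n - 1 are
  prime to p.\<close>

lemma card_field_gt_1: "CARD('a :: {field, finite}) > 1"
proof -
 have "card {0, 1 :: 'a} \<le> CARD('a)" by (intro card_mono) auto
 thus ?thesis by simp
qed

lemma power_card_field:
 fixes x :: "'a :: {field, finite}"
 shows "x ^ CARD('a) = x"
proof (cases "x = 0")
 case False
 have "x * (\<Prod>y\<in>UNIV-{0}. x * y) = x * x ^ (CARD('a) - 1) * \<Prod>(UNIV-{0})"
  by (simp add: prod.distrib mult_ac)
 also have "x * x ^ (CARD('a) - 1) = x ^ Suc (CARD('a) - 1)"
  by (subst power_Suc) auto
 also have "Suc (CARD('a) - 1) = CARD('a)"
  using finite_UNIV_card_ge_0[where ?'a = 'a] by simp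
 also have "(\<Prod>y\<in>UNIV-{0}. x * y) = (\<Prod>y\<in>UNIV-{0}. y)"
  by (rule prod.reindex_bij_witness[of _ "%y. y / x" "%y. x * y"]) (use False in auto)
 finally show ?thesis
  by simp
qed (use finite_UNIV_card_ge_0[where ?'a = 'a] in auto)

text \<open>Translation by 1 permutes the field, so the sums of all y + 1 and of all y agree; their
  difference is q times 1.\<close>

lemma of_nat_card_field: "of_nat CARD('a) = (0 :: 'a :: {field, finite})"
proof -
 have "(\<Sum>y\<in>UNIV. (y::'a) + 1) = (\<Sum>y\<in>UNIV. y)"
  by (rule sum.reindex_bij_witness[of _ "%y. y - 1" "%y. y + 1"]) auto
 thus ?thesis by (simp add: sum.distrib)
qed

text \<open>\<open>(X + 1)\<^sup>q - X\<^sup>q - 1\<close> has degree below \<open>q\<close> and vanishes on all of \<open>F\<^sub>q\<close>.\<close>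

lemma of_nat_choose_card_field:
 assumes "0 < i" "i < CARD('a :: {field, finite})"
 shows "of_nat (CARD('a) choose i) = (0 :: 'a)"
proof -
 define q where "q = CARD('a)"
 define f :: "'a Polynomial.poly" where
  "f = (\<Sum>i\<in>{0<..<q}. Polynomial.monom (of_nat (q choose i)) i)"
 have q: "q > 1" using card_field_gt_1[where 'a = 'a] by (simp add: q_def)
 have "poly f x = 0" for x
 proof -
  have "x + 1 = (x + 1) ^ q" by (simp add: q_def power_card_field)
  also have "... = (\<Sum>i\<le>q. of_nat (q choose i) * x ^ i)"
   by (simp add: binomial_ring)
  also have "{..q} = insert 0 (insert q {0<..<q})" using q by auto
  also have "(\<Sum>i\<in>.... of_nat (q choose i) * x ^ i) = 1 + (x ^ q + poly f x)"
   using q by (simp add: f_def poly_sum poly_monom)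
  also have "x ^ q = x" by (simp add: q_def power_card_field)
  finally show ?thesis by (simp add: algebra_simps)
 qed
 have deg: "Polynomial.degree f < q"
  unfolding f_def using q by (intro Polynomial.degree_sum_less) (auto intro: le_less_trans[OF Polynomial.degree_monom_le])
 have "f = 0"
 proof (rule ccontr)
  assume "f ~= 0"
  hence "card {x. poly f x = 0} \<le> Polynomial.degree f"
   by (intro card_poly_roots_bound)
  with \<open>!!x. poly f x = 0\<close> deg show False by (simp add: q_def)
 qed
 hence "Polynomial.coeff f i = 0" by simp
 thus ?thesis
  using assms by (simp add: f_def Polynomial.coeff_sum q_def)
qed

definition frob :: "'a :: {field, finite} alg_closure => 'a alg_closure" where
 "frob x = x ^ CARD('a)"

lemma card_pos [simp]: "0 < CARD('a :: {field, finite})"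
 by (simp add: finite_UNIV_card_ge_0)

lemma frob_0 [simp]: "frob 0 = 0" and frob_1 [simp]: "frob 1 = 1"
 by (simp_all add: frob_def)

lemma frob_mult [simp]: "frob (x * y) = frob x * frob y"
 by (simp add: frob_def power_mult_distrib)

lemma frob_inverse [simp]: "frob (inverse x) = inverse (frob x)"
 by (simp add: frob_def power_inverse)

lemma frob_power [simp]: "frob (x ^ n) = frob x ^ n"
 by (simp add: frob_def flip: power_mult) (simp add: mult.commute)

lemma frob_add [simp]: "frob (x + y) = frob x + frob (y :: 'a :: {field, finite} alg_closure)"
proof -
 define q where "q = CARD('a)"
 have q: "q > 1" using card_field_gt_1[where 'a = 'a] by (simp add: q_def)
 have "(x + y) ^ q = (\<Sum>i\<le>q. of_nat (q choose i) * x ^ i * y ^ (q - i))"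
  by (rule binomial_ring)
 also have "... = (\<Sum>i\<in>{0, q}. of_nat (q choose i) * x ^ i * y ^ (q - i))"
 proof (intro sum.mono_neutral_right ballI)
  fix i assume "i \<in> {..q} - {0, q}"
  hence "of_nat (q choose i) = (0 :: 'a)"
   unfolding q_def by (intro of_nat_choose_card_field) auto
  hence "to_ac (of_nat (q choose i) :: 'a) = 0" by simp
  hence "of_nat (q choose i) = (0 :: 'a alg_closure)" by (simp only: to_ac_of_nat)
  thus "of_nat (q choose i) * x ^ i * y ^ (q - i) = 0" by simp
 qed (use q in auto)
 also have "... = x ^ q + y ^ q" using q by simp
 finally show ?thesis by (simp add: frob_def q_def)
qed

lemma frob_uminus [simp]: "frob (- x) = - frob x"
 using frob_add[of x "- x"] by (simp add: eq_neg_iff_add_eq_0 add.commute)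

lemma frob_diff [simp]: "frob (x - y) = frob x - frob y"
 using frob_add[of x "- y"] by simp

lemma frob_sum [simp]: "frob (sum f A) = (\<Sum>i\<in>A. frob (f i))"
 by (induction A rule: infinite_finite_induct) auto

lemma frob_prod [simp]: "frob (prod f A) = (\<Prod>i\<in>A. frob (f i))"
 by (induction A rule: infinite_finite_induct) auto

lemma frob_to_ac [simp]: "frob (to_ac c) = to_ac c"
 by (simp add: frob_def power_card_field flip: to_ac_power)

lemma frob_eq_0_iff [simp]: "frob x = 0 \<longleftrightarrow> x = 0"
 by (simp add: frob_def)

lemma frob_eq_iff [simp]: "frob x = frob y \<longleftrightarrow> x = y"
 using frob_eq_0_iff[of "x - y"] by (simp del: frob_eq_0_iff)

lemma frob_funpow: "(frob ^^ n) x = (x :: 'a :: {field, finite} alg_closure) ^ (CARD('a) ^ n)"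
proof (induction n)
 case (Suc n)
 thus ?case by (simp add: frob_def mult.commute flip: power_mult)
qed simp

lemma card_roots_poly_le:
 fixes p :: "'b :: idom Polynomial.poly"
 assumes "p ~= 0" "!!x. x \<in> A ==> poly p x = 0"
 shows "finite A" "card A \<le> Polynomial.degree p"
proof -
 have "A \<subseteq> {x. poly p x = 0}" using assms by auto
 moreover have "finite {x. poly p x = 0}" using assms(1) by (rule poly_roots_finite)
 ultimately show "finite A" "card A \<le> Polynomial.degree p"
  using card_poly_roots_bound[OF assms(1)] by (auto intro: finite_subset dest: card_mono)
qed

lemma degree_monom_diff:
 assumes "m < n"
 shows "Polynomial.degree (Polynomial.monom 1 n - Polynomial.monom 1 m :: 'b :: comm_ring_1 Polynomial.poly) = n"
proof (rule antisym)
 show "Polynomial.degree (Polynomial.monom 1 n - Polynomial.monom 1 m :: 'b Polynomial.poly) \<le> n"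
  using assms by (intro Polynomial.degree_diff_le) (auto intro: order_trans[OF Polynomial.degree_monom_le])
 show "n \<le> Polynomial.degree (Polynomial.monom 1 n - Polynomial.monom 1 m :: 'b Polynomial.poly)"
  using assms by (intro Polynomial.le_degree) simp
qed

text \<open>The q embedded elements of the base field already exhaust the roots of X^q - X, a
  polynomial of degree q.\<close>

lemma frob_fixed_iff:
 fixes x :: "'a :: {field, finite} alg_closure"
 shows "frob x = x \<longleftrightarrow> x \<in> range to_ac"
proof
 assume x: "frob x = x"
 define q where "q = CARD('a)"
 have q: "q > 1" using card_field_gt_1[where 'a = 'a] by (simp add: q_def)
 define f :: "'a alg_closure Polynomial.poly" where
  "f = Polynomial.monom 1 q - Polynomial.monom 1 1"
 have deg: "Polynomial.degree f = q"
  unfolding f_def using q by (intro degree_monom_diff) simp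
 hence "f ~= 0" using q by auto
 have root: "poly f y = 0 \<longleftrightarrow> frob y = y" for y by (simp add: f_def poly_monom frob_def q_def)
 show "x \<in> range to_ac"
 proof (rule ccontr)
  assume "x ~: range to_ac"
  hence "card (insert x (range to_ac)) = Suc q"
   by (simp add: q_def card_image inj_to_ac)
  moreover have "card (insert x (range to_ac)) \<le> q"
   unfolding deg[symmetric]
  proof (rule card_roots_poly_le(2)[OF \<open>f ~= 0\<close>])
   fix y assume "y \<in> insert x (range to_ac)"
   hence "frob y = y" using x frob_to_ac by blast
   thus "poly f y = 0" using root by blast
  qed
  ultimately show False by simp
 qed
qed auto

text \<open>A multiple root would also be a root of the derivative. So each linear factor in the
  splitting over the algebraically closed field occurs once.\<close>

lemma card_roots_separable:
 fixes f :: "'a :: alg_closed_field Polynomial.poly"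
 assumes "!!x. poly f x = 0 ==> poly (pderiv f) x ~= 0" "f ~= 0"
 shows "card {x. poly f x = 0} = Polynomial.degree f"
proof -
 have ord: "Polynomial.order x f \<le> 1" for x
 proof (rule ccontr)
  assume "\<not> Polynomial.order x f \<le> 1"
  hence "[:- x, 1:] ^ 2 dvd f"
   using dvd_trans[OF le_imp_power_dvd[of 2 "Polynomial.order x f"] Polynomial.order_1[of x f]] by simp
  then obtain g where g: "f = [:- x, 1:] ^ 2 * g" by (elim dvdE)
  have "poly f x = 0" by (simp add: g)
  moreover have "poly (pderiv f) x = 0"
   unfolding g power2_eq_square pderiv_mult by simp
  ultimately show False using assms(1) by blast
 qed
 obtain A where A: "size A = Polynomial.degree f" "f = Polynomial.smult (Polynomial.lead_coeff f) (\<Prod>x\<in>#A. [:-x, 1:])"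
  using alg_closed_imp_factorization[OF assms(2)] by blast
 have "proots (Polynomial.smult (Polynomial.lead_coeff f) (\<Prod>x\<in>#A. [:-x, 1:])) =
   proots (\<Prod>x\<in>#A. [:-x, 1:])"
  using assms(2) by (intro proots_smult) simp
 also have "... = A"
 proof (induction A)
  case (add x A)
  have "(\<Prod>x\<in>#A. [:-x, 1:]) ~= 0" by (auto simp: prod_mset_zero_iff)
  hence "proots ([:-x, 1:] * (\<Prod>x\<in>#A. [:-x, 1:])) = {#x#} + A"
   using add by (subst proots_mult) auto
  thus ?case by (simp only: image_mset_add_mset prod_mset.add_mset) simp
 qed simp
 finally have pr: "proots f = A" by (simp only: A(2)[symmetric])
 have "count A x \<le> 1" for x using ord[of x] assms(2) by (simp flip: pr)
 hence "A = mset_set (set_mset A)"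
 proof (intro multiset_eqI)
  fix x
  have "count A x = 1" if "x \<in># A"
   using that \<open>count A x \<le> 1\<close> by (intro le_antisym) simp_all
  hence "count A x = (if x \<in># A then 1 else 0)"
   by (simp add: not_in_iff)
  thus "count A x = count (mset_set (set_mset A)) x" by (simp add: count_mset_set')
 qed
 hence "size A = card (set_mset A)" by (rule arg_cong[of _ _ size, THEN trans]) simp
 also have "set_mset A = {x. poly f x = 0}" using assms(2) by (simp flip: pr)
 finally show ?thesis using A(1) by simp
qed

text \<open>X^Q - X is separable: Q is zero in the field, so the derivative is the constant
  -1.\<close>

lemma card_frob_fixed:
 assumes "d > 0"
 shows "card {x :: 'a :: {field, finite} alg_closure. (frob ^^ d) x = x} = CARD('a) ^ d"
proof -
 define Q where "Q = CARD('a) ^ d"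
 have Q: "Q > 1" unfolding Q_def by (rule one_less_power[OF card_field_gt_1 assms])
 define f :: "'a alg_closure Polynomial.poly" where
  "f = Polynomial.monom 1 Q - Polynomial.monom 1 1"
 have deg: "Polynomial.degree f = Q"
  unfolding f_def using Q by (intro degree_monom_diff) simp
 have "to_ac (of_nat Q :: 'a) = 0"
  using assms by (simp add: Q_def of_nat_card_field del: to_ac_of_nat)
 hence Q0: "of_nat Q = (0 :: 'a alg_closure)" by (simp only: to_ac_of_nat)
 have "card {x. poly f x = 0} = Polynomial.degree f"
 proof (rule card_roots_separable)
  show "f ~= 0" using deg Q by auto
  show "poly (pderiv f) x ~= 0" for x
   by (simp add: f_def pderiv_diff pderiv_monom Q0)
 qed
 moreover have "poly f x = 0 \<longleftrightarrow> (frob ^^ d) x = x" for x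
  unfolding f_def frob_funpow Q_def by (simp only: poly_diff poly_monom right_minus_eq power_one_right mult_1)
 ultimately show ?thesis
  by (simp only: deg Q_def)
qed

lemma card_roots_of_unity:
 assumes "of_nat N ~= (0 :: 'a :: {field, finite})"
 shows "card {x :: 'a alg_closure. x ^ N = 1} = N"
proof -
 have N: "N > 0" using assms by (auto intro: Nat.gr0I)
 define f :: "'a alg_closure Polynomial.poly" where "f = Polynomial.monom 1 N - Polynomial.monom 1 0"
 have deg: "Polynomial.degree f = N"
  unfolding f_def using N by (intro degree_monom_diff) simp
 have "to_ac (of_nat N :: 'a) ~= 0" using assms by (simp only: to_ac_eq_0_iff not_False_eq_True)
 hence N0: "of_nat N ~= (0 :: 'a alg_closure)" by (simp only: to_ac_of_nat not_False_eq_True)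
 have "card {x. poly f x = 0} = Polynomial.degree f"
 proof (rule card_roots_separable)
  show "f ~= 0" using deg N by auto
 show "poly (pderiv f) x ~= 0" if "poly f x = 0" for x
  proof -
   have "x ~= 0" using that N by (auto simp: f_def poly_monom zero_power)
   thus ?thesis by (simp add: f_def pderiv_diff pderiv_monom poly_monom N0 del: Polynomial.monom_0)
  qed
 qed
 thus ?thesis
  unfolding deg by (simp add: f_def poly_monom)
qed

subsection \<open>Equivariant functions\<close>

text \<open>Abstracts the characters of (Z/P)^r: \<open>ph\<close> is the Frobenius map and
  \<open>io\<close> is inversion. The last axiom holds because a self-inverse character only takes
  the values 1 and -1; it makes the component at such a point an ordinary symplectic space over the
  base field.\<close>

locale frob_set =
 fixes T :: "'t set" and ph io :: "'t => 't" and ty :: "'a :: {field, finite} itself"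
 assumes finite_T: "finite T"
  and ph_T: "z \<in> T ==> ph z \<in> T"
  and inj_ph: "inj_on ph T"
  and io_T: "z \<in> T ==> io z \<in> T"
  and io_io: "z \<in> T ==> io (io z) = z"
  and io_ph: "z \<in> T ==> io (ph z) = ph (io z)"
  and io_fix: "z \<in> T ==> io z = z ==> ph z = z"
begin

definition Eq :: "('t => 'a alg_closure) set" where
 "Eq = {w. \<forall>z\<in>T. w (ph z) = frob (w z)}"

definition orb :: "'t => 't set" where
 "orb z = range (%i. (ph ^^ i) z)"

definition per :: "'t => nat" where
 "per z = card (orb z)"

definition ind :: "'t => 't => 'a alg_closure" where
 "ind z z' = (if z' \<in> orb z then 1 else 0)"

text \<open>The adjoint of w for an invariant form: the adjoint of an isometry is its inverse, and
  on characters this is inversion.\<close>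

definition star :: "('t => 'a alg_closure) => 't => 'a alg_closure" where
 "star w z = w (io z)"

definition cst :: "'a => 't => 'a alg_closure" where
 "cst c z = to_ac c"

text \<open>The sum of the field traces over all orbits. For equivariant w the sum is fixed by
  Frobenius, hence comes from the base field, so \<open>of_ac\<close> is meaningful there.\<close>

definition tr :: "('t => 'a alg_closure) => 'a" where
 "tr w = of_ac (\<Sum>z\<in>T. w z)"

text \<open>On such an orbit inversion acts on the residue field as an automorphism of order two,
  and an invariant form on the component amounts to a Hermitian form.\<close>

definition unitary :: "'t => bool" where
 "unitary z \<longleftrightarrow> io z \<in> orb z & io z ~= z"

lemma funpow_T: "z \<in> T ==> (ph ^^ i) z \<in> T"
 by (induction i) (auto intro: ph_T)

lemma orb_T: "z \<in> T ==> orb z \<subseteq> T"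
 by (auto simp: orb_def intro: funpow_T)

lemma finite_orb: "z \<in> T ==> finite (orb z)"
 using orb_T finite_T finite_subset by blast

lemma self_in_orb [simp]: "z \<in> orb z"
 unfolding orb_def by (rule range_eqI[of _ _ 0]) simp

lemma ph_in_orb: "z' \<in> orb z ==> ph z' \<in> orb z"
 unfolding orb_def by (auto intro: range_eqI[of _ _ "Suc _"])

lemma inj_funpow: "inj_on (ph ^^ i) T"
proof (induction i)
 case (Suc i)
 show ?case
 proof (rule inj_onI)
  fix x y assume xy: "x \<in> T" "y \<in> T" "(ph ^^ Suc i) x = (ph ^^ Suc i) y"
  hence "ph ((ph ^^ i) x) = ph ((ph ^^ i) y)" by simp
  hence "(ph ^^ i) x = (ph ^^ i) y"
   using inj_onD[OF inj_ph] funpow_T xy(1,2) by blast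
  thus "x = y" using Suc xy(1,2) by (auto dest: inj_onD)
 qed
qed simp

lemma ex_period:
 assumes "z \<in> T"
 shows "\<exists>k>0. (ph ^^ k) z = z"
proof -
 have "\<not> inj (%i. (ph ^^ i) z)"
 proof
  assume "inj (%i. (ph ^^ i) z)"
  hence "infinite (orb z)" unfolding orb_def using infinite_UNIV_nat by (auto dest: finite_imageD)
  thus False using finite_orb assms by blast
 qed
 then obtain i j where "i < j" "(ph ^^ i) z = (ph ^^ j) z"
  unfolding inj_on_def by (metis nat_neq_iff)
 moreover have "(ph ^^ j) z = (ph ^^ i) ((ph ^^ (j - i)) z)"
  using \<open>i < j\<close> by (metis funpow_add comp_apply le_add_diff_inverse less_imp_le)
 ultimately have "z = (ph ^^ (j - i)) z"
  using inj_onD[OF inj_funpow] assms funpow_T by metis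
 with \<open>i < j\<close> show ?thesis by (metis zero_less_diff)
qed

lemma per_props:
 assumes "z \<in> T"
 shows per_pos: "per z > 0" and funpow_per: "(ph ^^ per z) z = z"
  and funpow_eq_iff: "(ph ^^ i) z = (ph ^^ j) z \<longleftrightarrow> i mod per z = j mod per z"
  and orb_image: "orb z = (%i. (ph ^^ i) z) ` {..<per z}"
proof -
 define D where "D = (LEAST k. k > 0 & (ph ^^ k) z = z)"
 have D: "D > 0" "(ph ^^ D) z = z"
  using LeastI_ex[OF ex_period[OF assms]] by (simp_all add: D_def)
 have least: "D \<le> k" if "k > 0" "(ph ^^ k) z = z" for k
  unfolding D_def using that by (intro Least_le) simp
 have inj: "inj_on (%i. (ph ^^ i) z) {..<D}"
 proof (rule linorder_inj_onI)
  fix i j :: nat assume ij: "i < j" "i \<in> {..<D}" "j \<in> {..<D}"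
  show "(ph ^^ i) z ~= (ph ^^ j) z"
  proof
   assume "(ph ^^ i) z = (ph ^^ j) z"
   moreover have "(ph ^^ j) z = (ph ^^ i) ((ph ^^ (j - i)) z)"
    using \<open>i < j\<close> by (metis funpow_add comp_apply le_add_diff_inverse less_imp_le)
   ultimately have "z = (ph ^^ (j - i)) z"
    using inj_onD[OF inj_funpow] assms funpow_T by metis
   hence "D \<le> j - i" using ij(1) by (intro least) auto
   thus False using ij by auto
  qed
 qed auto
 have img: "orb z = (%i. (ph ^^ i) z) ` {..<D}"
 proof
  show "orb z \<subseteq> (%i. (ph ^^ i) z) ` {..<D}"
  proof
   fix y assume "y \<in> orb z"
   then obtain i where "y = (ph ^^ i) z" by (auto simp: orb_def)
   hence "y = (ph ^^ (i mod D)) z" using funpow_mod_eq[OF D(2)] by simp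
   thus "y \<in> (%i. (ph ^^ i) z) ` {..<D}" using D(1) by auto
  qed
 qed (auto simp: orb_def)
 have per: "per z = D"
  unfolding per_def img by (simp add: card_image[OF inj])
 show "per z > 0" "(ph ^^ per z) z = z" using D per by simp_all
 show "(ph ^^ i) z = (ph ^^ j) z \<longleftrightarrow> i mod per z = j mod per z"
 proof
  assume "(ph ^^ i) z = (ph ^^ j) z"
  hence "(ph ^^ (i mod D)) z = (ph ^^ (j mod D)) z" by (simp add: funpow_mod_eq[OF D(2)])
  thus "i mod per z = j mod per z" using inj D(1) by (auto simp: per dest: inj_onD)
 next
  assume "i mod per z = j mod per z"
  thus "(ph ^^ i) z = (ph ^^ j) z" by (metis funpow_mod_eq[OF D(2)] per)
 qed
 show "orb z = (%i. (ph ^^ i) z) ` {..<per z}" using img per by simp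
qed

lemma inj_on_per: "z \<in> T ==> inj_on (%i. (ph ^^ i) z) {..<per z}"
 by (auto simp: inj_on_def funpow_eq_iff)

lemma orb_eq:
 assumes "z \<in> T" "z' \<in> orb z"
 shows "orb z' = orb z"
proof
 obtain i where i: "z' = (ph ^^ i) z" using assms(2) by (auto simp: orb_def)
 show "orb z' \<subseteq> orb z"
  unfolding orb_def i by (auto simp flip: funpow_add comp_apply[of "ph ^^ _" "ph ^^ _"])
 have "per z * i \<ge> i" using per_pos[OF assms(1)] by simp
 moreover have "(ph ^^ (per z * i)) z = z"
  using funpow_eq_iff[OF assms(1), of "per z * i" 0] by simp
 ultimately have "(ph ^^ (per z * i - i)) z' = z"
  unfolding i by (metis funpow_add comp_apply le_add_diff_inverse2)
 hence "(ph ^^ j) z = (ph ^^ (j + (per z * i - i))) z'" for j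
  by (simp add: funpow_add)
 thus "orb z \<subseteq> orb z'" unfolding orb_def by auto
qed

lemma in_orb_sym: "z \<in> T ==> z' \<in> orb z ==> z \<in> orb z'"
 using orb_eq self_in_orb by blast

lemma ph_in_orb_iff: "z \<in> T ==> z' \<in> T ==> ph z' \<in> orb z \<longleftrightarrow> z' \<in> orb z"
 by (metis orb_eq ph_T ph_in_orb self_in_orb)

lemma io_funpow: "z \<in> T ==> io ((ph ^^ i) z) = (ph ^^ i) (io z)"
 by (induction i) (auto simp: io_ph funpow_T)

lemma io_orb: "z \<in> T ==> io ` orb z = orb (io z)"
 by (auto simp: orb_def image_image io_funpow)

lemma io_in_orb_iff:
 assumes "z \<in> T" "z' \<in> T"
 shows "io z' \<in> orb z \<longleftrightarrow> z' \<in> orb (io z)"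
proof
 show "z' \<in> orb (io z)" if "io z' \<in> orb z"
  using imageI[OF that, of io] assms by (simp add: io_io io_orb)
 show "io z' \<in> orb z" if "z' \<in> orb (io z)"
  using imageI[OF that, of io] assms by (simp add: io_io io_orb io_T)
qed

lemma inj_io: "inj_on io T"
 by (rule inj_on_inverseI[of _ io]) (rule io_io)

lemma per_io: "z \<in> T ==> per (io z) = per z"
 unfolding per_def
 by (subst io_orb[symmetric], assumption) (rule card_image[OF inj_on_subset[OF inj_io orb_T]])

lemma per_orb: "z \<in> T ==> z' \<in> orb z ==> per z' = per z"
 unfolding per_def using orb_eq[of z z'] by (simp only:)

lemma io_image: "io ` T = T"
 using io_T io_io by (metis image_subset_iff subsetI subset_antisym imageI)

lemma ph_image: "ph ` T = T"
 using finite_T inj_ph ph_T by (intro endo_inj_surj) auto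

lemma Eq_ph: "w \<in> Eq ==> z \<in> T ==> w (ph z) = frob (w z)"
 by (simp add: Eq_def)

lemma Eq_closed [simp, intro]:
 "1 \<in> Eq" "0 \<in> Eq" "cst c \<in> Eq"
 "w \<in> Eq ==> w' \<in> Eq ==> w + w' \<in> Eq"
 "w \<in> Eq ==> w' \<in> Eq ==> w - w' \<in> Eq"
 "w \<in> Eq ==> w' \<in> Eq ==> w * w' \<in> Eq"
 "w \<in> Eq ==> - w \<in> Eq"
 "w \<in> Eq ==> star w \<in> Eq"
 by (auto simp: Eq_def cst_def star_def io_ph io_T)

lemma Eq_inverse: "w \<in> Eq ==> (%z. inverse (w z)) \<in> Eq"
 by (auto simp: Eq_def)

lemma ind_Eq [simp, intro]: "z \<in> T ==> ind z \<in> Eq"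
 by (auto simp: Eq_def ind_def ph_in_orb_iff)

lemma Eq_funpow: "w \<in> Eq ==> z \<in> T ==> w ((ph ^^ i) z) = (frob ^^ i) (w z)"
 by (induction i) (auto simp: Eq_ph funpow_T)

lemma Eq_per: "w \<in> Eq ==> z \<in> T ==> (frob ^^ per z) (w z) = w z"
 using Eq_funpow[of w z "per z"] by (simp add: funpow_per)

lemma funpow_frob_0 [simp]: "(frob ^^ i) 0 = 0"
 by (induction i) auto

lemma funpow_frob_eq_0 [simp]: "(frob ^^ i) x = 0 \<longleftrightarrow> x = 0"
 by (induction i) auto

lemma Eq_orb_0: "w \<in> Eq ==> z \<in> T ==> w z = 0 ==> z' \<in> orb z ==> w z' = 0"
 by (auto simp: orb_def Eq_funpow)

lemma Eq_orb_eq: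
 "w \<in> Eq ==> w' \<in> Eq ==> z \<in> T ==> w z = w' z ==> z' \<in> orb z ==> w z' = w' z'"
 by (auto simp: orb_def Eq_funpow)

text \<open>The value at z is carried along the orbit by Frobenius, and closing up after one period
  is exactly the assumption on x. Thus the factor of the ring at an orbit is the field with q^per
  elements.\<close>

lemma Eq_section:
 assumes "z \<in> T" "(frob ^^ per z) x = x"
 obtains w where "w \<in> Eq" "w z = x" "!!z'. z' \<in> T ==> z' ~: orb z ==> w z' = 0"
proof
 define n where "n z' = (LEAST i. (ph ^^ i) z = z')" for z'
 have n: "(ph ^^ n z') z = z'" if "z' \<in> orb z" for z'
 proof -
  have "EX i. (ph ^^ i) z = z'" using that by (auto simp: orb_def)
  thus ?thesis unfolding n_def by (rule LeastI_ex)
 qed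
 define w where "w z' = (if z' \<in> orb z then (frob ^^ n z') x else 0)" for z'
 show "w \<in> Eq"
  unfolding Eq_def
 proof (intro CollectI ballI)
  fix z' assume z': "z' \<in> T"
  show "w (ph z') = frob (w z')"
  proof (cases "z' \<in> orb z")
   case True
   hence "(ph ^^ n (ph z')) z = (ph ^^ Suc (n z')) z"
    by (simp add: n ph_in_orb)
   hence "n (ph z') mod per z = Suc (n z') mod per z"
    using funpow_eq_iff[OF assms(1)] by blast
   hence "(frob ^^ n (ph z')) x = (frob ^^ Suc (n z')) x"
    by (metis funpow_mod_eq[OF assms(2)])
   thus ?thesis using True by (simp add: w_def ph_in_orb)
  qed (use z' assms(1) in \<open>simp add: w_def ph_in_orb_iff\<close>)
 qed
 have "n z = 0" unfolding n_def by (rule Least_eq_0) simp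
 thus "w z = x" by (simp add: w_def)
 show "w z' = 0" if "z' ~: orb z" for z' using that by (simp add: w_def)
qed

lemma card_Eq_values:
 assumes "z \<in> T"
 shows "card ((%w. w z) ` Eq) = CARD('a) ^ per z"
proof -
 have "(%w. w z) ` Eq = {x. (frob ^^ per z) x = x}"
  using Eq_section[OF assms] Eq_per[OF _ assms] by (auto simp: image_iff)
 thus ?thesis using card_frob_fixed[OF per_pos[OF assms]] by simp
qed

lemma to_ac_tr:
 assumes "w \<in> Eq"
 shows "to_ac (tr w) = (\<Sum>z\<in>T. w z)"
proof -
 have "frob (\<Sum>z\<in>T. w z) = (\<Sum>z\<in>T. w (ph z))"
  using assms by (simp add: Eq_ph)
 also have "... = (\<Sum>z\<in>ph ` T. w z)" by (simp add: sum.reindex inj_ph)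
 finally have "frob (\<Sum>z\<in>T. w z) = (\<Sum>z\<in>T. w z)" by (simp only: ph_image)
 hence "(\<Sum>z\<in>T. w z) \<in> range to_ac" by (simp only: frob_fixed_iff)
 thus ?thesis unfolding tr_def by (rule to_ac_of_ac)
qed

lemma tr_add: "w \<in> Eq ==> w' \<in> Eq ==> tr (w + w') = tr w + tr w'"
 by (subst to_ac_eq_iff[symmetric]) (simp add: to_ac_tr sum.distrib)

lemma tr_cst: "w \<in> Eq ==> tr (cst c * w) = c * tr w"
 by (subst to_ac_eq_iff[symmetric]) (simp add: to_ac_tr sum_distrib_left cst_def)

lemma tr_uminus: "w \<in> Eq ==> tr (- w) = - tr w"
 by (subst to_ac_eq_iff[symmetric]) (simp add: to_ac_tr sum_negf)

lemma tr_cong: "(!!z. z \<in> T ==> w z = w' z) ==> tr w = tr w'"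
 by (simp add: tr_def cong: sum.cong)

text \<open>The trace is given by the polynomial with terms X^(q^i) for i < d. Its degree is at most
  q^(d-1), too small to vanish on all q^d elements of the field.\<close>

lemma tr_ind_nonzero:
 assumes "z \<in> T"
 obtains u where "u \<in> Eq" "tr (ind z * u) ~= 0"
proof -
 define d where "d = per z"
 have d: "d > 0" unfolding d_def by (rule per_pos[OF assms])
 define q where "q = CARD('a)"
 have q: "q > 1" unfolding q_def by (rule card_field_gt_1)
 define f :: "'a alg_closure Polynomial.poly" where
  "f = (\<Sum>i<d. Polynomial.monom 1 (q ^ i))"
 have f: "poly f x = (\<Sum>i<d. (frob ^^ i) x)" for x
  by (simp add: f_def poly_sum poly_monom frob_funpow q_def)
 have "Polynomial.coeff f (q ^ (d - 1)) = (\<Sum>i<d. if i = d - 1 then 1 else 0)"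
  unfolding f_def Polynomial.coeff_sum using q
  by (intro sum.cong) (auto simp: power_inject_exp)
 also have "... = 1" using d by simp
 finally have "f ~= 0" by auto
 have "Polynomial.degree f \<le> q ^ (d - 1)"
  unfolding f_def using q d
  by (intro Polynomial.degree_sum_le) (auto intro!: order_trans[OF Polynomial.degree_monom_le] power_increasing)
 also have "... < q ^ d" using q d by (intro power_strict_increasing) auto
 also have "... = card {x :: 'a alg_closure. (frob ^^ d) x = x}"
  using card_frob_fixed[OF d, where 'a = 'a] by (simp add: q_def)
 finally have "EX x. (frob ^^ d) x = x & poly f x ~= 0"
  using card_roots_poly_le(2)[OF \<open>f ~= 0\<close>, of "{x. (frob ^^ d) x = x}"] by fastforce
 then obtain x where x: "(frob ^^ d) x = x" "poly f x ~= 0" by blast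
 obtain u where u: "u \<in> Eq" "u z = x" using Eq_section[OF assms] x(1) d_def by metis
 have "to_ac (tr (ind z * u)) = (\<Sum>z'\<in>T. (ind z * u) z')"
  using u assms by (intro to_ac_tr) auto
 also have "... = (\<Sum>z'\<in>orb z. u z')"
  using orb_T[OF assms] finite_T by (intro sum.mono_neutral_cong_right) (auto simp: ind_def)
 also have "... = (\<Sum>i<d. u ((ph ^^ i) z))"
  unfolding orb_image[OF assms] d_def by (simp add: sum.reindex inj_on_per[OF assms])
 also have "... = poly f x" using u assms by (simp add: f Eq_funpow)
 finally have "tr (ind z * u) ~= 0" using x(2) by auto
 with u(1) show ?thesis by (rule that)
qed

lemma tr_nondeg:
 assumes "w \<in> Eq" "z \<in> T" "w z ~= 0"
 obtains u where "u \<in> Eq" "tr (ind z * (w * u)) ~= 0"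
proof -
 obtain u where u: "u \<in> Eq" "tr (ind z * u) ~= 0" using tr_ind_nonzero[OF assms(2)] by blast
 \<comment> \<open>Away from the orbit of z, where \<open>inverse\<close> may return its default
   value 0, both sides are killed by \<open>ind z\<close>.\<close>
 have "tr (ind z * (w * ((%z. inverse (w z)) * u))) = tr (ind z * u)"
 proof (rule tr_cong)
  fix z' assume z': "z' \<in> T"
  show "(ind z * (w * ((%z. inverse (w z)) * u))) z' = (ind z * u) z'"
  proof (cases "z' \<in> orb z")
   case True
   hence "w z' ~= 0" using assms z' Eq_orb_0[of w z' z] in_orb_sym[OF assms(2) True] by auto
   thus ?thesis by simp
  qed (simp add: ind_def)
 qed
 thus ?thesis using u that[of "(%z. inverse (w z)) * u"] assms(1) Eq_inverse by auto
qed

section \<open>Orbits stable under inversion\<close>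

text \<open>If inversion is the shift by e with 0 < e < per, then twice the shift is the identity,
  so the period divides 2e and hence equals 2e.\<close>

lemma unitary_exp:
 assumes "z \<in> T" "unitary z"
 obtains e where "e > 0" "per z = 2 * e" "io z = (ph ^^ e) z"
proof -
 have "io z \<in> orb z" "io z ~= z" using assms by (auto simp: unitary_def)
 then obtain e where e: "e < per z" "io z = (ph ^^ e) z"
  using orb_image[OF assms(1)] by auto
 have "e > 0" using e \<open>io z ~= z\<close> by (cases e) auto
 have "z = io (io z)" using assms by (simp add: io_io)
 also have "... = (ph ^^ (e + e)) z"
  unfolding e(2) using assms(1) by (simp add: io_funpow e(2) funpow_add)
 finally have "(ph ^^ (e + e)) z = (ph ^^ 0) z" by simp
 hence "(e + e) mod per z = 0" using funpow_eq_iff[OF assms(1)] by (metis mod_0)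
 hence "per z dvd e + e" by blast
 then obtain k where k: "e + e = per z * k" by (elim dvdE)
 have "per z * k < per z * 2" using e(1) k by linarith
 hence "k < 2" by (metis mult_less_cancel1)
 moreover have "k ~= 0"
 proof
  assume "k = 0"
  hence "e + e = 0" using k by (simp only: mult_0_right)
  with \<open>e > 0\<close> show False by linarith
 qed
 ultimately have "k = 1" by linarith
 hence "per z = 2 * e" using k by (simp only: mult_1_right mult_2)
 show ?thesis by (rule that) fact+
qed

text \<open>The norm to the subfield with q^e elements is onto. A root x of x^(1 + q^e) = t exists
  in the algebraic closure, and since t is fixed by the e-th Frobenius power, x is automatically
  fixed by the 2e-th.\<close>

lemma unitary_norm:
 assumes "z \<in> T" "unitary z" "t \<in> Eq" "t (io z) = t z"
 obtains s where "s \<in> Eq" "s z * s (io z) = t z"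
proof -
 obtain e where e: "e > 0" "per z = 2 * e" "io z = (ph ^^ e) z"
  using unitary_exp[OF assms(1,2)] .
 obtain x where x: "x ^ (1 + CARD('a) ^ e) = t z"
  using nth_root_exists[of "1 + CARD('a) ^ e" "t z"] by auto
 have te: "(frob ^^ e) (t z) = t z"
  using assms(4) Eq_funpow[OF assms(3,1), of e] e(3) by simp
 have fx: "x * (frob ^^ e) x = t z" using x by (simp add: frob_funpow)
 have fm: "(frob ^^ i) (a * b) = (frob ^^ i) a * (frob ^^ i) b" for i a b
  by (induction i) auto
 have "(frob ^^ per z) x = x"
 proof (cases "x = 0")
  case False
  define y where "y = (frob ^^ e) x"
  have "y * (frob ^^ e) y = (frob ^^ e) (x * y)"
   by (simp add: fm y_def)
  also have "x * y = t z" using fx by (simp only: y_def)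
  also have "(frob ^^ e) (t z) = x * y" using te fx by (simp only: y_def)
  also have "... = y * x" by (rule mult.commute)
  finally have eq: "y * (frob ^^ e) y = y * x" .
  have "y ~= 0" using False by (simp add: y_def)
  with eq have "(frob ^^ e) y = x" by (simp only: mult_cancel_left simp_thms)
  thus ?thesis by (simp add: e(2) mult_2 funpow_add y_def)
 qed simp
 then obtain s where s: "s \<in> Eq" "s z = x" using Eq_section[OF assms(1)] by metis
 have "s (io z) = (frob ^^ e) x" unfolding e(3) using Eq_funpow[OF s(1) assms(1)] s(2) by simp
 thus ?thesis using that[OF s(1)] s(2) fx by simp
qed

text \<open>Conjugation is not trivial on the residue field, because its fixed field has q^e
  elements instead of q^(2e).\<close>

lemma unitary_nonfixed:
 assumes "z \<in> T" "unitary z"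
 obtains c where "c \<in> Eq" "c (io z) ~= c z"
proof -
 obtain e where e: "e > 0" "per z = 2 * e" "io z = (ph ^^ e) z"
  using unitary_exp[OF assms(1,2)] .
 have q: "CARD('a) > 1" by (rule card_field_gt_1)
 have "\<exists>x :: 'a alg_closure. (frob ^^ per z) x = x & (frob ^^ e) x ~= x"
 proof (rule ccontr)
  assume "\<not> ?thesis"
  hence sub: "{x :: 'a alg_closure. (frob ^^ per z) x = x} \<subseteq> {x. (frob ^^ e) x = x}" by blast
  have "card {x :: 'a alg_closure. (frob ^^ e) x = x} ~= 0"
   unfolding card_frob_fixed[OF e(1)] using q by simp
  hence "finite {x :: 'a alg_closure. (frob ^^ e) x = x}" by (metis card.infinite)
  from card_mono[OF this sub] have "CARD('a) ^ per z \<le> CARD('a) ^ e"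
   using card_frob_fixed[OF per_pos[OF assms(1)], where 'a = 'a] card_frob_fixed[OF e(1), where 'a = 'a]
   by simp
  moreover have "CARD('a) ^ e < CARD('a) ^ per z"
   using q e by (intro power_strict_increasing) auto
  ultimately show False by simp
 qed
 then obtain x :: "'a alg_closure" where x: "(frob ^^ per z) x = x" "(frob ^^ e) x ~= x" by blast
 obtain c where c: "c \<in> Eq" "c z = x" using Eq_section[OF assms(1) x(1)] by metis
 have "c (io z) = (frob ^^ e) x" unfolding e(3) using Eq_funpow[OF c(1) assms(1)] c(2) by simp
 thus ?thesis using that[OF c(1)] c(2) x(2) by simp
qed

lemma unitary_orb:
 assumes "z \<in> T" "unitary z"
 shows "orb (io z) = orb z"
 by (rule orb_eq) (use assms in \<open>simp_all add: unitary_def\<close>)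

lemma not_unitary_cases:
 assumes "z \<in> T" "\<not> unitary z"
 shows "orb (io z) Int orb z = {} \<or> (io z = z & ph z = z)"
proof (cases "io z = z")
 case False
 hence "io z ~: orb z" using assms by (auto simp: unitary_def)
 hence "orb (io z) Int orb z = {}"
  using orb_eq[OF assms(1)] orb_eq[OF io_T[OF assms(1)]] self_in_orb by blast
 thus ?thesis ..
qed (use io_fix assms in auto)

end

subsection \<open>Modules over the ring of equivariant functions\<close>

text \<open>Duality in finite dimension without bases: a functional vanishing on the common kernel
  of S is a combination of S. The induction restricts to the kernel of one member s of S, and a
  single a0 outside this kernel settles the coefficient of s.\<close>

lemma functional_in_span:
 fixes sc :: "'a :: field => 'x => 'x :: ab_group_add"
 assumes "finite S"
  and "!!a b c. a \<in> A ==> b \<in> A ==> a + sc c b \<in> A"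
  and "!!s a b c. s \<in> insert f S ==> a \<in> A ==> b \<in> A ==> s (a + sc c b) = s a + c * s b"
  and "!!a. a \<in> A ==> (!!s. s \<in> S ==> s a = 0) ==> f a = 0"
 shows "EX c. \<forall>a\<in>A. f a = (\<Sum>s\<in>S. c s * s a)"
 using assms
proof (induction S arbitrary: A rule: finite_induct)
 case empty
 thus ?case by simp
next
 case (insert s S)
 define A' where "A' = {a \<in> A. s a = 0}"
 have lin: "t (a + sc c b) = t a + c * t b" if "t \<in> insert f (insert s S)" "a \<in> A" "b \<in> A" for t a b c
  using insert.prems(2) that by blast
 have lin_s: "s (a + sc c b) = s a + c * s b" if "a \<in> A" "b \<in> A" for a b c
  using lin that by blast
 have "EX c. \<forall>a\<in>A'. f a = (\<Sum>s\<in>S. c s * s a)"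
 proof (rule insert.IH)
  show "a + sc c b \<in> A'" if "a \<in> A'" "b \<in> A'" for a b c
   using that insert.prems(1)[of a b c] lin_s[of a b c] by (simp add: A'_def)
  show "t (a + sc c b) = t a + c * t b" if "t \<in> insert f S" "a \<in> A'" "b \<in> A'" for t a b c
   by (rule lin) (use that in \<open>auto simp: A'_def\<close>)
  show "f a = 0" if "a \<in> A'" "!!t. t \<in> S ==> t a = 0" for a
   by (rule insert.prems(3)) (use that in \<open>auto simp: A'_def\<close>)
 qed
 then obtain c where c: "f a = (\<Sum>s\<in>S. c s * s a)" if "a \<in> A'" for a by blast
 show ?case
 proof (cases "A' = A")
  case True
  have "f a = (\<Sum>t\<in>insert s S. (c(s := 0)) t * t a)" if "a \<in> A" for a
  proof -
   have "(\<Sum>t\<in>insert s S. (c(s := 0)) t * t a) = (\<Sum>t\<in>S. c t * t a)"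
    using insert.hyps by (simp, intro sum.cong) auto
   thus ?thesis using c[of a] True that by simp
  qed
  thus ?thesis by blast
 next
  case False
  then obtain a0 where a0: "a0 \<in> A" "s a0 ~= 0" by (auto simp: A'_def)
  \<comment> \<open>What remains of f after subtracting the combination found on the kernel of s. It
    vanishes on that kernel and is therefore a multiple of s.\<close>
  define g where "g a = f a - (\<Sum>t\<in>S. c t * t a)" for a
  have g: "g a = s a / s a0 * g a0" if a: "a \<in> A" for a
  proof -
   define r where "r = - (s a / s a0)"
   have in_A': "a + sc r a0 \<in> A'"
    using insert.prems(1)[OF a a0(1)] lin_s[OF a a0(1)] a0(2) by (simp add: A'_def r_def)
   have "g (a + sc r a0) = 0" using c[OF in_A'] by (simp add: g_def)
   moreover have "g (a + sc r a0) = g a + r * g a0"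
   proof -
    have "f (a + sc r a0) = f a + r * f a0" using lin a a0(1) by blast
    moreover have "(\<Sum>t\<in>S. c t * t (a + sc r a0)) =
      (\<Sum>t\<in>S. c t * t a + r * (c t * t a0))"
     by (intro sum.cong refl) (simp add: lin[OF insertI2[OF insertI2] a a0(1)] algebra_simps)
    ultimately show ?thesis
     by (simp add: g_def sum.distrib sum_distrib_left algebra_simps)
   qed
   ultimately show ?thesis by (simp add: r_def eq_neg_iff_add_eq_0)
  qed
  have "f a = (\<Sum>t\<in>insert s S. (c(s := g a0 / s a0)) t * t a)" if "a \<in> A" for a
  proof -
   have "(\<Sum>t\<in>insert s S. (c(s := g a0 / s a0)) t * t a) = g a0 / s a0 * s a + (\<Sum>t\<in>S. c t * t a)"
    using insert.hyps by (simp, intro sum.cong) auto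
   moreover have "f a = g a + (\<Sum>t\<in>S. c t * t a)" by (simp add: g_def)
   moreover have "g a = g a0 / s a0 * s a" by (subst g[OF that]) simp
   ultimately show ?thesis by (simp only:)
  qed
  thus ?thesis by blast
 qed
qed

text \<open>Modules over the ring of equivariant functions on T. The functions are total, so
  \<open>act_cong\<close> says that only values on T matter. Carriers are sets, which lets every
  submodule be an instance again.\<close>

locale eqmod = frob_set T ph io ty
 for T :: "'t set" and ph io and ty :: "'a :: {field, finite} itself" +
 fixes U :: "'v :: ab_group_add set" and act :: "('t => 'a alg_closure) => 'v => 'v"
 assumes finite_U: "finite U"
  and zero_U: "0 \<in> U"
  and add_U: "u \<in> U ==> v \<in> U ==> u + v \<in> U"
  and act_U: "w \<in> Eq ==> u \<in> U ==> act w u \<in> U"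
  and act_add: "w \<in> Eq ==> u \<in> U ==> v \<in> U ==> act w (u + v) = act w u + act w v"
  and act_plus: "w \<in> Eq ==> w' \<in> Eq ==> u \<in> U ==> act (w + w') u = act w u + act w' u"
  and act_times: "w \<in> Eq ==> w' \<in> Eq ==> u \<in> U ==> act (w * w') u = act w (act w' u)"
  and act_one: "u \<in> U ==> act 1 u = u"
  and act_cong: "w \<in> Eq ==> w' \<in> Eq ==> (!!z. z \<in> T ==> w z = w' z) ==> u \<in> U ==> act w u = act w' u"
begin

definition part :: "'t => 'v set => 'v set" where
 "part z M = {u \<in> M. act (ind z) u = u}"

definition eqsub :: "'v set => bool" where
 "eqsub M \<longleftrightarrow> M \<subseteq> U & 0 \<in> M & (\<forall>u\<in>M. \<forall>v\<in>M. u + v \<in> M) & (\<forall>w\<in>Eq. \<forall>u\<in>M. act w u \<in> M)"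

lemma eqsubD:
 assumes "eqsub M"
 shows "u \<in> M ==> u \<in> U" "0 \<in> M" "u \<in> M ==> v \<in> M ==> u + v \<in> M"
  "w \<in> Eq ==> u \<in> M ==> act w u \<in> M"
 using assms by (auto simp: eqsub_def)

lemma eqsub_U: "eqsub U"
 by (simp add: eqsub_def zero_U add_U act_U)

lemma act_zero: "w \<in> Eq ==> act w 0 = 0"
 using act_add[of w 0 0] by (simp add: zero_U)

lemma act_0: "u \<in> U ==> act 0 u = 0"
 using act_plus[of 0 0 u] by simp

lemma act_uminus: "w \<in> Eq ==> u \<in> U ==> act (- w) u = - act w u"
 using act_plus[of "- w" w u] act_0[of u] by (simp add: eq_neg_iff_add_eq_0)

lemma act_minus: "w \<in> Eq ==> w' \<in> Eq ==> u \<in> U ==> act (w - w') u = act w u - act w' u"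
 using act_plus[of w "- w'" u] act_uminus[of w' u] by simp

lemma act_neg_one: "u \<in> U ==> act (- 1) u = - u"
 using act_uminus[of 1 u] by (simp add: act_one)

lemma uminus_U: "u \<in> U ==> - u \<in> U"
 by (metis act_U act_neg_one Eq_closed(1,7))

lemma diff_U: "u \<in> U ==> v \<in> U ==> u - v \<in> U"
 using add_U[of u "- v"] uminus_U by simp

lemma eqsub_uminus: "eqsub M ==> u \<in> M ==> - u \<in> M"
 by (metis eqsubD(1,4) act_neg_one Eq_closed(1,7))

lemma eqsub_diff: "eqsub M ==> u \<in> M ==> v \<in> M ==> u - v \<in> M"
 using eqsubD(3)[of M u "- v"] eqsub_uminus by simp

lemma act_comm: "w \<in> Eq ==> w' \<in> Eq ==> u \<in> U ==> act w (act w' u) = act w' (act w u)"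
 by (simp add: act_times[symmetric] mult.commute)

lemma ind_mult_self: "ind z * ind z = ind z"
 by (auto simp: ind_def)

lemma part_ind:
 assumes "z \<in> T" "eqsub M" "u \<in> M"
 shows "act (ind z) u \<in> part z M"
 using assms eqsubD[OF assms(2)]
 by (simp add: part_def act_times[symmetric] ind_mult_self)

lemma partD: "u \<in> part z M ==> u \<in> M" "u \<in> part z M ==> act (ind z) u = u"
 by (simp_all add: part_def)

lemma act_part:
 assumes "z \<in> T" "eqsub M" "u \<in> part z M" "w \<in> Eq"
 shows "act w u \<in> part z M"
 using assms eqsubD[OF assms(2)] act_comm[of "ind z" w u] by (simp add: part_def)

lemma part_add:
 assumes "z \<in> T" "eqsub M" "u \<in> part z M" "v \<in> part z M"
 shows "u + v \<in> part z M"
 using assms eqsubD[OF assms(2)] by (simp add: part_def act_add)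

text \<open>On the component of an orbit the ring acts through the residue field: an equivariant
  function is determined on the orbit by its value at z, and \<open>ind z\<close> erases the
  rest.\<close>

lemma act_eq_of_part:
 assumes "z \<in> T" "u \<in> part z U" "w \<in> Eq" "w' \<in> Eq" "w z = w' z"
 shows "act w u = act w' u"
proof -
 have u: "u \<in> U" "act (ind z) u = u" using partD assms(2) by blast+
 have "act w u = act (w * ind z) u" using assms(1,3) u by (simp add: act_times)
 also have "... = act (w' * ind z) u"
 proof (rule act_cong)
  fix x assume "x \<in> T"
  show "(w * ind z) x = (w' * ind z) x"
   using Eq_orb_eq[OF assms(3,4,1,5), of x] by (simp add: ind_def)
 qed (use assms u in auto)
 also have "... = act w' u" using assms(1,4) u by (simp add: act_times)
 finally show ?thesis .
qed

lemma act_eq_0_iff: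
 assumes "z \<in> T" "u \<in> part z U" "u ~= 0" "w \<in> Eq"
 shows "act w u = 0 \<longleftrightarrow> w z = 0"
proof
 have u: "u \<in> U" using partD assms(2) by blast
 show "act w u = 0" if "w z = 0"
  using act_eq_of_part[OF assms(1,2,4), of 0] that u by (simp add: act_0)
 show "w z = 0" if "act w u = 0"
 proof (rule ccontr)
  assume nz: "w z ~= 0"
  define v where "v = (%z. inverse (w z))"
  have v: "v \<in> Eq" unfolding v_def by (rule Eq_inverse[OF assms(4)])
  have "act (v * w) u = act 1 u"
   by (rule act_eq_of_part[OF assms(1,2)]) (use v assms(4) nz in \<open>auto simp: v_def\<close>)
  hence "act v (act w u) = u" using v assms(4) u by (simp add: act_times act_one)
  thus False using that assms(3) v by (simp add: act_zero)
 qed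
qed

lemma act_eq_iff:
 assumes "z \<in> T" "u \<in> part z U" "u ~= 0" "w \<in> Eq" "w' \<in> Eq"
 shows "act w u = act w' u \<longleftrightarrow> w z = w' z"
 using act_eq_0_iff[OF assms(1-3), of "w - w'"] assms partD(1)[OF assms(2)]
 by (simp add: act_minus)

definition cyc :: "'v => 'v set" where
 "cyc u = (%w. act w u) ` Eq"

lemma cyc_eqsub: "u \<in> U ==> eqsub (cyc u)"
 unfolding eqsub_def cyc_def
 by (auto simp: act_U act_plus[symmetric] act_times[symmetric] intro: rev_image_eqI[of 0] simp: act_0)

lemma self_in_cyc: "u \<in> U ==> u \<in> cyc u"
 unfolding cyc_def by (rule rev_image_eqI[of 1]) (auto simp: act_one)

lemma cyc_part: "z \<in> T ==> u \<in> part z U ==> x \<in> cyc u ==> x \<in> part z U"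
 unfolding cyc_def using act_part[OF _ eqsub_U] by auto

lemma cyc_subset: "eqsub M ==> u \<in> M ==> cyc u \<subseteq> M"
 unfolding cyc_def using eqsubD(4) by blast

lemma card_cyc:
 assumes "z \<in> T" "u \<in> part z U" "u ~= 0"
 shows "card (cyc u) = CARD('a) ^ per z"
proof -
 have "bij_betw (%x. act (SOME w. w \<in> Eq & w z = x) u) ((%w. w z) ` Eq) (cyc u)"
 proof (rule bij_betw_imageI)
  have sel: "(SOME w. w \<in> Eq & w z = x) \<in> Eq & (SOME w. w \<in> Eq & w z = x) z = x"
   if "x \<in> (%w. w z) ` Eq" for x
  proof -
   have "EX w. w \<in> Eq & w z = x" using that by blast
   thus ?thesis by (rule someI_ex)
  qed
  show "inj_on (%x. act (SOME w. w \<in> Eq & w z = x) u) ((%w. w z) ` Eq)"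
  proof (rule inj_onI)
   fix x y assume xy: "x \<in> (%w. w z) ` Eq" "y \<in> (%w. w z) ` Eq"
    "act (SOME w. w \<in> Eq & w z = x) u = act (SOME w. w \<in> Eq & w z = y) u"
   have "(SOME w. w \<in> Eq & w z = x) z = (SOME w. w \<in> Eq & w z = y) z"
    using act_eq_iff[OF assms conjunct1[OF sel[OF xy(1)]] conjunct1[OF sel[OF xy(2)]]] xy(3) by blast
   thus "x = y" by (simp only: conjunct2[OF sel[OF xy(1)]] conjunct2[OF sel[OF xy(2)]])
  qed
  show "(%x. act (SOME w. w \<in> Eq & w z = x) u) ` (%w. w z) ` Eq = cyc u"
  proof (intro subset_antisym subsetI)
   fix y assume "y \<in> (%x. act (SOME w. w \<in> Eq & w z = x) u) ` (%w. w z) ` Eq"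
   thus "y \<in> cyc u" using sel unfolding cyc_def by blast
  next
   fix y assume "y \<in> cyc u"
   then obtain w where w: "w \<in> Eq" "y = act w u" unfolding cyc_def by blast
   have wz: "w z \<in> (%w. w z) ` Eq" using w(1) by blast
   have "y = act (SOME w'. w' \<in> Eq & w' z = w z) u"
    unfolding w(2) using sel[OF wz] w(1) by (intro act_eq_of_part[OF assms(1,2)]) auto
   thus "y \<in> (%x. act (SOME w. w \<in> Eq & w z = x) u) ` (%w. w z) ` Eq"
    using wz by blast
  qed
 qed
 thus ?thesis using bij_betw_same_card card_Eq_values[OF assms(1)] by fastforce
qed

lemma part_disjoint:
 assumes "z \<in> T" "z' \<in> T" "z' ~: orb z" "u \<in> part z U"
 shows "act (ind z') u = 0"
proof -
 have "ind z' z = 0" using assms(1-3) in_orb_sym[OF assms(2), of z] by (auto simp: ind_def)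
 hence "act (ind z') u = act 0 u"
  using assms by (intro act_eq_of_part[OF assms(1,4)]) auto
 thus ?thesis using partD(1)[OF assms(4)] by (simp add: act_0)
qed

lemma part_orb: "z \<in> T ==> z' \<in> orb z ==> part z' M = part z M"
 using orb_eq[of z z'] by (simp add: part_def ind_def[abs_def])

text \<open>The indicator functions of the orbits are idempotents with sum 1.\<close>

lemma ex_part_nonzero:
 assumes "eqsub M" "u \<in> M" "u ~= 0"
 shows "\<exists>z\<in>T. act (ind z) u ~= 0"
proof (rule ccontr)
 assume "\<not> ?thesis"
 hence no: "act (ind z) u = 0" if "z \<in> T" for z using that by blast
 have u: "u \<in> U" using eqsubD(1) assms by blast
 have "finite Z ==> Z \<subseteq> T ==>
   act (%x. if \<exists>z\<in>Z. x \<in> orb z then 1 else 0) u = 0 &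
   (%x. if \<exists>z\<in>Z. x \<in> orb z then 1 else 0) \<in> Eq" for Z
 proof (induction Z rule: finite_induct)
  case empty
  have "(%x. if \<exists>z\<in>{}. x \<in> orb z then 1 else (0 :: 'a alg_closure)) = 0" by auto
  thus ?case using u by (simp add: act_0)
 next
  case (insert z Z)
  define e where "e = (%x. if \<exists>z\<in>Z. x \<in> orb z then 1 else (0 :: 'a alg_closure))"
  have z: "z \<in> T" using insert.prems by blast
  have e: "e \<in> Eq" "act e u = 0" using insert.IH insert.prems by (simp_all add: e_def)
  \<comment> \<open>Inclusion and exclusion for indicators: this combination is the indicator of the
    enlarged union of orbits, and it is visibly in the ring and annihilates u.\<close>
  have eq: "(%x. if \<exists>z\<in>insert z Z. x \<in> orb z then 1 else 0) = e + ind z - e * ind z"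
   by (auto simp: e_def ind_def)
  have "e + ind z - e * ind z \<in> Eq" using e z by blast
  moreover have "act (e + ind z - e * ind z) u = 0"
   using e z u no[OF z] by (simp add: act_minus act_plus act_times act_zero)
  ultimately show ?case unfolding eq by blast
 qed
 from this[OF finite_T] have Z: "act (%x. if \<exists>z\<in>T. x \<in> orb z then 1 else 0) u = 0"
  "(%x. if \<exists>z\<in>T. x \<in> orb z then 1 else 0) \<in> Eq" by auto
 have "act (%x. if \<exists>z\<in>T. x \<in> orb z then 1 else 0) u = act 1 u"
 proof (rule act_cong)
  fix z assume "z \<in> T"
  hence "\<exists>z'\<in>T. z \<in> orb z'" using self_in_orb by blast
  thus "(if \<exists>z'\<in>T. z \<in> orb z' then 1 else 0) = (1 :: 't => 'a alg_closure) z" by simp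
 qed (use Z(2) u in auto)
 thus False using Z(1) u assms(3) by (simp add: act_one)
qed

end

lemma (in eqmod) eqmod_eqsub:
 assumes "eqsub M"
 shows "eqmod T ph io M act"
proof unfold_locales
 show "finite M" using assms finite_U by (auto simp: eqsub_def intro: finite_subset)
 fix w w' u
 assume "w \<in> Eq" "w' \<in> Eq" "!!z. z \<in> T ==> w z = w' z" "u \<in> M"
 thus "act w u = act w' u" using eqsubD(1)[OF assms] by (intro act_cong) auto
qed (use eqsubD[OF assms] in \<open>simp_all add: act_add act_plus act_times act_one\<close>)

subsection \<open>Flagged symplectic modules\<close>

text \<open>\<open>om_self\<close> stands beside \<open>om_skew\<close> because in characteristic
  two skewness does not imply it. The flag is indexed by all naturals, is only weakly increasing and
  is constant from k on, so that intersecting it with an orthogonal summand yields a flag of the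
  same kind.\<close>

locale symp = eqmod T ph io ty U act
 for T :: "'t set" and ph io and ty :: "'a :: {field, finite} itself"
  and U :: "'v :: ab_group_add set" and act +
 fixes om :: "'v => 'v => 'a" and W :: "nat => 'v set" and k :: nat
 assumes om_addl: "u \<in> U ==> u' \<in> U ==> v \<in> U ==> om (u + u') v = om u v + om u' v"
  and om_skew: "u \<in> U ==> v \<in> U ==> om v u = - om u v"
  and om_self: "u \<in> U ==> om u u = 0"
  and om_cst: "u \<in> U ==> v \<in> U ==> om (act (cst c) u) v = c * om u v"
  and om_act: "w \<in> Eq ==> u \<in> U ==> v \<in> U ==> om (act w u) v = om u (act (star w) v)"
  and om_nondeg: "u \<in> U ==> (!!v. v \<in> U ==> om u v = 0) ==> u = 0"
  and W_sub: "eqsub (W i)"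
  and W_0: "W 0 = {0}"
  and W_mono: "W i \<subseteq> W (Suc i)"
  and W_top: "k \<le> i ==> W i = W k"
  and W_iso: "u \<in> W i ==> v \<in> W i ==> om u v = 0"
begin

lemma om_addr: "u \<in> U ==> v \<in> U ==> v' \<in> U ==> om u (v + v') = om u v + om u v'"
 using om_skew[of "v + v'" u] om_skew[of v u] om_skew[of v' u] om_addl[of v v' u] add_U[of v v'] by simp

lemma om_0_left [simp]: "v \<in> U ==> om 0 v = 0"
 using om_addl[of 0 0 v] zero_U by (metis add.right_neutral add_left_cancel)

lemma om_0_right [simp]: "v \<in> U ==> om v 0 = 0"
 using om_addr[of v 0 0] zero_U by (metis add.right_neutral add_left_cancel)

lemma om_cstr: "u \<in> U ==> v \<in> U ==> om u (act (cst c) v) = c * om u v"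
 using om_skew[of "act (cst c) v" u] om_skew[of v u] om_cst[of v u c] act_U[of "cst c" v] by simp

lemma om_actr:
 assumes "w \<in> Eq" "u \<in> U" "v \<in> U"
 shows "om u (act w v) = om (act (star w) u) v"
proof -
 have "act (star (star w)) v = act w v"
  using assms by (intro act_cong) (auto simp: star_def io_io)
 thus ?thesis using om_act[of "star w" u v] assms by simp
qed

lemma om_uminusl: "u \<in> U ==> v \<in> U ==> om (- u) v = - om u v"
 using om_addl[of "- u" u v] uminus_U[of u] by (simp add: eq_neg_iff_add_eq_0)

lemma om_diffl: "u \<in> U ==> u' \<in> U ==> v \<in> U ==> om (u - u') v = om u v - om u' v"
 using om_addl[of u "- u'" v] om_uminusl[of u' v] uminus_U[of u'] by simp

lemma om_sumr:
 assumes "finite S" "u \<in> U" "!!s. s \<in> S ==> g s \<in> U"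
 shows "sum g S \<in> U & om u (sum g S) = (\<Sum>s\<in>S. om u (g s))"
 using assms by (induction S rule: finite_induct) (auto simp: zero_U add_U om_addr)

text \<open>The idempotent \<open>ind z\<close> crosses the form as its adjoint, the indicator of
  the inverse orbit, which kills v. So the component at z pairs only with the component at the
  inverse.\<close>

lemma om_parts:
 assumes "z \<in> T" "z' \<in> T" "z' ~: orb (io z)" "u \<in> part z U" "v \<in> part z' U"
 shows "om u v = 0"
proof -
 have u: "u \<in> U" "act (ind z) u = u" and v: "v \<in> U" using partD assms(4,5) by blast+
 have "om u v = om u (act (star (ind z)) v)"
  using om_act[of "ind z" u v] assms(1) u v by auto
 also have "act (star (ind z)) v = act 0 v"
 proof (rule act_eq_of_part[OF assms(2,5)])
  show "star (ind z) z' = (0 :: 't => 'a alg_closure) z'"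
   using assms(1-3) by (simp add: star_def ind_def io_in_orb_iff)
 qed (use assms in auto)
 finally show ?thesis using u v by (simp add: act_0)
qed

text \<open>A nondegenerate pairing of finite vector spaces represents every functional.\<close>

lemma functional_represented:
 assumes A: "A \<subseteq> U" "!!a b. a \<in> A ==> b \<in> A ==> a + b \<in> A" "!!a c. a \<in> A ==> act (cst c) a \<in> A"
  and B: "eqsub B"
  and f: "!!a b. a \<in> A ==> b \<in> A ==> f (a + b) = f a + f b"
   "!!a c. a \<in> A ==> f (act (cst c) a) = c * f a"
  and vanish: "!!a. a \<in> A ==> (!!b. b \<in> B ==> om a b = 0) ==> f a = 0"
 shows "\<exists>b\<in>B. \<forall>a\<in>A. f a = om a b"
proof -
 have BU: "B \<subseteq> U" using B by (simp add: eqsub_def)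
 have finB: "finite B" using BU finite_U by (rule finite_subset)
 define S where "S = (%b a. om a b) ` B"
 have "EX c. \<forall>a\<in>A. f a = (\<Sum>s\<in>S. c s * s a)"
 proof (rule functional_in_span[where sc = "%c. act (cst c)"])
  show "finite S" using finB by (simp add: S_def)
  show "a + act (cst c) b \<in> A" if "a \<in> A" "b \<in> A" for a b c
   using that A by blast
  show "s (a + act (cst c) b) = s a + c * s b" if "s \<in> insert f S" "a \<in> A" "b \<in> A" for s a b c
  proof (cases "s = f")
   case True
   thus ?thesis using f A(3) that by simp
  next
   case False
   hence "s \<in> S" using that(1) by blast
   then obtain x where x: "s = (%a. om a x)" "x \<in> B" unfolding S_def by (elim imageE)
   have "x \<in> U" "a \<in> U" "b \<in> U" "act (cst c) b \<in> U" using x(2) that A BU by blast+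
   thus ?thesis by (simp add: x(1) om_addl om_cst)
  qed
  show "f a = 0" if "a \<in> A" "!!s. s \<in> S ==> s a = 0" for a
   using that by (intro vanish) (auto simp: S_def)
 qed
 then obtain c where c: "!!a. a \<in> A ==> f a = (\<Sum>s\<in>S. c s * s a)" by blast
 define r where "r s = (SOME b. b \<in> B & s = (%a. om a b))" for s
 have r: "r s \<in> B & s = (%a. om a (r s))" if "s \<in> S" for s
 proof -
  have "EX b. b \<in> B & s = (%a. om a b)" using that unfolding S_def by blast
  thus ?thesis unfolding r_def by (rule someI_ex)
 qed
 define b where "b = (\<Sum>s\<in>S. act (cst (c s)) (r s))"
 have finS: "finite S" using finB by (simp add: S_def)
 have inB: "act (cst (c s)) (r s) \<in> B" if "s \<in> S" for s
  using r[OF that] eqsubD(4)[OF B] by blast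
 have "b \<in> B"
  unfolding b_def using finS inB
  by (induction S rule: finite_induct) (auto simp: eqsubD[OF B])
 moreover have "f a = om a b" if a: "a \<in> A" for a
 proof -
  have aU: "a \<in> U" using a A(1) by blast
  have "om a b = (\<Sum>s\<in>S. om a (act (cst (c s)) (r s)))"
   unfolding b_def using om_sumr[OF finS aU, of "%s. act (cst (c s)) (r s)"] inB BU by blast
  also have "... = (\<Sum>s\<in>S. c s * s a)"
  proof (rule sum.cong[OF refl])
   fix s assume s: "s \<in> S"
   have "om a (act (cst (c s)) (r s)) = c s * om a (r s)"
    using r[OF s] BU aU by (intro om_cstr) auto
   also have "om a (r s) = s a" using r[OF s] by metis
   finally show "om a (act (cst (c s)) (r s)) = c s * s a" .
  qed
  finally show ?thesis using c[OF a] by simp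
 qed
 ultimately show ?thesis by blast
qed

text \<open>A hyperbolic pair: two isotropic lines over residue fields, with the pairing normalised
  to the trace. After this normalisation the form on the block depends on z alone.\<close>

definition hyp :: "'t => 'v => 'v => bool" where
 "hyp z v w \<longleftrightarrow> z \<in> T & v \<in> part z U & w \<in> part (io z) U &
   (\<forall>a\<in>Eq. om (act a v) v = 0) & (\<forall>a\<in>Eq. om (act a w) w = 0) &
   (\<forall>a\<in>Eq. om (act a v) w = tr (ind z * a))"

text \<open>A symmetric c is a norm, c = star s * s at z, so the value equals om (s w) (s w), which
  is 0 for an alternating form. This argument is insensitive to characteristic two.\<close>

lemma om_cyc_fixed:
 assumes "z \<in> T" "unitary z" "w \<in> part z U" "c \<in> Eq" "c (io z) = c z"
 shows "om (act c w) w = 0"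
proof -
 have w: "w \<in> U" using partD(1) assms(3) .
 obtain s where s: "s \<in> Eq" "s z * s (io z) = c z"
  using unitary_norm[OF assms(1,2,4,5)] .
 have "act c w = act (star s * s) w"
  by (rule act_eq_of_part[OF assms(1,3)]) (use s assms(4) in \<open>auto simp: star_def mult.commute\<close>)
 also have "... = act (star s) (act s w)" using s(1) w by (simp add: act_times)
 finally have "om (act c w) w = om (act s w) (act s w)"
  using om_actr[OF s(1), of "act s w" w] act_U[OF s(1) w] w by simp
 thus ?thesis using om_self act_U[OF s(1) w] by simp
qed

text \<open>Either the orbits of z and of its inverse are disjoint, and the component at z is
  orthogonal to itself; or z is its own inverse, hence Frobenius-fixed, and c acts on w as a scalar
  of the base field.\<close>

lemma om_cyc_nonunitary:
 assumes "z \<in> T" "\<not> unitary z" "w \<in> part z U" "c \<in> Eq"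
 shows "om (act c w) w = 0"
proof -
 have w: "w \<in> U" using partD(1) assms(3) .
 from not_unitary_cases[OF assms(1,2)] show ?thesis
 proof
  assume "orb (io z) Int orb z = {}"
  hence "z ~: orb (io z)" using self_in_orb by blast
  thus ?thesis
   using act_part[OF assms(1) eqsub_U assms(3,4)] assms by (intro om_parts) auto
 next
  assume fix_z: "io z = z & ph z = z"
  hence "frob (c z) = c z" using Eq_ph[OF assms(4,1)] by simp
  then obtain x where x: "c z = to_ac x" by (auto simp: frob_fixed_iff)
  have "act c w = act (cst x) w"
   by (rule act_eq_of_part[OF assms(1,3,4)]) (auto simp: cst_def x)
  thus ?thesis using om_cst om_self w by simp
 qed
qed

text \<open>Nondegeneracy represents the functional sending c v to the trace of c at z by some
  vector, whose component at the inverse of z is a candidate for w. Only its isotropy can fail, and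
  only on a unitary orbit.\<close>

lemma ex_hyp_partner:
 assumes z: "z \<in> T" and v: "v \<in> part z U" "v ~= 0" and iso: "!!a. a \<in> Eq ==> om (act a v) v = 0"
 shows "EX w. hyp z v w"
proof -
 have vU: "v \<in> U" and vz: "act (ind z) v = v" using partD v(1) by blast+
 \<comment> \<open>Some coefficient c with x = c v. Only its value at z is determined by x, and that
   is all the trace at z depends on.\<close>
 define cf where "cf x = (SOME c. c \<in> Eq & x = act c v)" for x
 have cf: "cf x \<in> Eq & x = act (cf x) v" if "x \<in> cyc v" for x
 proof -
  have "EX c. c \<in> Eq & x = act c v" using that by (auto simp: cyc_def)
  thus ?thesis unfolding cf_def by (rule someI_ex)
 qed
 have trz: "tr (ind z * c) = tr (ind z * c')" if "c \<in> Eq" "c' \<in> Eq" "c z = c' z" for c c'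
 proof (rule tr_cong)
  fix x assume "x \<in> T"
  show "(ind z * c) x = (ind z * c') x"
   using Eq_orb_eq[OF that(1,2) z that(3), of x] by (simp add: ind_def)
 qed
 have f: "tr (ind z * cf (act c v)) = tr (ind z * c)" if "c \<in> Eq" for c
 proof (rule trz)
  have x: "act c v \<in> cyc v" using that by (auto simp: cyc_def)
  show "cf (act c v) \<in> Eq" using cf[OF x] by blast
  show "cf (act c v) z = c z"
   using act_eq_iff[OF z v \<open>cf (act c v) \<in> Eq\<close> that] cf[OF x] by simp
 qed (rule that)
 have "\<exists>b\<in>U. \<forall>a\<in>cyc v. tr (ind z * cf a) = om a b"
 proof (rule functional_represented)
  note cs = cyc_eqsub[OF vU]
  show "cyc v \<subseteq> U" using cs by (simp add: eqsub_def)
  show "a + b \<in> cyc v" if "a \<in> cyc v" "b \<in> cyc v" for a b using eqsubD(3)[OF cs] that .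
  show "act (cst c) a \<in> cyc v" if "a \<in> cyc v" for a c using eqsubD(4)[OF cs _ that] by blast
  show "eqsub U" by (rule eqsub_U)
  show "tr (ind z * cf (a + b)) = tr (ind z * cf a) + tr (ind z * cf b)"
   if "a \<in> cyc v" "b \<in> cyc v" for a b
  proof -
   have ab: "a + b = act (cf a + cf b) v"
    using cf[OF that(1)] cf[OF that(2)] vU act_plus by metis
   have "tr (ind z * cf (a + b)) = tr (ind z * (cf a + cf b))"
    unfolding ab using cf that by (intro f) auto
   also have "... = tr (ind z * cf a) + tr (ind z * cf b)"
    unfolding distrib_left using cf that z by (intro tr_add) auto
   finally show ?thesis .
  qed
  show "tr (ind z * cf (act (cst c) a)) = c * tr (ind z * cf a)" if "a \<in> cyc v" for a c
  proof -
   have ab: "act (cst c) a = act (cst c * cf a) v"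
    using cf[OF that] vU act_times Eq_closed(3) by metis
   have "tr (ind z * cf (act (cst c) a)) = tr (ind z * (cst c * cf a))"
    unfolding ab using cf that by (intro f) auto
   also have "ind z * (cst c * cf a) = cst c * (ind z * cf a)" by (simp only: mult.left_commute)
   also have "tr (cst c * (ind z * cf a)) = c * tr (ind z * cf a)"
    using cf that z by (intro tr_cst) auto
   finally show ?thesis .
  qed
  show "tr (ind z * cf a) = 0" if a: "a \<in> cyc v" "!!b. b \<in> U ==> om a b = 0" for a
  proof -
   have "a \<in> U" using a(1) eqsubD(1)[OF cs] by blast
   hence "a = 0" using a(2) by (rule om_nondeg)
   hence "a = act 0 v" using vU by (simp add: act_0)
   hence "tr (ind z * cf a) = tr (ind z * 0)" using f[of 0] by simp
   thus ?thesis by (simp add: tr_def)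
  qed
 qed
 then obtain w1 where w1: "w1 \<in> U" "!!c. c \<in> Eq ==> om (act c v) w1 = tr (ind z * c)"
  using f by (auto simp: cyc_def)
 \<comment> \<open>Passing to the component at the inverse of z does not disturb the pairing with
   \<open>cyc v\<close>, since multiples of v are orthogonal to the other components.\<close>
 define w0 where "w0 = act (ind (io z)) w1"
 have w0: "w0 \<in> part (io z) U"
  unfolding w0_def using z w1(1) by (intro part_ind eqsub_U io_T)
 have w0U: "w0 \<in> U" using w0 by (rule partD)
 have om_w0: "om (act c v) w0 = tr (ind z * c)" if c: "c \<in> Eq" for c
 proof -
  have cv: "act c v \<in> part z U" using act_part[OF z eqsub_U v(1) c] .
  have "om (act c v) w0 = om (act (star (ind (io z))) (act c v)) w1"
   unfolding w0_def using partD(1)[OF cv] w1(1) z io_T by (intro om_actr) auto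
  also have "act (star (ind (io z))) (act c v) = act 1 (act c v)"
  proof (rule act_eq_of_part[OF z cv])
   have "io z \<in> orb (io z)" by simp
   thus "star (ind (io z)) z = (1 :: 't => 'a alg_closure) z"
    by (simp add: star_def ind_def)
  qed (use z io_T in auto)
  also have "... = act c v" using partD(1)[OF cv] by (rule act_one)
  finally show ?thesis using w1(2)[OF c] by simp
 qed
 show ?thesis
 proof (cases "unitary z")
  case False
  have nu: "\<not> unitary (io z)"
  proof
   assume "unitary (io z)"
   hence "z \<in> orb (io z)" "z ~= io z" using z by (auto simp: unitary_def io_io)
   thus False using False in_orb_sym[OF io_T[OF z]] unfolding unitary_def
    by (metis orb_eq io_T z self_in_orb)
  qed
  have "om (act c w0) w0 = 0" if "c \<in> Eq" for c
   by (rule om_cyc_nonunitary[OF io_T[OF z] nu w0 that])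
  hence "hyp z v w0" unfolding hyp_def using z v(1) w0 iso om_w0 by blast
  thus ?thesis by blast
 next
  case True
  have pz: "part (io z) U = part z U"
   using True z by (intro part_orb) (auto simp: unitary_def)
  have w0z: "w0 \<in> part z U" using w0 pz by simp
  text \<open>Correct \<open>w0\<close> by an element of \<open>cyc v\<close> so that its own span becomes isotropic.\<close>
  define A where "A = (%c. act (c - star c) v) ` Eq"
  define cg where "cg x = (SOME c. c \<in> Eq & x = act (c - star c) v)" for x
  have cg: "cg x \<in> Eq & x = act (cg x - star (cg x)) v" if "x \<in> A" for x
  proof -
   have "EX c. c \<in> Eq & x = act (c - star c) v" using that by (auto simp: A_def)
   thus ?thesis unfolding cg_def by (rule someI_ex)
  qed
  define lam where "lam c = om (act c w0) w0" for c
  have lam_add: "lam (c + c') = lam c + lam c'" if "c \<in> Eq" "c' \<in> Eq" for c c'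
   unfolding lam_def using that w0U by (simp add: act_plus om_addl act_U)
  have lam_diff: "lam (c - c') = lam c - lam c'" if "c \<in> Eq" "c' \<in> Eq" for c c'
   unfolding lam_def using that w0U by (simp add: act_minus om_diffl act_U)
  \<comment> \<open>Two coefficients with the same c - star c at z differ by a symmetric function,
    on which \<open>lam\<close> vanishes. So \<open>lam\<close> descends to a functional on
    \<open>A\<close>, and this functional is what the correction has to cancel.\<close>
  have g: "lam (cg (act (c - star c) v)) = lam c" if c: "c \<in> Eq" for c
  proof -
   have x: "act (c - star c) v \<in> A" using c by (auto simp: A_def)
   define c' where "c' = cg (act (c - star c) v)"
   have c': "c' \<in> Eq" "act (c - star c) v = act (c' - star c') v"
    using cg[OF x] by (simp_all add: c'_def)
   have "(c - star c) z = (c' - star c') z"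
    using act_eq_iff[OF z v, of "c - star c" "c' - star c'"] c c' by auto
   hence "(c - c') (io z) = (c - c') z"
    by (simp add: star_def algebra_simps)
   hence "lam (c - c') = 0"
    unfolding lam_def using c c'(1) by (intro om_cyc_fixed[OF z True w0z]) auto
   thus ?thesis using lam_diff[OF c c'(1)] by (simp add: c'_def)
  qed
  have star_plus: "star (c + c') = star c + star c'" for c c' :: "'t => 'a alg_closure"
   by (auto simp: star_def)
  have "\<exists>b\<in>cyc w0. \<forall>a\<in>A. - lam (cg a) = om a b"
  proof (rule functional_represented)
   show "A \<subseteq> U" unfolding A_def using vU by (auto intro: act_U)
   show "a + b \<in> A" if ab: "a \<in> A" "b \<in> A" for a b
   proof -
    have "a + b = act ((cg a + cg b) - star (cg a + cg b)) v"
     using cg[OF ab(1)] cg[OF ab(2)] vU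
     by (metis (no_types, lifting) Eq_closed(4,5,8) act_plus add_diff_add star_plus)
    thus ?thesis unfolding A_def using cg ab by blast
   qed
   have cst_star: "cst x * c - star (cst x * c) = cst x * (c - star c)" for x c
    by (auto simp: star_def cst_def algebra_simps)
   show actA: "act (cst x) a \<in> A" if a: "a \<in> A" for a x
   proof -
    have "act (cst x) a = act (cst x * (cg a - star (cg a))) v"
     using cg[OF a] vU act_times[of "cst x" "cg a - star (cg a)" v] by simp
    thus ?thesis unfolding A_def cst_star[symmetric] using cg a by blast
   qed
   show "eqsub (cyc w0)" using w0U by (rule cyc_eqsub)
   show "- lam (cg (a + b)) = - lam (cg a) + - lam (cg b)" if ab: "a \<in> A" "b \<in> A" for a b
   proof -
    have "a + b = act ((cg a + cg b) - star (cg a + cg b)) v"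
     using cg[OF ab(1)] cg[OF ab(2)] vU
     by (metis (no_types, lifting) Eq_closed(4,5,8) act_plus add_diff_add star_plus)
    hence "lam (cg (a + b)) = lam (cg a + cg b)" using g cg ab by auto
    thus ?thesis using lam_add cg ab by simp
   qed
   show "- lam (cg (act (cst x) a)) = x * - lam (cg a)" if a: "a \<in> A" for a x
   proof -
    have "act (cst x) a = act (cst x * (cg a - star (cg a))) v"
     using cg[OF a] vU act_times[of "cst x" "cg a - star (cg a)" v] by simp
    hence "lam (cg (act (cst x) a)) = lam (cst x * cg a)"
     unfolding cst_star[symmetric] using g cg a by auto
    also have "... = x * lam (cg a)"
     unfolding lam_def using cg a w0U by (simp add: act_times om_cst act_U)
    finally show ?thesis by simp
   qed
   show "- lam (cg a) = 0" if a: "a \<in> A" "!!b. b \<in> cyc w0 ==> om a b = 0" for a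
   proof -
    define d where "d = cg a - star (cg a)"
    have d: "d \<in> Eq" "a = act d v" using cg[OF a(1)] by (auto simp: d_def)
    have "d z = 0"
    proof (rule ccontr)
     assume "d z ~= 0"
     then obtain u where u: "u \<in> Eq" "tr (ind z * (d * u)) ~= 0" using tr_nondeg[OF d(1) z] by blast
     have "om a (act (star u) w0) = 0" using u(1) by (intro a(2)) (auto simp: cyc_def)
     moreover have "om a (act (star u) w0) = om (act u a) w0"
      using om_act[OF u(1), of a w0] d vU w0U act_U by simp
     moreover have "act u a = act (d * u) v"
      unfolding d(2) using d(1) u(1) vU by (simp add: act_times[symmetric] mult.commute)
     ultimately show False using u om_w0[of "d * u"] d(1) by auto
    qed
    hence "(cg a) (io z) = (cg a) z" by (simp add: d_def star_def)
    hence "lam (cg a) = 0"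
     unfolding lam_def using cg[OF a(1)] by (intro om_cyc_fixed[OF z True w0z]) auto
    thus ?thesis by simp
   qed
  qed
  then obtain b where b: "b \<in> Eq" "!!c. c \<in> Eq ==> - lam c = om (act (c - star c) v) (act b w0)"
   using g by (auto simp: cyc_def A_def)
  define x where "x = act (star b) v"
  define w where "w = w0 + x"
  have xz: "x \<in> part z U" unfolding x_def using act_part[OF z eqsub_U v(1)] b(1) by blast
  have xU: "x \<in> U" using xz by (rule partD)
  have wz: "w \<in> part z U" unfolding w_def by (rule part_add[OF z eqsub_U w0z xz])
  have vv: "om (act c v) (act c' v) = 0" if "c \<in> Eq" "c' \<in> Eq" for c c'
  proof -
   have "om (act c v) (act c' v) = om (act (star c' * c) v) v"
    using om_actr[of c' "act c v" v] act_times[of "star c'" c v] that vU by (simp add: act_U)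
   thus ?thesis using iso that by auto
  qed
  have 1: "om (act c v) w = tr (ind z * c)" if "c \<in> Eq" for c
   using that w0U xU vU vv[of c "star b"] b(1)
   by (simp add: w_def om_addr act_U om_w0 x_def)
  \<comment> \<open>The cross terms add up to om ((c - star c) x) w0, which equals om ((c - star c)
    v) (b w0) = - lam c by the choice of b; the term quadratic in x vanishes because v spans an
    isotropic line.\<close>
  have 2: "om (act c w) w = 0" if c: "c \<in> Eq" for c
  proof -
   have "om (act c w) w = om (act c w0) w0 + om (act c w0) x + (om (act c x) w0 + om (act c x) x)"
    unfolding w_def using w0U xU c
    by (simp add: act_add om_addl om_addr act_U add_U)
   also have "om (act c x) x = 0"
    unfolding x_def using vv[of "c * star b" "star b"] c b(1) vU by (simp add: act_times)
   also have "om (act c w0) x = - om x (act c w0)"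
    using om_skew[of x "act c w0"] xU act_U[OF c w0U] by simp
   also have "om x (act c w0) = om (act (star c) x) w0"
    using om_actr[OF c xU w0U] .
   also have "om (act c w0) w0 + - om (act (star c) x) w0 + (om (act c x) w0 + 0) =
     lam c + om (act (c - star c) x) w0"
    using c xU w0U by (simp add: lam_def act_minus om_diffl act_U)
   also have "om (act (c - star c) x) w0 = om (act (c - star c) v) (act b w0)"
   proof -
    have "act (c - star c) x = act (star b) (act (c - star c) v)"
     unfolding x_def using c b(1) vU by (intro act_comm) auto
    thus ?thesis
     using om_actr[OF b(1), of "act (c - star c) v" w0] c vU w0U by (simp add: act_U)
   qed
   also have "lam c + ... = 0" by (simp add: b(2)[OF c, symmetric])
   finally show ?thesis .
  qed
  have "w \<in> part (io z) U" using wz pz by simp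
  hence "hyp z v w" unfolding hyp_def using z v(1) iso 1 2 by blast
  thus ?thesis by blast
 qed
qed

end

section \<open>Normal form of a unitary line\<close>

context frob_set
begin

definition bet :: "'t => 't => 'a alg_closure" where
 "bet z = (SOME b. b \<in> Eq & (\<exists>c\<in>Eq. tr (ind z * (b * (c - star c))) ~= 0))"

text \<open>For a vector v at a unitary point, c -> om (c v) v is a functional that
  \<open>star\<close> negates. This is one nonzero functional of that type, fixed once for each z
  through the choice of \<open>bet z\<close>; rescaling v will bring every nonzero one to this
  form.\<close>

definition lam0 :: "'t => ('t => 'a alg_closure) => 'a" where
 "lam0 z c = tr (ind z * (bet z * (c - star c)))"

lemma bet_props:
 assumes "z \<in> T" "unitary z"
 shows "bet z \<in> Eq" "\<exists>c\<in>Eq. lam0 z c ~= 0"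
proof -
 obtain c where c: "c \<in> Eq" "c (io z) ~= c z" using unitary_nonfixed[OF assms] .
 hence "c - star c \<in> Eq" "(c - star c) z ~= 0" by (auto simp: star_def)
 from tr_nondeg[OF this(1) assms(1) this(2)] obtain u where
  u: "u \<in> Eq" "tr (ind z * ((c - star c) * u)) ~= 0" by blast
 hence "EX b. b \<in> Eq & (\<exists>c\<in>Eq. tr (ind z * (b * (c - star c))) ~= 0)"
  using c(1) by (intro exI[of _ u]) (auto simp: mult.commute)
 from someI_ex[OF this] show "bet z \<in> Eq" "\<exists>c\<in>Eq. lam0 z c ~= 0"
  by (simp_all add: bet_def lam0_def)
qed

lemma lam0_cong:
 assumes "z \<in> T" "unitary z" "c \<in> Eq" "c' \<in> Eq" "c z = c' z"
 shows "lam0 z c = lam0 z c'"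
 unfolding lam0_def
proof (rule tr_cong)
 fix x assume x: "x \<in> T"
 show "(ind z * (bet z * (c - star c))) x = (ind z * (bet z * (c' - star c'))) x"
 proof (cases "x \<in> orb z")
  case True
  hence "io x \<in> orb z"
   using io_in_orb_iff[OF assms(1) x] unitary_orb[OF assms(1,2)] by simp
  thus ?thesis
   using Eq_orb_eq[OF assms(3,4,1,5)] True by (simp add: star_def)
 qed (simp add: ind_def)
qed

lemma lam0_add:
 assumes "z \<in> T" "unitary z" "c \<in> Eq" "c' \<in> Eq"
 shows "lam0 z (c + c') = lam0 z c + lam0 z c'"
proof -
 have "ind z * (bet z * (c + c' - star (c + c'))) =
   ind z * (bet z * (c - star c)) + ind z * (bet z * (c' - star c'))"
  by (auto simp: star_def algebra_simps)
 thus ?thesis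
  unfolding lam0_def using assms bet_props(1)[OF assms(1,2)] by (simp only:) (intro tr_add; blast)
qed

lemma lam0_cst:
 assumes "z \<in> T" "unitary z" "c \<in> Eq"
 shows "lam0 z (cst x * c) = x * lam0 z c"
proof -
 have "ind z * (bet z * (cst x * c - star (cst x * c))) = cst x * (ind z * (bet z * (c - star c)))"
  by (auto simp: star_def cst_def algebra_simps)
 thus ?thesis
  unfolding lam0_def using assms bet_props(1)[OF assms(1,2)] by (simp only:) (intro tr_cst; blast)
qed

lemma lam0_star:
 assumes "z \<in> T" "unitary z" "c \<in> Eq"
 shows "lam0 z (star c) = - lam0 z c"
proof -
 have "lam0 z (star c) = tr (- (ind z * (bet z * (c - star c))))"
  unfolding lam0_def by (rule tr_cong) (simp add: star_def io_io algebra_simps)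
 thus ?thesis
  unfolding lam0_def using assms bet_props(1)[OF assms(1,2)] by (simp only:) (intro tr_uminus; blast)
qed

end

context symp
begin

definition uvec :: "'t => 'v => bool" where
 "uvec z v \<longleftrightarrow> z \<in> T & unitary z & v \<in> part z U & (\<forall>a\<in>Eq. om (act a v) v = lam0 z a)"

lemma cyc_functional_nondeg:
 assumes "z \<in> T" "v \<in> part z U" "c0 \<in> Eq" "om (act c0 v) v ~= 0" "d \<in> Eq"
  and "!!b. b \<in> Eq ==> om (act (d * b) v) v = 0"
 shows "d z = 0"
proof (rule ccontr)
 assume nz: "d z ~= 0"
 define e where "e = (%z. inverse (d z))"
 have e: "e \<in> Eq" unfolding e_def by (rule Eq_inverse[OF assms(5)])
 have "act (d * (e * c0)) v = act c0 v"
  by (rule act_eq_of_part[OF assms(1,2)]) (use e assms nz in \<open>auto simp: e_def\<close>)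
 moreover have "om (act (d * (e * c0)) v) v = 0" using e assms(3) by (intro assms(6)) blast
 ultimately show False using assms(4) by simp
qed

text \<open>A line on which the form is not identically zero exists by polarisation. There the
  prescribed functional \<open>lam0\<close> differs from the actual one by a factor t; both change
  sign under \<open>star\<close>, so t is symmetric, hence a norm, and rescaling the vector absorbs
  it.\<close>

lemma ex_uvec:
 assumes z: "z \<in> T" "unitary z" and u: "u \<in> part z U" "u ~= 0"
 shows "EX v. uvec z v"
proof -
 have "\<exists>v\<in>part z U. \<exists>c\<in>Eq. om (act c v) v ~= 0"
 proof (rule ccontr)
  assume "\<not> ?thesis"
  hence no: "om (act c v) v = 0" if "v \<in> part z U" "c \<in> Eq" for v c using that by blast
  obtain a where a: "a \<in> Eq" "a (io z) ~= a z" using unitary_nonfixed[OF z] .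
  define y where "y = act (a - star a) u"
  have uU: "u \<in> U" using partD(1)[OF u(1)] .
  have aa: "a - star a \<in> Eq" using a(1) by simp
  have y: "y \<in> part z U" unfolding y_def by (rule act_part[OF z(1) eqsub_U u(1) aa])
  have yU: "y \<in> U" using partD(1)[OF y] .
  \<comment> \<open>Polarisation: expanding the vanishing form at u + w leaves om ((a - star a) u)
    w, so y would be orthogonal to its whole component.\<close>
  have y0: "om y w = 0" if w: "w \<in> part z U" for w
  proof -
   have wU: "w \<in> U" using partD(1)[OF w] .
   have au: "act a u \<in> U" "act a w \<in> U" "act (star a) u \<in> U" using a(1) uU wU act_U by blast+
   have "0 = om (act a (u + w)) (u + w)"
    using no[OF part_add[OF z(1) eqsub_U u(1) w] a(1)] by simp
   also have "... = om (act a u) u + om (act a u) w + (om (act a w) u + om (act a w) w)"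
    using a(1) uU wU au by (simp add: act_add om_addl om_addr add_U)
   also have "om (act a u) u = 0" using no u(1) a(1) by blast
   also have "om (act a w) w = 0" using no w a(1) by blast
   also have "om (act a w) u = - om (act (star a) u) w"
    using om_skew[OF uU au(2)] om_actr[OF a(1) uU wU] by simp
   finally show ?thesis
    unfolding y_def using a(1) uU wU au by (simp add: act_minus om_diffl)
  qed
  have "y = 0"
  proof (rule om_nondeg[OF yU])
   fix x assume x: "x \<in> U"
   have "om y x = om (act (ind z) y) x" using partD(2)[OF y] by simp
   also have "... = om y (act (star (ind z)) x)" using z(1) yU x by (intro om_act) auto
   also have "act (star (ind z)) x = act (ind z) x"
   proof (rule act_cong)
    fix s assume "s \<in> T"
    thus "star (ind z) s = ind z s"
     using io_in_orb_iff[OF z(1)] unitary_orb[OF z] by (simp add: star_def ind_def)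
   qed (use z(1) x in auto)
   also have "om y (act (ind z) x) = 0" by (rule y0[OF part_ind[OF z(1) eqsub_U x]])
   finally show "om y x = 0" .
  qed
  from iffD1[OF act_eq_0_iff[OF z(1) u aa]] \<open>y = 0\<close> have "(a - star a) z = 0"
   by (simp add: y_def)
  thus False using a(2) by (simp add: star_def)
 qed
 then obtain v c0 where v: "v \<in> part z U" and c0: "c0 \<in> Eq" "om (act c0 v) v ~= 0" by blast
 have vU: "v \<in> U" using partD(1)[OF v] .
 have v0: "v ~= 0" using c0 vU act_U by auto
 define L where "L c = om (act c v) v" for c
 have L_star: "L (star c) = - L c" if "c \<in> Eq" for c
  unfolding L_def using om_actr[OF that vU vU] om_skew[OF vU act_U[OF that vU]] om_skew by simp
 have L_act: "om (act c v) (act b v) = L (star b * c)" if "b \<in> Eq" "c \<in> Eq" for b c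
  unfolding L_def using om_actr[OF that(1) act_U[OF that(2) vU] vU] act_times[of "star b" c v] that vU by simp
 have L_cong: "L c = L c'" if "c \<in> Eq" "c' \<in> Eq" "!!z. z \<in> T ==> c z = c' z" for c c'
  unfolding L_def using act_cong[OF that vU] by simp
 have L_nd: "d z = 0" if "d \<in> Eq" "!!b. b \<in> Eq ==> L (d * b) = 0" for d
  using cyc_functional_nondeg[OF z(1) v c0 that(1)] that(2) unfolding L_def by blast
 define cf where "cf x = (SOME c. c \<in> Eq & x = act c v)" for x
 have cf: "cf x \<in> Eq & x = act (cf x) v" if "x \<in> cyc v" for x
 proof -
  have "EX c. c \<in> Eq & x = act c v" using that by (auto simp: cyc_def)
  thus ?thesis unfolding cf_def by (rule someI_ex)
 qed
 have f: "lam0 z (cf (act c v)) = lam0 z c" if "c \<in> Eq" for c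
 proof (rule lam0_cong[OF z])
  have x: "act c v \<in> cyc v" using that by (auto simp: cyc_def)
  show "cf (act c v) \<in> Eq" using cf[OF x] by blast
  show "cf (act c v) z = c z"
   using act_eq_iff[OF z(1) v v0 \<open>cf (act c v) \<in> Eq\<close> that] cf[OF x] by simp
 qed (rule that)
 note cs = cyc_eqsub[OF vU]
 \<comment> \<open>The form on the line is nondegenerate, so \<open>lam0\<close> is represented by a
   vector t' v of the same line; star t' is the factor t.\<close>
 have "\<exists>b\<in>cyc v. \<forall>a\<in>cyc v. lam0 z (cf a) = om a b"
 proof (rule functional_represented)
  show "cyc v \<subseteq> U" using cs by (simp add: eqsub_def)
  show "a + b \<in> cyc v" if "a \<in> cyc v" "b \<in> cyc v" for a b using eqsubD(3)[OF cs] that .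
  show "act (cst c) a \<in> cyc v" if "a \<in> cyc v" for a c using eqsubD(4)[OF cs _ that] by blast
  show "eqsub (cyc v)" by (rule cs)
  show "lam0 z (cf (a + b)) = lam0 z (cf a) + lam0 z (cf b)" if "a \<in> cyc v" "b \<in> cyc v" for a b
  proof -
   have ab: "a + b = act (cf a + cf b) v"
    using cf[OF that(1)] cf[OF that(2)] vU act_plus by metis
   have "lam0 z (cf (a + b)) = lam0 z (cf a + cf b)"
    unfolding ab using cf that by (intro f) auto
   also have "... = lam0 z (cf a) + lam0 z (cf b)"
    using cf that z by (intro lam0_add) auto
   finally show ?thesis .
  qed
  show "lam0 z (cf (act (cst c) a)) = c * lam0 z (cf a)" if "a \<in> cyc v" for a c
  proof -
   have ab: "act (cst c) a = act (cst c * cf a) v"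
    using cf[OF that] vU act_times Eq_closed(3) by metis
   have "lam0 z (cf (act (cst c) a)) = lam0 z (cst c * cf a)"
    unfolding ab using cf that by (intro f) auto
   also have "... = c * lam0 z (cf a)" using cf that z by (intro lam0_cst) auto
   finally show ?thesis .
  qed
  show "lam0 z (cf a) = 0" if a: "a \<in> cyc v" "!!b. b \<in> cyc v ==> om a b = 0" for a
  proof -
   have "L (cf a * b) = 0" if b: "b \<in> Eq" for b
   proof -
    have "om (act (cf a) v) (act (star b) v) = 0"
     using a cf[OF a(1)] b unfolding cyc_def by auto
    hence "L (star (star b) * cf a) = 0" using L_act[of "star b" "cf a"] cf[OF a(1)] b by simp
    moreover have "L (star (star b) * cf a) = L (cf a * b)"
     using cf[OF a(1)] b by (intro L_cong) (auto simp: star_def io_io)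
    ultimately show ?thesis by simp
   qed
   hence "cf a z = 0" using L_nd cf[OF a(1)] by blast
   hence "lam0 z (cf a) = lam0 z 0"
    using cf[OF a(1)] by (intro lam0_cong[OF z]) auto
   also have "... = 0"
   proof -
    have "star 0 = (0 :: 't => 'a alg_closure)" by (auto simp: star_def)
    thus ?thesis by (simp add: lam0_def tr_def)
   qed
   finally show ?thesis .
  qed
 qed
 then obtain t' where t': "t' \<in> Eq" "!!c. c \<in> Eq ==> lam0 z c = om (act c v) (act t' v)"
  using f by (auto simp: cyc_def)
 define t where "t = star t'"
 have t: "t \<in> Eq" "!!c. c \<in> Eq ==> L (t * c) = lam0 z c"
  using t' L_act by (auto simp: t_def)
 \<comment> \<open>Comparing the sign changes of \<open>L\<close> and \<open>lam0\<close> under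
   \<open>star\<close> shows that t and star t define the same functional, hence agree at z.\<close>
 have "L ((t - star t) * c) = 0" if c: "c \<in> Eq" for c
 proof -
  have "L (star t * c) = L (star (t * star c))"
   using t(1) c by (intro L_cong) (auto simp: star_def io_io)
  also have "... = - L (t * star c)" using t(1) c by (intro L_star) blast
  also have "... = L (t * c)" using t(2) c lam0_star[OF z c] by simp
  finally have "L (star t * c) = L (t * c)" .
  moreover have "L (t * c - star t * c) = L (t * c) - L (star t * c)"
   unfolding L_def using t(1) c vU by (simp add: act_minus om_diffl act_U)
  ultimately show ?thesis by (simp add: left_diff_distrib)
 qed
 hence "(t - star t) z = 0" using L_nd[of "t - star t"] t(1) by blast
 hence "t (io z) = t z" by (simp add: star_def)
 then obtain s where s: "s \<in> Eq" "s z * s (io z) = t z" using unitary_norm[OF z t(1)] by blast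
 have "om (act c (act s v)) (act s v) = lam0 z c" if c: "c \<in> Eq" for c
 proof -
  have "om (act c (act s v)) (act s v) = L (star s * (c * s))"
   using L_act[OF s(1), of "c * s"] act_times[OF c s(1) vU] c s(1) by simp
  also have "... = L (t * c)"
   unfolding L_def
   by (rule arg_cong[where f = "%x. om x v"], rule act_eq_of_part[OF z(1) v])
    (use s c t(1) in \<open>auto simp: star_def mult_ac\<close>)
  finally show ?thesis using t(2)[OF c] by simp
 qed
 hence "uvec z (act s v)"
  unfolding uvec_def using z act_part[OF z(1) eqsub_U v s(1)] by blast
 thus ?thesis by blast
qed

section \<open>Orthogonal complements and splitting\<close>

definition perp :: "'v set => 'v set" where
 "perp B = {u \<in> U. \<forall>b\<in>B. om b u = 0}"

definition nondeg :: "'v set => bool" where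
 "nondeg B \<longleftrightarrow> (\<forall>b\<in>B. (\<forall>b'\<in>B. om b b' = 0) --> b = 0)"

text \<open>This holds for all of U as soon as B is nondegenerate, but for a flag step it is a
  condition on the choice of B. It is what allows B to be split off together with the flag.\<close>

definition decomposes :: "'v set => 'v set => bool" where
 "decomposes B M \<longleftrightarrow> (\<forall>x\<in>M. \<exists>b\<in>M Int B. \<exists>u\<in>M Int perp B. x = b + u)"

lemma perp_eqsub:
 assumes "eqsub B"
 shows "eqsub (perp B)"
 unfolding eqsub_def
proof (intro conjI ballI)
 have BU: "b \<in> U" if "b \<in> B" for b using eqsubD(1)[OF assms that] .
 show "perp B \<subseteq> U" by (auto simp: perp_def)
 show "0 \<in> perp B" using BU zero_U by (auto simp: perp_def)
 show "u + v \<in> perp B" if "u \<in> perp B" "v \<in> perp B" for u v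
  using that BU by (auto simp: perp_def add_U om_addr)
 show "act w u \<in> perp B" if "w \<in> Eq" "u \<in> perp B" for w u
 proof -
  have "om b (act w u) = 0" if b: "b \<in> B" for b
  proof -
   have "act (star w) b \<in> B" using eqsubD(4)[OF assms] \<open>w \<in> Eq\<close> b by blast
   thus ?thesis
    using om_actr[OF \<open>w \<in> Eq\<close> BU[OF b], of u] \<open>u \<in> perp B\<close> by (simp add: perp_def)
  qed
  thus ?thesis using that act_U by (simp add: perp_def)
 qed
qed

lemma perpD: "u \<in> perp B ==> u \<in> U" "u \<in> perp B ==> b \<in> B ==> om b u = 0"
 by (simp_all add: perp_def)

lemma nondeg_Int_perp:
 assumes "eqsub B" "nondeg B"
 shows "B Int perp B = {0}"
proof -
 have "b = 0" if "b \<in> B" "b \<in> perp B" for b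
 proof -
  have "om b b' = 0" if b': "b' \<in> B" for b'
   using perpD(2)[OF \<open>b \<in> perp B\<close> b'] om_skew[of b' b] eqsubD(1)[OF assms(1)] b' \<open>b \<in> B\<close> by simp
  thus ?thesis using assms(2) \<open>b \<in> B\<close> by (auto simp: nondeg_def)
 qed
 thus ?thesis using eqsubD(2)[OF assms(1)] eqsubD(2)[OF perp_eqsub[OF assms(1)]] by auto
qed

lemma decomposes_U:
 assumes "eqsub B" "nondeg B"
 shows "decomposes B U"
 unfolding decomposes_def
proof
 fix x assume x: "x \<in> U"
 have BU: "B \<subseteq> U" using assms(1) by (simp add: eqsub_def)
 have "\<exists>b\<in>B. \<forall>a\<in>B. om a x = om a b"
 proof (rule functional_represented[OF BU])
  show "om a x = 0" if "a \<in> B" "!!b. b \<in> B ==> om a b = 0" for a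
  proof -
   have "a = 0" using that assms(2) by (auto simp: nondeg_def)
   thus ?thesis using x by simp
  qed
  show "a + b \<in> B" if "a \<in> B" "b \<in> B" for a b using eqsubD(3)[OF assms(1) that] .
  show "act (cst c) a \<in> B" if "a \<in> B" for a c using eqsubD(4)[OF assms(1) _ that] by simp
  show "eqsub B" by (rule assms(1))
  show "om (a + b) x = om a x + om b x" if "a \<in> B" "b \<in> B" for a b
   using om_addl[of a b x] that BU x by blast
  show "om (act (cst c) a) x = c * om a x" if "a \<in> B" for a c
   using om_cst[of a x c] that BU x by blast
 qed
 then obtain b where b: "b \<in> B" "!!a. a \<in> B ==> om a x = om a b" by blast
 have bU: "b \<in> U" using b(1) BU by blast
 have "om a (x - b) = 0" if "a \<in> B" for a
  using om_addr[of a "x - b" b] b(2)[OF that] that BU x bU diff_U[OF x bU] by auto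
 hence "x - b \<in> perp B" using diff_U[OF x bU] by (simp add: perp_def)
 thus "\<exists>b\<in>U Int B. \<exists>u\<in>U Int perp B. x = b + u"
  using b(1) bU perpD(1) by (intro bexI[of _ b] bexI[of _ "x - b"]) auto
qed

lemma nondeg_perp:
 assumes "eqsub B" "nondeg B"
 shows "nondeg (perp B)"
 unfolding nondeg_def
proof (intro ballI impI)
 fix u assume u: "u \<in> perp B" "\<forall>u'\<in>perp B. om u u' = 0"
 have uU: "u \<in> U" using perpD(1)[OF u(1)] .
 show "u = 0"
 proof (rule om_nondeg[OF uU])
  fix x assume "x \<in> U"
  then obtain b v where bv: "b \<in> U" "b \<in> B" "v \<in> U" "v \<in> perp B" "x = b + v"
   using decomposes_U[OF assms] unfolding decomposes_def by blast
  have "om u b = 0" using perpD(2)[OF u(1) bv(2)] om_skew[of b u] bv(1) uU by simp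
  thus "om u x = 0" using u(2) bv uU by (simp add: om_addr)
 qed
qed

text \<open>Intersecting with a summand may make consecutive flag steps coincide, which the locale
  admits. The inductions on the size of U rest on this.\<close>

lemma symp_sub:
 assumes "eqsub M" "nondeg M"
 shows "symp T ph io M act om (%i. W i Int M) k"
proof -
 interpret M: eqmod T ph io ty M act by (rule eqmod_eqsub[OF assms(1)])
 have MU: "u \<in> U" if "u \<in> M" for u using eqsubD(1)[OF assms(1) that] .
 show ?thesis
 proof unfold_locales
  show "u = 0" if "u \<in> M" "!!v. v \<in> M ==> om u v = 0" for u
   using that assms(2) by (auto simp: nondeg_def)
  show "M.eqsub (W i Int M)" for i
   using W_sub[of i] assms(1) by (auto simp: M.eqsub_def eqsub_def)
  show "W 0 Int M = {0}" using W_0 eqsubD(2)[OF assms(1)] by auto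
  show "W i Int M \<subseteq> W (Suc i) Int M" for i using W_mono by auto
  show "W i Int M = W k Int M" if "k \<le> i" for i using W_top[OF that] by simp
  fix u v assume "u \<in> M" "v \<in> M"
  thus "om v u = - om u v" by (intro om_skew MU)
 qed (use MU om_addl om_self om_cst om_act W_iso in auto)
qed

lemma card_direct_sum:
 assumes "eqsub M1" "eqsub M2" "M1 Int M2 = {0}"
 shows "card ((%(x, y). x + y) ` (M1 \<times> M2)) = card M1 * card M2"
  and "z \<in> T ==> card (part z ((%(x, y). x + y) ` (M1 \<times> M2))) = card (part z M1) * card (part z M2)"
proof -
 have inj: "inj_on (%(x, y). x + y) (M1 \<times> M2)"
 proof (rule inj_onI, clarify)
  fix a b c d assume h: "a \<in> M1" "b \<in> M2" "c \<in> M1" "d \<in> M2" "a + b = c + d"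
  hence eq: "a - c = d - b" by (simp add: algebra_simps)
  have "a - c \<in> M1" using h eqsub_diff[OF assms(1)] by blast
  moreover have "a - c \<in> M2" unfolding eq using h eqsub_diff[OF assms(2)] by blast
  ultimately have "a - c = 0" using assms(3) by blast
  thus "a = c & b = d" using eq by simp
 qed
 show "card ((%(x, y). x + y) ` (M1 \<times> M2)) = card M1 * card M2"
  by (simp add: card_image[OF inj] card_cartesian_product)
 assume z: "z \<in> T"
 have "part z ((%(x, y). x + y) ` (M1 \<times> M2)) = (%(x, y). x + y) ` (part z M1 \<times> part z M2)"
 proof (intro subset_antisym subsetI)
  fix s assume "s \<in> part z ((%(x, y). x + y) ` (M1 \<times> M2))"
  then obtain x y where xy: "x \<in> M1" "y \<in> M2" "s = x + y" "act (ind z) (x + y) = x + y"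
   by (auto simp: part_def)
  have U: "x \<in> U" "y \<in> U" using xy eqsubD(1) assms by blast+
  have a: "act (ind z) x \<in> M1" "act (ind z) y \<in> M2"
   using xy z eqsubD(4)[OF assms(1)] eqsubD(4)[OF assms(2)] by auto
  have "act (ind z) x + act (ind z) y = x + y" using xy(4) U z by (simp add: act_add)
  hence "(case (act (ind z) x, act (ind z) y) of (x, y) => x + y) = (case (x, y) of (x, y) => x + y)" by simp
  from inj_onD[OF inj this] have "act (ind z) x = x" "act (ind z) y = y" using a xy by auto
  thus "s \<in> (%(x, y). x + y) ` (part z M1 \<times> part z M2)" using xy by (auto simp: part_def)
 next
  fix s assume "s \<in> (%(x, y). x + y) ` (part z M1 \<times> part z M2)"
  then obtain x y where xy: "x \<in> part z M1" "y \<in> part z M2" "s = x + y" by auto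
  have U: "x \<in> U" "y \<in> U" using partD(1)[OF xy(1)] partD(1)[OF xy(2)] eqsubD(1) assms by blast+
  hence "act (ind z) s = s" using xy z by (simp add: act_add part_def)
  thus "s \<in> part z ((%(x, y). x + y) ` (M1 \<times> M2))" using xy by (auto simp: part_def)
 qed
 moreover have "inj_on (%(x, y). x + y) (part z M1 \<times> part z M2)"
  by (rule inj_on_subset[OF inj]) (auto simp: part_def)
 ultimately show "card (part z ((%(x, y). x + y) ` (M1 \<times> M2))) = card (part z M1) * card (part z M2)"
  by (simp add: card_image card_cartesian_product)
qed

lemma eqsub_Int: "eqsub M ==> eqsub N ==> eqsub (M Int N)"
 by (auto simp: eqsub_def)

text \<open>Multiplicities are recorded as exponents of cardinalities; multiplicativity here is
  their additivity under orthogonal splitting.\<close>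

lemma card_decomposes:
 assumes "eqsub B" "nondeg B" "eqsub M" "decomposes B M"
 shows "card M = card (M Int B) * card (M Int perp B)"
  and "z \<in> T ==> card (part z M) = card (part z (M Int B)) * card (part z (M Int perp B))"
proof -
 have M: "M = (%(x, y). x + y) ` ((M Int B) \<times> (M Int perp B))"
 proof (intro subset_antisym subsetI)
  fix x assume "x \<in> M"
  then obtain b u where "b \<in> M Int B" "u \<in> M Int perp B" "x = b + u"
   using assms(4) unfolding decomposes_def by blast
  thus "x \<in> (%(x, y). x + y) ` ((M Int B) \<times> (M Int perp B))" by blast
 qed (use eqsubD(3)[OF assms(3)] in auto)
 have disj: "(M Int B) Int (M Int perp B) = {0}"
  using nondeg_Int_perp[OF assms(1,2)] eqsubD(2)[OF assms(3)] by blast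
 note * = card_direct_sum[OF eqsub_Int[OF assms(3,1)] eqsub_Int[OF assms(3) perp_eqsub[OF assms(1)]] disj,
  folded M]
 show "card M = card (M Int B) * card (M Int perp B)" by (rule *(1))
 show "z \<in> T ==> card (part z M) = card (part z (M Int B)) * card (part z (M Int perp B))" by (rule *(2))
qed

end

section \<open>Hyperbolic and unitary blocks\<close>

context symp
begin

lemma eqsub_0: "eqsub {0}"
 by (auto simp: eqsub_def zero_U act_zero)

lemma eqsub_sum:
 assumes "eqsub M1" "eqsub M2"
 shows "eqsub ((%(x, y). x + y) ` (M1 \<times> M2))"
 unfolding eqsub_def
proof (intro conjI ballI)
 have MU: "x \<in> U" "y \<in> U" if "x \<in> M1" "y \<in> M2" for x y
  using eqsubD(1) assms that by blast+
 show "(%(x, y). x + y) ` (M1 \<times> M2) \<subseteq> U" using MU add_U by auto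
 show "0 \<in> (%(x, y). x + y) ` (M1 \<times> M2)"
  using eqsubD(2)[OF assms(1)] eqsubD(2)[OF assms(2)] by (auto intro!: rev_image_eqI[of "(0, 0)"])
 fix u assume "u \<in> (%(x, y). x + y) ` (M1 \<times> M2)"
 then obtain x y where u: "x \<in> M1" "y \<in> M2" "u = x + y" by auto
 {
  fix v assume "v \<in> (%(x, y). x + y) ` (M1 \<times> M2)"
  then obtain x' y' where v: "x' \<in> M1" "y' \<in> M2" "v = x' + y'" by auto
  have "u + v = (x + x') + (y + y')" using u v by (simp add: ac_simps)
  thus "u + v \<in> (%(x, y). x + y) ` (M1 \<times> M2)"
   using u v eqsubD(3) assms by (auto intro!: rev_image_eqI[of "(x + x', y + y')"])
 }
 fix w assume w: "w \<in> Eq"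
 have "act w u = act w x + act w y" using u MU w by (simp add: act_add)
 thus "act w u \<in> (%(x, y). x + y) ` (M1 \<times> M2)"
  using u w eqsubD(4) assms by (auto intro!: rev_image_eqI[of "(act w x, act w y)"])
qed

definition hblock :: "'v => 'v => 'v set" where
 "hblock v w = (%(x, y). x + y) ` (cyc v \<times> cyc w)"

lemma hypD:
 assumes "hyp z v w"
 shows "z \<in> T" "v \<in> part z U" "w \<in> part (io z) U" "v \<in> U" "w \<in> U"
  "a \<in> Eq ==> om (act a v) v = 0" "a \<in> Eq ==> om (act a w) w = 0"
  "a \<in> Eq ==> om (act a v) w = tr (ind z * a)"
 using assms partD(1) by (auto simp: hyp_def)

lemma hyp_forms:
 assumes "hyp z v w" "a \<in> Eq" "b \<in> Eq"
 shows "om (act a v) (act b v) = 0" "om (act a w) (act b w) = 0"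
  "om (act a v) (act b w) = tr (ind z * (star b * a))"
  "om (act b w) (act a v) = - tr (ind z * (star b * a))"
proof -
 note h = hypD[OF assms(1)]
 have *: "om (act a x) (act b y) = om (act (star b * a) x) y" if "x \<in> U" "y \<in> U" for x y
  using om_actr[OF assms(3) act_U[OF assms(2) that(1)] that(2)]
   act_times[of "star b" a x] assms(2,3) that by simp
 show "om (act a v) (act b v) = 0" "om (act a w) (act b w) = 0"
  using * h assms(2,3) by simp_all
 show vw: "om (act a v) (act b w) = tr (ind z * (star b * a))"
  using * h assms(2,3) by simp
 show "om (act b w) (act a v) = - tr (ind z * (star b * a))"
  using om_skew[of "act a v" "act b w"] vw h act_U assms(2,3) by simp
qed

lemma hyp_eval:
 assumes "hyp z v w" "a \<in> Eq" "b \<in> Eq" "a' \<in> Eq" "b' \<in> Eq"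
 shows "om (act a v + act b w) (act a' v + act b' w) =
  tr (ind z * (star b' * a)) - tr (ind z * (star b * a'))"
 using hypD(4,5)[OF assms(1)] hyp_forms[OF assms(1)] assms(2-5)
 by (simp add: om_addl om_addr act_U add_U)

lemma hyp_nonzero:
 assumes "hyp z v w"
 shows "v ~= 0" "w ~= 0"
proof -
 note h = hypD[OF assms]
 obtain u where u: "u \<in> Eq" "tr (ind z * u) ~= 0" using tr_ind_nonzero[OF h(1)] .
 hence ne: "om (act u v) w ~= 0" using h(8)[OF u(1)] by simp
 show "v ~= 0" using ne h(5) u(1) by (auto simp: act_zero)
 show "w ~= 0" using ne act_U[OF u(1) h(4)] by auto
qed

lemma tr_pairing_zero:
 assumes "z \<in> T" "d \<in> Eq" "!!c. c \<in> Eq ==> tr (ind z * (d * c)) = 0"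
 shows "d z = 0"
 using tr_nondeg[OF assms(2,1)] assms(3) by metis

text \<open>Testing against multiples of v sees only the coordinate along w, and the trace pairing
  is nondegenerate.\<close>

lemma hyp_zero:
 assumes "hyp z v w" "a \<in> Eq" "b \<in> Eq"
  and "!!c. c \<in> Eq ==> om (act c v) (act a v + act b w) = 0"
 shows "b (io z) = 0" "act b w = 0"
proof -
 note h = hypD[OF assms(1)]
 have "star b z = 0"
 proof (rule tr_pairing_zero[OF h(1)])
  fix c assume c: "c \<in> Eq"
  have "om (act c v) (act a v + act b w) = tr (ind z * (star b * c))"
   using hyp_forms[OF assms(1) c] assms(2,3) c h(4,5) by (simp add: om_addr act_U)
  thus "tr (ind z * (star b * c)) = 0" using assms(4)[OF c] by simp
 qed (use assms(3) in blast)
 thus b: "b (io z) = 0" by (simp add: star_def)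
 show "act b w = 0"
  using act_eq_0_iff[OF io_T[OF h(1)] h(3) hyp_nonzero(2)[OF assms(1)] assms(3)] b by simp
qed

lemma hyp_sum_zero:
 assumes "hyp z v w" "a \<in> Eq" "b \<in> Eq"
 shows "act a v + act b w = 0 \<longleftrightarrow> a z = 0 & b (io z) = 0"
proof
 note h = hypD[OF assms(1)]
 show "act a v + act b w = 0" if "a z = 0 & b (io z) = 0"
  using that act_eq_0_iff[OF h(1,2) hyp_nonzero(1)[OF assms(1)] assms(2)]
   act_eq_0_iff[OF io_T[OF h(1)] h(3) hyp_nonzero(2)[OF assms(1)] assms(3)] by simp
 assume s: "act a v + act b w = 0"
 have "b (io z) = 0" "act b w = 0"
  by (rule hyp_zero[OF assms]; simp add: s act_U h)+
 thus "a z = 0 & b (io z) = 0"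
  using s act_eq_0_iff[OF h(1,2) hyp_nonzero(1)[OF assms(1)] assms(2)] by simp
qed

lemma hblock_iff: "x \<in> hblock v w \<longleftrightarrow> (\<exists>a\<in>Eq. \<exists>b\<in>Eq. x = act a v + act b w)"
 by (auto simp: hblock_def cyc_def)

lemma hblock_eqsub: "v \<in> U ==> w \<in> U ==> eqsub (hblock v w)"
 unfolding hblock_def by (intro eqsub_sum cyc_eqsub)

lemma hblock_nondeg:
 assumes "hyp z v w"
 shows "nondeg (hblock v w)"
 unfolding nondeg_def
proof (intro ballI impI)
 note h = hypD[OF assms]
 fix x assume x: "x \<in> hblock v w" "\<forall>y\<in>hblock v w. om x y = 0"
 then obtain a b where ab: "a \<in> Eq" "b \<in> Eq" "x = act a v + act b w" by (auto simp: hblock_iff)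
 have xU: "x \<in> U" using eqsubD(1)[OF hblock_eqsub[OF h(4,5)] x(1)] .
 have mem: "act c v \<in> hblock v w" "act c w \<in> hblock v w" if "c \<in> Eq" for c
 proof -
  have "act c v = act c v + act 0 w" "act c w = act 0 v + act c w"
   using h by (simp_all add: act_0)
  thus "act c v \<in> hblock v w" "act c w \<in> hblock v w"
   using that Eq_closed(2) unfolding hblock_iff by blast+
 qed
 have "b (io z) = 0"
 proof (rule hyp_zero(1)[OF assms ab(1,2)])
  fix c assume "c \<in> Eq"
  hence "om x (act c v) = 0" "act c v \<in> U" using x(2) mem h(4) act_U by blast+
  thus "om (act c v) (act a v + act b w) = 0" using om_skew[of x "act c v"] xU ab(3) by simp
 qed
 moreover have "a z = 0"
 proof (rule tr_pairing_zero[OF h(1) ab(1)])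
  fix c assume c: "c \<in> Eq"
  have "om x (act (star c) w) = tr (ind z * (star (star c) * a))"
   using hyp_forms[OF assms ab(1), of "star c"] hyp_forms(2)[OF assms ab(2), of "star c"] c h(4,5) ab
   by (simp add: om_addl act_U)
  also have "... = tr (ind z * (a * c))"
   by (rule tr_cong) (simp add: star_def io_io)
  finally show "tr (ind z * (a * c)) = 0" using x(2) mem[of "star c"] c by simp
 qed
 ultimately show "x = 0" using hyp_sum_zero[OF assms ab(1,2)] ab(3) by simp
qed

text \<open>If v lies in the isotropic M, the block component of an element of M is orthogonal to
  \<open>cyc v\<close>, so it has no coordinate along w and lies in \<open>cyc v\<close>, hence in
  M. The other component then lies in M as a difference.\<close>

lemma hblock_flag:
 assumes "hyp z v w" "M = {0} \<or> v \<in> M" "eqsub M" "!!x y. x \<in> M ==> y \<in> M ==> om x y = 0"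
 shows "decomposes (hblock v w) M" "M Int hblock v w = (if M = {0} then {0} else cyc v)"
proof -
 note h = hypD[OF assms(1)]
 note Bs = hblock_eqsub[OF h(4,5)]
 note Bn = hblock_nondeg[OF assms(1)]
 have v_in: "act c v \<in> hblock v w" if "c \<in> Eq" for c
  using that Eq_closed(2) h act_0[of w] unfolding hblock_iff by (metis add.right_neutral)
 have key: "b \<in> cyc v" if b: "b \<in> hblock v w" "!!c. c \<in> Eq ==> om (act c v) b = 0" for b
 proof -
  obtain a b' where ab: "a \<in> Eq" "b' \<in> Eq" "b = act a v + act b' w" using b(1) by (auto simp: hblock_iff)
  have "act b' w = 0" using b(2) unfolding ab(3) by (intro hyp_zero(2)[OF assms(1) ab(1,2)])
  thus ?thesis using ab by (auto simp: cyc_def)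
 qed
 show "decomposes (hblock v w) M"
  unfolding decomposes_def
 proof
  fix x assume x: "x \<in> M"
  hence xU: "x \<in> U" using eqsubD(1)[OF assms(3)] by blast
  obtain b u where bu: "b \<in> U" "b \<in> hblock v w" "u \<in> U" "u \<in> perp (hblock v w)" "x = b + u"
   using decomposes_U[OF Bs Bn] xU unfolding decomposes_def by blast
  show "\<exists>b\<in>M Int hblock v w. \<exists>u\<in>M Int perp (hblock v w). x = b + u"
  proof (cases "M = {0}")
   case True
   thus ?thesis
    using x eqsubD(2)[OF Bs] eqsubD(2)[OF perp_eqsub[OF Bs]] by auto
  next
   case False
   hence vM: "v \<in> M" using assms(2) by blast
   have "b \<in> cyc v"
   proof (rule key[OF bu(2)])
    fix c assume c: "c \<in> Eq"
    have cv: "act c v \<in> M" "act c v \<in> U" using eqsubD(4)[OF assms(3) c vM] act_U[OF c h(4)] .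
    have "0 = om (act c v) x" using assms(4) cv(1) x by simp
    also have "... = om (act c v) b + om (act c v) u" using bu cv by (simp add: om_addr)
    also have "om (act c v) u = 0" using perpD(2)[OF bu(4) v_in[OF c]] .
    finally show "om (act c v) b = 0" by simp
   qed
   hence bM: "b \<in> M" using cyc_subset[OF assms(3) vM] by blast
   have "u = x - b" using bu(5) by simp
   hence "u \<in> M" using eqsub_diff[OF assms(3) x bM] by simp
   thus ?thesis using bM bu by blast
  qed
 qed
 show "M Int hblock v w = (if M = {0} then {0} else cyc v)"
 proof (cases "M = {0}")
  case True
  thus ?thesis using eqsubD(2)[OF Bs] by auto
 next
  case False
  hence vM: "v \<in> M" using assms(2) by blast
  have "b \<in> cyc v" if "b \<in> M" "b \<in> hblock v w" for b
  proof (rule key[OF that(2)])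
   fix c assume "c \<in> Eq"
   thus "om (act c v) b = 0" using eqsubD(4)[OF assms(3) _ vM] that(1) assms(4) by blast
  qed
  moreover have "cyc v \<subseteq> M" using cyc_subset[OF assms(3) vM] .
  moreover have "cyc v \<subseteq> hblock v w" using v_in by (auto simp: cyc_def)
  ultimately show ?thesis using False by auto
 qed
qed

lemma card_part_cyc:
 assumes "z \<in> T" "z' \<in> T" "u \<in> part z U" "u ~= 0"
 shows "card (part z' (cyc u)) = CARD('a) ^ (per z' * of_bool (z' \<in> orb z))"
proof (cases "z' \<in> orb z")
 case True
 have "part z' (cyc u) = cyc u"
  unfolding part_orb[OF assms(1) True]
  using cyc_part[OF assms(1,3)] by (auto simp: part_def)
 thus ?thesis
  using True card_cyc[OF assms(1,3,4)] per_orb[OF assms(1) True] by simp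
next
 case False
 have "u' = 0" if "u' \<in> part z' (cyc u)" for u'
 proof -
  have "u' \<in> part z U" using cyc_part[OF assms(1,3)] partD(1)[OF that] by blast
  hence "act (ind z') u' = 0" using part_disjoint[OF assms(1,2) False] by blast
  thus ?thesis using partD(2)[OF that] by simp
 qed
 moreover have "0 \<in> part z' (cyc u)"
  using eqsubD(2)[OF cyc_eqsub[OF partD(1)[OF assms(3)]]] assms(2) by (simp add: part_def act_zero)
 ultimately have "part z' (cyc u) = {0}" by blast
 thus ?thesis using False by simp
qed

lemma hyp_cyc_disjoint:
 assumes "hyp z v w"
 shows "cyc v Int cyc w = {0}"
proof -
 note h = hypD[OF assms]
 have "x = 0" if x: "x \<in> cyc v" "x \<in> cyc w" for x
 proof -
  obtain a where a: "a \<in> Eq" "x = act a v" using x(1) by (auto simp: cyc_def)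
  obtain b where b: "b \<in> Eq" "x = act b w" using x(2) by (auto simp: cyc_def)
  note ab = a(1) b(1) a(2) b(2)
  have "act a v + act (- b) w = 0" using ab h(5) by (simp add: act_uminus)
  hence "a z = 0" using hyp_sum_zero[OF assms ab(1), of "- b"] ab(2) by simp
  thus ?thesis using act_eq_0_iff[OF h(1,2) hyp_nonzero(1)[OF assms] ab(1)] ab(3) by simp
 qed
 thus ?thesis
  using eqsubD(2)[OF cyc_eqsub[OF h(4)]] eqsubD(2)[OF cyc_eqsub[OF h(5)]] by blast
qed

lemma card_part_hblock:
 assumes "hyp z v w" "z' \<in> T"
 shows "card (part z' (hblock v w)) =
  CARD('a) ^ (per z' * (of_bool (z' \<in> orb z) + of_bool (z' \<in> orb (io z))))"
proof -
 note h = hypD[OF assms(1)]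
 show ?thesis
  unfolding hblock_def
   card_direct_sum(2)[OF cyc_eqsub[OF h(4)] cyc_eqsub[OF h(5)] hyp_cyc_disjoint[OF assms(1)] assms(2)]
   card_part_cyc[OF h(1) assms(2) h(2) hyp_nonzero(1)[OF assms(1)]]
   card_part_cyc[OF io_T[OF h(1)] assms(2) h(3) hyp_nonzero(2)[OF assms(1)]]
  by (simp add: power_add[symmetric] distrib_left)
qed

lemma card_hblock:
 assumes "hyp z v w"
 shows "card (hblock v w) = CARD('a) ^ (per z + per (io z))"
proof -
 note h = hypD[OF assms(1)]
 show ?thesis
  unfolding hblock_def
   card_direct_sum(1)[OF cyc_eqsub[OF h(4)] cyc_eqsub[OF h(5)] hyp_cyc_disjoint[OF assms(1)]]
   card_cyc[OF h(1) h(2) hyp_nonzero(1)[OF assms(1)]]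
   card_cyc[OF io_T[OF h(1)] h(3) hyp_nonzero(2)[OF assms(1)]]
  by (simp add: power_add)
qed

lemma uvecD:
 assumes "uvec z v"
 shows "z \<in> T" "unitary z" "v \<in> part z U" "v \<in> U" "a \<in> Eq ==> om (act a v) v = lam0 z a"
 using assms partD(1) by (auto simp: uvec_def)

lemma uvec_eval:
 assumes "uvec z v" "a \<in> Eq" "b \<in> Eq"
 shows "om (act a v) (act b v) = lam0 z (star b * a)"
 using om_actr[OF assms(3) act_U[OF assms(2) uvecD(4)[OF assms(1)]] uvecD(4)[OF assms(1)]]
  act_times[of "star b" a v] uvecD(4)[OF assms(1)] uvecD(5)[OF assms(1), of "star b * a"] assms(2,3)
 by simp

lemma uvec_nonzero:
 assumes "uvec z v"
 shows "v ~= 0"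
proof
 assume v: "v = 0"
 obtain c where c: "c \<in> Eq" "lam0 z c ~= 0" using bet_props(2)[OF uvecD(1,2)[OF assms]] by blast
 thus False using uvecD(5)[OF assms c(1)] v zero_U by (simp add: act_zero)
qed

lemma ublock_nondeg:
 assumes "uvec z v"
 shows "nondeg (cyc v)"
 unfolding nondeg_def
proof (intro ballI impI)
 note h = uvecD[OF assms]
 fix x assume x: "x \<in> cyc v" "\<forall>y\<in>cyc v. om x y = 0"
 then obtain a where a: "a \<in> Eq" "x = act a v" by (auto simp: cyc_def)
 obtain c0 where c0: "c0 \<in> Eq" "om (act c0 v) v ~= 0"
  using bet_props(2)[OF h(1,2)] h(5) by metis
 have "a z = 0"
 proof (rule cyc_functional_nondeg[OF h(1,3) c0 a(1)])
  fix b assume b: "b \<in> Eq"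
  have "om x (act (star b) v) = om (act b x) v"
   using om_act[OF b, of x v] a h(4) act_U by simp
  moreover have "act b x = act (a * b) v" using a b h(4) act_times[of b a v] by (simp add: mult.commute)
  moreover have "act (star b) v \<in> cyc v" using b by (auto simp: cyc_def)
  ultimately show "om (act (a * b) v) v = 0" using x(2) by simp
 qed
 thus "x = 0" using act_eq_0_iff[OF h(1,3) uvec_nonzero[OF assms] a(1)] a(2) by simp
qed

end

subsection \<open>Numerical data of a flagged symplectic module\<close>

context frob_set
begin

text \<open>Here \<open>G i z\<close> is the multiplicity of z in the i-th flag step and
  \<open>m z\<close> the multiplicity in what remains after removing the top step and its dual. The
  rest is self-dual, which gives invariance under \<open>io\<close>; at a self-inverse point it is a
  symplectic space, which gives evenness.\<close>

definition valid :: "nat => ('t => nat) => (nat => 't => nat) => bool" where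
 "valid k m G \<longleftrightarrow>
  (\<forall>z\<in>T. m (ph z) = m z & m (io z) = m z & (io z = z --> even (m z))) &
  (ALL i. \<forall>z\<in>T. G i (ph z) = G i z & G 0 z = 0 & G i z \<le> G (Suc i) z & (k \<le> i --> G i z = G k z))"

text \<open>The top step is isotropic, so its multiplicity at the inverse point appears a second
  time in U as the dual part. A line at z has q^per elements, hence the factor \<open>per z\<close>
  on components; summing over all points of T already counts each orbit \<open>per z\<close>
  times.\<close>

definition has_data ::
  "'v :: ab_group_add set => (('t => 'a alg_closure) => 'v => 'v) => (nat => 'v set) => nat => ('t => nat) => (nat => 't => nat) => bool" where
 "has_data U act W k m G \<longleftrightarrow>
  (\<forall>z\<in>T. card (eqmod.part ph act z U) = CARD('a) ^ (per z * (m z + G k z + G k (io z)))) &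
  (ALL i. \<forall>z\<in>T. card (eqmod.part ph act z (W i)) = CARD('a) ^ (per z * G i z)) &
  card U = CARD('a) ^ (\<Sum>z\<in>T. m z + G k z + G k (io z)) &
  (ALL i. card (W i) = CARD('a) ^ (\<Sum>z\<in>T. G i z))"

lemma validD:
 assumes "valid k m G" "z \<in> T"
 shows "m (ph z) = m z" "m (io z) = m z" "io z = z ==> even (m z)"
  "G i (ph z) = G i z" "G 0 z = 0" "G i z \<le> G (Suc i) z" "k \<le> i ==> G i z = G k z"
 using assms unfolding valid_def by blast+

lemma valid_add:
 assumes "valid k m1 G1" "valid k m2 G2"
 shows "valid k (%z. m1 z + m2 z) (%i z. G1 i z + G2 i z)"
 unfolding valid_def
proof (intro conjI ballI allI impI)
 fix z i assume z: "z \<in> T"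
 note d1 = validD[OF assms(1) z] and d2 = validD[OF assms(2) z]
 show "m1 (ph z) + m2 (ph z) = m1 z + m2 z" by (simp only: d1(1) d2(1))
 show "m1 (io z) + m2 (io z) = m1 z + m2 z" by (simp only: d1(2) d2(2))
 show "even (m1 z + m2 z)" if "io z = z" using d1(3)[OF that] d2(3)[OF that] by (rule dvd_add)
 show "G1 i (ph z) + G2 i (ph z) = G1 i z + G2 i z" by (simp only: d1(4) d2(4))
 show "G1 0 z + G2 0 z = 0" by (simp only: d1(5) d2(5) add_0)
 show "G1 i z + G2 i z \<le> G1 (Suc i) z + G2 (Suc i) z" by (rule add_mono[OF d1(6) d2(6)])
 show "G1 i z + G2 i z = G1 k z + G2 k z" if "k \<le> i" by (simp only: d1(7)[OF that] d2(7)[OF that])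
qed

lemma sum_orb:
 assumes "z \<in> T"
 shows "(\<Sum>z'\<in>T. of_bool (z' \<in> orb z)) = per z"
proof -
 have "T Int {z'. z' \<in> orb z} = orb z" using orb_T[OF assms] by auto
 thus ?thesis by (simp add: per_def sum_of_bool_eq finite_T)
qed

end

context symp
begin

lemma has_data_decomposes:
 assumes "eqsub B" "nondeg B" "!!i. decomposes B (W i)"
  and "has_data B act (%i. W i Int B) k m1 G1"
  and "has_data (perp B) act (%i. W i Int perp B) k m2 G2"
 shows "has_data U act W k (%z. m1 z + m2 z) (%i z. G1 i z + G2 i z)"
proof -
 have UB: "U Int B = B" "U Int perp B = perp B"
  using eqsubD(1)[OF assms(1)] perpD(1) by auto
 note cU = card_decomposes[OF assms(1,2) eqsub_U decomposes_U[OF assms(1,2)], unfolded UB]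
 note cW = card_decomposes[OF assms(1,2) W_sub assms(3)]
 have d1: "!!z. z \<in> T ==> card (part z B) = CARD('a) ^ (per z * (m1 z + G1 k z + G1 k (io z)))"
  "!!i z. z \<in> T ==> card (part z (W i Int B)) = CARD('a) ^ (per z * G1 i z)"
  "card B = CARD('a) ^ (\<Sum>z\<in>T. m1 z + G1 k z + G1 k (io z))"
  "!!i. card (W i Int B) = CARD('a) ^ (\<Sum>z\<in>T. G1 i z)"
  using assms(4) unfolding has_data_def by blast+
 have d2: "!!z. z \<in> T ==> card (part z (perp B)) = CARD('a) ^ (per z * (m2 z + G2 k z + G2 k (io z)))"
  "!!i z. z \<in> T ==> card (part z (W i Int perp B)) = CARD('a) ^ (per z * G2 i z)"
  "card (perp B) = CARD('a) ^ (\<Sum>z\<in>T. m2 z + G2 k z + G2 k (io z))"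
  "!!i. card (W i Int perp B) = CARD('a) ^ (\<Sum>z\<in>T. G2 i z)"
  using assms(5) unfolding has_data_def by blast+
 show ?thesis
  unfolding has_data_def
 proof (intro conjI allI ballI)
  fix z i assume z: "z \<in> T"
  show "card (part z U) = CARD('a) ^ (per z * (m1 z + m2 z + (G1 k z + G2 k z) + (G1 k (io z) + G2 k (io z))))"
   unfolding cU(2)[OF z] d1(1)[OF z] d2(1)[OF z] power_add[symmetric]
   by (rule arg_cong[where f = "%n. CARD('a) ^ n"]) (simp add: algebra_simps)
  show "card (part z (W i)) = CARD('a) ^ (per z * (G1 i z + G2 i z))"
   unfolding cW(2)[OF z] d1(2)[OF z] d2(2)[OF z] power_add[symmetric]
   by (rule arg_cong[where f = "%n. CARD('a) ^ n"]) (simp add: algebra_simps)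
 next
  show "card U = CARD('a) ^ (\<Sum>z\<in>T. m1 z + m2 z + (G1 k z + G2 k z) + (G1 k (io z) + G2 k (io z)))"
   unfolding cU(1) d1(3) d2(3) power_add[symmetric] sum.distrib[symmetric]
   by (intro arg_cong[where f = "%n. CARD('a) ^ n"] sum.cong refl) simp
  fix i
  show "card (W i) = CARD('a) ^ (\<Sum>z\<in>T. G1 i z + G2 i z)"
   unfolding cW(1) d1(4) d2(4) power_add[symmetric] sum.distrib[symmetric] ..
 qed
qed

lemma W_le: "i \<le> j ==> W i \<subseteq> W j"
 by (rule lift_Suc_mono_le[of W, OF W_mono])

lemma W_zero_mono:
 assumes "W i ~= {0}" "i \<le> j"
 shows "W j ~= {0}"
proof -
 have "W i \<subseteq> W j" using assms(2) by (rule W_le)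
 thus ?thesis using assms(1) eqsubD(2)[OF W_sub[of i]] by blast
qed

lemma W_zero_iff:
 assumes "W k = {0}"
 shows "W i = {0}"
proof (cases "k \<le> i")
 case False
 thus ?thesis using W_zero_mono[of i k] assms by auto
qed (use W_top assms in auto)

text \<open>If the flag is zero, the block belongs to the rest and counts in m at z and at its
  inverse. Otherwise v lies in all nonzero steps, so the block counts in G from the first nonzero
  step on, and its dual line is accounted for by \<open>G k (io z)\<close>.\<close>

lemma hblock_data:
 assumes "hyp z v w" "!!i. W i = {0} \<or> v \<in> W i"
 defines "m \<equiv> %z'. if W k = {0} then of_bool (z' \<in> orb z) + of_bool (z' \<in> orb (io z)) else 0"
  and "G \<equiv> %i z'. of_bool (W i ~= {0} & z' \<in> orb z)"
 shows "valid k m G" "has_data (hblock v w) act (%i. W i Int hblock v w) k m G"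
proof -
 note h = hypD[OF assms(1)]
 have flag: "W i Int hblock v w = (if W i = {0} then {0} else cyc v)" for i
  by (rule hblock_flag(2)[OF assms(1,2) W_sub W_iso])
 have io_iff: "io z' \<in> orb (io z) \<longleftrightarrow> z' \<in> orb z" "io z' \<in> orb z \<longleftrightarrow> z' \<in> orb (io z)" if "z' \<in> T" for z'
  using io_in_orb_iff[OF io_T[OF h(1)] that] io_in_orb_iff[OF h(1) that] h(1) by (simp_all add: io_io)
 have ph_iff: "ph z' \<in> orb (io z) \<longleftrightarrow> z' \<in> orb (io z)" "ph z' \<in> orb z \<longleftrightarrow> z' \<in> orb z" if "z' \<in> T" for z'
  using ph_in_orb_iff[OF io_T[OF h(1)] that] ph_in_orb_iff[OF h(1) that] .
 show "valid k m G"
  unfolding valid_def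
 proof (intro conjI ballI allI impI)
  fix z' assume z': "z' \<in> T"
  show "m (ph z') = m z'" "m (io z') = m z'" using io_iff[OF z'] ph_iff[OF z'] by (simp_all add: m_def)
  show "even (m z')" if "io z' = z'" using io_iff[OF z'] that by (simp add: m_def)
  fix i
  show "G i (ph z') = G i z'" using ph_iff[OF z'] by (simp add: G_def)
  show "G 0 z' = 0" using W_0 by (simp add: G_def)
  show "G i z' \<le> G (Suc i) z'" using W_zero_mono[of i "Suc i"] by (simp add: G_def)
  show "G i z' = G k z'" if "k \<le> i" using W_top[OF that] by (simp add: G_def)
 qed
 have tot: "m z' + G k z' + G k (io z') = of_bool (z' \<in> orb z) + of_bool (z' \<in> orb (io z))" if "z' \<in> T" for z'
  using io_iff[OF that] by (simp add: m_def G_def)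
 have z0: "card (part z' {0}) = 1" if "z' \<in> T" for z'
 proof -
  have "part z' {0} = {0}" using that by (auto simp: part_def act_zero)
  thus ?thesis by simp
 qed
 show "has_data (hblock v w) act (%i. W i Int hblock v w) k m G"
  unfolding has_data_def
 proof (intro conjI allI ballI)
  fix z' assume z': "z' \<in> T"
  show "card (part z' (hblock v w)) = CARD('a) ^ (per z' * (m z' + G k z' + G k (io z')))"
   using card_part_hblock[OF assms(1) z'] tot[OF z'] by simp
  fix i
  show "card (part z' (W i Int hblock v w)) = CARD('a) ^ (per z' * G i z')"
   using card_part_cyc[OF h(1) z' h(2) hyp_nonzero(1)[OF assms(1)]] z0[OF z'] by (simp add: flag G_def)
 next
  have "(\<Sum>z'\<in>T. m z' + G k z' + G k (io z')) = (\<Sum>z'\<in>T. of_bool (z' \<in> orb z) + of_bool (z' \<in> orb (io z)))"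
   by (intro sum.cong refl tot)
  also have "... = per z + per (io z)"
   by (simp only: sum.distrib sum_orb h(1) io_T)
  finally show "card (hblock v w) = CARD('a) ^ (\<Sum>z'\<in>T. m z' + G k z' + G k (io z'))"
   using card_hblock[OF assms(1)] by simp
  fix i
  show "card (W i Int hblock v w) = CARD('a) ^ (\<Sum>z'\<in>T. G i z')"
  proof (cases "W i = {0}")
   case False
   hence "(\<Sum>z'\<in>T. G i z') = per z" using sum_orb[OF h(1)] by (simp only: G_def simp_thms not_False_eq_True)
   thus ?thesis using False card_cyc[OF h(1,2) hyp_nonzero(1)[OF assms(1)]] by (simp add: flag)
  next
   case True
   have "card (W i Int hblock v w) = 1" unfolding flag using True by simp
   thus ?thesis using True by (simp add: G_def)
  qed
 qed
qed

lemma ublock_data: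
 assumes "uvec z v" "W k = {0}"
 defines "m \<equiv> %z'. of_bool (z' \<in> orb z)"
 shows "valid k m (%i z'. 0)" "has_data (cyc v) act (%i. W i Int cyc v) k m (%i z'. 0)"
proof -
 note h = uvecD[OF assms(1)]
 have flag: "W i Int cyc v = {0}" for i
  using W_zero_iff[OF assms(2)] eqsubD(2)[OF cyc_eqsub[OF h(4)]] by simp
 show "valid k m (%i z'. 0)"
  unfolding valid_def
 proof (intro conjI ballI allI impI)
  fix z' assume z': "z' \<in> T"
  show "m (ph z') = m z'" using ph_in_orb_iff[OF h(1) z'] by (simp add: m_def)
  show "m (io z') = m z'" using io_in_orb_iff[OF h(1) z'] unitary_orb[OF h(1,2)] by (simp add: m_def)
  \<comment> \<open>An orbit containing a self-inverse point is a single point and so not unitary;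
    the parity condition only meets multiplicity 0.\<close>
  show "even (m z')" if fz: "io z' = z'"
  proof -
   have "z' ~: orb z"
   proof
    assume "z' \<in> orb z"
    hence "z \<in> orb z'" by (rule in_orb_sym[OF h(1)])
    moreover have "(ph ^^ i) z' = z'" for i using io_fix[OF z' fz] by (induction i) auto
    ultimately have "z = z'" by (auto simp: orb_def)
    thus False using h(2) fz by (simp add: unitary_def)
   qed
   thus ?thesis by (simp add: m_def)
  qed
 qed auto
 have z0: "card (part z' {0}) = 1" if "z' \<in> T" for z'
 proof -
  have "part z' {0} = {0}" using that by (auto simp: part_def act_zero)
  thus ?thesis by simp
 qed
 show "has_data (cyc v) act (%i. W i Int cyc v) k m (%i z'. 0)"
  unfolding has_data_def
 proof (intro conjI allI ballI)
  fix z' assume z': "z' \<in> T"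
  show "card (part z' (cyc v)) = CARD('a) ^ (per z' * (m z' + 0 + 0))"
   using card_part_cyc[OF h(1) z' h(3) uvec_nonzero[OF assms(1)]] by (simp add: m_def)
  fix i
  show "card (part z' (W i Int cyc v)) = CARD('a) ^ (per z' * 0)" using z0[OF z'] by (simp add: flag)
 next
  have "(\<Sum>z'\<in>T. m z' + 0 + 0) = per z" using sum_orb[OF h(1)] by (simp only: m_def add_0_right)
  thus "card (cyc v) = CARD('a) ^ (\<Sum>z'\<in>T. m z' + 0 + 0)"
   using card_cyc[OF h(1,3) uvec_nonzero[OF assms(1)]] by simp
 qed (simp add: flag)
qed

lemma decomposes_0: "eqsub B ==> decomposes B {0}"
 using eqsubD(2)[of B] eqsubD(2)[OF perp_eqsub, of B] by (auto simp: decomposes_def)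

text \<open>A vector of the first nonzero step lies in every nonzero step. This is the choice that
  makes all flag steps split along its hyperbolic block.\<close>

lemma ex_flag_vector:
 assumes "W k ~= {0}"
 obtains z v where "z \<in> T" "v \<in> part z (W (LEAST i. W i ~= {0}))" "v ~= 0"
proof -
 define i0 where "i0 = (LEAST i. W i ~= {0})"
 have "W i0 ~= {0}" unfolding i0_def by (rule LeastI[of "%i. W i ~= {0}"]) (rule assms)
 then obtain x where x: "x \<in> W i0" "x ~= 0" using eqsubD(2)[OF W_sub[of i0]] by blast
 obtain z where z: "z \<in> T" "act (ind z) x ~= 0" using ex_part_nonzero[OF W_sub x] by blast
 show ?thesis
  by (rule that[OF z(1) _ z(2)]) (use part_ind[OF z(1) W_sub x(1)] in \<open>simp add: i0_def\<close>)
qed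

lemma flag_vector_props:
 assumes "z \<in> T" "v \<in> part z (W (LEAST i. W i ~= {0}))"
 shows "W i = {0} \<or> v \<in> W i" "v \<in> part z U" "a \<in> Eq ==> om (act a v) v = 0"
proof -
 define i0 where "i0 = (LEAST i. W i ~= {0})"
 have v: "v \<in> W i0" using partD(1)[OF assms(2)] by (simp add: i0_def)
 show "W i = {0} \<or> v \<in> W i"
 proof (cases "i0 \<le> i")
  case True
  hence "W i0 \<subseteq> W i" by (rule W_le)
  thus ?thesis using v by blast
 next
  case False
  thus ?thesis using not_less_Least[of i "%i. W i ~= {0}"] by (auto simp: i0_def)
 qed
 show "v \<in> part z U" using assms(2) eqsubD(1)[OF W_sub] by (auto simp: part_def)
 show "om (act a v) v = 0" if "a \<in> Eq"
  using W_iso[OF eqsubD(4)[OF W_sub that v] v] .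
qed

lemma card_perp_less:
 assumes "eqsub B" "nondeg B" "v \<in> B" "v ~= 0"
 shows "card (perp B) < card U"
proof (rule psubset_card_mono[OF finite_U])
 have "v ~: perp B" using nondeg_Int_perp[OF assms(1,2)] assms(3,4) by blast
 moreover have "v \<in> U" using eqsubD(1)[OF assms(1,3)] .
 ultimately show "perp B \<subset> U" using perpD(1) by blast
qed

lemma mem_hblock: "v \<in> U ==> w \<in> U ==> v \<in> hblock v w"
 unfolding hblock_iff by (rule bexI[of _ 1], rule bexI[of _ 0]) (simp_all add: act_one act_0)

end

text \<open>One block is removed at a time and the data of block and complement are added: a
  hyperbolic block through the flag while the flag is nonzero, afterwards a hyperbolic block or a
  unitary line, according to the orbit met.\<close>

lemma (in frob_set) symp_ex_data:
 assumes "symp T ph io U act om W k"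
 shows "EX m G. valid k m G & has_data U act W k m G"
 using assms
proof (induction "card U" arbitrary: U W rule: less_induct)
 case less
 interpret symp T ph io ty U act om W k by (rule less.prems)
 have step: ?case
  if B: "eqsub B" "nondeg B" "!!i. decomposes B (W i)" "v \<in> B" "v ~= 0"
   and d: "valid k m1 G1" "has_data B act (%i. W i Int B) k m1 G1" for B v m1 G1
 proof -
  obtain m2 G2 where "valid k m2 G2" "has_data (perp B) act (%i. W i Int perp B) k m2 G2"
   using less.hyps[OF card_perp_less[OF B(1,2,4,5)] symp_sub[OF perp_eqsub[OF B(1)] nondeg_perp[OF B(1,2)]]]
   by blast
  thus ?thesis using has_data_decomposes[OF B(1-3) d(2)] valid_add[OF d(1)] by blast
 qed
 have hstep: ?case if hy: "hyp z v w" and fl: "!!i. W i = {0} \<or> v \<in> W i" for z v w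
  by (rule step[OF hblock_eqsub[OF hypD(4,5)[OF hy]] hblock_nondeg[OF hy]
     hblock_flag(1)[OF hy fl W_sub W_iso] mem_hblock[OF hypD(4,5)[OF hy]] hyp_nonzero(1)[OF hy]
     hblock_data[OF hy fl]])
 show ?case
 proof (cases "W k = {0}")
  case False
  then obtain z v where zv: "z \<in> T" "v \<in> part z (W (LEAST i. W i ~= {0}))" "v ~= 0"
   by (rule ex_flag_vector)
  obtain w where "hyp z v w"
   using ex_hyp_partner[OF zv(1) flag_vector_props(2)[OF zv(1,2)] zv(3) flag_vector_props(3)[OF zv(1,2)]]
   by blast
  thus ?thesis using flag_vector_props(1)[OF zv(1,2)] by (rule hstep)
 next
  case True
  hence W0: "W i = {0}" for i by (rule W_zero_iff)
  show ?thesis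
  proof (cases "U = {0}")
   case True
   have "part z {0} = {0}" if "z \<in> T" for z using that by (auto simp: part_def act_zero)
   hence "valid k (%_. 0) (%_ _. 0) & has_data U act W k (%_. 0) (%_ _. 0)"
    by (simp add: valid_def has_data_def W0 True)
   thus ?thesis by blast
  next
   case False
   then obtain x where x: "x \<in> U" "x ~= 0" using zero_U by blast
   obtain z where z: "z \<in> T" "act (ind z) x ~= 0" using ex_part_nonzero[OF eqsub_U x] by blast
   define v where "v = act (ind z) x"
   have v: "v \<in> part z U" "v ~= 0" using part_ind[OF z(1) eqsub_U x(1)] z(2) by (simp_all add: v_def)
   show ?thesis
   proof (cases "unitary z")
    case False
    obtain w where "hyp z v w"
     using ex_hyp_partner[OF z(1) v om_cyc_nonunitary[OF z(1) False v(1)]] by blast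
    thus ?thesis using W0 by (intro hstep) auto
   next
    case ut: True
    obtain v' where v': "uvec z v'" using ex_uvec[OF z(1) ut v] by blast
    note cs = cyc_eqsub[OF uvecD(4)[OF v']]
    show ?thesis
     by (rule step[OF cs ublock_nondeg[OF v'] _ self_in_cyc[OF uvecD(4)[OF v']] uvec_nonzero[OF v']
        ublock_data[OF v' True]]) (simp add: W0 decomposes_0[OF cs])
   qed
  qed
 qed
qed

subsection \<open>Isometries\<close>

text \<open>Isometries are kept as relations: gluing along an orthogonal sum or matching coordinates
  then needs no choice of representatives. That the relation is a function is recovered at the end
  from nondegeneracy.\<close>

definition iso_rel where
 "iso_rel E U act om W U' act' om' W' R \<longleftrightarrow> fst ` R = U & snd ` R = U' &
  (ALL x x' y y'. (x, x') \<in> R --> (y, y') \<in> R --> (x + y, x' + y') \<in> R & om x y = om' x' y') &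
  (\<forall>w\<in>E. ALL x x'. (x, x') \<in> R --> (act w x, act' w x') \<in> R) &
  (ALL x x' i. (x, x') \<in> R --> (x \<in> W i \<longleftrightarrow> x' \<in> W' i))"

lemma iso_relD:
 assumes "iso_rel E U act om W U' act' om' W' R"
 shows "(x, x') \<in> R ==> x \<in> U" "(x, x') \<in> R ==> x' \<in> U'"
  "x \<in> U ==> EX x'. (x, x') \<in> R" "x' \<in> U' ==> EX x. (x, x') \<in> R"
  "(x, x') \<in> R ==> (y, y') \<in> R ==> (x + y, x' + y') \<in> R"
  "(x, x') \<in> R ==> (y, y') \<in> R ==> om x y = om' x' y'"
  "w \<in> E ==> (x, x') \<in> R ==> (act w x, act' w x') \<in> R"
  "(x, x') \<in> R ==> x \<in> W i \<longleftrightarrow> x' \<in> W' i"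
proof -
 have i: "fst ` R = U" "snd ` R = U'"
  and c: "!!x x' y y'. (x, x') \<in> R ==> (y, y') \<in> R ==> (x + y, x' + y') \<in> R & om x y = om' x' y'"
  and a: "!!w x x'. w \<in> E ==> (x, x') \<in> R ==> (act w x, act' w x') \<in> R"
  and f: "!!x x' i. (x, x') \<in> R ==> x \<in> W i \<longleftrightarrow> x' \<in> W' i"
  using assms unfolding iso_rel_def by simp_all
 show "(x, x') \<in> R ==> x \<in> U" "(x, x') \<in> R ==> x' \<in> U'"
  unfolding i[symmetric] by (auto intro: rev_image_eqI)
 show "x \<in> U ==> EX x'. (x, x') \<in> R" "x' \<in> U' ==> EX x. (x, x') \<in> R"
  unfolding i[symmetric] by auto
 show "(x, x') \<in> R ==> (y, y') \<in> R ==> (x + y, x' + y') \<in> R"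
  "(x, x') \<in> R ==> (y, y') \<in> R ==> om x y = om' x' y'"
  using c by blast+
 show "w \<in> E ==> (x, x') \<in> R ==> (act w x, act' w x') \<in> R" by (rule a)
 show "(x, x') \<in> R ==> x \<in> W i \<longleftrightarrow> x' \<in> W' i" by (rule f)
qed

section \<open>Building isometries from blocks\<close>

locale two_symp =
 A: symp T ph io ty U act om W k + B: symp T ph io ty U' act' om' W' k
 for T :: "'t set" and ph io and ty :: "'a :: {field, finite} itself"
  and U :: "'v :: ab_group_add set" and act om W and k
  and U' :: "'w :: ab_group_add set" and act' om' W'
begin

text \<open>If 0 is related to y, then y is orthogonal to everything and therefore 0; applied to
  differences, in both directions, this gives single-valuedness and injectivity.\<close>

lemma iso_rel_fun:
 assumes "iso_rel A.Eq U act om W U' act' om' W' R"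
 shows "EX f. bij_betw f U U' & (\<forall>x\<in>U. \<forall>y\<in>U. f (x + y) = f x + f y & om' (f x) (f y) = om x y) &
  (\<forall>w\<in>A.Eq. \<forall>x\<in>U. f (act w x) = act' w (f x)) & (ALL i. f ` W i = W' i)"
proof -
 note R = iso_relD[OF assms]
 have neg: "(- x, - x') \<in> R" if "(x, x') \<in> R" for x x'
  using R(7)[OF _ that, of "- 1"] A.act_neg_one[OF R(1)[OF that]] B.act_neg_one[OF R(2)[OF that]] by simp
 have fun_R: "x' = y'" if "(x, x') \<in> R" "(x, y') \<in> R" for x x' y'
 proof -
  have z: "(0, x' - y') \<in> R" using R(5)[OF that(1) neg[OF that(2)]] by simp
  have "x' - y' = 0"
  proof (rule B.om_nondeg[OF R(2)[OF z]])
   fix v' assume "v' \<in> U'"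
   then obtain v where v: "(v, v') \<in> R" using R(4) by blast
   show "om' (x' - y') v' = 0" using R(6)[OF z v] R(1)[OF v] by simp
  qed
  thus ?thesis by simp
 qed
 have inj_R: "x = y" if "(x, x') \<in> R" "(y, x') \<in> R" for x x' y
 proof -
  have z: "(x - y, 0) \<in> R" using R(5)[OF that(1) neg[OF that(2)]] by simp
  have "x - y = 0"
  proof (rule A.om_nondeg[OF R(1)[OF z]])
   fix v assume "v \<in> U"
   then obtain v' where v: "(v, v') \<in> R" using R(3) by blast
   show "om (x - y) v = 0" using R(6)[OF z v] R(2)[OF v] by simp
  qed
  thus ?thesis by simp
 qed
 define f where "f x = (SOME x'. (x, x') \<in> R)" for x
 have fR: "(x, f x) \<in> R" if "x \<in> U" for x unfolding f_def using someI_ex[OF R(3)[OF that]] .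
 have f_eq: "f x = x'" if "(x, x') \<in> R" for x x' using fun_R[OF fR[OF R(1)[OF that]] that] .
 have bij: "bij_betw f U U'"
 proof (rule bij_betw_imageI)
  show "inj_on f U"
  proof (rule inj_onI)
   fix x y assume xy: "x \<in> U" "y \<in> U" "f x = f y"
   have "(y, f x) \<in> R" using fR[OF xy(2)] by (simp only: xy(3))
   thus "x = y" by (rule inj_R[OF fR[OF xy(1)]])
  qed
  show "f ` U = U'"
  proof (intro subset_antisym subsetI)
   fix y assume "y \<in> f ` U" thus "y \<in> U'" using fR R(2) by blast
  next
   fix y assume "y \<in> U'"
   then obtain x where x: "(x, y) \<in> R" using R(4) by blast
   show "y \<in> f ` U" using f_eq[OF x] R(1)[OF x] by blast
  qed
 qed
 have W: "f ` W i = W' i" for i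
 proof (intro subset_antisym subsetI)
  fix y assume "y \<in> f ` W i"
  then obtain x where x: "x \<in> W i" "y = f x" by blast
  thus "y \<in> W' i" using R(8)[OF fR] A.eqsubD(1)[OF A.W_sub] by blast
 next
  fix y assume y: "y \<in> W' i"
  then obtain x where x: "(x, y) \<in> R" using R(4) B.eqsubD(1)[OF B.W_sub] by blast
  have "x \<in> W i" using R(8)[OF x] y by blast
  thus "y \<in> f ` W i" using f_eq[OF x] by blast
 qed
 have "f (x + y) = f x + f y & om' (f x) (f y) = om x y" if "x \<in> U" "y \<in> U" for x y
  using f_eq[OF R(5)[OF fR[OF that(1)] fR[OF that(2)]]] R(6)[OF fR[OF that(1)] fR[OF that(2)]] by simp
 moreover have "f (act w x) = act' w (f x)" if "w \<in> A.Eq" "x \<in> U" for w x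
  using f_eq[OF R(7)[OF that(1) fR[OF that(2)]]] .
 ultimately show ?thesis using bij W by (intro exI[of _ f]) simp
qed

lemma iso_rel_glue:
 assumes B: "A.eqsub D" "A.nondeg D" "!!i. A.decomposes D (W i)"
  and B': "B.eqsub D'" "B.nondeg D'" "!!i. B.decomposes D' (W' i)"
  and R1: "iso_rel A.Eq D act om (%i. W i Int D) D' act' om' (%i. W' i Int D') R1"
  and R2: "iso_rel A.Eq (A.perp D) act om (%i. W i Int A.perp D) (B.perp D') act' om' (%i. W' i Int B.perp D') R2"
 shows "iso_rel A.Eq U act om W U' act' om' W' {(x + y, x' + y') | x y x' y'. (x, x') \<in> R1 & (y, y') \<in> R2}"
  (is "iso_rel _ _ _ _ _ _ _ _ _ ?R")
proof -
 note r1 = iso_relD[OF R1] and r2 = iso_relD[OF R2]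
 \<comment> \<open>The splitting of a vector along D and its complement is unique, so the splitting
   supplied by the flag step must be the given one.\<close>
 have W_iff: "x + y \<in> W i \<longleftrightarrow> x \<in> W i & y \<in> W i" if "x \<in> D" "y \<in> A.perp D" for x y i
 proof
  assume "x + y \<in> W i"
  then obtain b u where bu: "b \<in> W i" "b \<in> D" "u \<in> W i" "u \<in> A.perp D" "x + y = b + u"
   using B(3)[of i] unfolding A.decomposes_def by blast
  have e: "x - b = u - y" using bu(5) by (simp add: algebra_simps)
  have "x - b \<in> D" "u - y \<in> A.perp D"
   using A.eqsub_diff[OF B(1) that(1) bu(2)] A.eqsub_diff[OF A.perp_eqsub[OF B(1)] bu(4) that(2)] .
  hence "u - y \<in> D Int A.perp D" unfolding e by (rule IntI)
  hence z: "u - y = 0" unfolding A.nondeg_Int_perp[OF B(1,2)] by (rule singletonD)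
  from e have "x - b = 0" unfolding z .
  thus "x \<in> W i & y \<in> W i" using bu(1,3) z by simp
 qed (use A.eqsubD(3)[OF A.W_sub] in blast)
 have W'_iff: "x + y \<in> W' i \<longleftrightarrow> x \<in> W' i & y \<in> W' i" if "x \<in> D'" "y \<in> B.perp D'" for x y i
 proof
  assume "x + y \<in> W' i"
  then obtain b u where bu: "b \<in> W' i" "b \<in> D'" "u \<in> W' i" "u \<in> B.perp D'" "x + y = b + u"
   using B'(3)[of i] unfolding B.decomposes_def by blast
  have e: "x - b = u - y" using bu(5) by (simp add: algebra_simps)
  have "x - b \<in> D'" "u - y \<in> B.perp D'"
   using B.eqsub_diff[OF B'(1) that(1) bu(2)] B.eqsub_diff[OF B.perp_eqsub[OF B'(1)] bu(4) that(2)] .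
  hence "u - y \<in> D' Int B.perp D'" unfolding e by (rule IntI)
  hence z: "u - y = 0" unfolding B.nondeg_Int_perp[OF B'(1,2)] by (rule singletonD)
  from e have "x - b = 0" unfolding z .
  thus "x \<in> W' i & y \<in> W' i" using bu(1,3) z by simp
 qed (use B.eqsubD(3)[OF B.W_sub] in blast)
 have DU: "x \<in> U" if "x \<in> D" for x using A.eqsubD(1)[OF B(1) that] .
 have DU': "x \<in> U'" if "x \<in> D'" for x using B.eqsubD(1)[OF B'(1) that] .
 have om_dec: "om (x + y) (s + t) = om x s + om y t"
  if "x \<in> D" "y \<in> A.perp D" "s \<in> D" "t \<in> A.perp D" for x y s t
 proof -
  have mem: "x \<in> U" "y \<in> U" "s \<in> U" "t \<in> U" using that DU A.perpD(1) by auto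
  have "om x t = 0" "om s y = 0" using A.perpD(2) that by blast+
  moreover have "om y s = - om s y" using A.om_skew[OF mem(3,2)] .
  ultimately show ?thesis using mem by (simp add: A.om_addl A.om_addr A.add_U)
 qed
 have om'_dec: "om' (x + y) (s + t) = om' x s + om' y t"
  if "x \<in> D'" "y \<in> B.perp D'" "s \<in> D'" "t \<in> B.perp D'" for x y s t
 proof -
  have mem: "x \<in> U'" "y \<in> U'" "s \<in> U'" "t \<in> U'" using that DU' B.perpD(1) by auto
  have "om' x t = 0" "om' s y = 0" using B.perpD(2) that by blast+
  moreover have "om' y s = - om' s y" using B.om_skew[OF mem(3,2)] .
  ultimately show ?thesis using mem by (simp add: B.om_addl B.om_addr B.add_U)
 qed
 show ?thesis
  unfolding iso_rel_def
 proof (intro conjI allI impI ballI)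
  show "fst ` ?R = U"
  proof (intro subset_antisym subsetI)
   fix s assume "s \<in> fst ` ?R"
   then obtain x y x' y' where "s = x + y" "(x, x') \<in> R1" "(y, y') \<in> R2" by auto
   thus "s \<in> U" using r1(1) r2(1) DU A.perpD(1) A.add_U by blast
  next
   fix s assume "s \<in> U"
   then obtain x y where xy: "x \<in> D" "y \<in> A.perp D" "s = x + y"
    using A.decomposes_U[OF B(1,2)] unfolding A.decomposes_def by blast
   obtain x' where "(x, x') \<in> R1" using r1(3)[OF xy(1)] by blast
   moreover obtain y' where "(y, y') \<in> R2" using r2(3)[OF xy(2)] by blast
   ultimately have "(s, x' + y') \<in> ?R" using xy(3) by blast
   thus "s \<in> fst ` ?R" by (rule rev_image_eqI) simp
  qed
  show "snd ` ?R = U'"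
  proof (intro subset_antisym subsetI)
   fix s assume "s \<in> snd ` ?R"
   then obtain x y x' y' where "s = x' + y'" "(x, x') \<in> R1" "(y, y') \<in> R2" by auto
   thus "s \<in> U'" using r1(2) r2(2) DU' B.perpD(1) B.add_U by blast
  next
   fix s assume "s \<in> U'"
   then obtain x' y' where xy: "x' \<in> D'" "y' \<in> B.perp D'" "s = x' + y'"
    using B.decomposes_U[OF B'(1,2)] unfolding B.decomposes_def by blast
   obtain x where "(x, x') \<in> R1" using r1(4)[OF xy(1)] by blast
   moreover obtain y where "(y, y') \<in> R2" using r2(4)[OF xy(2)] by blast
   ultimately have "(x + y, s) \<in> ?R" using xy(3) by blast
   thus "s \<in> snd ` ?R" by (rule rev_image_eqI) simp
  qed
  fix s s' assume "(s, s') \<in> ?R"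
  then obtain x y x' y' where s: "s = x + y" "s' = x' + y'" "(x, x') \<in> R1" "(y, y') \<in> R2" by auto
  note m = r1(1,2)[OF s(3)] r2(1,2)[OF s(4)]
  {
   fix t t' assume "(t, t') \<in> ?R"
   then obtain a b a' b' where t: "t = a + b" "t' = a' + b'" "(a, a') \<in> R1" "(b, b') \<in> R2" by auto
   note n = r1(1,2)[OF t(3)] r2(1,2)[OF t(4)]
   have "s + t = (x + a) + (y + b)" "s' + t' = (x' + a') + (y' + b')"
    using s t by (simp_all add: ac_simps)
   thus "(s + t, s' + t') \<in> ?R" using r1(5)[OF s(3) t(3)] r2(5)[OF s(4) t(4)] by blast
   show "om s t = om' s' t'"
    unfolding s(1,2) t(1,2) om_dec[OF m(1,3) n(1,3)] om'_dec[OF m(2,4) n(2,4)]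
     r1(6)[OF s(3) t(3)] r2(6)[OF s(4) t(4)] ..
  }
  {
   fix w assume w: "w \<in> A.Eq"
   have "act w s = act w x + act w y" "act' w s' = act' w x' + act' w y'"
    unfolding s(1,2)
    using A.act_add[OF w DU[OF m(1)] A.perpD(1)[OF m(3)]] B.act_add[OF w DU'[OF m(2)] B.perpD(1)[OF m(4)]] .
   thus "(act w s, act' w s') \<in> ?R" using r1(7)[OF w s(3)] r2(7)[OF w s(4)] by blast
  }
  fix i
  show "s \<in> W i \<longleftrightarrow> s' \<in> W' i"
   unfolding s(1,2) W_iff[OF m(1,3)] W'_iff[OF m(2,4)]
   using r1(8)[OF s(3), of i] r2(8)[OF s(4), of i] m by auto
 qed
qed

text \<open>\<open>hyp_eval\<close> and \<open>hyp_sum_zero\<close> describe the form and the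
  relations among coordinates by z alone, so equal coordinates in the two blocks correspond
  isometrically.\<close>

lemma iso_rel_hblock:
 assumes hy: "A.hyp z v w" "!!i. W i = {0} \<or> v \<in> W i"
  and hy': "B.hyp z v' w'" "!!i. W' i = {0} \<or> v' \<in> W' i"
  and flag: "!!i. W i = {0} \<longleftrightarrow> W' i = {0}"
 shows "iso_rel A.Eq (A.hblock v w) act om (%i. W i Int A.hblock v w)
  (B.hblock v' w') act' om' (%i. W' i Int B.hblock v' w')
  {(act a v + act b w, act' a v' + act' b w') | a b. a \<in> A.Eq & b \<in> A.Eq}"
  (is "iso_rel _ _ _ _ _ _ _ _ _ ?R")
proof -
 note h = A.hypD[OF hy(1)] and h' = B.hypD[OF hy'(1)]
 have F: "W i Int A.hblock v w = (if W i = {0} then {0} else A.cyc v)"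
  "W' i Int B.hblock v' w' = (if W i = {0} then {0} else B.cyc v')" for i
  using A.hblock_flag(2)[OF hy A.W_sub A.W_iso] B.hblock_flag(2)[OF hy' B.W_sub B.W_iso] flag by simp_all
 have zero_iff: "act a v + act b w = 0 \<longleftrightarrow> act' a v' + act' b w' = 0" if "a \<in> A.Eq" "b \<in> A.Eq" for a b
  using A.hyp_sum_zero[OF hy(1) that] B.hyp_sum_zero[OF hy'(1) that] by simp
 have cyc_iff: "act a v + act b w \<in> A.cyc v \<longleftrightarrow> act' a v' + act' b w' \<in> B.cyc v'"
  if ab: "a \<in> A.Eq" "b \<in> A.Eq" for a b
 proof -
  have "act a v + act b w \<in> A.cyc v \<longleftrightarrow> b (io z) = 0"
  proof
   assume "act a v + act b w \<in> A.cyc v"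
   then obtain c where c: "c \<in> A.Eq" "act a v + act b w = act c v" by (auto simp: A.cyc_def)
   hence "act (a - c) v + act b w = 0" using ab h by (simp add: A.act_minus algebra_simps)
   thus "b (io z) = 0" using A.hyp_sum_zero[OF hy(1) _ ab(2), of "a - c"] ab c by simp
  next
   assume "b (io z) = 0"
   hence "act 0 v + act b w = 0" using A.hyp_sum_zero[OF hy(1) _ ab(2), of 0] by simp
   hence "act b w = 0" using h by (simp add: A.act_0)
   thus "act a v + act b w \<in> A.cyc v" using ab by (auto simp: A.cyc_def)
  qed
  moreover have "act' a v' + act' b w' \<in> B.cyc v' \<longleftrightarrow> b (io z) = 0"
  proof
   assume "act' a v' + act' b w' \<in> B.cyc v'"
   then obtain c where c: "c \<in> A.Eq" "act' a v' + act' b w' = act' c v'" by (auto simp: B.cyc_def)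
   hence "act' (a - c) v' + act' b w' = 0" using ab h' by (simp add: B.act_minus algebra_simps)
   thus "b (io z) = 0" using B.hyp_sum_zero[OF hy'(1) _ ab(2), of "a - c"] ab c by simp
  next
   assume "b (io z) = 0"
   hence "act' 0 v' + act' b w' = 0" using B.hyp_sum_zero[OF hy'(1) _ ab(2), of 0] by simp
   hence "act' b w' = 0" using h' by (simp add: B.act_0)
   thus "act' a v' + act' b w' \<in> B.cyc v'" using ab by (auto simp: B.cyc_def)
  qed
  ultimately show ?thesis by simp
 qed
 show ?thesis
  unfolding iso_rel_def F
 proof (intro conjI allI impI ballI)
  show "fst ` ?R = A.hblock v w" by (force simp: A.hblock_iff image_iff)
  show "snd ` ?R = B.hblock v' w'" by (force simp: B.hblock_iff image_iff)
  fix s s' assume "(s, s') \<in> ?R"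
  then obtain a b where s: "s = act a v + act b w" "s' = act' a v' + act' b w'" "a \<in> A.Eq" "b \<in> A.Eq" by auto
  {
   fix t t' assume "(t, t') \<in> ?R"
   then obtain c d where t: "t = act c v + act d w" "t' = act' c v' + act' d w'" "c \<in> A.Eq" "d \<in> A.Eq" by auto
   have "s + t = act (a + c) v + act (b + d) w" "s' + t' = act' (a + c) v' + act' (b + d) w'"
    using s t h h' by (simp_all add: A.act_plus B.act_plus ac_simps)
   thus "(s + t, s' + t') \<in> ?R" using s t A.Eq_closed(4) by blast
   show "om s t = om' s' t'"
    unfolding s(1,2) t(1,2) A.hyp_eval[OF hy(1) s(3,4) t(3,4)] B.hyp_eval[OF hy'(1) s(3,4) t(3,4)] ..
  }
  {
   fix c assume c: "c \<in> A.Eq"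
   have "act c s = act (c * a) v + act (c * b) w" "act' c s' = act' (c * a) v' + act' (c * b) w'"
    using s c h h' by (simp_all add: A.act_add B.act_add A.act_times B.act_times A.act_U B.act_U)
   thus "(act c s, act' c s') \<in> ?R" using s c A.Eq_closed(6) by blast
  }
  fix i
  show "s \<in> (if W i = {0} then {0} else A.cyc v) \<longleftrightarrow> s' \<in> (if W i = {0} then {0} else B.cyc v')"
   unfolding s(1,2) using zero_iff[OF s(3,4)] cyc_iff[OF s(3,4)] by simp
 qed
qed

lemma iso_rel_ublock:
 assumes u: "A.uvec z v" "!!i. W i = {0}" and u': "B.uvec z v'" "!!i. W' i = {0}"
 shows "iso_rel A.Eq (A.cyc v) act om (%i. W i Int A.cyc v)
  (B.cyc v') act' om' (%i. W' i Int B.cyc v') {(act a v, act' a v') | a. a \<in> A.Eq}"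
  (is "iso_rel _ _ _ _ _ _ _ _ _ ?R")
proof -
 note h = A.uvecD[OF u(1)] and h' = B.uvecD[OF u'(1)]
 have F: "W i Int A.cyc v = {0}" "W' i Int B.cyc v' = {0}" for i
  using u(2) u'(2) A.eqsubD(2)[OF A.cyc_eqsub[OF h(4)]] B.eqsubD(2)[OF B.cyc_eqsub[OF h'(4)]] by simp_all
 show ?thesis
  unfolding iso_rel_def F
 proof (intro conjI allI impI ballI)
  show "fst ` ?R = A.cyc v" by (force simp: A.cyc_def image_iff)
  show "snd ` ?R = B.cyc v'" by (force simp: B.cyc_def image_iff)
  fix s s' assume "(s, s') \<in> ?R"
  then obtain a where s: "s = act a v" "s' = act' a v'" "a \<in> A.Eq" by auto
  {
   fix t t' assume "(t, t') \<in> ?R"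
   then obtain c where t: "t = act c v" "t' = act' c v'" "c \<in> A.Eq" by auto
   have "s + t = act (a + c) v" "s' + t' = act' (a + c) v'"
    using s t h h' by (simp_all add: A.act_plus B.act_plus)
   thus "(s + t, s' + t') \<in> ?R" using s t A.Eq_closed(4) by blast
   show "om s t = om' s' t'"
    unfolding s(1,2) t(1,2) A.uvec_eval[OF u(1) s(3) t(3)] B.uvec_eval[OF u'(1) s(3) t(3)] ..
  }
  {
   fix c assume c: "c \<in> A.Eq"
   have "act c s = act (c * a) v" "act' c s' = act' (c * a) v'"
    using s c h h' by (simp_all add: A.act_times B.act_times)
   thus "(act c s, act' c s') \<in> ?R" using s c A.Eq_closed(6) by blast
  }
  fix i
  show "s \<in> {0} \<longleftrightarrow> s' \<in> {0}"
   unfolding s(1,2)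
   using A.act_eq_0_iff[OF h(1,3) A.uvec_nonzero[OF u(1)] s(3)]
    B.act_eq_0_iff[OF h'(1,3) B.uvec_nonzero[OF u'(1)] s(3)] by simp
 qed
qed

end

context two_symp
begin

text \<open>Witt cancellation at the level of numbers: the block contributes the same nonzero factor
  on both sides.\<close>

lemma card_perp_parts:
 assumes B: "A.eqsub D" "A.nondeg D" "!!i. A.decomposes D (W i)"
  and B': "B.eqsub D'" "B.nondeg D'" "!!i. B.decomposes D' (W' i)"
  and U: "!!z. z \<in> T ==> card (A.part z U) = card (B.part z U')"
  and F: "!!i z. z \<in> T ==> card (A.part z (W i)) = card (B.part z (W' i))"
  and D: "!!z. z \<in> T ==> card (A.part z D) = card (B.part z D')"
  and DF: "!!i z. z \<in> T ==> card (A.part z (W i Int D)) = card (B.part z (W' i Int D'))"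
  and z: "z \<in> T"
 shows "card (A.part z (A.perp D)) = card (B.part z (B.perp D'))"
  "card (A.part z (W i Int A.perp D)) = card (B.part z (W' i Int B.perp D'))"
proof -
 have UB: "U Int D = D" "U Int A.perp D = A.perp D" "U' Int D' = D'" "U' Int B.perp D' = B.perp D'"
  using A.eqsubD(1)[OF B(1)] A.perpD(1) B.eqsubD(1)[OF B'(1)] B.perpD(1) by auto
 have pos: "card (A.part z M) ~= 0" if "A.eqsub M" for M
 proof -
  have "A.part z M \<subseteq> U" using A.eqsubD(1)[OF that] by (auto simp: A.part_def)
  hence "finite (A.part z M)" using A.finite_U finite_subset by blast
  moreover have "0 \<in> A.part z M" using A.eqsubD(2)[OF that] z by (simp add: A.part_def A.act_zero)
  ultimately show ?thesis by auto
 qed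
 note e = A.card_decomposes(2)[OF B(1,2) A.eqsub_U A.decomposes_U[OF B(1,2)] z, unfolded UB(1,2)]
 note e' = B.card_decomposes(2)[OF B'(1,2) B.eqsub_U B.decomposes_U[OF B'(1,2)] z, unfolded UB(3,4)]
 have "card (A.part z D) * card (A.part z (A.perp D)) = card (B.part z D') * card (B.part z (B.perp D'))"
  using U[OF z] unfolding e e' .
 hence "card (A.part z D) * card (A.part z (A.perp D)) = card (A.part z D) * card (B.part z (B.perp D'))"
  unfolding D[OF z] .
 thus "card (A.part z (A.perp D)) = card (B.part z (B.perp D'))"
  using pos[OF B(1)] by (rule mult_left_cancel[THEN iffD1, rotated])
 note f = A.card_decomposes(2)[OF B(1,2) A.W_sub B(3) z, of i]
 note f' = B.card_decomposes(2)[OF B'(1,2) B.W_sub B'(3) z, of i]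
 have "card (A.part z (W i Int D)) * card (A.part z (W i Int A.perp D)) =
   card (B.part z (W' i Int D')) * card (B.part z (W' i Int B.perp D'))"
  using F[OF z, of i] unfolding f f' .
 hence "card (A.part z (W i Int D)) * card (A.part z (W i Int A.perp D)) =
   card (A.part z (W i Int D)) * card (B.part z (W' i Int B.perp D'))"
  unfolding DF[OF z] .
 thus "card (A.part z (W i Int A.perp D)) = card (B.part z (W' i Int B.perp D'))"
  using pos[OF A.eqsub_Int[OF A.W_sub B(1)]] by (rule mult_left_cancel[THEN iffD1, rotated])
qed

end

lemma (in symp) eqsub_trivial_iff:
 assumes "eqsub M"
 shows "M = {0} \<longleftrightarrow> (\<forall>z\<in>T. card (part z M) = 1)"
proof
 assume M: "M = {0}"
 have "part z {0} = {0}" if "z \<in> T" for z using that by (auto simp: part_def act_zero)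
 thus "\<forall>z\<in>T. card (part z M) = 1" using M by simp
next
 assume h: "\<forall>z\<in>T. card (part z M) = 1"
 have "x = 0" if x: "x \<in> M" for x
 proof (rule ccontr)
  assume "x ~= 0"
  then obtain z where z: "z \<in> T" "act (ind z) x ~= 0" using ex_part_nonzero[OF assms x] by blast
  have "0 \<in> part z M" using z(1) eqsubD(2)[OF assms] by (simp add: part_def act_zero)
  moreover have "act (ind z) x \<in> part z M" using part_ind[OF z(1) assms x] .
  moreover obtain y where "part z M = {y}" using h z(1) by (metis card_1_singletonE)
  ultimately show False using z(2) by auto
 qed
 thus "M = {0}" using eqsubD(2)[OF assms] by auto
qed

lemma (in symp) ex_nonzero_part:
 assumes "eqsub M" "z \<in> T" "card (part z M) ~= 1"
 obtains x where "x \<in> part z M" "x ~= 0"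
proof -
 have "0 \<in> part z M" using assms eqsubD(2)[OF assms(1)] by (simp add: part_def act_zero)
 moreover have "part z M ~= {0}" using assms(3) by auto
 ultimately have "\<exists>x\<in>part z M. x ~= 0" by blast
 thus ?thesis using that by blast
qed

lemma (in symp) part_nonzero_card:
 assumes "eqsub M" "z \<in> T" "x \<in> part z M" "x ~= 0"
 shows "card (part z M) ~= 1"
proof
 assume "card (part z M) = 1"
 then obtain y where "part z M = {y}" by (metis card_1_singletonE)
 moreover have "0 \<in> part z M" using assms eqsubD(2)[OF assms(1)] by (simp add: part_def act_zero)
 ultimately show False using assms(3,4) by auto
qed

text \<open>A Witt theorem for flagged modules. Equal component sizes force the next block to be
  available on both sides at the same z and of the same type; \<open>card_perp_parts\<close> passes
  the hypothesis to the complements.\<close>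

lemma (in frob_set) symp_iso_rel:
 assumes "symp T ph io U act om W k" "symp T ph io U' act' om' W' k"
  and "!!z. z \<in> T ==> card (eqmod.part ph act z U) = card (eqmod.part ph act' z U')"
  and "!!i z. z \<in> T ==> card (eqmod.part ph act z (W i)) = card (eqmod.part ph act' z (W' i))"
 shows "EX R. iso_rel Eq U act om W U' act' om' W' R"
 using assms
proof (induction "card U" arbitrary: U W U' W' rule: less_induct)
 case less
 interpret A: symp T ph io ty U act om W k by (rule less.prems)
 interpret B: symp T ph io ty U' act' om' W' k by (rule less.prems)
 interpret two_symp T ph io ty U act om W k U' act' om' W' ..
 have step: ?case
  if B: "A.eqsub D" "A.nondeg D" "!!i. A.decomposes D (W i)" "v \<in> D" "v ~= 0"
   and B': "B.eqsub D'" "B.nondeg D'" "!!i. B.decomposes D' (W' i)"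
   and D: "!!z. z \<in> T ==> card (A.part z D) = card (B.part z D')"
   and DF: "!!i z. z \<in> T ==> card (A.part z (W i Int D)) = card (B.part z (W' i Int D'))"
   and R: "iso_rel Eq D act om (%i. W i Int D) D' act' om' (%i. W' i Int D') R1"
  for D v D' R1
 proof -
  have "EX R. iso_rel Eq (A.perp D) act om (%i. W i Int A.perp D) (B.perp D') act' om' (%i. W' i Int B.perp D') R"
   by (rule less.hyps[OF A.card_perp_less[OF B(1,2,4,5)]
      A.symp_sub[OF A.perp_eqsub[OF B(1)] A.nondeg_perp[OF B(1,2)]]
      B.symp_sub[OF B.perp_eqsub[OF B'(1)] B.nondeg_perp[OF B'(1,2)]]])
    (rule card_perp_parts[OF B(1-3) B' less.prems(3,4) D DF]; assumption)+
  thus ?thesis using iso_rel_glue[OF B(1-3) B' R] by blast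
 qed
 have triv: "W i = {0} \<longleftrightarrow> W' i = {0}" for i
  using A.eqsub_trivial_iff[OF A.W_sub, of i] B.eqsub_trivial_iff[OF B.W_sub, of i] less.prems(4) by simp
 have hstep: ?case if hy: "A.hyp z v w" and fl: "!!i. W i = {0} \<or> v \<in> W i"
  and hy': "B.hyp z v' w'" and fl': "!!i. W' i = {0} \<or> v' \<in> W' i" for z v w v' w'
 proof (rule step[OF A.hblock_eqsub[OF A.hypD(4,5)[OF hy]] A.hblock_nondeg[OF hy]
     A.hblock_flag(1)[OF hy fl A.W_sub A.W_iso] A.mem_hblock[OF A.hypD(4,5)[OF hy]] A.hyp_nonzero(1)[OF hy]
     B.hblock_eqsub[OF B.hypD(4,5)[OF hy']] B.hblock_nondeg[OF hy']
     B.hblock_flag(1)[OF hy' fl' B.W_sub B.W_iso] _ _ iso_rel_hblock[OF hy fl hy' fl' triv]])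
  fix x assume x: "x \<in> T"
  show "card (A.part x (A.hblock v w)) = card (B.part x (B.hblock v' w'))"
   by (simp only: A.card_part_hblock[OF hy x] B.card_part_hblock[OF hy' x])
  fix i
  have G: "(%i z'. of_bool (W i ~= {0} & z' \<in> orb z)) = (%i z'. of_bool (W' i ~= {0} & z' \<in> orb z))"
   by (simp only: triv)
  show "card (A.part x (W i Int A.hblock v w)) = card (B.part x (W' i Int B.hblock v' w'))"
   using A.hblock_data(2)[OF hy fl] B.hblock_data(2)[OF hy' fl'] x
   unfolding has_data_def G by metis
 qed
 show ?case
 proof (cases "W k = {0}")
  case False
  define i0 where "i0 = (LEAST i. W i ~= {0})"
  \<comment> \<open>Whether a step is zero is visible from its component sizes, so both flags begin
    at the same index.\<close>
  have i0': "i0 = (LEAST i. W' i ~= {0})" unfolding i0_def by (simp only: triv)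
  obtain z v where zv: "z \<in> T" "v \<in> A.part z (W i0)" "v ~= 0"
   unfolding i0_def by (rule A.ex_flag_vector[OF False])
  have "card (B.part z (W' i0)) ~= 1"
   using A.part_nonzero_card[OF A.W_sub zv] less.prems(4)[OF zv(1), of i0] by simp
  then obtain v' where v': "v' \<in> B.part z (W' i0)" "v' ~= 0"
   by (rule B.ex_nonzero_part[OF B.W_sub zv(1)])
  note p = A.flag_vector_props[OF zv(1) zv(2)[unfolded i0_def]]
  note p' = B.flag_vector_props[OF zv(1) v'(1)[unfolded i0']]
  obtain w where w: "A.hyp z v w" using A.ex_hyp_partner[OF zv(1) p(2) zv(3) p(3)] by blast
  obtain w' where w': "B.hyp z v' w'" using B.ex_hyp_partner[OF zv(1) p'(2) v'(2) p'(3)] by blast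
  show ?thesis by (rule hstep[OF w p(1) w' p'(1)])
 next
  case True
  hence W0: "W i = {0}" for i by (rule A.W_zero_iff)
  hence W0': "W' i = {0}" for i using triv by simp
  show ?thesis
  proof (cases "U = {0}")
   case True
   hence "\<forall>z\<in>T. card (A.part z U) = 1" using A.eqsub_trivial_iff[OF A.eqsub_U] by blast
   hence "\<forall>z\<in>T. card (B.part z U') = 1" using less.prems(3) by simp
   hence "U' = {0}" using B.eqsub_trivial_iff[OF B.eqsub_U] by blast
   hence "iso_rel Eq U act om W U' act' om' W' {(0, 0)}"
    using True W0 W0' by (auto simp: iso_rel_def A.act_zero B.act_zero A.om_self B.om_self)
   thus ?thesis by blast
  next
   case False
   then obtain z where z: "z \<in> T" "card (A.part z U) ~= 1" using A.eqsub_trivial_iff[OF A.eqsub_U] by blast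
   hence z': "card (B.part z U') ~= 1" using less.prems(3) by simp
   obtain v where v: "v \<in> A.part z U" "v ~= 0" using A.ex_nonzero_part[OF A.eqsub_U z] .
   obtain v' where v': "v' \<in> B.part z U'" "v' ~= 0" using B.ex_nonzero_part[OF B.eqsub_U z(1) z'] .
   show ?thesis
   proof (cases "unitary z")
    case False
    obtain w where w: "A.hyp z v w"
     using A.ex_hyp_partner[OF z(1) v A.om_cyc_nonunitary[OF z(1) False v(1)]] by blast
    obtain w' where w': "B.hyp z v' w'"
     using B.ex_hyp_partner[OF z(1) v' B.om_cyc_nonunitary[OF z(1) False v'(1)]] by blast
    show ?thesis by (rule hstep[OF w _ w']) (simp_all add: W0 W0')
   next
    case ut: True
    obtain x where x: "A.uvec z x" using A.ex_uvec[OF z(1) ut v] by blast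
    obtain x' where x': "B.uvec z x'" using B.ex_uvec[OF z(1) ut v'] by blast
    note c = A.cyc_eqsub[OF A.uvecD(4)[OF x]] and c' = B.cyc_eqsub[OF B.uvecD(4)[OF x']]
    have 0: "W i Int A.cyc x = {0}" "W' i Int B.cyc x' = {0}" for i
     using W0 W0' A.eqsubD(2)[OF c] B.eqsubD(2)[OF c'] by simp_all
    show ?thesis
    proof (rule step[OF c A.ublock_nondeg[OF x] _ A.self_in_cyc[OF A.uvecD(4)[OF x]] A.uvec_nonzero[OF x]
       c' B.ublock_nondeg[OF x'] _ _ _ iso_rel_ublock[OF x W0 x' W0']])
     fix y assume y: "y \<in> T"
     show "card (A.part y (A.cyc x)) = card (B.part y (B.cyc x'))"
      by (simp only: A.card_part_cyc[OF z(1) y A.uvecD(3)[OF x] A.uvec_nonzero[OF x]]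
        B.card_part_cyc[OF z(1) y B.uvecD(3)[OF x'] B.uvec_nonzero[OF x']])
     fix i
     have "\<forall>z\<in>T. card (A.part z (W i Int A.cyc x)) = 1" "\<forall>z\<in>T. card (B.part z (W' i Int B.cyc x')) = 1"
      unfolding 0 using A.eqsub_trivial_iff[OF A.eqsub_0] B.eqsub_trivial_iff[OF B.eqsub_0] by blast+
     thus "card (A.part y (W i Int A.cyc x)) = card (B.part y (W' i Int B.cyc x'))" using y by simp
    qed (simp_all add: W0 W0' A.decomposes_0[OF c] B.decomposes_0[OF c'])
   qed
  qed
 qed
qed

subsection \<open>Characters of a finite abelian group of exponent \<open>P\<close>\<close>

text \<open>A character is given by the images of r generators. Restriction to indices below r makes
  equality of characters equality of functions; \<open>mon\<close> evaluates a character at the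
  group element with exponents g.\<close>

definition Tchar :: "nat => nat => (nat => 'a :: {field, finite} alg_closure) set" where
 "Tchar P r = (\<Pi>\<^sub>E i\<in>{..<r}. {x. x ^ P = 1})"

definition phc :: "nat => (nat => 'a :: {field, finite} alg_closure) => nat => 'a alg_closure" where
 "phc r z = (\<lambda>i\<in>{..<r}. frob (z i))"

definition ioc :: "nat => (nat => 'a :: {field, finite} alg_closure) => nat => 'a alg_closure" where
 "ioc r z = (\<lambda>i\<in>{..<r}. inverse (z i))"

definition mon :: "nat => (nat => 'b :: field) => (nat => nat) => 'b" where
 "mon r z g = (\<Prod>i<r. z i ^ g i)"

definition Gexp :: "nat => nat => (nat => nat) set" where
 "Gexp P r = (\<Pi>\<^sub>E i\<in>{..<r}. {..<P})"

lemma finite_roots: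
 assumes "P > 0"
 shows "finite {x :: 'a :: {field, finite} alg_closure. x ^ P = 1}"
proof (rule card_roots_poly_le(1))
 show "Polynomial.monom 1 P - Polynomial.monom 1 0 ~= (0 :: 'a alg_closure Polynomial.poly)"
  using degree_monom_diff[OF assms, where 'b = "'a alg_closure"] assms by auto
qed (simp add: poly_monom)

lemma frob_set_Tchar:
 assumes "P > 0"
 shows "frob_set (Tchar P r :: (nat => 'a :: {field, finite} alg_closure) set) (phc r) (ioc r)"
proof
 show "finite (Tchar P r :: (nat => 'a alg_closure) set)"
  unfolding Tchar_def by (intro finite_PiE finite_roots assms) simp
 fix z :: "nat => 'a alg_closure" assume z: "z \<in> Tchar P r"
 hence e: "z \<in> extensional {..<r}" and p: "!!i. i < r ==> z i ^ P = 1"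
  by (auto simp: Tchar_def PiE_def)
 show "phc r z \<in> Tchar P r" using p by (auto simp: Tchar_def phc_def frob_power[symmetric] simp del: frob_power)
 show "ioc r z \<in> Tchar P r" using p by (auto simp: Tchar_def ioc_def power_inverse)
 show "ioc r (ioc r z) = z" using e by (auto simp: ioc_def extensional_def)
 show "ioc r (phc r z) = phc r (ioc r z)" by (auto simp: ioc_def phc_def)
 assume fix_z: "ioc r z = z"
 \<comment> \<open>From z i = 1 / z i the value is 1 or -1, and both lie in the base field, also
   when they coincide.\<close>
 have "frob (z i) = z i" if "i < r" for i
 proof -
  have "inverse (z i) = z i" using fun_cong[OF fix_z, of i] that by (simp add: ioc_def)
  moreover have "z i ~= 0" using p[OF that] assms by (auto simp: zero_power)
  ultimately have "z i * z i = 1" by (metis right_inverse)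
  hence "(z i - 1) * (z i + 1) = 0" by (simp add: algebra_simps)
  hence "z i = 1 \<or> z i = - 1" by (auto simp: eq_neg_iff_add_eq_0)
  thus ?thesis by auto
 qed
 thus "phc r z = z" using e by (auto simp: phc_def extensional_def)
next
 show "inj_on (phc r) (Tchar P r :: (nat => 'a alg_closure) set)"
 proof (rule inj_onI)
  fix x y :: "nat => 'a alg_closure"
  assume h: "x \<in> Tchar P r" "y \<in> Tchar P r" "phc r x = phc r y"
  show "x = y"
  proof
   fix i show "x i = y i"
   proof (cases "i < r")
    case True
    thus ?thesis using fun_cong[OF h(3), of i] by (simp add: phc_def)
   next
    case False
    thus ?thesis using h(1,2) by (auto simp: Tchar_def PiE_def extensional_def)
   qed
  qed
 qed
qed

lemma sum_powers_root:
 fixes x :: "'b :: field"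
 assumes "x ^ P = 1"
 shows "(\<Sum>g<P. x ^ g) = (if x = 1 then of_nat P else 0)"
proof (cases "x = 1")
 case False
 thus ?thesis using geometric_sum[of x P] assms by simp
qed simp

text \<open>Since P is invertible there are P roots of unity, more than the equation y^g = 1 has
  solutions. Multiplying the summation variable by a root y with y^g not 1 rescales the sum by a
  factor other than 1.\<close>

lemma sum_roots_power:
 assumes "of_nat P ~= (0 :: 'a :: {field, finite})" "0 < g" "g < P"
 shows "(\<Sum>x | x ^ P = 1. inverse (x :: 'a alg_closure) ^ g) = 0"
proof -
 have P: "P > 0" using assms by simp
 let ?M = "{x :: 'a alg_closure. x ^ P = 1}"
 have "\<exists>y\<in>?M. y ^ g ~= 1"
 proof (rule ccontr)
  assume "\<not> ?thesis"
  hence sub: "?M \<subseteq> {x. x ^ g = 1}" by blast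
  have "card ?M \<le> Polynomial.degree (Polynomial.monom 1 g - Polynomial.monom 1 0 :: 'a alg_closure Polynomial.poly)"
  proof (rule card_roots_poly_le(2))
   show "Polynomial.monom 1 g - Polynomial.monom 1 0 ~= (0 :: 'a alg_closure Polynomial.poly)"
    using degree_monom_diff[OF assms(2), where 'b = "'a alg_closure"] assms by auto
  qed (use sub in \<open>auto simp: poly_monom\<close>)
  thus False using degree_monom_diff[OF assms(2), where 'b = "'a alg_closure"]
    card_roots_of_unity[OF assms(1)] assms(3) by simp
 qed
 then obtain y :: "'a alg_closure" where y: "y ^ P = 1" "y ^ g ~= 1" by blast
 have y0: "y ~= 0" using y(1) P by (auto simp: zero_power)
 have "(\<Sum>x\<in>?M. inverse x ^ g) = (\<Sum>x\<in>?M. inverse (y * x) ^ g)"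
  by (rule sum.reindex_bij_witness[of _ "%x. y * x" "%x. x / y"])
   (use y y0 in \<open>auto simp: power_mult_distrib power_divide\<close>)
 also have "... = inverse y ^ g * (\<Sum>x\<in>?M. inverse x ^ g)"
  by (simp add: power_mult_distrib sum_distrib_left)
 finally have "(inverse y ^ g - 1) * (\<Sum>x\<in>?M. inverse x ^ g) = 0"
  by (simp add: algebra_simps)
 moreover have "inverse y ^ g ~= 1" using y(2) by (simp add: power_inverse)
 ultimately show ?thesis by simp
qed

lemma sum_mon_Gexp:
 fixes z z' :: "nat => 'a :: {field, finite} alg_closure"
 assumes P: "P > 0" and z: "z \<in> Tchar P r" "z' \<in> Tchar P r"
 shows "(\<Sum>g\<in>Gexp P r. mon r z g * inverse (mon r z' g)) = (if z = z' then of_nat P ^ r else 0)"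
proof -
 have p: "z i ^ P = 1" "z' i ^ P = 1" if "i < r" for i using z that by (auto simp: Tchar_def)
 have n0: "z' i ~= 0" if "i < r" for i using p[OF that] P by (auto simp: zero_power)
 have "(\<Sum>g\<in>Gexp P r. mon r z g * inverse (mon r z' g)) = (\<Sum>g\<in>Gexp P r. \<Prod>i<r. (z i / z' i) ^ g i)"
  by (intro sum.cong refl) (simp only: mon_def divide_inverse[symmetric] prod_dividef[symmetric] power_divide)
 also have "... = (\<Prod>i<r. \<Sum>g<P. (z i / z' i) ^ g)"
  unfolding Gexp_def by (rule prod_sum_PiE[symmetric]) auto
 also have "... = (\<Prod>i<r. if z i = z' i then of_nat P else 0)"
 proof (rule prod.cong[OF refl])
  fix i assume "i \<in> {..<r}"
  hence i: "i < r" by simp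
  have "(z i / z' i) ^ P = 1" using p[OF i] by (simp add: power_divide)
  thus "(\<Sum>g<P. (z i / z' i) ^ g) = (if z i = z' i then of_nat P else 0)"
   using sum_powers_root[of "z i / z' i" P] n0[OF i] by simp
 qed
 also have "... = (if z = z' then of_nat P ^ r else 0)"
 proof (cases "z = z'")
  case False
  then obtain j where j: "z j ~= z' j" by blast
  hence "j < r" using z by (metis Tchar_def PiE_arb lessThan_iff)
  thus ?thesis using j False by (auto intro!: prod_zero)
 qed simp
 finally show ?thesis .
qed

lemma sum_mon_Tchar:
 assumes P: "of_nat P ~= (0 :: 'a :: {field, finite})" and g: "g \<in> Gexp P r"
 shows "(\<Sum>z\<in>Tchar P r. inverse (mon r z g)) =
  (if \<forall>i<r. g i = 0 then of_nat P ^ r else (0 :: 'a alg_closure))"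
proof -
 have P0: "P > 0" using P by (cases P) simp_all
 have "(\<Sum>z\<in>Tchar P r. inverse (mon r z g)) = (\<Sum>z\<in>Tchar P r. \<Prod>i<r. inverse (z i) ^ g i)"
  by (intro sum.cong refl) (simp only: mon_def prod_inversef[symmetric, unfolded comp_def] power_inverse)
 also have "... = (\<Prod>i<r. \<Sum>x | x ^ P = 1. inverse (x :: 'a alg_closure) ^ g i)"
  unfolding Tchar_def by (rule prod_sum_PiE[symmetric]) (auto intro: finite_roots P0)
 also have "... = (\<Prod>i<r. if g i = 0 then of_nat P else 0)"
 proof (rule prod.cong[OF refl])
  fix i assume "i \<in> {..<r}"
  hence "g i < P" using g by (auto simp: Gexp_def)
  thus "(\<Sum>x | x ^ P = 1. inverse (x :: 'a alg_closure) ^ g i) = (if g i = 0 then of_nat P else 0)"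
   using sum_roots_power[OF P, of "g i"] card_roots_of_unity[OF P] by (cases "g i = 0") simp_all
 qed
 also have "... = (if \<forall>i<r. g i = 0 then of_nat P ^ r else 0)"
 proof (cases "\<forall>i<r. g i = 0")
  case False
  then obtain j where j: "j < r" "g j ~= 0" by blast
  hence "(\<Prod>i<r. if g i = 0 then of_nat P else (0 :: 'a alg_closure)) = 0"
   by (intro prod_zero bexI[of _ j]) auto
  thus ?thesis using False by simp
 qed simp
 finally show ?thesis .
qed

subsection \<open>Tuples of commuting operators\<close>

text \<open>A module over the group algebra of (Z/P)^r. Invertibility of P is what gives Fourier
  inversion and with it the action of the ring of equivariant functions.\<close>

locale rep =
 fixes U :: "'v :: ab_group_add set" and sc :: "'a :: {field, finite} => 'v => 'v"
  and Y :: "nat => 'v => 'v" and P r :: nat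
 assumes finU: "finite U"
  and zeroU: "0 \<in> U"
  and addU: "u \<in> U ==> v \<in> U ==> u + v \<in> U"
  and sc_U: "u \<in> U ==> sc c u \<in> U"
  and sc_add: "u \<in> U ==> v \<in> U ==> sc c (u + v) = sc c u + sc c v"
  and sc_plus: "u \<in> U ==> sc (c + d) u = sc c u + sc d u"
  and sc_times: "u \<in> U ==> sc (c * d) u = sc c (sc d u)"
  and sc_one: "u \<in> U ==> sc 1 u = u"
  and Y_U: "i < r ==> u \<in> U ==> Y i u \<in> U"
  and Y_add: "i < r ==> u \<in> U ==> v \<in> U ==> Y i (u + v) = Y i u + Y i v"
  and Y_sc: "i < r ==> u \<in> U ==> Y i (sc c u) = sc c (Y i u)"
  and Y_comm: "i < r ==> j < r ==> u \<in> U ==> Y i (Y j u) = Y j (Y i u)"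
  and Y_P: "i < r ==> u \<in> U ==> (Y i ^^ P) u = u"
  and P_inv: "of_nat P ~= (0 :: 'a)"
begin

lemma P_pos: "P > 0"
 using P_inv by (cases P) simp_all

sublocale F: frob_set "Tchar P r :: (nat => 'a alg_closure) set" "phc r" "ioc r" "TYPE('a)"
 by (rule frob_set_Tchar[OF P_pos])

primrec yp :: "nat => (nat => nat) => 'v => 'v" where
 "yp 0 g v = v"
| "yp (Suc j) g v = (Y j ^^ g j) (yp j g v)"

definition mo :: "(nat => nat) => (nat => 'a alg_closure) => 'a alg_closure" where
 "mo g z = mon r z g"

definition moi :: "(nat => nat) => (nat => 'a alg_closure) => 'a alg_closure" where
 "moi g z = inverse (mon r z g)"

text \<open>The Fourier coefficient of w at g. It lies in the base field because it is a trace;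
  \<open>act\<close> substitutes the operators for the monomials in the inversion formula.\<close>

definition hat :: "((nat => 'a alg_closure) => 'a alg_closure) => (nat => nat) => 'a" where
 "hat w g = inverse (of_nat P ^ r) * F.tr (w * moi g)"

definition act :: "((nat => 'a alg_closure) => 'a alg_closure) => 'v => 'v" where
 "act w v = (\<Sum>g\<in>Gexp P r. sc (hat w g) (yp r g v))"

definition co :: "nat => (nat => 'a alg_closure) => 'a alg_closure" where
 "co i z = z i"

definition pm :: "nat => (nat => nat) => (nat => 'a alg_closure) => 'a alg_closure" where
 "pm n g z = (\<Prod>i<n. z i ^ g i)"

lemma finite_Gexp: "finite (Gexp P r)"
 unfolding Gexp_def by (intro finite_PiE) auto

lemma Tchar_nz: "z \<in> Tchar P r ==> i < r ==> z i ~= (0 :: 'a alg_closure)"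
 using P_pos by (auto simp: Tchar_def zero_power dest!: PiE_mem[where x = i])

lemma Tchar_pow: "z \<in> Tchar P r ==> i < r ==> z i ^ P = (1 :: 'a alg_closure)"
 by (auto simp: Tchar_def dest!: PiE_mem[where x = i])

lemma mo_Eq: "mo g \<in> F.Eq"
 by (auto simp: F.Eq_def mo_def mon_def phc_def)

lemma moi_Eq: "moi g \<in> F.Eq"
 unfolding moi_def[abs_def] by (rule F.Eq_inverse[OF mo_Eq[unfolded mo_def[abs_def]]])

lemma coord_Eq: "i < r ==> co i \<in> F.Eq"
 by (auto simp: F.Eq_def phc_def co_def)

lemma hat_add: "w \<in> F.Eq ==> w' \<in> F.Eq ==> hat (w + w') g = hat w g + hat w' g"
 unfolding hat_def distrib_right using moi_Eq[of g] by (simp add: F.tr_add distrib_left)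

lemma hat_cst:
 assumes "w \<in> F.Eq"
 shows "hat (F.cst c * w) g = c * hat w g"
 unfolding hat_def mult.assoc F.tr_cst[OF F.Eq_closed(6)[OF assms moi_Eq]] by (simp add: ac_simps)

lemma hat_cong: "(!!z. z \<in> Tchar P r ==> w z = w' z) ==> hat w g = hat w' g"
 unfolding hat_def by (simp cong: F.tr_cong)

lemma ofP: "of_nat P ^ r ~= (0 :: 'a alg_closure)"
proof -
 have "to_ac (of_nat P :: 'a) ~= 0" using P_inv by (simp only: to_ac_eq_0_iff not_False_eq_True)
 thus ?thesis by (simp only: to_ac_of_nat power_not_zero not_False_eq_True)
qed

lemma to_ac_hat:
 assumes "w \<in> F.Eq"
 shows "to_ac (hat w g) = inverse (of_nat P ^ r) * (\<Sum>z\<in>Tchar P r. w z * inverse (mon r z g))"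
 unfolding hat_def to_ac_mult F.to_ac_tr[OF F.Eq_closed(6)[OF assms moi_Eq]]
 by (simp add: moi_def)

lemma hat_inversion:
 assumes w: "w \<in> F.Eq" and z: "z \<in> Tchar P r"
 shows "(\<Sum>g\<in>Gexp P r. to_ac (hat w g) * mon r z g) = w z"
proof -
 have "(\<Sum>g\<in>Gexp P r. to_ac (hat w g) * mon r z g) =
   (\<Sum>g\<in>Gexp P r. \<Sum>z'\<in>Tchar P r. inverse (of_nat P ^ r) * w z' * (mon r z g * inverse (mon r z' g)))"
  unfolding to_ac_hat[OF w] by (simp add: sum_distrib_left sum_distrib_right ac_simps)
 also have "... = (\<Sum>z'\<in>Tchar P r. \<Sum>g\<in>Gexp P r. inverse (of_nat P ^ r) * w z' * (mon r z g * inverse (mon r z' g)))"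
  by (rule sum.swap)
 also have "... = (\<Sum>z'\<in>Tchar P r. inverse (of_nat P ^ r) * w z' * (if z = z' then of_nat P ^ r else 0))"
  unfolding sum_distrib_left[symmetric]
  by (intro sum.cong refl) (simp only: sum_mon_Gexp[OF P_pos z])
 also have "... = (\<Sum>z'\<in>Tchar P r. if z = z' then w z' else 0)"
  using ofP by (intro sum.cong refl) (simp add: field_simps)
 also have "... = w z" using z F.finite_T by (simp add: sum.delta)
 finally show ?thesis .
qed

lemma hat_one:
 assumes "g \<in> Gexp P r"
 shows "hat 1 g = (if \<forall>i<r. g i = 0 then 1 else 0)"
proof -
 have "to_ac (hat 1 g) = inverse (of_nat P ^ r) * (if \<forall>i<r. g i = 0 then of_nat P ^ r else 0)"
  unfolding to_ac_hat[OF F.Eq_closed(1)] using sum_mon_Tchar[OF P_inv assms] by simp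
 also have "... = to_ac (if \<forall>i<r. g i = 0 then 1 else 0)"
 proof (cases "\<forall>i<r. g i = 0")
  case True
  show ?thesis unfolding if_P[OF True] to_ac_1 by (rule left_inverse[OF ofP])
 next
  case False
  show ?thesis unfolding if_not_P[OF False] to_ac_0 by simp
 qed
 finally show ?thesis by (simp only: to_ac_eq_iff)
qed

lemma funpow_Y_U: "i < r ==> u \<in> U ==> (Y i ^^ m) u \<in> U"
 by (induction m) (auto intro: Y_U)

lemma yp_U: "n \<le> r ==> u \<in> U ==> yp n g u \<in> U"
 by (induction n) (auto intro: funpow_Y_U)

lemma funpow_Y_add: "i < r ==> u \<in> U ==> v \<in> U ==> (Y i ^^ m) (u + v) = (Y i ^^ m) u + (Y i ^^ m) v"
 by (induction m) (auto simp: Y_add funpow_Y_U)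

lemma yp_add: "n \<le> r ==> u \<in> U ==> v \<in> U ==> yp n g (u + v) = yp n g u + yp n g v"
 by (induction n) (auto simp: funpow_Y_add yp_U)

lemma funpow_Y_comm: "i < r ==> j < r ==> u \<in> U ==> Y i ((Y j ^^ m) u) = (Y j ^^ m) (Y i u)"
proof (induction m)
 case (Suc m)
 thus ?case using Y_comm[of i j "(Y j ^^ m) u"] funpow_Y_U[of j u m] by simp
qed simp

lemma yp_irrelevant: "n \<le> i ==> yp n (g(i := m)) v = yp n g v"
 by (induction n) auto

lemma yp_upd:
 assumes "i < n" "n \<le> r" "v \<in> U"
 shows "yp n (g(i := Suc m)) v = Y i (yp n (g(i := m)) v)"
 using assms
proof (induction n)
 case (Suc n)
 show ?case
 proof (cases "i = n")
  case True
  show ?thesis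
   unfolding True by (simp only: yp.simps fun_upd_same yp_irrelevant[OF order_refl] funpow.simps comp_apply)
 next
  case False
  hence "yp n (g(i := Suc m)) v = Y i (yp n (g(i := m)) v)" using Suc by (simp del: fun_upd_apply)
  thus ?thesis
   using False[symmetric] Suc.prems funpow_Y_comm[of i n "yp n (g(i := m)) v" "g n"] yp_U[of n v "g(i := m)"]
   by (simp del: fun_upd_apply add: fun_upd_other)
 qed
qed simp

lemma yp_mod:
 assumes "i < n" "n \<le> r" "v \<in> U"
 shows "yp n (g(i := m mod P)) v = yp n (g(i := m)) v"
 using assms
proof (induction n)
 case (Suc n)
 show ?case
 proof (cases "i = n")
  case True
  have "(Y n ^^ P) (yp n g v) = yp n g v" using Suc.prems by (intro Y_P yp_U) auto
  thus ?thesis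
   unfolding True by (simp only: yp.simps fun_upd_same yp_irrelevant[OF order_refl] funpow_mod_eq)
 next
  case False
  thus ?thesis using Suc False[symmetric] by (simp del: fun_upd_apply add: fun_upd_other)
 qed
qed simp

lemma Y_yp:
 assumes "i < r" "v \<in> U"
 shows "Y i (yp r g v) = yp r (g(i := Suc (g i) mod P)) v"
 using yp_upd[OF assms(1) order_refl assms(2), of g "g i"] yp_mod[OF assms(1) order_refl assms(2)] by simp

lemma bij_shift:
 assumes "i < r"
 shows "bij_betw (%g. g(i := Suc (g i) mod P)) (Gexp P r) (Gexp P r)"
\<comment> \<open>Adding P - 1 is the inverse of adding 1 modulo P and avoids truncated
  subtraction.\<close>
proof (rule bij_betwI[where g = "%g. g(i := (g i + (P - 1)) mod P)"])
 show "(%g. g(i := Suc (g i) mod P)) \<in> Gexp P r \<rightarrow> Gexp P r"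
  "(%g. g(i := (g i + (P - 1)) mod P)) \<in> Gexp P r \<rightarrow> Gexp P r"
  using assms P_pos by (auto simp: Gexp_def PiE_def Pi_def extensional_def)
 fix g assume g: "g \<in> Gexp P r"
 hence gi: "g i < P" using assms by (auto simp: Gexp_def)
 have a: "(Suc (g i) mod P + (P - 1)) mod P = g i"
 proof -
  have "(Suc (g i) mod P + (P - 1)) mod P = (Suc (g i) + (P - 1)) mod P" by (simp add: mod_add_left_eq)
  also have "Suc (g i) + (P - 1) = g i + P" using P_pos by simp
  finally show ?thesis using gi by simp
 qed
 have b: "Suc ((g i + (P - 1)) mod P) mod P = g i"
 proof -
  have "Suc ((g i + (P - 1)) mod P) mod P = Suc (g i + (P - 1)) mod P" by (simp add: mod_Suc_eq)
  also have "Suc (g i + (P - 1)) = g i + P" using P_pos by simp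
  finally show ?thesis using gi by simp
 qed
 show "(g(i := Suc (g i) mod P))(i := ((g(i := Suc (g i) mod P)) i + (P - 1)) mod P) = g"
  using a by (simp del: mod_add_left_eq)
 show "(g(i := (g i + (P - 1)) mod P))(i := Suc ((g(i := (g i + (P - 1)) mod P)) i) mod P) = g"
  using b by (simp del: mod_Suc_eq)
qed

lemma mon_shift:
 fixes z :: "nat => 'a alg_closure"
 assumes "i < r" "z \<in> Tchar P r"
 shows "mon r z (g(i := Suc (g i) mod P)) = z i * mon r z (g :: nat => nat)"
proof -
 have p: "z i ^ (Suc (g i) mod P) = z i * z i ^ g i"
 proof -
  have "z i ^ (P * (Suc (g i) div P) + Suc (g i) mod P) = z i ^ (Suc (g i) mod P)"
   by (simp only: power_add power_mult Tchar_pow[OF assms(2,1)] power_one mult_1_left)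
  thus ?thesis by (simp only: mult_div_mod_eq power_Suc)
 qed
 have s: "{..<r} = insert i ({..<r} - {i})" using assms(1) by auto
 have "(\<Prod>j\<in>{..<r} - {i}. z j ^ (g(i := Suc (g i) mod P)) j) = (\<Prod>j\<in>{..<r} - {i}. z j ^ g j)"
  by (intro prod.cong) auto
 thus ?thesis
  unfolding mon_def by (subst (1 2) s, subst (1 2) prod.insert) (use p in \<open>simp_all add: mult.assoc\<close>)
qed

lemma sc_zero: "sc c 0 = 0"
 using sc_add[of 0 0 c] zeroU by (metis add.right_neutral add_left_cancel)

lemma sum_U: "finite S ==> (!!s. s \<in> S ==> f s \<in> U) ==> sum f S \<in> U"
 by (induction S rule: finite_induct) (auto simp: zeroU addU)

lemma sc_sum: "finite S ==> (!!s. s \<in> S ==> f s \<in> U) ==> sc c (sum f S) = (\<Sum>s\<in>S. sc c (f s))"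
 by (induction S rule: finite_induct) (auto simp: sc_zero sc_add sum_U)

lemma Y_zero: "i < r ==> Y i 0 = 0"
 using Y_add[of i 0 0] zeroU by (metis add.right_neutral add_left_cancel)

lemma Y_sum: "finite S ==> i < r ==> (!!s. s \<in> S ==> f s \<in> U) ==> Y i (sum f S) = (\<Sum>s\<in>S. Y i (f s))"
 by (induction S rule: finite_induct) (auto simp: Y_zero Y_add sum_U)

lemma act_U: "u \<in> U ==> act w u \<in> U"
 unfolding act_def by (intro sum_U finite_Gexp sc_U yp_U) auto

lemma act_add: "u \<in> U ==> v \<in> U ==> act w (u + v) = act w u + act w v"
 unfolding act_def by (simp add: yp_add sc_add yp_U sum.distrib)

lemma act_plus: "w \<in> F.Eq ==> w' \<in> F.Eq ==> u \<in> U ==> act (w + w') u = act w u + act w' u"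
 unfolding act_def by (simp add: hat_add sc_plus yp_U sum.distrib)

lemma act_cong: "(!!z. z \<in> Tchar P r ==> w z = w' z) ==> act w u = act w' u"
 unfolding act_def using hat_cong[of w w'] by simp

lemma act_sc: "w \<in> F.Eq ==> u \<in> U ==> act (F.cst c * w) u = sc c (act w u)"
 unfolding act_def by (simp add: hat_cst sc_sum finite_Gexp sc_U yp_U sc_times)

lemma act_one:
 assumes "u \<in> U"
 shows "act 1 u = u"
proof -
 define g0 :: "nat => nat" where "g0 = (\<lambda>i\<in>{..<r}. 0)"
 have g0: "g0 \<in> Gexp P r" using P_pos by (auto simp: g0_def Gexp_def)
 have yp0: "n \<le> r ==> yp n g0 u = u" for n by (induction n) (auto simp: g0_def)
 have sc0: "sc 0 v = 0" if "v \<in> U" for v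
  using sc_plus[OF that, of 0 0] by (metis add.right_neutral add_left_cancel)
 have "act 1 u = (\<Sum>g\<in>Gexp P r. if g = g0 then u else 0)"
  unfolding act_def
 proof (rule sum.cong[OF refl])
  fix g assume g: "g \<in> Gexp P r"
  have "g = g0 \<longleftrightarrow> (\<forall>i<r. g i = 0)"
  proof
   assume "\<forall>i<r. g i = 0"
   thus "g = g0" using g by (auto simp: g0_def Gexp_def PiE_def extensional_def)
  qed (auto simp: g0_def)
  hence "hat 1 g = (if g = g0 then 1 else 0)" using hat_one[OF g] by (simp only:)
  thus "sc (hat 1 g) (yp r g u) = (if g = g0 then u else 0)"
   using yp0[OF order_refl] sc_one[OF assms] sc0[OF yp_U[OF order_refl assms]] by simp
 qed
 also have "... = u" using g0 finite_Gexp by (simp add: sum.delta')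
 finally show ?thesis .
qed

text \<open>Multiplying w by the i-th coordinate shifts its Fourier coefficients by one in direction
  i; applying Y i shifts the exponents of the operator monomials in the same way.\<close>

lemma act_Y:
 assumes "i < r" "w \<in> F.Eq" "u \<in> U"
 shows "Y i (act w u) = act (co i * w) u"
proof -
 have "Y i (act w u) = (\<Sum>g\<in>Gexp P r. Y i (sc (hat w g) (yp r g u)))"
  unfolding act_def by (intro Y_sum finite_Gexp assms(1) sc_U yp_U assms(3)) auto
 also have "... = (\<Sum>g\<in>Gexp P r. sc (hat (co i * w) (g(i := Suc (g i) mod P))) (yp r (g(i := Suc (g i) mod P)) u))"
 proof (rule sum.cong[OF refl])
  fix g
  have "hat (co i * w) (g(i := Suc (g i) mod P)) = hat w g"
   unfolding hat_def
  proof (rule arg_cong[where f = "%x. inverse (of_nat P ^ r) * x"], rule F.tr_cong)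
   fix z :: "nat => 'a alg_closure" assume z: "z \<in> Tchar P r"
   show "(co i * w * moi (g(i := Suc (g i) mod P))) z = (w * moi g) z"
    using Tchar_nz[OF z assms(1)] by (simp add: moi_def co_def mon_shift[OF assms(1) z])
  qed
  thus "Y i (sc (hat w g) (yp r g u)) =
    sc (hat (co i * w) (g(i := Suc (g i) mod P))) (yp r (g(i := Suc (g i) mod P)) u)"
   using Y_sc[OF assms(1) yp_U[OF order_refl assms(3)]] Y_yp[OF assms(1,3)] by simp
 qed
 also have "... = act (co i * w) u"
  unfolding act_def by (rule sum.reindex_bij_betw[OF bij_shift[OF assms(1)]])
 finally show ?thesis .
qed

lemma act_funpow_Y:
 assumes "i < r" "w \<in> F.Eq" "u \<in> U"
 shows "(Y i ^^ m) (act w u) = act (co i ^ m * w) u & co i ^ m * w \<in> F.Eq"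
proof (induction m)
 case (Suc m)
 hence e: "co i ^ m * w \<in> F.Eq" by blast
 have "(Y i ^^ Suc m) (act w u) = Y i (act (co i ^ m * w) u)"
  by (simp only: funpow.simps comp_apply conjunct1[OF Suc])
 also have "... = act (co i * (co i ^ m * w)) u" by (rule act_Y[OF assms(1) e assms(3)])
 finally show ?case
  using F.Eq_closed(6)[OF coord_Eq[OF assms(1)] e] by (simp only: power_Suc mult.assoc)
qed (use assms in simp)

lemma power_fun_apply: "(f ^ m) z = f z ^ m" for f :: "'z => 'b :: comm_ring_1"
 by (induction m) simp_all

lemma act_yp:
 assumes "n \<le> r" "w \<in> F.Eq" "u \<in> U"
 shows "yp n g (act w u) = act (pm n g * w) u & pm n g * w \<in> F.Eq"
 using assms(1)
proof (induction n)
 case 0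
 have "pm 0 g * w = w" by (rule ext) (simp add: pm_def)
 thus ?case using assms by simp
next
 case (Suc n)
 hence n: "n < r" by simp
 note IH = Suc.IH[OF less_imp_le[OF n]]
 have eq: "co n ^ g n * (pm n g * w) = pm (Suc n) g * w"
  by (rule ext) (simp add: power_fun_apply co_def pm_def ac_simps)
 have "yp (Suc n) g (act w u) = (Y n ^^ g n) (act (pm n g * w) u)"
  by (simp only: yp.simps conjunct1[OF IH])
 thus ?case using act_funpow_Y[OF n conjunct2[OF IH] assms(3), of "g n"] unfolding eq by (simp only: simp_thms)
qed

lemma act_mo:
 assumes "w \<in> F.Eq" "u \<in> U"
 shows "yp r g (act w u) = act (mo g * w) u"
proof -
 have "pm r g = mo g" by (rule ext) (simp add: pm_def mo_def mon_def)
 thus ?thesis using act_yp[OF order_refl assms, of g] by simp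
qed

lemma act_sum:
 assumes "finite S" "!!s. s \<in> S ==> f s \<in> F.Eq" "u \<in> U"
 shows "act (\<Sum>s\<in>S. f s) u = (\<Sum>s\<in>S. act (f s) u) & (\<Sum>s\<in>S. f s) \<in> F.Eq"
 using assms(1,2)
proof (induction S rule: finite_induct)
 case empty
 have "act 0 u = 0" using act_plus[of 0 0 u] assms(3) by (metis add.right_neutral add_left_cancel F.Eq_closed(2))
 thus ?case unfolding sum.empty using F.Eq_closed(2) by (rule conjI)
next
 case (insert s S)
 hence IH: "act (sum f S) u = (\<Sum>s\<in>S. act (f s) u)" "sum f S \<in> F.Eq" and s: "f s \<in> F.Eq" by blast+
 show ?case
  unfolding sum.insert[OF insert.hyps] act_plus[OF s IH(2) assms(3)] IH(1)
  using F.Eq_closed(4)[OF s IH(2)] by (rule conjI[OF refl])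
qed

lemma sum_fun_apply: "(\<Sum>s\<in>S. f s) z = (\<Sum>s\<in>S. f s z)" for f :: "'s => 'z => 'b :: comm_monoid_add"
 by (induction S rule: infinite_finite_induct) auto

text \<open>By inversion w is a combination of monomials, and for a monomial factor multiplicativity
  follows from repeated use of \<open>act_Y\<close>.\<close>

lemma act_times:
 assumes "w \<in> F.Eq" "w' \<in> F.Eq" "u \<in> U"
 shows "act (w * w') u = act w (act w' u)"
proof -
 have e: "F.cst c * (mo g * w') \<in> F.Eq" for c g using assms(2) mo_Eq by blast
 have "act w (act w' u) = (\<Sum>g\<in>Gexp P r. sc (hat w g) (act (mo g * w') u))"
  unfolding act_def[of w] act_mo[OF assms(2,3)] by (rule refl)
 also have "... = (\<Sum>g\<in>Gexp P r. act (F.cst (hat w g) * (mo g * w')) u)"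
  using act_sc[OF F.Eq_closed(6)[OF mo_Eq assms(2)] assms(3)] by simp
 also have "... = act (\<Sum>g\<in>Gexp P r. F.cst (hat w g) * (mo g * w')) u"
  using act_sum[OF finite_Gexp, of "%g. F.cst (hat w g) * (mo g * w')" u] e assms(3) by simp
 also have "... = act (w * w') u"
 proof (rule act_cong)
  fix z :: "nat => 'a alg_closure" assume z: "z \<in> Tchar P r"
  have "(\<Sum>g\<in>Gexp P r. F.cst (hat w g) * (mo g * w')) z = (\<Sum>g\<in>Gexp P r. to_ac (hat w g) * mon r z g) * w' z"
   by (simp add: sum_fun_apply F.cst_def mo_def sum_distrib_right mult.assoc)
  thus "(\<Sum>g\<in>Gexp P r. F.cst (hat w g) * (mo g * w')) z = (w * w') z"
   using hat_inversion[OF assms(1) z] by simp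
 qed
 finally show ?thesis by simp
qed

sublocale E: eqmod "Tchar P r :: (nat => 'a alg_closure) set" "phc r" "ioc r" "TYPE('a)" U act
proof unfold_locales
 show "act w u = act w' u" if "!!z. z \<in> Tchar P r ==> w z = w' z" for w w' u
  using that by (rule act_cong)
qed (blast intro: finU zeroU addU act_U act_add act_plus act_times act_one)+

lemma act_cst: "u \<in> U ==> act (F.cst c) u = sc c u"
 using act_sc[of 1 u c] by (simp add: act_one)

lemma act_coord: "i < r ==> u \<in> U ==> act (co i) u = Y i u"
 using act_Y[of i 1 u] by (simp add: act_one)

lemma eqsub_iff:
 "E.eqsub M \<longleftrightarrow> M \<subseteq> U & 0 \<in> M & (\<forall>u\<in>M. \<forall>v\<in>M. u + v \<in> M) & (ALL c. \<forall>u\<in>M. sc c u \<in> M) &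
  (\<forall>i<r. \<forall>u\<in>M. Y i u \<in> M)"
proof
 assume M: "E.eqsub M"
 have "sc c u \<in> M" if "u \<in> M" for c u
  using E.eqsubD(4)[OF M F.Eq_closed(3) that, of c] unfolding act_cst[OF E.eqsubD(1)[OF M that]] .
 moreover have "Y i u \<in> M" if "u \<in> M" "i < r" for i u
  using E.eqsubD(4)[OF M coord_Eq[OF that(2)] that(1)] unfolding act_coord[OF that(2) E.eqsubD(1)[OF M that(1)]] .
 ultimately show "M \<subseteq> U & 0 \<in> M & (\<forall>u\<in>M. \<forall>v\<in>M. u + v \<in> M) & (ALL c. \<forall>u\<in>M. sc c u \<in> M) &
  (\<forall>i<r. \<forall>u\<in>M. Y i u \<in> M)" using M unfolding E.eqsub_def by blast
next
 assume M: "M \<subseteq> U & 0 \<in> M & (\<forall>u\<in>M. \<forall>v\<in>M. u + v \<in> M) & (ALL c. \<forall>u\<in>M. sc c u \<in> M) &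
  (\<forall>i<r. \<forall>u\<in>M. Y i u \<in> M)"
 have fp: "(Y i ^^ m) u \<in> M" if "u \<in> M" "i < r" for i m u using M that by (induction m) auto
 have yp: "n \<le> r ==> yp n g u \<in> M" if "u \<in> M" for n g u using fp that by (induction n) auto
 have sums: "finite S ==> (!!s. s \<in> S ==> f s \<in> M) ==> sum f S \<in> M" for S :: "(nat => nat) set" and f
  by (induction S rule: finite_induct) (use M in auto)
 have "act w u \<in> M" if "u \<in> M" for w u
  unfolding act_def by (intro sums finite_Gexp) (use M yp[OF that] in auto)
 thus "E.eqsub M" unfolding E.eqsub_def using M by blast
qed

text \<open>Monomials with scalar coefficients exhaust the equivariant functions on T. This
  identifies the built-in action of a constructed module with the one defined from its
  operators.\<close>

lemma act_unique:
 assumes "eqmod (Tchar P r :: (nat => 'a alg_closure) set) (phc r) (ioc r) U act'"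
  and c: "!!c u. u \<in> U ==> act' (F.cst c) u = sc c u"
  and Y: "!!i u. i < r ==> u \<in> U ==> act' (co i) u = Y i u"
  and w: "w \<in> F.Eq" and u: "u \<in> U"
 shows "act' w u = act w u"
proof -
 interpret N: eqmod "Tchar P r :: (nat => 'a alg_closure) set" "phc r" "ioc r" "TYPE('a)" U act' by (rule assms(1))
 have pw: "act' (co i ^ m) v = (Y i ^^ m) v & co i ^ m \<in> F.Eq" if "i < r" "v \<in> U" for i m v
 proof (induction m)
  case 0
  show ?case unfolding power_0 funpow.simps id_apply
   using N.act_one[OF that(2)] F.Eq_closed(1) by (rule conjI)
 next
  case (Suc m)
  note IH = conjunct1[OF Suc] conjunct2[OF Suc]
  show ?case
   unfolding power_Suc funpow.simps comp_apply N.act_times[OF coord_Eq[OF that(1)] IH(2) that(2)] IH(1)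
    Y[OF that(1) funpow_Y_U[OF that]]
   using F.Eq_closed(6)[OF coord_Eq[OF that(1)] IH(2)] by (rule conjI[OF refl])
 qed
 have mo': "act' (pm n g) u = yp n g u & pm n g \<in> F.Eq" if "n \<le> r" for n g
  using that
 proof (induction n)
  case 0
  have "pm 0 g = 1" by (rule ext) (simp add: pm_def)
  thus ?case unfolding yp.simps using N.act_one[OF u] F.Eq_closed(1) by (simp only: simp_thms)
 next
  case (Suc n)
  hence n: "n < r" by simp
  note IH = Suc.IH[OF less_imp_le[OF n]]
  have eq: "co n ^ g n * pm n g = pm (Suc n) g"
   by (rule ext) (simp add: power_fun_apply co_def pm_def ac_simps)
  have ypU: "yp n g u \<in> U" using yp_U[of n u g] n u by simp
  note p = pw[OF n ypU, of "g n"]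
  show ?case
   unfolding eq[symmetric] N.act_times[OF conjunct2[OF p] conjunct2[OF IH] u] conjunct1[OF IH] conjunct1[OF p] yp.simps
   using F.Eq_closed(6)[OF conjunct2[OF p] conjunct2[OF IH]] by (rule conjI[OF refl])
 qed
 have mo: "act' (mo g) u = yp r g u" for g
 proof -
  have "pm r g = mo g" by (rule ext) (simp add: pm_def mo_def mon_def)
  thus ?thesis using mo'[OF order_refl, of g] by simp
 qed
 have e: "F.cst c * mo g \<in> F.Eq" for c g using mo_Eq by blast
 have s: "finite S ==> act' (\<Sum>g\<in>S. F.cst (hat w g) * mo g) u = (\<Sum>g\<in>S. act' (F.cst (hat w g) * mo g) u) &
   (\<Sum>g\<in>S. F.cst (hat w g) * mo g) \<in> F.Eq" for S
 proof (induction S rule: finite_induct)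
  case empty
  show ?case unfolding sum.empty using N.act_0[OF u] F.Eq_closed(2) by (rule conjI)
 next
  case (insert g S)
  note IH = conjunct1[OF insert.IH] conjunct2[OF insert.IH]
  show ?case
   unfolding sum.insert[OF insert.hyps] N.act_plus[OF e IH(2) u] IH(1)
   using F.Eq_closed(4)[OF e IH(2)] by (rule conjI[OF refl])
 qed
 have "act' w u = act' (\<Sum>g\<in>Gexp P r. F.cst (hat w g) * mo g) u"
 proof (rule N.act_cong[OF w conjunct2[OF s[OF finite_Gexp]] _ u])
  fix z :: "nat => 'a alg_closure" assume "z \<in> Tchar P r"
  thus "w z = (\<Sum>g\<in>Gexp P r. F.cst (hat w g) * mo g) z"
   using hat_inversion[OF w] by (simp add: sum_fun_apply F.cst_def mo_def)
 qed
 also have "... = (\<Sum>g\<in>Gexp P r. act' (F.cst (hat w g) * mo g) u)" using s[OF finite_Gexp] by blast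
 also have "... = act w u"
  unfolding act_def
  by (intro sum.cong refl) (simp add: N.act_times mo_Eq u mo c yp_U)
 finally show ?thesis .
qed

end

section \<open>Commuting isometries of an alternating form\<close>

locale rep_symp = rep U sc Y P r
 for U :: "'v :: ab_group_add set" and sc :: "'a :: {field, finite} => 'v => 'v" and Y P r +
 fixes om :: "'v => 'v => 'a" and W :: "nat => 'v set" and k :: nat
 assumes omb_addl: "u \<in> U ==> u' \<in> U ==> v \<in> U ==> om (u + u') v = om u v + om u' v"
  and omb_skew: "u \<in> U ==> v \<in> U ==> om v u = - om u v"
  and omb_self: "u \<in> U ==> om u u = 0"
  and omb_sc: "u \<in> U ==> v \<in> U ==> om (sc c u) v = c * om u v"
  and omb_Y: "i < r ==> u \<in> U ==> v \<in> U ==> om (Y i u) (Y i v) = om u v"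
  and omb_nondeg: "u \<in> U ==> (!!v. v \<in> U ==> om u v = 0) ==> u = 0"
  and Wb_sub: "W i \<subseteq> U" "0 \<in> W i" "u \<in> W i ==> v \<in> W i ==> u + v \<in> W i"
   "u \<in> W i ==> sc c u \<in> W i" "j < r ==> u \<in> W i ==> Y j u \<in> W i"
  and Wb_0: "W 0 = {0}"
  and Wb_mono: "W i \<subseteq> W (Suc i)"
  and Wb_top: "k \<le> i ==> W i = W k"
  and Wb_iso: "u \<in> W i ==> v \<in> W i ==> om u v = 0"
begin

lemma omb_addr: "u \<in> U ==> v \<in> U ==> v' \<in> U ==> om u (v + v') = om u v + om u v'"
 using omb_skew[of "v + v'" u] omb_skew[of v u] omb_skew[of v' u] omb_addl[of v v' u] addU[of v v'] by simp

lemma omb_scr: "u \<in> U ==> v \<in> U ==> om u (sc c v) = c * om u v"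
 using omb_skew[of "sc c v" u] omb_skew[of v u] omb_sc[of v u c] sc_U[of v c] by simp

lemma omb_0: "v \<in> U ==> om 0 v = 0" "v \<in> U ==> om v 0 = 0"
 using omb_addl[of 0 0 v] omb_addr[of v 0 0] zeroU by (metis add.right_neutral add_left_cancel)+

lemma omb_suml: "finite S ==> (!!s. s \<in> S ==> f s \<in> U) ==> v \<in> U ==> om (sum f S) v = (\<Sum>s\<in>S. om (f s) v)"
 by (induction S rule: finite_induct) (auto simp: omb_0 omb_addl sum_U)

lemma omb_sumr: "finite S ==> (!!s. s \<in> S ==> f s \<in> U) ==> v \<in> U ==> om v (sum f S) = (\<Sum>s\<in>S. om v (f s))"
 by (induction S rule: finite_induct) (auto simp: omb_0 omb_addr sum_U)

lemma omb_funpow: "i < r ==> u \<in> U ==> v \<in> U ==> om ((Y i ^^ m) u) ((Y i ^^ m) v) = om u v"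
 by (induction m) (auto simp: omb_Y funpow_Y_U)

lemma omb_yp: "n \<le> r ==> u \<in> U ==> v \<in> U ==> om (yp n g u) (yp n g v) = om u v"
 by (induction n) (auto simp: omb_funpow yp_U)

text \<open>Each operator monomial is an isometry, so its adjoint is its inverse; on Fourier
  expansions this replaces z by its inverse.\<close>

lemma omb_act:
 assumes "w \<in> F.Eq" "u \<in> U" "v \<in> U"
 shows "om (act w u) v = om u (act (F.star w) v)"
proof -
 have 1: "om (yp r g u) v = om u (act (moi g) v)" for g
 proof -
  have "yp r g (act (moi g) v) = act (mo g * moi g) v" by (rule act_mo[OF moi_Eq assms(3)])
  also have "... = act 1 v"
  proof (rule act_cong)
   fix z :: "nat => 'a alg_closure" assume z: "z \<in> Tchar P r"
   have "mon r z g ~= 0" unfolding mon_def using Tchar_nz[OF z] by simp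
   thus "(mo g * moi g) z = 1 z" by (simp add: mo_def moi_def)
  qed
  finally have "v = yp r g (act (moi g) v)" using act_one[OF assms(3)] by simp
  thus ?thesis using omb_yp[OF order_refl assms(2) act_U[OF assms(3)], of g "moi g"] by simp
 qed
 have e: "F.cst c * moi g \<in> F.Eq" for c g using moi_Eq by blast
 have "om (act w u) v = (\<Sum>g\<in>Gexp P r. om (sc (hat w g) (yp r g u)) v)"
  unfolding act_def by (intro omb_suml finite_Gexp sc_U yp_U assms) auto
 also have "... = (\<Sum>g\<in>Gexp P r. hat w g * om u (act (moi g) v))"
  using omb_sc[OF yp_U[OF order_refl assms(2)] assms(3)] 1 by simp
 also have "... = (\<Sum>g\<in>Gexp P r. om u (act (F.cst (hat w g) * moi g) v))"
  using omb_scr[OF assms(2) act_U[OF assms(3)]] act_sc[OF moi_Eq assms(3)] by simp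
 also have "... = om u (\<Sum>g\<in>Gexp P r. act (F.cst (hat w g) * moi g) v)"
  by (rule omb_sumr[symmetric]) (use finite_Gexp act_U assms in auto)
 also have "(\<Sum>g\<in>Gexp P r. act (F.cst (hat w g) * moi g) v) = act (\<Sum>g\<in>Gexp P r. F.cst (hat w g) * moi g) v"
  using act_sum[OF finite_Gexp, of "%g. F.cst (hat w g) * moi g" v] e assms(3) by simp
 also have "... = act (F.star w) v"
 proof (rule act_cong)
  fix z :: "nat => 'a alg_closure" assume z: "z \<in> Tchar P r"
  have "mon r (ioc r z) g = inverse (mon r z g)" for g
   by (simp add: mon_def ioc_def prod_inversef[symmetric, unfolded comp_def] power_inverse)
  hence "(\<Sum>g\<in>Gexp P r. F.cst (hat w g) * moi g) z = (\<Sum>g\<in>Gexp P r. to_ac (hat w g) * mon r (ioc r z) g)"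
   by (simp add: sum_fun_apply F.cst_def moi_def)
  thus "(\<Sum>g\<in>Gexp P r. F.cst (hat w g) * moi g) z = F.star w z"
   using hat_inversion[OF assms(1) F.io_T[OF z]] by (simp add: F.star_def)
 qed
 finally show ?thesis .
qed

sublocale S: symp "Tchar P r :: (nat => 'a alg_closure) set" "phc r" "ioc r" "TYPE('a)" U act om W k
proof unfold_locales
 show "E.eqsub (W i)" for i using Wb_sub by (simp add: eqsub_iff)
 show "om (act (F.cst c) u) v = c * om u v" if "u \<in> U" "v \<in> U" for c u v
  using act_cst omb_sc that by simp
qed (fact omb_addl omb_skew omb_self omb_act omb_nondeg Wb_0 Wb_mono Wb_top Wb_iso)+

end

subsection \<open>Generating functions\<close>

unbundle fps_syntax
no_notation vec_index (infixl \<open>$\<close> 100)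

text \<open>The series X^w / (1 - X^w).\<close>

definition geo :: "nat => rat fps" where
 "geo w = Abs_fps (%j. if 0 < j & w dvd j then 1 else 0)"

lemma geo_eq:
 assumes "w > 0"
 shows "geo w = fps_X ^ w * (1 + geo w)"
proof (rule fps_ext)
 fix n
 show "geo w $ n = (fps_X ^ w * (1 + geo w)) $ n"
 proof (cases "n < w")
  case True
  thus ?thesis using assms by (auto simp: geo_def fps_X_power_mult_nth dest: dvd_imp_le)
 next
  case False
  hence "w dvd n \<longleftrightarrow> w dvd n - w" by (simp add: dvd_minus_self)
  thus ?thesis using False assms by (auto simp: geo_def fps_X_power_mult_nth)
 qed
qed

text \<open>Counting functions by their total value: removing one copy of the block \<open>b z\<close> from the functions
 that are positive at \<open>z\<close> gives a recursion for the sum of all values at \<open>z\<close>.\<close>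

lemma block_generating_function:
 fixes T :: "'t set" and C :: "('t => nat) set" and b :: "'t => 't => nat" and w :: "'t => nat" and s :: nat
 defines "Cn \<equiv> %n. {m \<in> C. sum m T = s * n}"
 assumes T: "finite T" and s: "s > 0"
  and supp: "!!m z. m \<in> C ==> z ~: T ==> m z = 0"
  and add: "!!m z. m \<in> C ==> z \<in> T ==> (%x. m x + b z x) \<in> C"
  and sub: "!!m z x. m \<in> C ==> z \<in> T ==> m z > 0 ==> b z x \<le> m x"
   "!!m z. m \<in> C ==> z \<in> T ==> m z > 0 ==> (%x. m x - b z x) \<in> C"
  and pos: "!!z. z \<in> T ==> b z z > 0" "!!z. z \<in> T ==> w z > 0"
  and tot: "!!z. z \<in> T ==> sum (b z) T = s * w z"
 shows "of_nat s * (fps_X * fps_deriv (Abs_fps (%n. of_nat (card (Cn n)) :: rat))) =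
   (\<Sum>z\<in>T. of_nat (b z z) * geo (w z)) * Abs_fps (%n. of_nat (card (Cn n)))"
  and "finite (Cn n)"
proof -
 show fin: "finite (Cn n)" for n
 proof (rule finite_subset)
  show "Cn n \<subseteq> {m. ALL z. (z \<in> T --> m z \<in> {..s * n}) & (z ~: T --> m z = 0)}"
  proof
   fix m assume m: "m \<in> Cn n"
   have "m z \<le> s * n" if "z \<in> T" for z
    using member_le_sum[OF that, of m] T m by (simp add: Cn_def)
   thus "m \<in> {m. ALL z. (z \<in> T --> m z \<in> {..s * n}) & (z ~: T --> m z = 0)}"
    using m supp by (simp add: Cn_def)
  qed
  show "finite {m. ALL z. (z \<in> T --> m z \<in> {..s * n}) & (z ~: T --> m z = (0 :: nat))}"
   by (rule finite_set_of_finite_funs) (use T in auto)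
 qed
 define Cf :: "rat fps" where "Cf = Abs_fps (%n. of_nat (card (Cn n)))"
 define Sf :: "'t => rat fps" where "Sf z = Abs_fps (%n. of_nat (\<Sum>m\<in>Cn n. m z))" for z
 have Sf: "Sf z = of_nat (b z z) * geo (w z) * Cf" if z: "z \<in> T" for z
 proof -
  have rec: "Sf z = fps_X ^ w z * (Sf z + of_nat (b z z) * Cf)"
  proof (rule fps_ext)
   fix n
   have split: "(\<Sum>m\<in>Cn n. m z) = (\<Sum>m\<in>{m \<in> Cn n. m z > 0}. m z)"
    using fin by (intro sum.mono_neutral_right) auto
   have sum_sub: "sum (%x. m x - b z x) T = sum m T - s * w z & s * w z \<le> sum m T" if "m \<in> C" "m z > 0" for m
    using sub(1)[OF that(1) z that(2)] tot[OF z] by (metis sum_subtractf_nat sum_mono)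
   show "Sf z $ n = (fps_X ^ w z * (Sf z + of_nat (b z z) * Cf)) $ n"
   proof (cases "n < w z")
    case True
    have "{m \<in> Cn n. m z > 0} = {}"
    proof -
     have "False" if "m \<in> Cn n" "m z > 0" for m
     proof -
      have "s * w z \<le> s * n" using sum_sub[of m] that by (simp add: Cn_def)
      thus False using True s by simp
     qed
     thus ?thesis by blast
    qed
    thus ?thesis using True split by (simp add: Sf_def fps_X_power_mult_nth)
   next
    case False
    have bij: "bij_betw (%m x. m x + b z x) (Cn (n - w z)) {m \<in> Cn n. m z > 0}"
    proof (rule bij_betwI[where g = "%m x. m x - b z x"])
     show "(%m x. m x + b z x) \<in> Cn (n - w z) \<rightarrow> {m \<in> Cn n. m z > 0}"
     proof
      fix m assume "m \<in> Cn (n - w z)"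
      thus "(%x. m x + b z x) \<in> {m \<in> Cn n. m z > 0}"
       using add[OF _ z, of m] pos(1)[OF z] False tot[OF z]
       by (simp add: Cn_def sum.distrib distrib_left[symmetric])
     qed
     show "(%m x. m x - b z x) \<in> {m \<in> Cn n. m z > 0} \<rightarrow> Cn (n - w z)"
     proof
      fix m assume "m \<in> {m \<in> Cn n. m z > 0}"
      hence m: "m \<in> C" "sum m T = s * n" "m z > 0" by (auto simp: Cn_def)
      thus "(%x. m x - b z x) \<in> Cn (n - w z)"
       using sub(2)[OF m(1) z m(3)] sum_sub[OF m(1,3)] by (simp add: Cn_def diff_mult_distrib2)
     qed
     show "(%x. (m x + b z x) - b z x) = m" for m by simp
     show "(%x. (m x - b z x) + b z x) = m" if "m \<in> {m \<in> Cn n. m z > 0}" for m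
     proof
      fix x show "m x - b z x + b z x = m x" using sub(1)[of m z x] z that by (simp add: Cn_def)
     qed
    qed
    have "(\<Sum>m\<in>Cn n. m z) = (\<Sum>m\<in>Cn (n - w z). m z + b z z)"
     unfolding split by (rule sum.reindex_bij_betw[OF bij, symmetric])
    also have "... = (\<Sum>m\<in>Cn (n - w z). m z) + b z z * card (Cn (n - w z))"
     by (simp add: sum.distrib)
    finally have "Sf z $ n = of_nat ((\<Sum>m\<in>Cn (n - w z). m z) + b z z * card (Cn (n - w z)))"
     by (simp only: Sf_def fps_nth_Abs_fps)
    thus ?thesis
     using False by (simp add: Sf_def Cf_def fps_X_power_mult_nth fps_mult_of_nat_nth)
   qed
  qed
  have g: "(1 - fps_X ^ w z) * geo (w z) = fps_X ^ w z"
   using geo_eq[OF pos(2)[OF z]] by (simp add: algebra_simps)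
  have "(1 - fps_X ^ w z) * Sf z = fps_X ^ w z * (of_nat (b z z) * Cf)"
   using rec by (simp add: algebra_simps)
  also have "... = ((1 - fps_X ^ w z) * geo (w z)) * (of_nat (b z z) * Cf)" by (simp only: g)
  also have "... = (1 - fps_X ^ w z) * (of_nat (b z z) * geo (w z) * Cf)" by (simp only: ac_simps)
  finally have "(1 - fps_X ^ w z) * Sf z = (1 - fps_X ^ w z) * (of_nat (b z z) * geo (w z) * Cf)" .
  moreover have "(1 - fps_X ^ w z :: rat fps) ~= 0"
  proof
   assume h: "(1 - fps_X ^ w z :: rat fps) = 0"
   have "(1 - fps_X ^ w z :: rat fps) $ 0 = 1"
    using pos(2)[OF z] by (simp only: fps_sub_nth fps_one_nth fps_X_power_nth) simp
   thus False unfolding h by (simp only: fps_zero_nth zero_neq_one)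
  qed
  ultimately show ?thesis by (simp only: mult_cancel_left simp_thms)
 qed
 \<comment> \<open>Summing the values over all points z turns them into the total s * n, and this is
   the factor by which s X d/dX multiplies the n-th coefficient.\<close>
 have "of_nat s * (fps_X * fps_deriv Cf) = (\<Sum>z\<in>T. Sf z)"
 proof (rule fps_ext)
  fix n
  have "of_nat (s * n * card (Cn n)) = (of_nat (\<Sum>m\<in>Cn n. sum m T) :: rat)"
   by (simp add: Cn_def)
  also have "(\<Sum>m\<in>Cn n. sum m T) = (\<Sum>z\<in>T. \<Sum>m\<in>Cn n. m z)" by (rule sum.swap)
  finally have "of_nat (s * n * card (Cn n)) = (\<Sum>z\<in>T. Sf z $ n)" by (simp add: Sf_def)
  moreover have "(of_nat s * (fps_X * fps_deriv Cf)) $ n = of_nat (s * n * card (Cn n))"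
   by (cases n) (simp_all add: Cf_def fps_mult_of_nat_nth algebra_simps)
  ultimately show "(of_nat s * (fps_X * fps_deriv Cf)) $ n = (\<Sum>z\<in>T. Sf z) $ n"
   by (simp add: fps_sum_nth)
 qed
 also have "... = (\<Sum>z\<in>T. of_nat (b z z) * geo (w z)) * Cf"
  by (simp add: Sf sum_distrib_right)
 finally show "of_nat s * (fps_X * fps_deriv (Abs_fps (%n. of_nat (card (Cn n)) :: rat))) =
   (\<Sum>z\<in>T. of_nat (b z z) * geo (w z)) * Abs_fps (%n. of_nat (card (Cn n)))"
  by (simp only: Cf_def)
qed

context frob_set
begin

text \<open>Multiplicity functions of a flag increment. They are set to 0 outside T so that distinct
  functions represent distinct data.\<close>

definition Gclass :: "('t => nat) set" where
 "Gclass = {g. (ALL z. z ~: T --> g z = 0) & (\<forall>z\<in>T. g (ph z) = g z)}"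

definition Hclass :: "('t => nat) set" where
 "Hclass = {m \<in> Gclass. \<forall>z\<in>T. m (io z) = m z & (io z = z --> even (m z))}"

definition Gn :: "nat => ('t => nat) set" where
 "Gn n = {g \<in> Gclass. sum g T = n}"

definition Hn :: "nat => ('t => nat) set" where
 "Hn n = {m \<in> Hclass. sum m T = 2 * n}"

text \<open>The counts of z with z^(q^j) = z, and below of z with z^(q^j) = 1/z. The entry at j = 0
  is set to 0, as for any X times a logarithmic derivative.\<close>

definition Nf :: "rat fps" where
 "Nf = Abs_fps (%j. if j = 0 then 0 else of_nat (card {z \<in> T. (ph ^^ j) z = z}))"

definition Mf :: "rat fps" where
 "Mf = Abs_fps (%j. if j = 0 then 0 else of_nat (card {z \<in> T. (ph ^^ j) z = io z}))"

lemma Gclass_orb: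
 assumes "g \<in> Gclass" "z \<in> T" "x \<in> orb z"
 shows "g x = g z"
proof -
 have "g ((ph ^^ i) z) = g z" for i
  using assms funpow_T by (induction i) (auto simp: Gclass_def)
 thus ?thesis using assms(3) by (auto simp: orb_def)
qed

lemma sum_orb_nat: "z \<in> T ==> (\<Sum>x\<in>T. of_bool (x \<in> orb z)) = per z"
proof -
 assume z: "z \<in> T"
 have "T Int {x. x \<in> orb z} = orb z" using orb_T[OF z] by auto
 thus ?thesis by (simp add: per_def sum_of_bool_eq finite_T)
qed

lemma orb_outside: "z \<in> T ==> x ~: T ==> x ~: orb z"
 using orb_T by blast

lemma funpow_eq_self_iff: "z \<in> T ==> (ph ^^ j) z = z \<longleftrightarrow> per z dvd j"
 using funpow_eq_iff[of z j 0] by (simp add: dvd_eq_mod_eq_0)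

text \<open>The block is the indicator of an orbit, of weight \<open>per z\<close>; each point of
  the orbit contributes X^per / (1 - X^per), and \<open>per z\<close> divides j exactly when the
  j-th Frobenius power fixes z.\<close>

lemma G_gf: "fps_X * fps_deriv (Abs_fps (%n. of_nat (card (Gn n)))) = Nf * Abs_fps (%n. of_nat (card (Gn n)))"
  and finite_Gn: "finite (Gn n)"
proof -
 define b :: "'t => 't => nat" where "b z x = of_bool (x \<in> orb z)" for z x
 have bg: "b z \<in> Gclass" if "z \<in> T" for z
  using that ph_in_orb_iff[OF that] orb_outside[OF that] by (auto simp: Gclass_def b_def)
 have sub1: "b z x \<le> m x" if "m \<in> Gclass" "z \<in> T" "m z > 0" for m z x
  using Gclass_orb[OF that(1,2), of x] that(3) by (simp add: b_def)
 have sub2: "(%x. m x - b z x) \<in> Gclass" if "m \<in> Gclass" "z \<in> T" for m z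
  using that bg[OF that(2)] by (simp add: Gclass_def)
 have add1: "(%x. m x + b z x) \<in> Gclass" if "m \<in> Gclass" "z \<in> T" for m z
  using that bg[OF that(2)] by (simp add: Gclass_def)
 note R = block_generating_function[where C = Gclass and b = b and w = per and s = 1, OF finite_T]
 have *: "of_nat 1 * (fps_X * fps_deriv (Abs_fps (%n. of_nat (card {m \<in> Gclass. sum m T = 1 * n}) :: rat))) =
   (\<Sum>z\<in>T. of_nat (b z z) * geo (per z)) * Abs_fps (%n. of_nat (card {m \<in> Gclass. sum m T = 1 * n}))"
  "finite {m \<in> Gclass. sum m T = 1 * n}"
  by (rule R; use sub1 sub2 add1 in \<open>auto simp: Gclass_def b_def per_pos sum_orb_nat\<close>)+
 have "(\<Sum>z\<in>T. of_nat (b z z) * geo (per z)) = Nf"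
 proof (rule fps_ext)
  fix j
  have "(\<Sum>z\<in>T. of_nat (b z z) * geo (per z)) $ j = (\<Sum>z\<in>T. of_bool (0 < j & per z dvd j))"
   by (simp add: fps_sum_nth b_def geo_def of_bool_def)
  also have "... = Nf $ j"
  proof (cases "j = 0")
   case False
   have "T Int {z. 0 < j & per z dvd j} = {z \<in> T. (ph ^^ j) z = z}"
    using False funpow_eq_self_iff by auto
   thus ?thesis using False by (simp add: Nf_def sum_of_bool_eq finite_T)
  qed (simp add: Nf_def)
  finally show "(\<Sum>z\<in>T. of_nat (b z z) * geo (per z)) $ j = Nf $ j" .
 qed
 thus "fps_X * fps_deriv (Abs_fps (%n. of_nat (card (Gn n)))) = Nf * Abs_fps (%n. of_nat (card (Gn n)))"
  using *(1) by (simp add: Gn_def)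
 show "finite (Gn n)" using *(2) by (simp add: Gn_def)
qed

text \<open>The blocks are a unitary orbit, a pair of mutually inverse orbits, or a self-inverse
  point taken twice. Totals are 2n, so the weight is half the block total: e for a unitary orbit of
  length 2e. At a self-inverse point the block has value 2, matching its presence in both
  counts.\<close>

lemma H_gf: "2 * (fps_X * fps_deriv (Abs_fps (%n. of_nat (card (Hn n))))) =
   (Nf + Mf) * Abs_fps (%n. of_nat (card (Hn n)))"
  and finite_Hn: "finite (Hn n)"
proof -
 define b :: "'t => 't => nat" where
  "b z x = of_bool (x \<in> orb z) + (if unitary z then 0 else of_bool (x \<in> orb (io z)))" for z x
 define w where "w z = (if unitary z then per z div 2 else per z)" for z
 have fix_orb: "x \<in> orb z \<longleftrightarrow> x = z" if "z \<in> T" "io z = z" for x z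
 proof -
  have "(ph ^^ i) z = z" for i using io_fix[OF that] by (induction i) auto
  thus ?thesis by (auto simp: orb_def)
 qed
 have io_iff: "io x \<in> orb (io z) \<longleftrightarrow> x \<in> orb z" "io x \<in> orb z \<longleftrightarrow> x \<in> orb (io z)" if "x \<in> T" "z \<in> T" for x z
  using io_in_orb_iff[OF io_T[OF that(2)] that(1)] io_in_orb_iff[OF that(2,1)] that(2) by (simp_all add: io_io)
 have ph_iff: "ph x \<in> orb (io z) \<longleftrightarrow> x \<in> orb (io z)" "ph x \<in> orb z \<longleftrightarrow> x \<in> orb z" if "x \<in> T" "z \<in> T" for x z
  using ph_in_orb_iff[OF io_T[OF that(2)] that(1)] ph_in_orb_iff[OF that(2,1)] .
 have b_out: "b z x = 0" if "z \<in> T" "x ~: T" for z x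
  using orb_outside[OF that] orb_outside[OF io_T[OF that(1)] that(2)] by (simp add: b_def)
 have b_ph: "b z (ph x) = b z x" if "z \<in> T" "x \<in> T" for z x
  using ph_iff[OF that(2,1)] by (simp add: b_def)
 have b_io: "b z (io x) = b z x" if "z \<in> T" "x \<in> T" for z x
  using io_iff[OF that(2,1)] unitary_orb[OF that(1)] by (cases "unitary z") (simp_all add: b_def)
 have b_even: "even (b z x)" if "z \<in> T" "x \<in> T" "io x = x" for z x
 proof (cases "unitary z")
  case True
  have "x ~: orb z"
  proof
   assume "x \<in> orb z"
   hence "z = x" using in_orb_sym[OF that(1)] fix_orb[OF that(2,3)] by blast
   thus False using True that(3) by (simp add: unitary_def)
  qed
  thus ?thesis using True by (simp add: b_def)
 next
  case False
  thus ?thesis using io_iff(2)[OF that(2,1)] that(3) by (simp add: b_def)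
 qed
 have sub1: "b z x \<le> m x" if m: "m \<in> Hclass" "z \<in> T" "m z > 0" for m z x
 proof (cases "x \<in> T")
  case True
  have mG: "m \<in> Gclass" using m(1) by (simp add: Hclass_def)
  have miz: "m (io z) = m z" using m(1,2) by (simp add: Hclass_def)
  have 1: "m x = m z" if "x \<in> orb z" using Gclass_orb[OF mG m(2) that] .
  have 2: "m x = m z" if "x \<in> orb (io z)" using Gclass_orb[OF mG io_T[OF m(2)] that] miz by simp
  have 3: "m z \<ge> 2" if "x \<in> orb z" "x \<in> orb (io z)" "\<not> unitary z"
  proof -
   have "io z = z" using not_unitary_cases[OF m(2) that(3)] that(1,2) by blast
   hence "even (m z)" using m(1,2) by (simp add: Hclass_def)
   thus ?thesis using m(3) by (auto elim!: evenE)
  qed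
  show ?thesis using 1 2 3 m(3) by (auto simp: b_def)
 qed (use b_out m(2) in simp)
 have sub2: "(%x. m x - b z x) \<in> Hclass" if "m \<in> Hclass" "z \<in> T" for m z
  using that b_out b_ph b_io b_even by (auto simp: Hclass_def Gclass_def)
 have add1: "(%x. m x + b z x) \<in> Hclass" if "m \<in> Hclass" "z \<in> T" for m z
  using that b_out b_ph b_io b_even by (auto simp: Hclass_def Gclass_def)
 have wpos: "w z > 0" if zT: "z \<in> T" for z
 proof (cases "unitary z")
  case True
  obtain e where "e > 0" "per z = 2 * e" using unitary_exp[OF zT True] by metis
  thus ?thesis using True by (simp add: w_def)
 qed (use per_pos[OF zT] in \<open>simp add: w_def\<close>)
 have tot: "sum (b z) T = 2 * w z" if zT: "z \<in> T" for z
 proof (cases "unitary z")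
  case True
  obtain e where "per z = 2 * e" using unitary_exp[OF zT True] by metis
  thus ?thesis using True sum_orb_nat[OF zT] by (simp add: b_def w_def)
 next
  case False
  thus ?thesis using sum_orb_nat[OF zT] sum_orb_nat[OF io_T[OF zT]] per_io[OF zT]
   by (simp add: b_def w_def sum.distrib)
 qed
 have supp: "m z = 0" if "m \<in> Hclass" "z ~: T" for m z using that by (simp add: Hclass_def Gclass_def)
 have bpos: "b z z > 0" if "z \<in> T" for z by (simp add: b_def)
 note R = block_generating_function[where C = Hclass and b = b and w = w and s = 2, OF finite_T]
 have *: "of_nat 2 * (fps_X * fps_deriv (Abs_fps (%n. of_nat (card {m \<in> Hclass. sum m T = 2 * n}) :: rat))) =
   (\<Sum>z\<in>T. of_nat (b z z) * geo (w z)) * Abs_fps (%n. of_nat (card {m \<in> Hclass. sum m T = 2 * n}))"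
  "finite {m \<in> Hclass. sum m T = 2 * n}"
 proof -
  show "of_nat 2 * (fps_X * fps_deriv (Abs_fps (%n. of_nat (card {m \<in> Hclass. sum m T = 2 * n}) :: rat))) =
   (\<Sum>z\<in>T. of_nat (b z z) * geo (w z)) * Abs_fps (%n. of_nat (card {m \<in> Hclass. sum m T = 2 * n}))"
   by (rule R(1)) (use supp add1 sub1 sub2 bpos wpos tot in auto)
  show "finite {m \<in> Hclass. sum m T = 2 * n}"
   by (rule R(2)) (use supp add1 sub1 sub2 bpos wpos tot in auto)
 qed
 have "(\<Sum>z\<in>T. of_nat (b z z) * geo (w z)) = Nf + Mf"
 proof (rule fps_ext)
  fix j
  show "(\<Sum>z\<in>T. of_nat (b z z) * geo (w z)) $ j = (Nf + Mf) $ j"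
  proof (cases "j = 0")
   case True
   thus ?thesis by (simp add: fps_sum_nth geo_def Nf_def Mf_def fps_mult_of_nat_nth)
  next
   case False
   have "(\<Sum>z\<in>T. of_nat (b z z) * geo (w z)) $ j = (\<Sum>z\<in>T. of_nat (b z z) * of_bool (w z dvd j))"
    using False by (simp add: fps_sum_nth geo_def fps_mult_of_nat_nth of_bool_def)
   also have "... = (\<Sum>z\<in>T. of_bool ((ph ^^ j) z = z) + of_bool ((ph ^^ j) z = io z))"
   proof (rule sum.cong[OF refl])
    fix z assume z: "z \<in> T"
    show "of_nat (b z z) * of_bool (w z dvd j) = (of_bool ((ph ^^ j) z = z) + of_bool ((ph ^^ j) z = io z) :: rat)"
    proof (cases "unitary z")
     case True
     obtain e where e: "e > 0" "per z = 2 * e" "io z = (ph ^^ e) z" using unitary_exp[OF z True] .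
     have bw: "b z z = 1" "w z = e" using True e(2) by (simp_all add: b_def w_def)
     have io: "(ph ^^ j) z = io z \<longleftrightarrow> j mod (2 * e) = e"
      unfolding e(3) using funpow_eq_iff[OF z, of j e] e(1,2) by simp
     have self: "(ph ^^ j) z = z \<longleftrightarrow> j mod (2 * e) = 0"
      using funpow_eq_self_iff[OF z] e(2) by (simp add: dvd_eq_mod_eq_0)
     \<comment> \<open>The weight e allows two residues of j modulo the period 2e: residue 0 is
       counted by \<open>Nf\<close>, residue e by \<open>Mf\<close>.\<close>
     have "e dvd j \<longleftrightarrow> j mod (2 * e) = 0 \<or> j mod (2 * e) = e"
     proof
      assume "e dvd j"
      then obtain q where q: "j = e * q" by (elim dvdE)
      have "j mod (2 * e) = e * (q mod 2)" unfolding q mult.commute[of 2 e] by (rule mult_mod_right[symmetric])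
      thus "j mod (2 * e) = 0 \<or> j mod (2 * e) = e" by (cases "even q") (simp_all add: even_iff_mod_2_eq_zero odd_iff_mod_2_eq_one)
     next
      assume "j mod (2 * e) = 0 \<or> j mod (2 * e) = e"
      hence "e dvd j mod (2 * e)" by auto
      thus "e dvd j" by (simp add: dvd_mod_iff)
     qed
     thus ?thesis unfolding io self bw using e(1) by auto
    next
     case nu: False
     show ?thesis
     proof (cases "io z = z")
      case True
      have "(ph ^^ i) z = z" for i using io_fix[OF z True] by (induction i) auto
      moreover have "per z = 1"
      proof -
       have "orb z = {z}" using fix_orb[OF z True] by auto
       thus ?thesis by (simp add: per_def)
      qed
      ultimately show ?thesis using True nu by (simp add: b_def w_def)
     next
      case False
      have "io z ~: orb z" using nu False by (simp add: unitary_def)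
      hence "(ph ^^ j) z ~= io z" unfolding orb_def by (metis rangeI)
      moreover have "z ~: orb (io z)" using \<open>io z ~: orb z\<close> io_in_orb_iff[OF z z] by simp
      ultimately show ?thesis using nu funpow_eq_self_iff[OF z] by (simp add: b_def w_def)
     qed
    qed
   qed
   also have "... = (Nf + Mf) $ j"
   proof -
    have "T Int {z. (ph ^^ j) z = z} = {z \<in> T. (ph ^^ j) z = z}"
     "T Int {z. (ph ^^ j) z = io z} = {z \<in> T. (ph ^^ j) z = io z}" by auto
    thus ?thesis using False by (simp add: Nf_def Mf_def sum.distrib sum_of_bool_eq finite_T)
   qed
   finally show ?thesis .
  qed
 qed
 thus "2 * (fps_X * fps_deriv (Abs_fps (%n. of_nat (card (Hn n))))) =
   (Nf + Mf) * Abs_fps (%n. of_nat (card (Hn n)))"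
  using *(1) by (simp add: Hn_def)
 show "finite (Hn n)" using *(2) by (simp add: Hn_def)
qed

end

section \<open>Logarithmic derivatives of power series\<close>

text \<open>Series obtained with a fixed P agree with the final one only in finitely many
  coefficients.\<close>

definition same_upto :: "nat => rat fps => rat fps => bool" where
 "same_upto N f g \<longleftrightarrow> (\<forall>n\<le>N. f $ n = g $ n)"

text \<open>As c has constant term 0, the equation expresses 2n times the n-th coefficient through
  lower coefficients, which is a recursion.\<close>

lemma log_deriv_determines:
 fixes f g :: "rat fps"
 assumes "2 * (fps_X * fps_deriv f) = c * f" "2 * (fps_X * fps_deriv g) = d * g" "f $ 0 = g $ 0"
  and "c $ 0 = 0" "d $ 0 = 0" "same_upto N c d"
 shows "same_upto N f g"
proof -
 have "n \<le> N ==> f $ n = g $ n" for n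
 proof (induction n rule: less_induct)
  case (less n)
  show ?case
  proof (cases "n = 0")
   case True
   thus ?thesis using assms(3) by simp
  next
   case False
   have coeff: "(2 * (fps_X * fps_deriv h)) $ n = of_nat (2 * n) * h $ n" for h :: "rat fps"
    using False by (cases n) (simp_all add: numeral_fps_const)
   have "(c * f) $ n = (\<Sum>i=0..n. c $ i * f $ (n - i))" by (rule fps_mult_nth)
   also have "... = (\<Sum>i=0..n. d $ i * g $ (n - i))"
   proof (rule sum.cong[OF refl])
    fix i assume i: "i \<in> {0..n}"
    show "c $ i * f $ (n - i) = d $ i * g $ (n - i)"
    proof (cases "i = 0")
     case False
     hence "f $ (n - i) = g $ (n - i)" using i less.prems by (intro less.IH) auto
     moreover have "c $ i = d $ i" using i less.prems assms(6) by (auto simp: same_upto_def)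
     ultimately show ?thesis by simp
    qed (simp add: assms(4,5))
   qed
   also have "... = (d * g) $ n" by (rule fps_mult_nth[symmetric])
   finally have "of_nat (2 * n) * f $ n = of_nat (2 * n) * g $ n"
    by (simp only: coeff[symmetric] assms(1,2))
   thus ?thesis using False by simp
  qed
 qed
 thus ?thesis by (simp add: same_upto_def)
qed

lemma exp_fps_deriv:
 assumes "f $ 0 = 0"
 shows "fps_deriv (exp_fps f) = fps_deriv f * exp_fps f" "exp_fps f $ 0 = 1"
 using assms by (simp_all add: exp_fps_def fps_compose_deriv fps_compose_nth)

text \<open>The factor 2n produced by 2 X d/dX cancels the denominators of the exponents.\<close>

lemma exp_quotient_log_deriv:
 fixes a b :: "nat => rat"
 defines "A \<equiv> Abs_fps (%n. if n = 0 then 0 else a n / of_nat (2 * n))"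
  and "B \<equiv> Abs_fps (%n. if n = 0 then 0 else b n / of_nat (2 * n))"
 shows "2 * (fps_X * fps_deriv (exp_fps A / exp_fps B)) =
   Abs_fps (%n. if n = 0 then 0 else a n - b n) * (exp_fps A / exp_fps B)"
  and "(exp_fps A / exp_fps B) $ 0 = 1"
proof -
 have A0: "A $ 0 = 0" and B0: "B $ 0 = 0" by (simp_all add: A_def B_def)
 note dA = exp_fps_deriv[OF A0] and dB = exp_fps_deriv[OF B0]
 define Q where "Q = exp_fps A / exp_fps B"
 have QB: "Q * exp_fps B = exp_fps A"
  unfolding Q_def using dB(2) by (subst fps_divide_unit) (simp_all add: mult.assoc inverse_mult_eq_1)
 have eq: "fps_deriv Q * exp_fps B + Q * (fps_deriv B * exp_fps B) = fps_deriv A * (Q * exp_fps B)"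
 proof -
  have "fps_deriv (Q * exp_fps B) = fps_deriv A * (Q * exp_fps B)" unfolding QB by (rule dA(1))
  thus ?thesis unfolding fps_deriv_mult dB(1) by (simp only: add.commute)
 qed
 have "(fps_deriv Q + Q * fps_deriv B) * exp_fps B = (fps_deriv A * Q) * exp_fps B"
  using eq by (simp only: distrib_right mult.assoc)
 moreover have "exp_fps B ~= 0" using dB(2) by auto
 ultimately have "fps_deriv Q + Q * fps_deriv B = fps_deriv A * Q"
  by (simp only: mult_cancel_right simp_thms)
 hence dQ: "fps_deriv Q = (fps_deriv A - fps_deriv B) * Q"
  by (metis add_diff_cancel_right' left_diff_distrib mult.commute)
 have "2 * (fps_X * (fps_deriv A - fps_deriv B)) = Abs_fps (%n. if n = 0 then 0 else a n - b n)"
 proof (rule fps_ext)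
  fix n
  show "(2 * (fps_X * (fps_deriv A - fps_deriv B))) $ n = Abs_fps (%n. if n = 0 then 0 else a n - b n) $ n"
  proof (cases n)
   case (Suc k)
   define x where "x = (of_nat (2 * Suc k) :: rat)"
   have x: "x ~= 0" unfolding x_def by simp
   have "(2 * (fps_X * (fps_deriv A - fps_deriv B))) $ n = x * (A $ n - B $ n)"
    unfolding Suc x_def by (simp add: numeral_fps_const algebra_simps)
   also have "... = x * (a n / x - b n / x)" unfolding Suc x_def by (simp add: A_def B_def)
   also have "... = a n - b n" using x by (simp add: right_diff_distrib)
   finally show ?thesis using Suc by simp
  qed simp
 qed
 thus "2 * (fps_X * fps_deriv (exp_fps A / exp_fps B)) =
   Abs_fps (%n. if n = 0 then 0 else a n - b n) * (exp_fps A / exp_fps B)"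
  unfolding Q_def[symmetric] dQ by (simp add: mult.assoc[symmetric])
 have "Q $ 0 * exp_fps B $ 0 = exp_fps A $ 0" using arg_cong[OF QB, of "%f. f $ 0"] by simp
 thus "(exp_fps A / exp_fps B) $ 0 = 1" using dA(2) dB(2) by (simp add: Q_def)
qed

text \<open>Differentiating F G = H and using both recursions leaves (N + M) - 2 N = M - N.\<close>

lemma (in frob_set) quotient_log_deriv:
 fixes F :: "rat fps"
 assumes "F * Abs_fps (%n. of_nat (card (Gn n))) = Abs_fps (%n. of_nat (card (Hn n)))"
 shows "2 * (fps_X * fps_deriv F) = (Mf - Nf) * F" "F $ 0 = 1"
proof -
 define G :: "rat fps" where "G = Abs_fps (%n. of_nat (card (Gn n)))"
 define H :: "rat fps" where "H = Abs_fps (%n. of_nat (card (Hn n)))"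
 have FG: "F * G = H" using assms by (simp add: G_def H_def)
 have dG: "fps_X * fps_deriv G = Nf * G" unfolding G_def by (rule G_gf)
 have dH: "2 * (fps_X * fps_deriv H) = (Nf + Mf) * H" unfolding H_def by (rule H_gf)
 have zero: "Gn 0 = {%_. 0}" "Hn 0 = {%_. 0}"
 proof -
  have z: "m = (%_. 0)" if "m \<in> Gclass" "sum m T = 0" for m
  proof
   fix x show "m x = 0" using that finite_T by (cases "x \<in> T") (auto simp: Gclass_def)
  qed
  show "Gn 0 = {%_. 0}" using z by (auto simp: Gn_def) (auto simp: Gclass_def)
  show "Hn 0 = {%_. 0}" using z by (auto simp: Hn_def Hclass_def) (auto simp: Gclass_def)
 qed
 have G0: "G $ 0 = 1" and H0: "H $ 0 = 1" by (simp_all add: G_def H_def zero)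
 show "F $ 0 = 1" using arg_cong[OF FG, of "%f. f $ 0"] G0 H0 by simp
 have "2 * (fps_X * fps_deriv F) * G + 2 * F * (fps_X * fps_deriv G) = 2 * (fps_X * fps_deriv H)"
  unfolding FG[symmetric] by (simp add: algebra_simps)
 hence "2 * (fps_X * fps_deriv F) * G + 2 * F * (Nf * G) = (Nf + Mf) * (F * G)"
  unfolding dG dH FG .
 hence "(2 * (fps_X * fps_deriv F)) * G = ((Mf - Nf) * F) * G" by (simp add: algebra_simps)
 moreover have "G ~= 0" using G0 by auto
 ultimately show "2 * (fps_X * fps_deriv F) = (Mf - Nf) * F" by (simp only: mult_cancel_right simp_thms)
qed

section \<open>Counting characters fixed by Frobenius, up to inversion\<close>

lemma funpow_phc:
 fixes z :: "nat => 'a :: {field, finite} alg_closure"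
 assumes "z \<in> Tchar P r"
 shows "(phc r ^^ j) z = (\<lambda>i\<in>{..<r}. z i ^ (CARD('a) ^ j))"
proof (induction j)
 case 0
 show ?case using assms by (auto simp: Tchar_def PiE_def extensional_def)
next
 case (Suc j)
 thus ?case by (auto simp: phc_def frob_def power_mult[symmetric] mult.commute)
qed

lemma card_gcd_roots:
 assumes "of_nat P ~= (0 :: 'a :: {field, finite})"
 shows "card {x :: 'a alg_closure. x ^ P = 1 & x ^ m = 1} = gcd P m"
proof -
 have eq: "x ^ P = 1 & x ^ m = 1 \<longleftrightarrow> x ^ gcd P m = 1" for x :: "'a alg_closure"
 proof
  assume h: "x ^ P = 1 & x ^ m = 1"
  have P: "P ~= 0" using assms by (intro notI) simp
  obtain a b where ab: "P * a = m * b + gcd P m" using bezout_nat[OF P, of m] by blast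
  have "x ^ (P * a) = 1" "x ^ (m * b) = 1" using h by (simp_all add: power_mult)
  thus "x ^ gcd P m = 1" unfolding ab by (simp add: power_add)
 next
  assume h: "x ^ gcd P m = 1"
  have "x ^ (gcd P m * k) = 1" for k using h by (simp add: power_mult)
  thus "x ^ P = 1 & x ^ m = 1" by (metis gcd_dvd1 gcd_dvd2 dvd_mult_div_cancel)
 qed
 have "of_nat (gcd P m) ~= (0 :: 'a)"
 proof
  assume "of_nat (gcd P m) = (0 :: 'a)"
  hence "of_nat (gcd P m * (P div gcd P m)) = (0 :: 'a)" by (simp only: of_nat_mult mult_zero_left)
  thus False using assms by simp
 qed
 thus ?thesis unfolding eq by (rule card_roots_of_unity)
qed

text \<open>The bound on m forces its exponent of p to be at most a, so p^a is large enough to catch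
  the whole p-part.\<close>

lemma gcd_prime_power_part:
 assumes "Factorial_Ring.prime p" "m > 0" "m \<le> p ^ a"
 shows "gcd (p ^ a) m = p_part p m"
proof -
 obtain x where x: "m = p ^ multiplicity p m * x" "\<not> p dvd x"
  using multiplicity_decompose'[of m p] assms(1,2) not_prime_unit by (metis not_gr_zero)
 have "p ^ multiplicity p m \<le> p ^ a"
  using dvd_imp_le[OF multiplicity_dvd assms(2)] assms(3) by (rule order_trans)
 hence le: "multiplicity p m \<le> a" using prime_gt_1_nat[OF assms(1)] by (simp add: power_increasing_iff)
 have "coprime p x" using assms(1) x(2) by (simp add: prime_imp_coprime)
 have "gcd (p ^ a) m = gcd (p ^ multiplicity p m * p ^ (a - multiplicity p m)) (p ^ multiplicity p m * x)"
  using x(1) le by (simp add: power_add[symmetric])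
 also have "... = p ^ multiplicity p m * gcd (p ^ (a - multiplicity p m)) x"
  by (simp add: gcd_mult_distrib_nat)
 also have "gcd (p ^ (a - multiplicity p m)) x = 1" using \<open>coprime p x\<close> by simp
 finally show ?thesis by (simp add: p_part_def)
qed

text \<open>The condition separates over the r coordinates. On P-th roots of unity it reads x^(q^j -
  1) = 1 or x^(q^j + 1) = 1, and the solutions are the roots of unity of order dividing the
  gcd.\<close>

lemma card_fixed_Tchar:
 fixes r j :: nat
 assumes "of_nat P ~= (0 :: 'a :: {field, finite})"
 shows "card {z \<in> Tchar P r. (phc r ^^ j) z = (z :: nat => 'a alg_closure)} = gcd P (CARD('a) ^ j - 1) ^ r"
  and "card {z \<in> Tchar P r. (phc r ^^ j) z = ioc r (z :: nat => 'a alg_closure)} = gcd P (CARD('a) ^ j + 1) ^ r"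
proof -
 define Q where "Q = CARD('a) ^ j"
 have Q: "Q > 0" unfolding Q_def by simp
 have P: "P > 0" using assms by (cases P) simp_all
 have nz: "x ~= 0" if "x ^ P = 1" for x :: "'a alg_closure" using that P by (auto simp: zero_power)
 have 1: "x ^ Q = x \<longleftrightarrow> x ^ (Q - 1) = 1" if "x ^ P = 1" for x :: "'a alg_closure"
 proof -
  have "x ^ Q = x ^ (Q - 1) * x" using Q by (metis Suc_diff_1 power_Suc2)
  thus ?thesis using nz[OF that] by simp
 qed
 have 2: "x ^ Q = inverse x \<longleftrightarrow> x ^ (Q + 1) = 1" if "x ^ P = 1" for x :: "'a alg_closure"
  using nz[OF that] by (simp add: field_simps inverse_eq_divide eq_divide_eq)
 have "{z \<in> Tchar P r. (phc r ^^ j) z = (z :: nat => 'a alg_closure)} =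
   (\<Pi>\<^sub>E i\<in>{..<r}. {x. x ^ P = 1 & x ^ (Q - 1) = 1})" (is "?L = ?R")
 proof (intro subset_antisym subsetI)
  fix z :: "nat => 'a alg_closure" assume "z \<in> ?L"
  hence zT: "z \<in> Tchar P r" "(phc r ^^ j) z = z" by auto
  have z: "z \<in> Tchar P r" "(\<lambda>i\<in>{..<r}. z i ^ Q) = z"
   using zT unfolding funpow_phc[OF zT(1)] Q_def by auto
  have "z i ^ Q = z i" if "i < r" for i using fun_cong[OF z(2), of i] that by simp
  thus "z \<in> ?R" using z(1) 1 by (auto simp: Tchar_def PiE_def Pi_def)
 next
  fix z :: "nat => 'a alg_closure" assume z: "z \<in> ?R"
  hence T: "z \<in> Tchar P r" by (auto simp: Tchar_def PiE_def Pi_def)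
  have "(\<lambda>i\<in>{..<r}. z i ^ Q) = z" using z 1 by (auto simp: PiE_def Pi_def extensional_def)
  thus "z \<in> ?L" using T funpow_phc[OF T] by (simp add: Q_def)
 qed
 thus "card {z \<in> Tchar P r. (phc r ^^ j) z = (z :: nat => 'a alg_closure)} = gcd P (CARD('a) ^ j - 1) ^ r"
  by (simp add: card_PiE card_gcd_roots[OF assms] Q_def)
 have "{z \<in> Tchar P r. (phc r ^^ j) z = ioc r (z :: nat => 'a alg_closure)} =
   (\<Pi>\<^sub>E i\<in>{..<r}. {x. x ^ P = 1 & x ^ (Q + 1) = 1})" (is "?L = ?R")
 proof (intro subset_antisym subsetI)
  fix z :: "nat => 'a alg_closure" assume "z \<in> ?L"
  hence zT: "z \<in> Tchar P r" "(phc r ^^ j) z = ioc r z" by auto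
  have z: "z \<in> Tchar P r" "(\<lambda>i\<in>{..<r}. z i ^ Q) = ioc r z"
   using zT unfolding funpow_phc[OF zT(1)] Q_def by auto
  have "z i ^ Q = inverse (z i)" if "i < r" for i using fun_cong[OF z(2), of i] that by (simp add: ioc_def)
  thus "z \<in> ?R" using z(1) 2 by (auto simp: Tchar_def PiE_def Pi_def)
 next
  fix z :: "nat => 'a alg_closure" assume z: "z \<in> ?R"
  hence T: "z \<in> Tchar P r" by (auto simp: Tchar_def PiE_def Pi_def)
  have "z i ^ Q = inverse (z i)" if "i < r" for i using z 2[of "z i"] that by (auto simp: PiE_def Pi_def)
  hence "(\<lambda>i\<in>{..<r}. z i ^ Q) = ioc r z" by (auto simp: ioc_def)
  thus "z \<in> ?L" using T funpow_phc[OF T] by (simp add: Q_def)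
 qed
 thus "card {z \<in> Tchar P r. (phc r ^^ j) z = ioc r (z :: nat => 'a alg_closure)} = gcd P (CARD('a) ^ j + 1) ^ r"
  by (simp only: card_PiE finite_lessThan prod_constant card_lessThan card_gcd_roots[OF assms] Q_def)
qed

unbundle no fps_syntax
notation vec_index (infixl \<open>$\<close> 100)

subsection \<open>Matrices and functions\<close>

text \<open>The module locales need carriers inside an additive group type. Functions vanishing from
  N on provide one for vectors of length N.\<close>

definition FV :: "nat => (nat => 'a :: zero) set" where
 "FV N = {f. \<forall>i\<ge>N. f i = 0}"

definition fv :: "'a :: zero vec => nat => 'a" where
 "fv v i = (if i < dim_vec v then v $ i else 0)"

definition scf :: "'a :: times => (nat => 'a) => nat => 'a" where
 "scf c f i = c * f i"

definition opm :: "nat => 'a :: field mat => (nat => 'a) => nat => 'a" where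
 "opm N A f = fv (A *\<^sub>v vec N f)"

definition unitf :: "nat => nat => 'a :: zero_neq_one" where
 "unitf j i = (if i = j then 1 else 0)"

definition mat_of :: "nat => ((nat => 'a) => nat => 'a :: field) => 'a mat" where
 "mat_of N h = mat N N (%(i, j). h (unitf j) i)"

definition omf :: "nat => (nat => 'a :: field) => (nat => 'a) => 'a" where
 "omf n f g = (\<Sum>i<n. f i * g (n + i) - f (n + i) * g i)"

lemma fv_FV: "v \<in> carrier_vec N ==> fv v \<in> FV N"
 by (auto simp: fv_def FV_def)

lemma vec_fv: "v \<in> carrier_vec N ==> vec N (fv v) = v"
 by (intro eq_vecI) (auto simp: fv_def)

lemma fv_vec: "f \<in> FV N ==> fv (vec N f) = f"
 by (rule ext) (auto simp: fv_def FV_def)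

lemma inj_fv: "inj_on fv (carrier_vec N)"
 by (rule inj_on_inverseI[of _ "vec N"]) (rule vec_fv)

lemma fv_image: "fv ` carrier_vec N = (FV N :: (nat => 'a :: zero) set)"
proof
 show "(FV N :: (nat => 'a) set) \<subseteq> fv ` carrier_vec N"
 proof
  fix f :: "nat => 'a" assume "f \<in> FV N"
  hence "f = fv (vec N f)" by (simp only: fv_vec)
  thus "f \<in> fv ` carrier_vec N" by (rule image_eqI) (rule vec_carrier)
 qed
 show "fv ` carrier_vec N \<subseteq> (FV N :: (nat => 'a) set)" using fv_FV by (rule image_subsetI)
qed

lemma fv_add: "u \<in> carrier_vec N ==> v \<in> carrier_vec N ==> fv (u + v) = fv u + fv v"
 for u :: "'a :: field vec"
 by (rule ext) (auto simp: fv_def)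

lemma fv_smult: "fv (c \<cdot>\<^sub>v u) = scf c (fv u)" for c :: "'a :: mult_zero"
 by (rule ext) (auto simp: fv_def scf_def)

lemma fv_zero: "fv (0\<^sub>v N) = 0"
 by (rule ext) (auto simp: fv_def)

lemma finite_FV: "finite (FV N :: (nat => 'a :: {zero, finite}) set)"
proof -
 have "FV N = {f :: nat => 'a. ALL i. (i \<in> {..<N} --> f i \<in> UNIV) & (i ~: {..<N} --> f i = 0)}"
  by (auto simp: FV_def)
 thus ?thesis by (simp only:) (rule finite_set_of_finite_funs; simp)
qed

lemma card_FV: "card (FV N :: (nat => 'a :: {zero, finite}) set) = CARD('a) ^ N"
proof -
 have "bij_betw (%f. restrict f {..<N}) (FV N :: (nat => 'a) set) ({..<N} \<rightarrow>\<^sub>E UNIV)"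
  by (rule bij_betwI[where g = "%f i. if i < N then f i else 0"])
   (auto simp: FV_def PiE_def extensional_def fun_eq_iff)
 from bij_betw_same_card[OF this] show ?thesis by (simp add: card_PiE)
qed

lemma FV_closed:
 "0 \<in> FV N" "f \<in> FV N ==> g \<in> FV N ==> f + g \<in> FV N" "f \<in> FV N ==> scf c f \<in> FV N"
 for f g :: "nat => 'a :: field"
 by (auto simp: FV_def scf_def)

lemma unitf_FV: "j < N ==> unitf j \<in> FV N"
 by (auto simp: FV_def unitf_def)

lemma opm_apply:
 "A \<in> carrier_mat N N ==> opm N A f i = (if i < N then (\<Sum>j<N. A $$ (i, j) * f j) else 0)"
 by (auto simp: opm_def fv_def scalar_prod_def lessThan_atLeast0 intro!: sum.cong)

lemma opm_FV: "A \<in> carrier_mat N N ==> opm N A f \<in> FV N"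
 by (auto simp: FV_def opm_apply)

lemma opm_add: "A \<in> carrier_mat N N ==> opm N A (f + g) = opm N A f + opm N A g"
 by (rule ext) (simp add: opm_apply distrib_left sum.distrib)

lemma opm_scf: "A \<in> carrier_mat N N ==> opm N A (scf c f) = scf c (opm N A f)"
 by (rule ext) (simp add: opm_apply scf_def sum_distrib_left mult.left_commute)

lemma opm_vec: "v \<in> carrier_vec N ==> A \<in> carrier_mat N N ==> opm N A (fv v) = fv (A *\<^sub>v v)"
 by (simp add: opm_def vec_fv)

lemma opm_one: "f \<in> FV N ==> opm N (1\<^sub>m N) f = f"
 by (simp add: opm_def fv_vec)

lemma opm_mult:
 assumes "A \<in> carrier_mat N N" "B \<in> carrier_mat N N"
 shows "opm N (A * B) f = opm N A (opm N B f)"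
proof -
 have "vec N (fv (B *\<^sub>v vec N f)) = B *\<^sub>v vec N f"
  using assms by (intro vec_fv mult_mat_vec_carrier) auto
 thus ?thesis using assms by (simp add: opm_def assoc_mult_mat_vec[of A N N B N])
qed

lemma opm_inject:
 assumes "A \<in> carrier_mat N N" "B \<in> carrier_mat N N" "!!f. f \<in> FV N ==> opm N A f = opm N B f"
 shows "A = B"
proof (rule eq_matI)
 fix i j assume ij: "i < dim_row B" "j < dim_col B"
 have u: "opm N D (unitf j) i = D $$ (i, j)" if "D \<in> carrier_mat N N" for D :: "'a mat"
 proof -
  have iN: "i < N" "j < N" using ij assms(2) by auto
  have "opm N D (unitf j) i = (\<Sum>l<N. D $$ (i, l) * unitf j l)" using iN by (simp add: opm_apply[OF that])
  also have "... = (\<Sum>l\<in>{j}. D $$ (i, l) * unitf j l)"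
   using iN by (intro sum.mono_neutral_right) (auto simp: unitf_def)
  finally show ?thesis by (simp add: unitf_def)
 qed
 show "A $$ (i, j) = B $$ (i, j)"
  using assms(3)[OF unitf_FV, of j] u[OF assms(1)] u[OF assms(2)] ij assms(2) by simp
qed (use assms in auto)

lemma FV_expand:
 fixes f :: "nat => 'a :: field"
 assumes "f \<in> FV N" "h 0 = 0"
  and "!!f g. f \<in> FV N ==> g \<in> FV N ==> h (f + g) = h f + h g"
  and "!!c f. f \<in> FV N ==> h (scf c f) = scf c (h f)"
 shows "h f i = (\<Sum>j<N. h (unitf j) i * f j)"
proof -
 have "n \<le> N ==> h (%i. if i < n then f i else 0) = (%i. \<Sum>j<n. h (unitf j) i * f j)" for n
 proof (induction n)
  case 0
  have "(%i. if i < 0 then f i else 0) = 0" by auto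
  thus ?case using assms(2) by auto
 next
  case (Suc n)
  have e: "(%i. if i < Suc n then f i else 0) = (%i. if i < n then f i else 0) + scf (f n) (unitf n)"
   by (auto simp: fun_eq_iff scf_def unitf_def less_Suc_eq)
  have a: "(%i. if i < n then f i else 0) \<in> FV N" using Suc.prems by (auto simp: FV_def)
  have b: "unitf n \<in> FV N" using Suc.prems by (intro unitf_FV) simp
  show ?case
   unfolding e assms(3)[OF a FV_closed(3)[OF b]] assms(4)[OF b]
   using Suc by (auto simp: scf_def fun_eq_iff)
 qed
 from this[OF order_refl] have "h (%i. if i < N then f i else 0) = (%i. \<Sum>j<N. h (unitf j) i * f j)" .
 moreover have "(%i. if i < N then f i else 0) = f" using assms(1) by (auto simp: FV_def)
 ultimately show ?thesis by simp
qed

lemma mat_of_carrier: "mat_of N h \<in> carrier_mat N N"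
 by (simp add: mat_of_def)

lemma opm_mat_of:
 fixes f :: "nat => 'a :: field"
 assumes "f \<in> FV N" "!!f. f \<in> FV N ==> h f \<in> FV N"
  and "!!f g. f \<in> FV N ==> g \<in> FV N ==> h (f + g) = h f + h g"
  and "!!c f. f \<in> FV N ==> h (scf c f) = scf c (h f)"
 shows "opm N (mat_of N h) f = h f"
proof
 fix i
 have "h 0 = 0" using assms(3)[of 0 0] FV_closed(1) by (metis add.right_neutral add_left_cancel)
 note e = FV_expand[OF assms(1) this assms(3,4), of i]
 show "opm N (mat_of N h) f i = h f i"
 proof (cases "i < N")
  case True
  have "opm N (mat_of N h) f i = (\<Sum>j<N. h (unitf j) i * f j)"
   unfolding opm_apply[OF mat_of_carrier] using True by (auto simp: mat_of_def intro!: sum.cong)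
  thus ?thesis using e by simp
 next
  case False
  thus ?thesis using assms(2)[OF assms(1)] by (auto simp: opm_apply[OF mat_of_carrier] FV_def)
 qed
qed

lemma omf_addl: "omf n (f + f') g = omf n f g + omf n f' g"
 by (simp add: omf_def sum.distrib[symmetric] algebra_simps)

lemma omf_skew: "omf n g f = - omf n f g"
 by (simp add: omf_def sum_negf[symmetric] mult.commute)

lemma omf_self: "omf n f f = 0"
 by (simp add: omf_def mult.commute)

lemma omf_scf: "omf n (scf c f) g = c * omf n f g"
 by (simp add: omf_def scf_def sum_distrib_left algebra_simps)

lemma omf_nondeg:
 assumes "f \<in> FV (2 * n)" "!!g. g \<in> FV (2 * n) ==> omf n f g = 0"
 shows "f = 0"
proof
 fix i
 have 1: "f j = 0" if "j < n" for j
 proof -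
  have "omf n f (unitf (n + j)) = (\<Sum>i<n. if i = j then f i else 0)"
   unfolding omf_def using that by (intro sum.cong) (auto simp: unitf_def)
  thus ?thesis using assms(2)[OF unitf_FV, of "n + j"] that by (simp add: sum.delta')
 qed
 have 2: "f (n + j) = 0" if "j < n" for j
 proof -
  have "omf n f (unitf j) = (\<Sum>i<n. if i = j then - f (n + i) else 0)"
   unfolding omf_def using that by (intro sum.cong) (auto simp: unitf_def)
  thus ?thesis using assms(2)[OF unitf_FV, of j] that by (simp add: sum.delta')
 qed
 consider "i < n" | "n \<le> i" "i < 2 * n" | "2 * n \<le> i" by linarith
 thus "f i = 0 i"
 proof cases
  case 2
  hence "f (n + (i - n)) = 0" by (intro \<open>!!j. j < n ==> f (n + j) = 0\<close>) simp
  thus ?thesis using 2 by simp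
 qed (use 1 assms(1) in \<open>auto simp: FV_def\<close>)
qed

lemma sp_form_omf:
 assumes "u \<in> carrier_vec (2 * n)" "v \<in> carrier_vec (2 * n)"
 shows "sp_form n u v = omf n (fv u) (fv v)"
 using assms by (auto simp: sp_form_def omf_def fv_def intro!: sum.cong)

section \<open>The symplectic group as a group of operators\<close>

definition spm :: "nat => 'a :: {field, finite} mat => bool" where
 "spm n A \<longleftrightarrow> A \<in> carrier_mat (2 * n) (2 * n) &
  (\<forall>f\<in>FV (2 * n). \<forall>g\<in>FV (2 * n). omf n (opm (2 * n) A f) (opm (2 * n) A g) = omf n f g)"

text \<open>Preserving a nondegenerate form makes the operator injective, hence bijective on the
  finite space. The inverse map is linear and preserves the form as well, so it comes from a
  matrix.\<close>

lemma spm_inverse: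
 fixes A :: "'a :: {field, finite} mat"
 assumes "spm n A"
 obtains B where "spm n B" "A * B = 1\<^sub>m (2 * n)" "B * A = 1\<^sub>m (2 * n)"
proof -
 let ?V = "FV (2 * n) :: (nat => 'a) set" and ?o = "opm (2 * n)"
 have A: "A \<in> carrier_mat (2 * n) (2 * n)"
  and iso: "!!f g. f \<in> ?V ==> g \<in> ?V ==> omf n (?o A f) (?o A g) = omf n f g"
  using assms by (auto simp: spm_def)
 have inj: "inj_on (?o A) ?V"
 proof (rule inj_onI)
  fix f g assume fg: "f \<in> ?V" "g \<in> ?V" "?o A f = ?o A g"
  have neg: "scf (- 1) g \<in> ?V" using fg(2) by (rule FV_closed)
  have "f + scf (- 1) g = 0"
  proof (rule omf_nondeg)
   show "f + scf (- 1) g \<in> ?V" using fg(1) neg by (rule FV_closed)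
   fix h assume h: "h \<in> ?V"
   have "omf n (f + scf (- 1) g) h = omf n f h - omf n g h" by (simp add: omf_addl omf_scf)
   also have "... = 0" using iso[OF fg(1) h] iso[OF fg(2) h] fg(3) by simp
   finally show "omf n (f + scf (- 1) g) h = 0" .
  qed
  thus "f = g" by (auto simp: fun_eq_iff scf_def)
 qed
 have "?o A ` ?V = ?V"
  by (rule endo_inj_surj[OF finite_FV _ inj]) (use opm_FV[OF A] in auto)
 hence bij: "bij_betw (?o A) ?V ?V" using inj by (simp add: bij_betw_def)
 define h where "h = inv_into ?V (?o A)"
 have hV: "h f \<in> ?V" if "f \<in> ?V" for f
  using bij_betw_inv_into[OF bij] that by (auto simp: h_def bij_betw_def)
 have Ah: "?o A (h f) = f" if "f \<in> ?V" for f using bij_betw_inv_into_right[OF bij that] by (simp add: h_def)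
 have hA: "h (?o A f) = f" if "f \<in> ?V" for f using bij_betw_inv_into_left[OF bij that] by (simp add: h_def)
 have h_eq: "h f = g" if "g \<in> ?V" "?o A g = f" for f g using hA[OF that(1)] that(2) by simp
 have h_add: "h (f + g) = h f + h g" if "f \<in> ?V" "g \<in> ?V" for f g
  by (rule h_eq) (simp_all add: hV that FV_closed opm_add[OF A] Ah)
 have h_sc: "h (scf c f) = scf c (h f)" if "f \<in> ?V" for c f
  by (rule h_eq) (simp_all add: hV that FV_closed opm_scf[OF A] Ah)
 define B where "B = mat_of (2 * n) h"
 have B: "B \<in> carrier_mat (2 * n) (2 * n)" by (simp add: B_def mat_of_carrier)
 have oB: "?o B f = h f" if "f \<in> ?V" for f
  unfolding B_def by (rule opm_mat_of[OF that hV h_add h_sc])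
 have "spm n B"
  unfolding spm_def using B iso[OF hV hV] by (auto simp: oB Ah)
 moreover have "A * B = 1\<^sub>m (2 * n)"
  by (rule opm_inject[of _ "2 * n"]) (use A B in \<open>auto simp: opm_mult oB Ah opm_one\<close>)
 moreover have "B * A = 1\<^sub>m (2 * n)"
  by (rule opm_inject[of _ "2 * n"]) (use A B in \<open>auto simp: opm_mult oB hA opm_FV opm_one\<close>)
 ultimately show ?thesis by (rule that)
qed

lemma carrier_Sp: "A \<in> carrier (Sp ty n) \<longleftrightarrow> spm n A"
 for A :: "'a :: {field, finite} mat"
proof
 assume "A \<in> carrier (Sp ty n)"
 hence A: "A \<in> carrier_mat (2 * n) (2 * n)"
  and iso: "!!u v. u \<in> carrier_vec (2 * n) ==> v \<in> carrier_vec (2 * n) ==>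
   sp_form n (A *\<^sub>v u) (A *\<^sub>v v) = sp_form n u v"
  by (auto simp: Sp_def)
 have "omf n (opm (2 * n) A (fv u)) (opm (2 * n) A (fv v)) = omf n (fv u) (fv v)"
  if "u \<in> carrier_vec (2 * n)" "v \<in> carrier_vec (2 * n)" for u v
  using iso[OF that] that A sp_form_omf[OF mult_mat_vec_carrier[OF A] mult_mat_vec_carrier[OF A]]
  by (simp add: opm_vec sp_form_omf)
 thus "spm n A" unfolding spm_def fv_image[symmetric] using A by blast
next
 assume s: "spm n A"
 hence A: "A \<in> carrier_mat (2 * n) (2 * n)" by (simp add: spm_def)
 obtain B where B: "spm n B" "A * B = 1\<^sub>m (2 * n)" "B * A = 1\<^sub>m (2 * n)" using spm_inverse[OF s] .
 have "invertible_mat A"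
  unfolding invertible_mat_def inverts_mat_def square_mat.simps
  using A B by (intro conjI exI[of _ B]) (auto simp: spm_def)
 moreover have "sp_form n (A *\<^sub>v u) (A *\<^sub>v v) = sp_form n u v"
  if uv: "u \<in> carrier_vec (2 * n)" "v \<in> carrier_vec (2 * n)" for u v
 proof -
  have "sp_form n (A *\<^sub>v u) (A *\<^sub>v v) = omf n (opm (2 * n) A (fv u)) (opm (2 * n) A (fv v))"
   using sp_form_omf[OF mult_mat_vec_carrier[OF A uv(1)] mult_mat_vec_carrier[OF A uv(2)]] uv A
   by (simp add: opm_vec)
  also have "... = omf n (fv u) (fv v)" using s fv_FV[OF uv(1)] fv_FV[OF uv(2)] by (simp add: spm_def)
  finally show ?thesis using sp_form_omf[OF uv] by simp
 qed
 ultimately show "A \<in> carrier (Sp ty n)" using A by (simp add: Sp_def)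
qed

lemma Sp_simps [simp]: "monoid.mult (Sp ty n) = (*)" "one (Sp ty n) = 1\<^sub>m (2 * n)"
 by (simp_all add: Sp_def)

lemma spm_one: "spm n (1\<^sub>m (2 * n))"
 by (simp add: spm_def opm_one)

lemma spm_mult: "spm n A ==> spm n B ==> spm n (A * B)"
 by (auto simp: spm_def opm_mult opm_FV)

lemma group_Sp: "group (Sp (ty :: 'a :: {field, finite} itself) n)"
proof (rule groupI)
 fix x y z :: "'a mat"
 assume "x \<in> carrier (Sp ty n)" "y \<in> carrier (Sp ty n)" "z \<in> carrier (Sp ty n)"
 thus "x \<otimes>\<^bsub>Sp ty n\<^esub> y \<otimes>\<^bsub>Sp ty n\<^esub> z = x \<otimes>\<^bsub>Sp ty n\<^esub> (y \<otimes>\<^bsub>Sp ty n\<^esub> z)"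
  by (simp add: carrier_Sp spm_def assoc_mult_mat[of x "2 * n" "2 * n" y "2 * n" z "2 * n"])
next
 fix x :: "'a mat" assume "x \<in> carrier (Sp ty n)"
 hence x: "spm n x" by (simp add: carrier_Sp)
 obtain y where y: "spm n y" "x * y = 1\<^sub>m (2 * n)" "y * x = 1\<^sub>m (2 * n)" using spm_inverse[OF x] .
 show "\<exists>y\<in>carrier (Sp ty n). y \<otimes>\<^bsub>Sp ty n\<^esub> x = \<one>\<^bsub>Sp ty n\<^esub>"
  using y by (intro bexI[of _ y]) (simp_all add: carrier_Sp)
 show "\<one>\<^bsub>Sp ty n\<^esub> \<otimes>\<^bsub>Sp ty n\<^esub> x = x" using x by (auto simp: spm_def intro: left_mult_one_mat)
qed (simp_all add: carrier_Sp spm_one spm_mult)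

lemma finite_Sp: "finite (carrier (Sp (ty :: 'a :: {field, finite} itself) n))"
proof (rule finite_subset)
 let ?N = "2 * n"
 show "carrier (Sp ty n) \<subseteq> (%f. mat ?N ?N f) ` (({..<?N} \<times> {..<?N}) \<rightarrow>\<^sub>E UNIV)"
 proof
  fix A assume "A \<in> carrier (Sp ty n)"
  hence A: "A \<in> carrier_mat ?N ?N" by (simp add: carrier_Sp spm_def)
  have "A = mat ?N ?N (restrict (%p. A $$ p) ({..<?N} \<times> {..<?N}))"
   using A by (intro eq_matI) auto
  thus "A \<in> (%f. mat ?N ?N f) ` (({..<?N} \<times> {..<?N}) \<rightarrow>\<^sub>E UNIV)"
   by (rule image_eqI[where x = "restrict (%p. A $$ p) ({..<?N} \<times> {..<?N})"]) auto
 qed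
 show "finite ((%f. mat ?N ?N f :: 'a mat) ` (({..<?N} \<times> {..<?N}) \<rightarrow>\<^sub>E UNIV))"
  by (intro finite_imageI finite_PiE) auto
qed

lemma opm_pow:
 fixes A :: "'a :: {field, finite} mat"
 assumes "A \<in> carrier (Sp ty n)" "f \<in> FV (2 * n)"
 shows "opm (2 * n) (A [^]\<^bsub>Sp ty n\<^esub> (m :: nat)) f = (opm (2 * n) A ^^ m) f"
proof -
 interpret G: group "Sp ty n" by (rule group_Sp)
 have A: "A \<in> carrier_mat (2 * n) (2 * n)" using assms(1) by (simp add: carrier_Sp spm_def)
 have "opm (2 * n) (A [^]\<^bsub>Sp ty n\<^esub> m) g = (opm (2 * n) A ^^ m) g" if "g \<in> FV (2 * n)" for g
  using that
 proof (induction m arbitrary: g)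
  case (Suc m)
  have "A [^]\<^bsub>Sp ty n\<^esub> m \<in> carrier_mat (2 * n) (2 * n)"
   using G.nat_pow_closed[OF assms(1)] by (simp add: carrier_Sp spm_def)
  thus ?case using Suc.IH[OF opm_FV[OF A]] A
   by (simp add: opm_mult funpow_swap1)
 qed (simp add: opm_one)
 thus ?thesis using assms(2) .
qed

subsection \<open>Orbit counting and chains\<close>

text \<open>f is a complete invariant of orbits, so its fibres in Om are the orbits, and the
  stabiliser orders along one orbit add up to the order of the group.\<close>

lemma (in group) weighted_burnside:
 assumes fin: "finite (carrier G)" "finite Om"
  and comp: "!!g h w. g \<in> carrier G ==> h \<in> carrier G ==> w \<in> Om ==> al (g \<otimes> h) w = al g (al h w)"
  and one: "!!w. w \<in> Om ==> al \<one> w = w"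
  and f: "!!w w'. w \<in> Om ==> w' \<in> Om ==> f w = f w' \<longleftrightarrow> (\<exists>g\<in>carrier G. al g w = w')"
  and cl: "!!g w. g \<in> carrier G ==> w \<in> Om ==> al g w \<in> Om"
 shows "(\<Sum>w\<in>Om. card {g \<in> carrier G. al g w = w}) = card (carrier G) * card (f ` Om)"
proof -
 have orbit: "(\<Sum>w\<in>{w \<in> Om. f w = d}. card {g \<in> carrier G. al g w = w}) = card (carrier G)" if d: "d \<in> f ` Om" for d
 proof -
  obtain w0 where w0: "w0 \<in> Om" "f w0 = d" using d by blast
  \<comment> \<open>A stabiliser has as many elements as the set of g carrying the base point w0 to
    w; these sets partition the group.\<close>
  have stab: "card {g \<in> carrier G. al g w = w} = card {g \<in> carrier G. al g w0 = w}"
   if w: "w \<in> Om" "f w = d" for w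
  proof -
   have "f w0 = f w" using w w0 by simp
   then obtain h where h: "h \<in> carrier G" "al h w0 = w" using f[OF w0(1) w(1)] by blast
   have bk: "al (inv h) w = w0"
    using comp[of "inv h" h w0] h w0(1) one by simp
   have "bij_betw (%g. g \<otimes> h) {g \<in> carrier G. al g w = w} {g \<in> carrier G. al g w0 = w}"
   proof (rule bij_betwI[where g = "%g. g \<otimes> inv h"])
    show "(%g. g \<otimes> h) \<in> {g \<in> carrier G. al g w = w} \<rightarrow> {g \<in> carrier G. al g w0 = w}"
     using h w0(1) comp[of _ h w0] by auto
    show "(%g. g \<otimes> inv h) \<in> {g \<in> carrier G. al g w0 = w} \<rightarrow> {g \<in> carrier G. al g w = w}"
     using h(1) w(1) comp[of _ "inv h" w] bk by auto
   qed (use h(1) in \<open>auto simp: m_assoc\<close>)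
   thus ?thesis by (rule bij_betw_same_card)
  qed
  have "(\<Sum>w\<in>{w \<in> Om. f w = d}. card {g \<in> carrier G. al g w = w}) =
    (\<Sum>w\<in>{w \<in> Om. f w = d}. card {g \<in> carrier G. al g w0 = w})"
   by (rule sum.cong) (auto simp: stab)
  also have "... = card (\<Union>w\<in>{w \<in> Om. f w = d}. {g \<in> carrier G. al g w0 = w})"
   by (rule card_UN_disjoint[symmetric]) (use fin in auto)
  also have "(\<Union>w\<in>{w \<in> Om. f w = d}. {g \<in> carrier G. al g w0 = w}) = carrier G"
  proof -
   have "al g w0 \<in> Om & f (al g w0) = d" if g: "g \<in> carrier G" for g
    using f[OF w0(1) cl[OF g w0(1)]] cl[OF g w0(1)] g w0(2) by auto
   thus ?thesis by auto
  qed
  finally show ?thesis .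
 qed
 have "(\<Sum>w\<in>Om. card {g \<in> carrier G. al g w = w}) =
   (\<Sum>d\<in>f ` Om. \<Sum>w\<in>{w \<in> Om. f w = d}. card {g \<in> carrier G. al g w = w})"
  by (rule sum.image_gen[OF fin(2)])
 also have "... = card (carrier G) * card (f ` Om)" using orbit by simp
 finally show ?thesis .
qed

section \<open>Chains and flags\<close>

definition flags :: "'b set set => nat => 'b set list set" where
 "flags Q k = {ws. length ws = k & set ws \<subseteq> Q & sorted_wrt (\<subset>) ws}"

text \<open>The empty chain is included with sign 1, so this is the negative of the reduced Euler
  characteristic.\<close>

definition chain_sum :: "'b set set => int" where
 "chain_sum Q = (\<Sum>C | subset.chain Q C. (-1) ^ card C)"

lemma finite_chains: "finite Q ==> finite {C. subset.chain Q C}"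
 by (rule finite_subset[of _ "Pow Q"]) (auto simp: subset_chain_def)

lemma reduced_euler_chain_sum:
 assumes "finite Q"
 shows "reduced_euler_char Q = - chain_sum Q"
proof -
 have fin: "finite {C. subset.chain Q C & C ~= {}}"
  by (rule finite_subset[OF _ finite_chains[OF assms]]) auto
 have "{C. subset.chain Q C} = insert {} {C. subset.chain Q C & C ~= {}}"
  by (auto simp: subset_chain_def)
 hence "chain_sum Q = 1 + (\<Sum>C | subset.chain Q C & C ~= {}. (-1) ^ card C)"
  unfolding chain_sum_def by (simp only:) (subst sum.insert; use fin in simp)
 also have "(\<Sum>C | subset.chain Q C & C ~= {}. (-1) ^ card C) =
   (\<Sum>C | subset.chain Q C & C ~= {}. - ((-1 :: int) ^ (card C - 1)))"
 proof (rule sum.cong[OF refl])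
  fix C assume "C \<in> {C. subset.chain Q C & C ~= {}}"
  hence "card C > 0" using assms finite_subset by (auto simp: subset_chain_def card_gt_0_iff)
  then obtain c where "card C = Suc c" using gr0_conv_Suc by blast
  thus "(-1 :: int) ^ card C = - ((-1) ^ (card C - 1))" by simp
 qed
 finally show ?thesis by (simp add: reduced_euler_char_def sum_negf)
qed

lemma sorted_psubset_distinct: "sorted_wrt (\<subset>) ws ==> distinct ws"
 by (induction ws) auto

lemma sorted_psubset_unique:
 "sorted_wrt (\<subset>) ws ==> sorted_wrt (\<subset>) vs ==> set ws = set vs ==> ws = vs"
proof (induction ws arbitrary: vs)
 case (Cons w ws)
 then obtain v vs' where vs: "vs = v # vs'" by (cases vs) auto
 have p: "!!y. y \<in> set ws ==> w \<subset> y" "!!y. y \<in> set vs' ==> v \<subset> y"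
  using Cons.prems(1,2) by (simp_all add: vs)
 have e: "insert w (set ws) = insert v (set vs')" using Cons.prems(3) by (simp add: vs)
 have "w \<in> insert v (set vs')" "v \<in> insert w (set ws)" unfolding e[symmetric] by (rule insertI1) (simp only: e insertI1)
 hence "w = v" using p by blast
 have "w ~: set ws" "v ~: set vs'" using p by blast+
 hence "set ws = set vs'" using e unfolding \<open>w = v\<close> by (metis insert_ident)
 thus ?case using Cons.IH[of vs'] Cons.prems unfolding vs \<open>w = v\<close> by simp
qed simp

lemma chain_sorted_list:
 assumes "finite C" "subset.chain Q C"
 shows "EX ws. sorted_wrt (\<subset>) ws & set ws = C"
 using assms
proof (induction "card C" arbitrary: C)
 case 0
 thus ?case by (intro exI[of _ "[]"]) simp
next
 case (Suc c)
 hence "C ~= {}" by auto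
 then obtain m where m: "m \<in> C" "!!b. b \<in> C ==> m \<subseteq> b ==> m = b"
  using finite_has_maximal[OF Suc.prems(1)] by metis
 have lt: "b \<subset> m" if "b \<in> C - {m}" for b
 proof -
  have "b \<subseteq> m \<or> m \<subseteq> b" using that m(1) Suc.prems(2) by (auto simp only: subset_chain_def)
  thus ?thesis using m(2)[of b] that by blast
 qed
 have "subset.chain Q (C - {m})" using Suc.prems(2) by (auto simp: subset_chain_def)
 moreover have "c = card (C - {m})" using Suc m by simp
 ultimately obtain ws where "sorted_wrt (\<subset>) ws" "set ws = C - {m}"
  using Suc.hyps(1)[of "C - {m}"] Suc.prems by auto
 thus ?case using lt m(1) by (intro exI[of _ "ws @ [m]"]) (auto simp: sorted_wrt_append)
qed

lemma card_flags:
 assumes "finite Q"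
 shows "card (flags Q k) = card {C. subset.chain Q C & card C = k}"
proof (rule bij_betw_same_card[of set], unfold bij_betw_def, intro conjI)
 show "inj_on set (flags Q k)"
  by (rule inj_onI) (auto simp: flags_def intro: sorted_psubset_unique)
 show "set ` flags Q k = {C. subset.chain Q C & card C = k}"
 proof (intro subset_antisym subsetI)
  fix C assume "C \<in> set ` flags Q k"
  then obtain ws where ws: "C = set ws" "length ws = k" "set ws \<subseteq> Q" "sorted_wrt (\<subset>) ws"
   by (auto simp: flags_def)
  have "x \<subseteq> y \<or> y \<subseteq> x" if "x \<in> set ws" "y \<in> set ws" for x y
   using that ws(4) by (induction ws) auto
  thus "C \<in> {C. subset.chain Q C & card C = k}"
   using ws distinct_card[OF sorted_psubset_distinct[OF ws(4)]] by (auto simp: subset_chain_def)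
 next
  fix C assume C: "C \<in> {C. subset.chain Q C & card C = k}"
  hence "finite C" using assms finite_subset by (auto simp: subset_chain_def)
  then obtain ws where ws: "sorted_wrt (\<subset>) ws" "set ws = C" using chain_sorted_list C by blast
  have "ws \<in> flags Q k"
   using ws C distinct_card[OF sorted_psubset_distinct[OF ws(1)]] by (auto simp: flags_def subset_chain_def)
  thus "C \<in> set ` flags Q k" using ws(2) by blast
 qed
qed

text \<open>K may be any upper bound for the size, so one bound can be used simultaneously for the
  fixed posets of all tuples.\<close>

lemma chain_sum_flags:
 assumes "finite Q" "card Q \<le> K"
 shows "chain_sum Q = (\<Sum>k\<le>K. (-1) ^ k * int (card (flags Q k)))"
proof -
 have "card ` {C. subset.chain Q C} \<subseteq> {..K}"
  using assms by (auto simp: subset_chain_def intro: order_trans[OF card_mono])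
 hence "chain_sum Q = (\<Sum>k\<le>K. \<Sum>C\<in>{C. C \<in> {C. subset.chain Q C} & card C = k}. (-1) ^ card C)"
  unfolding chain_sum_def by (intro sum.group[symmetric] finite_chains assms(1)) auto
 also have "... = (\<Sum>k\<le>K. (-1) ^ k * int (card (flags Q k)))"
  by (rule sum.cong[OF refl]) (simp add: card_flags[OF assms(1)])
 finally show ?thesis .
qed

lemma finite_flags: "finite Q ==> finite (flags Q k)"
 by (rule finite_subset[OF _ finite_lists_length_eq[of Q k]]) (auto simp: flags_def)

lemma chain_sum_image:
 assumes "!!A B. A \<in> Q ==> B \<in> Q ==> A \<subseteq> B \<longleftrightarrow> h A \<subseteq> h B"
 shows "chain_sum (h ` Q) = chain_sum Q"
proof -
 have inj: "inj_on h Q" by (rule inj_onI) (use assms in blast)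
 have "bij_betw (image h) {C. subset.chain Q C} {C. subset.chain (h ` Q) C}"
  unfolding bij_betw_def
 proof
  show "inj_on (image h) {C. subset.chain Q C}"
   using inj by (auto simp: inj_on_def subset_chain_def dest!: inj_on_image_eq_iff[OF inj, THEN iffD1, rotated -1])
  show "image h ` {C. subset.chain Q C} = {C. subset.chain (h ` Q) C}"
  proof (intro subset_antisym subsetI)
   fix C assume "C \<in> {C. subset.chain (h ` Q) C}"
   hence C: "C \<subseteq> h ` Q" "!!x y. x \<in> C ==> y \<in> C ==> x \<subseteq> y \<or> y \<subseteq> x" by (auto simp: subset_chain_def)
   define D where "D = {A \<in> Q. h A \<in> C}"
   have "C = h ` D" using C(1) by (auto simp: D_def)
   moreover have "subset.chain Q D" using C(2) assms by (auto simp: D_def subset_chain_def)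
   ultimately show "C \<in> image h ` {C. subset.chain Q C}" by blast
  next
   fix C assume "C \<in> image h ` {C. subset.chain Q C}"
   then obtain D where D: "C = h ` D" "D \<subseteq> Q" "!!a b. a \<in> D ==> b \<in> D ==> a \<subseteq> b \<or> b \<subseteq> a"
    by (auto simp: subset_chain_def)
   have "h a \<subseteq> h b \<or> h b \<subseteq> h a" if "a \<in> D" "b \<in> D" for a b
    using D(3)[OF that] assms[of a b] assms[of b a] that D(2) by blast
   thus "C \<in> {C. subset.chain (h ` Q) C}" unfolding D(1) using D(2) by (auto simp: subset_chain_def)
  qed
 qed
 hence "chain_sum (h ` Q) = (\<Sum>C | subset.chain Q C. (-1) ^ card (h ` C))"
  unfolding chain_sum_def by (rule sum.reindex_bij_betw[symmetric])
 also have "... = chain_sum Q"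
  unfolding chain_sum_def
  by (rule sum.cong[OF refl]) (auto simp: subset_chain_def card_image inj_on_subset[OF inj])
 finally show ?thesis .
qed

subsection \<open>Models with prescribed data\<close>

context frob_set
begin

text \<open>Locally c - star c works, for c not fixed by inversion: a non-symmetric c on a unitary
  orbit, the indicator of one orbit on a pair. It supplies the skew coefficients of the model
  form.\<close>

lemma ex_skew:
 obtains b where "b \<in> Eq" "!!z. z \<in> T ==> b (io z) = - b z" "!!z. z \<in> T ==> io z ~= z ==> b z ~= 0"
proof -
 define S where "S z = orb z \<union> orb (io z)" for z
 define good where "good z g \<longleftrightarrow> g \<in> Eq & (\<forall>x\<in>T. g (io x) = - g x) & (io z ~= z --> (\<forall>x\<in>S z. g x ~= 0))" for z g
 have ex: "EX g. good z g" if z: "z \<in> T" for z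
 proof -
  have "\<exists>c\<in>Eq. c (io z) ~= c z \<or> io z = z"
  proof (cases "unitary z")
   case True
   thus ?thesis using unitary_nonfixed[OF z] by metis
  next
   case False
   show ?thesis
   proof (cases "io z = z")
    case nf: False
    hence "io z ~: orb z" using False by (simp add: unitary_def)
    thus ?thesis using z by (intro bexI[of _ "ind z"]) (auto simp: ind_def)
   qed (use Eq_closed(1) in blast)
  qed
  then obtain c where c: "c \<in> Eq" "c (io z) ~= c z \<or> io z = z" by blast
  let ?g = "c - star c"
  have g: "?g \<in> Eq" using c(1) by simp
  have sk: "?g (io x) = - ?g x" if "x \<in> T" for x using that by (simp add: star_def io_io)
  have "?g x ~= 0" if "io z ~= z" "x \<in> S z" for x
  proof
   assume x0: "?g x = 0"
   have xT: "x \<in> T" using that(2) orb_T z io_T by (auto simp: S_def)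
   have "?g z = 0"
   proof (cases "x \<in> orb z")
    case True
    thus ?thesis using Eq_orb_0[OF g xT x0 in_orb_sym[OF z True]] by simp
   next
    case False
    hence "x \<in> orb (io z)" using that(2) by (simp add: S_def)
    hence "?g (io z) = 0" using Eq_orb_0[OF g xT x0 in_orb_sym[OF io_T[OF z]]] by simp
    thus ?thesis using sk[OF z] by simp
   qed
   thus False using c(2) that(1) by (simp add: star_def)
  qed
  thus ?thesis using g sk unfolding good_def by (intro exI[of _ ?g]) blast
 qed
 \<comment> \<open>The choice depends only on the union of the orbits of z and its inverse, so all
   its points use the same function and equivariance and skewness survive the patching.\<close>
 define ga where "ga A = (SOME g. g \<in> Eq & (\<forall>x\<in>T. g (io x) = - g x) & (ALL z. z \<in> T --> A = S z --> io z ~= z --> (\<forall>x\<in>S z. g x ~= 0)))" for A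
 have S_ph: "S (ph z) = S z" if "z \<in> T" for z
  unfolding S_def io_ph[OF that] orb_eq[OF that ph_in_orb[OF self_in_orb]]
   orb_eq[OF io_T[OF that] ph_in_orb[OF self_in_orb]] ..
 have S_io: "S (io z) = S z" if "z \<in> T" for z
  unfolding S_def io_io[OF that] by (rule Un_commute)
 have io_S: "io z' ~= z'" if "z \<in> T" "z' \<in> T" "S z' = S z" "io z ~= z" for z z'
 proof
  assume f: "io z' = z'"
  have "(ph ^^ i) z' = z'" for i using io_fix[OF that(2) f] by (induction i) auto
  hence "orb z' = {z'}" by (auto simp: orb_def)
  hence "S z' = {z'}" using f by (simp add: S_def)
  hence e: "S z = {z'}" using that(3) by (simp only:)
  have "z \<in> S z" "io z \<in> S z" by (simp_all add: S_def)
  hence "z = z'" "io z = z'" unfolding e by blast+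
  thus False using that(4) by simp
 qed
 have ga: "ga (S z) \<in> Eq & (\<forall>x\<in>T. ga (S z) (io x) = - ga (S z) x) & (io z ~= z --> (\<forall>x\<in>S z. ga (S z) x ~= 0))"
  if z: "z \<in> T" for z
 proof -
  obtain g where g: "good z g" using ex[OF z] by blast
  have "EX g. g \<in> Eq & (\<forall>x\<in>T. g (io x) = - g x) & (ALL z'. z' \<in> T --> S z = S z' --> io z' ~= z' --> (\<forall>x\<in>S z'. g x ~= 0))"
  proof (intro exI[of _ g] conjI allI impI)
   fix z' assume h: "z' \<in> T" "S z = S z'" "io z' ~= z'"
   have "io z ~= z" using io_S[OF h(1) z h(2,3)] .
   thus "\<forall>x\<in>S z'. g x ~= 0" using g unfolding good_def h(2) by blast
  qed (use g in \<open>auto simp: good_def\<close>)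
  from someI_ex[OF this] show ?thesis unfolding ga_def using z by blast
 qed
 show ?thesis
 proof (rule that[of "%z. ga (S z) z"])
  show "(%z. ga (S z) z) \<in> Eq"
   unfolding Eq_def
  proof (intro CollectI ballI)
   fix z assume z: "z \<in> T"
   show "ga (S (ph z)) (ph z) = frob (ga (S z) z)"
    unfolding S_ph[OF z] by (rule Eq_ph[OF conjunct1[OF ga[OF z]] z])
  qed
 next
  fix z assume z: "z \<in> T"
  show "ga (S (io z)) (io z) = - ga (S z) z" unfolding S_io[OF z] using ga[OF z] z by blast
 next
  fix z assume z: "z \<in> T" "io z ~= z"
  have "z \<in> S z" by (simp add: S_def)
  thus "ga (S z) z ~= 0" using ga[OF z(1)] z(2) by blast
 qed
qed

end

section \<open>Modules of sequences with a monomial form\<close>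

context frob_set
begin

text \<open>The coordinate \<open>u j\<close> is an equivariant function switched off at z for j
  beyond \<open>M z\<close>, so the component at z has dimension \<open>M z\<close> over the residue
  field. Flag steps are obtained by lowering the cutoff.\<close>

definition Um :: "('t => nat) => (nat => 't => 'a alg_closure) set" where
 "Um M = {u. (ALL j. u j \<in> Eq) & (ALL j z. z ~: T \<or> M z \<le> j --> u j z = 0)}"

definition actm :: "('t => 'a alg_closure) => (nat => 't => 'a alg_closure) => nat => 't => 'a alg_closure" where
 "actm w u j z = w z * u j z"

text \<open>The trace of a monomial sesquilinear form with coefficients c, where coordinate j at z
  meets coordinate \<open>pr z j\<close> at the inverse point.\<close>

definition omm :: "('t => nat) => (nat => 't => 'a alg_closure) => ('t => nat => nat) =>
  (nat => 't => 'a alg_closure) => (nat => 't => 'a alg_closure) => 'a" where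
 "omm M c pr u v = tr (%z. \<Sum>j<M z. c j z * u j z * v (pr z j) (io z))"

lemma finite_Um: "finite (Um M)"
proof -
 define A where "A = {..<Suc (\<Sum>z\<in>T. M z)} \<times> T"
 define B where "B = insert 0 (\<Union>z\<in>T. (%w. w z) ` Eq)"
 have K: "finite ((%w. w z) ` Eq)" if "z \<in> T" for z
  using card_Eq_values[OF that] by (intro card_ge_0_finite) simp
 have "finite B" unfolding B_def using finite_T K by simp
 hence fin: "finite {h. ALL x. (x \<in> A --> h x \<in> B) & (x ~: A --> h x = 0)}"
  by (intro finite_set_of_finite_funs) (use finite_T in \<open>auto simp: A_def\<close>)
 have "(%u (j, z). u j z) ` Um M \<subseteq> {h. ALL x. (x \<in> A --> h x \<in> B) & (x ~: A --> h x = 0)}"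
 proof
  fix h assume "h \<in> (%u (j, z). u j z) ` Um M"
  then obtain u where u: "u \<in> Um M" "h = (%(j, z). u j z)" by blast
  have "u j z = 0" if "(j, z) ~: A" for j z
  proof (cases "z \<in> T")
   case True
   hence "M z \<le> (\<Sum>z\<in>T. M z)" using finite_T by (intro member_le_sum) auto
   hence "M z \<le> j" using that True by (simp add: A_def)
   thus ?thesis using u(1) by (simp add: Um_def)
  qed (use u(1) in \<open>simp add: Um_def\<close>)
  moreover have "u j z \<in> B" if "(j, z) \<in> A" for j z
  proof -
   have "z \<in> T" "u j \<in> Eq" using that u(1) by (auto simp: A_def Um_def)
   thus ?thesis unfolding B_def by blast
  qed
  ultimately show "h \<in> {h. ALL x. (x \<in> A --> h x \<in> B) & (x ~: A --> h x = 0)}"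
   unfolding u(2) by auto
 qed
 hence "finite ((%u (j, z). u j z) ` Um M)" using fin finite_subset by blast
 thus ?thesis by (rule finite_imageD) (auto simp: inj_on_def fun_eq_iff)
qed

lemma Um_add: "u \<in> Um M ==> v \<in> Um M ==> u + v \<in> Um M"
 by (auto simp: Um_def)

lemma Um_actm: "w \<in> Eq ==> u \<in> Um M ==> actm w u \<in> Um M"
proof -
 assume h: "w \<in> Eq" "u \<in> Um M"
 have "actm w u j = w * u j" for j by (auto simp: actm_def)
 thus ?thesis using h by (auto simp: Um_def simp del: times_fun_apply) (auto simp: actm_def)
qed

lemma eqmod_Um: "eqmod T ph io (Um M) actm"
proof unfold_locales
 show "finite (Um M)" by (rule finite_Um)
 show "0 \<in> Um M" using Eq_closed(2) by (auto simp: Um_def)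
qed (auto simp: Um_add Um_actm actm_def fun_eq_iff algebra_simps, auto simp: Um_def)

lemma card_part_Um:
 assumes z: "z \<in> T" and M: "!!z. z \<in> T ==> M (ph z) = M z"
 shows "card (eqmod.part ph actm z (Um M)) = CARD('a) ^ (per z * M z)"
proof -
 interpret E: eqmod T ph io ty "Um M" actm by (rule eqmod_Um)
 define K where "K = (%w. w z) ` Eq"
 have M_orb: "M x = M z" if "x \<in> orb z" for x
 proof -
  have "M ((ph ^^ i) z) = M z" for i using M funpow_T[OF z] by (induction i) auto
  thus ?thesis using that by (auto simp: orb_def)
 qed
 have part: "u \<in> E.part z (Um M) \<longleftrightarrow> u \<in> Um M & (ALL j x. x ~: orb z --> u j x = 0)" for u
 proof -
  have "actm (ind z) u = u \<longleftrightarrow> (ALL j x. x ~: orb z --> u j x = 0)"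
   by (auto simp: actm_def ind_def fun_eq_iff)
  thus ?thesis by (simp add: E.part_def)
 qed
 have "bij_betw (%u. \<lambda>j\<in>{..<M z}. u j z) (E.part z (Um M)) ({..<M z} \<rightarrow>\<^sub>E K)"
  unfolding bij_betw_def
 proof
  show "inj_on (%u. \<lambda>j\<in>{..<M z}. u j z) (E.part z (Um M))"
  proof (rule inj_onI)
   fix u v assume h: "u \<in> E.part z (Um M)" "v \<in> E.part z (Um M)"
    "(\<lambda>j\<in>{..<M z}. u j z) = (\<lambda>j\<in>{..<M z}. v j z)"
   note u = h(1)[unfolded part] and v = h(2)[unfolded part]
   have e: "u j z = v j z" for j
   proof (cases "j < M z")
    case True
    thus ?thesis using fun_cong[OF h(3), of j] by simp
   next
    case False
    thus ?thesis using u v by (simp add: Um_def)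
   qed
   have "u j x = v j x" for j x
   proof (cases "x \<in> orb z")
    case True
    show ?thesis
     by (rule Eq_orb_eq[where w = "u j" and w' = "v j", OF _ _ z e True]) (use u v in \<open>simp_all add: Um_def\<close>)
   qed (use u v in simp)
   thus "u = v" by (intro ext)
  qed
  show "(%u. \<lambda>j\<in>{..<M z}. u j z) ` E.part z (Um M) = {..<M z} \<rightarrow>\<^sub>E K"
  proof (intro subset_antisym subsetI)
   fix h assume "h \<in> (%u. \<lambda>j\<in>{..<M z}. u j z) ` E.part z (Um M)"
   then obtain u where u: "u \<in> Um M" "h = (\<lambda>j\<in>{..<M z}. u j z)" unfolding E.part_def by blast
   have "u j z \<in> K" for j using u(1) unfolding K_def Um_def by blast
   thus "h \<in> {..<M z} \<rightarrow>\<^sub>E K" unfolding u(2) by auto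
  next
   fix h assume h: "h \<in> {..<M z} \<rightarrow>\<^sub>E K"
   have "\<exists>w\<in>Eq. w z = h j & (\<forall>x\<in>T. x ~: orb z --> w x = 0)" if "j < M z" for j
   proof -
    have "h j \<in> K" using h that by auto
    hence "(frob ^^ per z) (h j) = h j" unfolding K_def using Eq_per[OF _ z] by auto
    thus ?thesis using Eq_section[OF z] by metis
   qed
   then obtain w where w: "!!j. j < M z ==> w j \<in> Eq" "!!j. j < M z ==> w j z = h j"
    "!!j x. j < M z ==> x \<in> T ==> x ~: orb z ==> w j x = 0" by metis
   define u where "u j x = (if j < M z & x \<in> orb z then w j x else 0)" for j x
   have "u j \<in> Eq" for j
    unfolding Eq_def
   proof (intro CollectI ballI)
    fix x assume x: "x \<in> T"
    show "u j (ph x) = frob (u j x)"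
     using Eq_ph[OF w(1)[of j] x] ph_in_orb_iff[OF z x] by (simp add: u_def)
   qed
   moreover have "u j x = 0" if "x ~: T \<or> M x \<le> j" for j x
    using that orb_T[OF z] M_orb[of x] by (auto simp: u_def)
   ultimately have "u \<in> E.part z (Um M)" unfolding part by (auto simp: Um_def u_def)
   moreover have "h = (\<lambda>j\<in>{..<M z}. u j z)"
    using h by (auto simp: u_def w(2) PiE_def extensional_def fun_eq_iff)
   ultimately show "h \<in> (%u. \<lambda>j\<in>{..<M z}. u j z) ` E.part z (Um M)" by blast
  qed
 qed
 hence "card (E.part z (Um M)) = card ({..<M z} \<rightarrow>\<^sub>E K)" by (rule bij_betw_same_card)
 also have "... = CARD('a) ^ (per z * M z)"
  using card_Eq_values[OF z] by (simp add: card_PiE K_def power_mult)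
 finally show ?thesis .
qed

end

context frob_set
begin

lemma Um_mono:
 assumes "!!z. z \<in> T ==> M' z \<le> M z"
 shows "Um M' \<subseteq> Um M"
proof
 fix u assume u: "u \<in> Um M'"
 have "u j z = 0" if "z ~: T \<or> M z \<le> j" for j z
 proof -
  have "z ~: T \<or> M' z \<le> j" using that assms[of z] by linarith
  thus ?thesis using u unfolding Um_def by blast
 qed
 thus "u \<in> Um M" using u unfolding Um_def by blast
qed

text \<open>The pairing matches index \<open>j\<close> at \<open>z\<close> with index \<open>pr z j\<close> at \<open>io z\<close>; it has no fixed points, so the
 form is alternating in characteristic two as well.\<close>

lemma symp_Um:
 fixes G :: "nat => 't => nat"
 assumes M: "!!z. z \<in> T ==> M (ph z) = M z" "!!z. z \<in> T ==> M (io z) = M z"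
  and pr: "!!z j. z \<in> T ==> j < M z ==> pr z j < M z" "!!z j. z \<in> T ==> j < M z ==> pr (io z) (pr z j) = j"
   "!!z j. z \<in> T ==> pr (ph z) j = pr z j" "!!z j. z \<in> T ==> io z = z ==> j < M z ==> pr z j ~= j"
  and c: "!!j. c j \<in> Eq" "!!z j. z \<in> T ==> j < M z ==> c (pr z j) (io z) = - c j z"
   "!!z j. z \<in> T ==> j < M z ==> c j z ~= 0"
  and G: "!!i z. z \<in> T ==> G i z \<le> M z" "!!z. z \<in> T ==> G 0 z = 0" "!!i z. z \<in> T ==> G i z \<le> G (Suc i) z"
   "!!i z. z \<in> T ==> k \<le> i ==> G i z = G k z"
   "!!i z j. z \<in> T ==> j < G i z ==> G i (io z) \<le> pr z j"
 shows "symp T ph io (Um M) actm (omm M c pr) (%i. Um (G i)) k"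
proof -
 interpret E: eqmod T ph io ty "Um M" actm by (rule eqmod_Um)
 define tm where "tm u v j z = c j z * u j z * v (pr z j) (io z)" for u v j z
 have om: "omm M c pr u v = tr (%z. \<Sum>j<M z. tm u v j z)" for u v by (simp add: omm_def tm_def)
 have tmE: "(%z. \<Sum>j<M z. tm u v j z) \<in> Eq" if "u \<in> Um M" "v \<in> Um M" for u v
  unfolding Eq_def
 proof (intro CollectI ballI)
  fix z assume z: "z \<in> T"
  have uE: "u j \<in> Eq" "v j \<in> Eq" for j using that by (auto simp: Um_def)
  have "tm u v j (ph z) = frob (tm u v j z)" for j
   by (simp add: tm_def Eq_ph[OF c(1) z] Eq_ph[OF uE(1) z] pr(3)[OF z] io_ph[OF z] Eq_ph[OF uE(2) io_T[OF z]])
  thus "(\<Sum>j<M (ph z). tm u v j (ph z)) = frob (\<Sum>j<M z. tm u v j z)" by (simp add: M(1)[OF z])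
 qed
 define Z where "Z = Sigma T (%z. {..<M z})"
 have finZ: "finite Z" unfolding Z_def using finite_T by auto
 have toac: "to_ac (omm M c pr u v) = (\<Sum>(z, j)\<in>Z. tm u v j z)" if "u \<in> Um M" "v \<in> Um M" for u v
  unfolding om to_ac_tr[OF tmE[OF that]] Z_def by (rule sum.Sigma) (use finite_T in auto)
 define rf where "rf = (%(z, j). (io z, pr z j))"
 have rfZ: "rf x \<in> Z" "rf (rf x) = x" "rf x ~= x" if "x \<in> Z" for x
  using that pr io_T io_io M(2) by (auto simp: rf_def Z_def)
 have sw: "tm v u (pr z j) (io z) = - tm u v j z" if "z \<in> T" "j < M z" for u v z j
  using that by (simp add: tm_def c(2) pr(2) io_io)
 have skew: "omm M c pr v u = - omm M c pr u v" if uv: "u \<in> Um M" "v \<in> Um M" for u v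
 proof (subst to_ac_eq_iff[symmetric])
  have "(\<Sum>x\<in>Z. (%(z, j). tm v u j z) x) = (\<Sum>x\<in>Z. (%(z, j). tm v u j z) (rf x))"
   by (rule sum.reindex_bij_witness[of _ rf rf]) (use rfZ in auto)
  also have "... = (\<Sum>x\<in>Z. - (%(z, j). tm u v j z) x)"
   by (rule sum.cong[OF refl]) (use sw in \<open>auto simp: rf_def Z_def\<close>)
  finally show "to_ac (omm M c pr v u) = to_ac (- omm M c pr u v)"
   by (simp add: toac uv sum_negf)
 qed
 have self0: "omm M c pr u u = 0" if u: "u \<in> Um M" for u
 proof (subst to_ac_eq_iff[symmetric])
  \<comment> \<open>Index pairs cancel two by two under the fixed-point-free involution
    \<open>rf\<close>. Skewness alone would only show that twice the sum is 0.\<close>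
  have "finite A ==> (!!x. x \<in> A ==> rf x \<in> A) ==> A \<subseteq> Z ==> (\<Sum>x\<in>A. (%(z, j). tm u u j z) x) = 0" for A
  proof (induction "card A" arbitrary: A rule: less_induct)
   case less
   show ?case
   proof (cases "A = {}")
    case False
    then obtain x where x: "x \<in> A" by blast
    hence xZ: "x \<in> Z" using less.prems(3) by blast
    have rx: "rf x \<in> A" "rf x ~= x" using less.prems(2)[OF x] rfZ(3)[OF xZ] .
    let ?B = "A - {x} - {rf x}"
    have "rf y \<in> ?B" if "y \<in> ?B" for y
    proof -
     have y: "y \<in> A" "y ~= x" "y ~= rf x" "y \<in> Z" using that less.prems(3) by auto
     have "rf y ~= x" using rfZ(2)[OF y(4)] y(3) by auto
     moreover have "rf y ~= rf x" using rfZ(2)[OF y(4)] rfZ(2)[OF xZ] y(2) by metis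
     ultimately show ?thesis using less.prems(2)[OF y(1)] by simp
    qed
    moreover have "card ?B < card A"
     by (rule psubset_card_mono) (use less.prems(1) x in auto)
    ultimately have "(\<Sum>y\<in>?B. (%(z, j). tm u u j z) y) = 0"
     using less.prems by (intro less.hyps) auto
    moreover have "(%(z, j). tm u u j z) (rf x) = - (%(z, j). tm u u j z) x"
     using xZ sw by (auto simp: rf_def Z_def)
    moreover have "(\<Sum>y\<in>A. (%(z, j). tm u u j z) y) = (%(z, j). tm u u j z) x + ((%(z, j). tm u u j z) (rf x) + (\<Sum>y\<in>?B. (%(z, j). tm u u j z) y))"
     using less.prems(1) x rx by (subst sum.remove[OF _ x], simp, subst sum.remove[of _ "rf x"]) auto
    ultimately show ?thesis by simp
   qed simp
  qed
  from this[OF finZ rfZ(1) subset_refl] show "to_ac (omm M c pr u u) = to_ac 0"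
   by (simp only: toac[OF u u] to_ac_0)
 qed
 have om_tr: "omm M c pr u v = tr f" if "!!z. z \<in> T ==> (\<Sum>j<M z. tm u v j z) = f z" for u v f
  unfolding om using that by (rule tr_cong)
 show ?thesis
 proof unfold_locales
  fix u u' v assume h: "u \<in> Um M" "u' \<in> Um M" "v \<in> Um M"
  have "omm M c pr (u + u') v = tr ((%z. \<Sum>j<M z. tm u v j z) + (%z. \<Sum>j<M z. tm u' v j z))"
   by (rule om_tr) (simp add: tm_def algebra_simps sum.distrib)
  thus "omm M c pr (u + u') v = omm M c pr u v + omm M c pr u' v"
   using tr_add[OF tmE[OF h(1,3)] tmE[OF h(2,3)]] by (simp only: om)
 next
  fix u v x assume h: "u \<in> Um M" "v \<in> Um M"
  have "omm M c pr (actm (cst x) u) v = tr (cst x * (%z. \<Sum>j<M z. tm u v j z))"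
   by (rule om_tr) (simp add: tm_def actm_def sum_distrib_left algebra_simps)
  thus "omm M c pr (actm (cst x) u) v = x * omm M c pr u v"
   using tr_cst[OF tmE[OF h]] by (simp only: om)
 next
  fix w u v assume h: "w \<in> Eq" "u \<in> Um M" "v \<in> Um M"
  show "omm M c pr (actm w u) v = omm M c pr u (actm (star w) v)"
   unfolding om
   by (rule tr_cong) (simp add: tm_def actm_def star_def io_io algebra_simps)
 next
  fix u assume u: "u \<in> Um M" and z0: "!!v. v \<in> Um M ==> omm M c pr u v = 0"
  have "u j z = 0" for j z
  proof (rule ccontr)
   assume nz: "u j z ~= 0"
   hence z: "z \<in> T" and j: "j < M z" using u by (auto simp: Um_def not_less[symmetric])
   have uE: "u j \<in> Eq" using u by (simp add: Um_def)
   have "c j * u j \<in> Eq" "(c j * u j) z ~= 0" using c(1) uE c(3)[OF z j] nz by auto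
   from tr_nondeg[OF this(1) z this(2)] obtain d where d: "d \<in> Eq" "tr (ind z * ((c j * u j) * d)) ~= 0" by blast
   \<comment> \<open>A test vector with the single coordinate \<open>pr z j\<close>, supported on
     the inverse orbit; pairing with it isolates the coordinate j of u on the orbit of z.\<close>
   define v where "v l x = (if l = pr z j & x \<in> T then (ind z * d) (io x) else 0)" for l x
   have e: "ind z * d \<in> Eq" using z d(1) by auto
   have M_orb: "M x = M z" "pr x l = pr z l" if "x \<in> orb z" for x l
   proof -
    have "M ((ph ^^ i) z) = M z & pr ((ph ^^ i) z) l = pr z l" for i l
     using M(1) pr(3) funpow_T[OF z] by (induction i) auto
    thus "M x = M z" "pr x l = pr z l" using that by (auto simp: orb_def)
   qed
   have "v l \<in> Eq" for l
    unfolding Eq_def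
   proof (intro CollectI ballI)
    fix x assume x: "x \<in> T"
    show "v l (ph x) = frob (v l x)"
     using Eq_ph[OF e io_T[OF x]] ph_T[OF x] by (simp add: v_def x io_ph)
   qed
   moreover have "v l x = 0" if "x ~: T \<or> M x \<le> l" for l x
   proof (cases "l = pr z j & x \<in> T & io x \<in> orb z")
    case True
    hence "M (io x) = M z" using M_orb by blast
    hence "M x = M z" using M(2) True by simp
    thus ?thesis using that True pr(1)[OF z j] by simp
   qed (auto simp: v_def ind_def)
   ultimately have "v \<in> Um M" by (auto simp: Um_def)
   hence "omm M c pr u v = 0" by (rule z0)
   moreover have "omm M c pr u v = tr (ind z * ((c j * u j) * d))"
   proof (rule om_tr)
    fix x assume x: "x \<in> T"
    show "(\<Sum>l<M x. tm u v l x) = (ind z * ((c j * u j) * d)) x"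
    proof (cases "x \<in> orb z")
     case True
     have "tm u v l x = (if l = j then c j x * u j x * d x else 0)" if "l < M x" for l
     proof (cases "l = j")
      case l: True
      thus ?thesis using True x M_orb[OF True] by (simp add: tm_def v_def io_T io_io ind_def)
     next
      case False
      have "pr x l ~= pr z j"
      proof
       assume "pr x l = pr z j"
       hence "pr (io z) (pr z l) = pr (io z) (pr z j)" using M_orb[OF True] by simp
       hence "l = j" using pr(2)[OF z, of l] pr(2)[OF z j] that M_orb(1)[OF True] by simp
       thus False using False by simp
      qed
      thus ?thesis using False by (simp add: tm_def v_def)
     qed
     hence "(\<Sum>l<M x. tm u v l x) = (\<Sum>l<M x. if l = j then c j x * u j x * d x else 0)" by simp
     also have "... = c j x * u j x * d x" using j M_orb(1)[OF True] by (simp add: sum.delta')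
     finally show ?thesis using True by (simp add: ind_def)
    next
     case False
     thus ?thesis using x by (simp add: tm_def v_def ind_def io_io io_T)
    qed
   qed
   ultimately show False using d(2) by simp
  qed
  thus "u = 0" by (intro ext) simp
 next
  fix i
  show "E.eqsub (Um (G i))"
  proof -
   interpret I: eqmod T ph io ty "Um (G i)" actm by (rule eqmod_Um)
   have "Um (G i) \<subseteq> Um M" by (rule Um_mono) (rule G(1))
   thus ?thesis unfolding E.eqsub_def using I.zero_U I.add_U I.act_U by blast
  qed
  show "Um (G i) \<subseteq> Um (G (Suc i))" by (rule Um_mono) (rule G(3))
  show "Um (G i) = Um (G k)" if "k \<le> i"
   by (intro subset_antisym Um_mono) (use G(4)[OF _ that] in \<open>simp_all only: order_refl\<close>)
  fix u v assume uv: "u \<in> Um (G i)" "v \<in> Um (G i)"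
  have "omm M c pr u v = tr 0"
  proof (rule om_tr)
   fix z assume z: "z \<in> T"
   have "tm u v j z = 0" if "j < M z" for j
   proof (cases "j < G i z")
    case True
    hence "v (pr z j) (io z) = 0" using G(5)[OF z True] uv(2) by (simp add: Um_def)
    thus ?thesis by (simp add: tm_def)
   next
    case False
    hence "u j z = 0" using uv(1) by (simp add: Um_def)
    thus ?thesis by (simp add: tm_def)
   qed
   thus "(\<Sum>j<M z. tm u v j z) = 0 z" by simp
  qed
  thus "omm M c pr u v = 0" by (simp add: tr_def)
 next
  show "Um (G 0) = {0}"
  proof (intro subset_antisym subsetI)
   fix u assume "u \<in> Um (G 0)"
   hence "u j z = 0" for j z using G(2) by (cases "z \<in> T") (auto simp: Um_def)
   thus "u \<in> {0}" by (auto intro!: ext)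
  qed (use Eq_closed(2) in \<open>auto simp: Um_def\<close>)
 qed ((rule skew, assumption, assumption) | (rule self0, assumption))+
qed

end

context frob_set
begin

text \<open>All valid multiplicities occur. The flag occupies initial coordinates whose partners lie
  beyond the flag at the inverse point, which makes each step isotropic.\<close>

lemma ex_model:
 assumes v: "valid k m G"
 shows "\<exists>(U :: (nat => 't => 'a alg_closure) set) (act :: ('t => 'a alg_closure) => _) om W.
  symp T ph io U act om W k &
  (\<forall>z\<in>T. card (eqmod.part ph act z U) = CARD('a) ^ (per z * (m z + G k z + G k (io z)))) &
  (ALL i. \<forall>z\<in>T. card (eqmod.part ph act z (W i)) = CARD('a) ^ (per z * G i z))"
proof -
 obtain b where b: "b \<in> Eq" "!!z. z \<in> T ==> b (io z) = - b z" "!!z. z \<in> T ==> io z ~= z ==> b z ~= 0"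
 proof (rule ex_skew)
  fix b :: "'t => 'a alg_closure"
  assume "b \<in> Eq" "!!z. z \<in> T ==> b (io z) = - b z" "!!z. z \<in> T ==> io z ~= z ==> b z ~= 0"
  thus thesis by (rule that)
 qed
 define M where "M z = m z + G k z + G k (io z)" for z
 \<comment> \<open>Coordinates at z come in three ranges: \<open>G k z\<close> for the flag,
   \<open>G k (io z)\<close> for its dual, and m for the rest. The first two are exchanged across
   inversion. The rest is matched with equal indices if z and its inverse differ, and otherwise in
   neighbouring pairs, which works because m is then even.\<close>
 define pr where "pr z j = (if j < G k z then j + G k (io z) else if j < G k z + G k (io z) then j - G k z
  else if io z ~= z then j else if even j then j + 1 else j - 1)" for z and j :: nat
 define c where "c j z = (if io z ~= z then b z else if j < G k z then 1 else if j < G k z + G k (io z) then - 1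
  else if even j then 1 else - 1)" for j z
 note d = validD[OF v]
 have Gk: "G i z \<le> G k z" if "z \<in> T" for i z
 proof (cases "i \<le> k")
  case True
  show ?thesis by (rule lift_Suc_mono_le[of "%i. G i z", OF d(6)[OF that] True])
 qed (use d(7)[OF that, of i] in simp)
 have io_ph_fix: "io (ph z) = ph z \<longleftrightarrow> io z = z" if "z \<in> T" for z
  using io_ph[OF that] inj_onD[OF inj_ph _ io_T[OF that] that] by auto
 have M1: "M (ph z) = M z" if "z \<in> T" for z
  unfolding M_def io_ph[OF that] d(1)[OF that] d(4)[OF that] d(4)[OF io_T[OF that]] ..
 have M2: "M (io z) = M z" if "z \<in> T" for z
  unfolding M_def io_io[OF that] d(2)[OF that] by simp
 have Mev: "even (M z)" "M z = m z + G k z + G k z" if "z \<in> T" "io z = z" for z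
  using d(3)[OF that] that(2) by (simp_all add: M_def)
 have s1: "symp T ph io (Um M) actm (omm M c pr) (%i. Um (G i)) k"
 proof (rule symp_Um[OF M1 M2])
  fix z j assume z: "z \<in> T" and j: "j < M z"
  show "pr z j < M z"
  proof (cases "io z = z & \<not> j < G k z + G k (io z)")
   case True
   have "even (M z)" using Mev(1)[OF z] True by simp
   thus ?thesis using True j by (auto simp: pr_def elim!: evenE)
  next
   case False
   thus ?thesis using j by (auto simp: pr_def M_def)
  qed
  show "pr (io z) (pr z j) = j"
  proof (cases "io z = z & \<not> j < G k z + G k (io z)")
   case True
   hence f: "io z = z" and g: "2 * G k z \<le> j" by auto
   show ?thesis
   proof (cases "even j")
    case True
    thus ?thesis using f g by (simp add: pr_def)
   next
    case False
    hence "2 * G k z \<le> j - 1" "j > 0" using g by presburger+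
    thus ?thesis using f g False by (simp add: pr_def)
   qed
  next
   case False
   thus ?thesis using io_io[OF z] by (auto simp: pr_def)
  qed
  show "c (pr z j) (io z) = - c j z"
  proof (cases "io z = z")
   case True
   show ?thesis
   proof (cases "j < G k z + G k (io z)")
    case lt: True
    thus ?thesis using True by (auto simp: c_def pr_def)
   next
    case False
    hence g: "2 * G k z \<le> j" using True by auto
    have "odd j ==> 2 * G k z \<le> j - 1" using g by presburger
    thus ?thesis using True g by (cases "even j") (auto simp: c_def pr_def)
   qed
  qed (use z b(2) io_io[OF z] in \<open>auto simp: c_def\<close>)
  show "c j z ~= 0" using b(3)[OF z] by (auto simp: c_def)
 next
  fix z j assume z: "z \<in> T"
  show "pr (ph z) j = pr z j"
   unfolding pr_def io_ph_fix[OF z] d(4)[OF z] unfolding io_ph[OF z] d(4)[OF io_T[OF z]] ..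
  show "pr z j ~= j" if "io z = z" "j < M z" using that by (cases "j = 0") (auto simp: pr_def)
 next
  fix j
  show "c j \<in> Eq"
   unfolding Eq_def
  proof (intro CollectI ballI)
   fix z assume z: "z \<in> T"
   show "c j (ph z) = frob (c j z)"
    unfolding c_def io_ph_fix[OF z] d(4)[OF z] Eq_ph[OF b(1) z] unfolding io_ph[OF z] d(4)[OF io_T[OF z]]
    by simp
  qed
 next
  fix i z assume z: "z \<in> T"
  show "G i z \<le> M z" using Gk[OF z, of i] by (simp add: M_def)
  show "G 0 z = 0" "G i z \<le> G (Suc i) z" by (rule d(5,6)[OF z])+
  show "G i z = G k z" if "k \<le> i" using d(7)[OF z that] .
  fix j assume j: "j < G i z"
  hence "j < G k z" using Gk[OF z, of i] by simp
  thus "G i (io z) \<le> pr z j" using Gk[OF io_T[OF z], of i] by (simp add: pr_def)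
 qed
 have s2: "card (eqmod.part ph actm z (Um M)) = CARD('a) ^ (per z * (m z + G k z + G k (io z)))" if "z \<in> T" for z
  using card_part_Um[where M = M, OF that M1] by (simp only: M_def)
 have s3: "card (eqmod.part ph actm z (Um (G i))) = CARD('a) ^ (per z * G i z)" if "z \<in> T" for i z
  by (rule card_part_Um[where M = "G i", OF that d(4)])
 show ?thesis
  by (intro exI[of _ "Um M"] exI[of _ actm] exI[of _ "omm M c pr"] exI[of _ "%i. Um (G i)"] conjI allI ballI)
   (rule s1, erule s2, erule s3)
qed

end

subsection \<open>Counting data\<close>

context frob_set
begin

text \<open>Normalised data of a module of dimension 2n with a strictly increasing flag of k nonzero
  steps; vanishing outside T makes them unique.\<close>

definition Dat :: "nat => nat => (('t => nat) \<times> (nat => 't => nat)) set" where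
 "Dat k n = {(m, G). valid k m G & (ALL z. z ~: T --> m z = 0 & (ALL i. G i z = 0)) &
   (\<Sum>z\<in>T. m z + G k z + G k (io z)) = 2 * n & (\<forall>i<k. G i ~= G (Suc i))}"

lemma sum_io: "(\<Sum>z\<in>T. f (io z)) = (\<Sum>z\<in>T. f z)" for f :: "'t => nat"
 by (rule sum.reindex_bij_witness[of _ io io]) (simp_all add: io_T io_io)

lemma sum_data: "(\<Sum>z\<in>T. m z + g z + g (io z)) = sum m T + 2 * sum g T" for m g :: "'t => nat"
 using sum_io[of g] by (simp add: sum.distrib)

lemma Dat_iff:
 "(m, G) \<in> Dat k n \<longleftrightarrow> m \<in> Hclass & (ALL i. G i \<in> Gclass) & (ALL z. G 0 z = 0) & (ALL i z. G i z \<le> G (Suc i) z) &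
  (\<forall>i\<ge>k. G i = G k) & sum m T + 2 * sum (G k) T = 2 * n & (\<forall>i<k. G i ~= G (Suc i))"
proof -
 have "valid k m G & (ALL z. z ~: T --> m z = 0 & (ALL i. G i z = 0)) \<longleftrightarrow>
  m \<in> Hclass & (ALL i. G i \<in> Gclass) & (ALL z. G 0 z = 0) & (ALL i z. G i z \<le> G (Suc i) z) & (\<forall>i\<ge>k. G i = G k)" (is "?L \<longleftrightarrow> ?R")
 proof
  assume L: ?L
  note v = validD[OF conjunct1[OF L]]
  have o: "m z = 0" "G i z = 0" if "z ~: T" for z i using L that by blast+
  show ?R
  proof (intro conjI allI impI)
   show "m \<in> Hclass" using v(1-3) o(1) by (simp add: Hclass_def Gclass_def)
   show "G i \<in> Gclass" for i using v(4) o(2) by (simp add: Gclass_def)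
   show "G 0 z = 0" for z using v(5) o(2) by (cases "z \<in> T") simp_all
   show "G i z \<le> G (Suc i) z" for i z using v(6) o(2) by (cases "z \<in> T") simp_all
   show "G i = G k" if "k \<le> i" for i
   proof
    fix z show "G i z = G k z" using v(7)[OF _ that] o(2) by (cases "z \<in> T") simp_all
   qed
  qed
 next
  assume R: ?R
  have "m (ph z) = m z" "m (io z) = m z" "io z = z --> even (m z)" if "z \<in> T" for z
   using R that by (simp_all add: Hclass_def Gclass_def)
  moreover have "G i (ph z) = G i z" "G 0 z = 0" "G i z \<le> G (Suc i) z" if "z \<in> T" for i z
   using R that by (simp_all add: Gclass_def)
  moreover have "k \<le> i --> G i z = G k z" for i z using R by (metis (no_types))
  moreover have "m z = 0" "G i z = 0" if "z ~: T" for i z using R that by (simp_all add: Hclass_def Gclass_def)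
  ultimately show ?L unfolding valid_def by blast
 qed
 thus ?thesis unfolding Dat_def mem_Collect_eq prod.case sum_data by blast
qed

lemma DatD:
 assumes "(m, G) \<in> Dat k n"
 shows "m \<in> Hclass" "G i \<in> Gclass" "G 0 z = 0" "G i z \<le> G (Suc i) z" "k \<le> i ==> G i = G k"
  "sum m T + 2 * sum (G k) T = 2 * n" "i < k ==> G i ~= G (Suc i)"
 using assms unfolding Dat_iff by blast+

lemma Dat_0D:
 assumes "(m, G) \<in> Dat 0 n"
 shows "m \<in> Hn n" "G = (%_ _. 0)"
proof -
 note D = DatD[OF assms]
 have z: "G i z = 0" for i z using fun_cong[OF D(5)[of i], of z] D(3)[of z] by simp
 thus "G = (%_ _. 0)" by (intro ext)
 have "sum (G 0) T = 0" using z by simp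
 thus "m \<in> Hn n" using D(1,6) by (simp add: Hn_def)
qed

lemma zero_Gclass: "(%_. 0) \<in> Gclass"
 by (simp add: Gclass_def)

lemma Gn_0: "Gn 0 = {%_. 0}"
proof -
 have "m = (%_. 0)" if "m \<in> Gclass" "sum m T = 0" for m
 proof
  fix x show "m x = 0" using that finite_T by (cases "x \<in> T") (auto simp: Gclass_def)
 qed
 hence "m \<in> {%_. 0}" if "m \<in> Gn 0" for m using that unfolding Gn_def by blast
 moreover have "(%_. 0) \<in> Gn 0" using zero_Gclass by (simp add: Gn_def)
 ultimately show ?thesis by blast
qed

lemma card_Dat_0: "card (Dat 0 n) = card (Hn n)"
proof (rule bij_betw_same_card)
 show "bij_betw fst (Dat 0 n) (Hn n)"
 proof (rule bij_betwI[where g = "%m. (m, %_ _. 0)"])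
  show "fst \<in> Dat 0 n \<rightarrow> Hn n"
  proof
   fix x assume "x \<in> Dat 0 n"
   then obtain m G where "x = (m, G)" "(m, G) \<in> Dat 0 n" by (cases x) blast
   thus "fst x \<in> Hn n" using Dat_0D(1) by simp
  qed
  show "(%m. (m, %_ _. 0)) \<in> Hn n \<rightarrow> Dat 0 n"
   using zero_Gclass unfolding Pi_iff Dat_iff by (auto simp: Hn_def)
 next
  fix x assume "x \<in> Dat 0 n"
  then obtain m G where x: "x = (m, G)" "(m, G) \<in> Dat 0 n" by (cases x) blast
  show "(fst x, %_ _. 0) = x" unfolding x(1) Dat_0D(2)[OF x(2)] by simp
 qed simp
qed

text \<open>Removing the last flag step leaves shorter data and a nonzero increment g. An increment
  of total i accounts for dimension 2i, since its dual leaves as well.\<close>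

lemma card_Dat_Suc:
 assumes fin: "!!n. finite (Dat k n)"
 shows "card (Dat (Suc k) n) = (\<Sum>i\<in>{0..n}. card (Gn i - {%_. 0}) * card (Dat k (n - i)))"
  and "finite (Dat (Suc k) n)"
proof -
 let ?S = "Sigma {0..n} (%i. (Gn i - {%_. 0}) \<times> Dat k (n - i))"
 define f where "f = (%(m :: 't => nat, G :: nat => 't => nat).
  (\<Sum>z\<in>T. G (Suc k) z - G k z, (%z. G (Suc k) z - G k z), m, %j. G (min j k)))"
 define h where "h = (%(i :: nat, g :: 't => nat, m :: 't => nat, G :: nat => 't => nat).
  (m, %j z. if j \<le> k then G j z else G k z + g z))"
 have bij: "bij_betw f (Dat (Suc k) n) ?S"
 proof (rule bij_betwI[where g = h])
  show "f \<in> Dat (Suc k) n \<rightarrow> ?S"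
  proof
   fix x assume "x \<in> Dat (Suc k) n"
   then obtain m G where x: "x = (m, G)" "(m, G) \<in> Dat (Suc k) n" by (cases x) blast
   note D = x(2)[unfolded Dat_iff] and E = DatD[OF x(2)]
   define g where "g z = G (Suc k) z - G k z" for z
   have le: "G k z \<le> G (Suc k) z" for z using D by blast
   have g: "G (Suc k) z = G k z + g z" for z using le by (simp add: g_def)
   have gG: "g \<in> Gclass" using E(2)[of "Suc k"] E(2)[of k] unfolding g_def[abs_def] Gclass_def by simp
   have g0: "g ~= (%_. 0)"
   proof
    assume "g = (%_. 0)"
    hence "G (Suc k) = G k" using g by (intro ext) simp
    thus False using D by (metis lessI)
   qed
   have sumS: "sum (G (Suc k)) T = sum (G k) T + sum g T" by (simp add: g sum.distrib)
   hence tot: "sum m T + 2 * sum (G k) T = 2 * (n - sum g T)" "sum g T \<le> n" using E(6) by linarith+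
   have "(m, %j. G (min j k)) \<in> Dat k (n - sum g T)"
    unfolding Dat_iff
   proof (intro conjI allI impI)
    show "m \<in> Hclass" "!!i. G (min i k) \<in> Gclass" "!!z. G (min 0 k) z = 0" using D by simp_all
    show "G (min i k) z \<le> G (min (Suc i) k) z" for i z using D by (cases "i < k") (simp_all add: min_def)
    show "G (min i k) = G (min k k)" if "k \<le> i" for i using that by (simp add: min_def)
    show "sum m T + 2 * sum (G (min k k)) T = 2 * (n - sum g T)" using tot(1) by simp
    show "G (min i k) ~= G (min (Suc i) k)" if "i < k" for i
    proof -
     have "min i k = i" "min (Suc i) k = Suc i" using that by simp_all
     thus ?thesis using D that by (metis less_SucI)
    qed
   qed
   thus "f x \<in> ?S" unfolding x(1) f_def using gG g0 tot(2) by (simp add: g_def[abs_def] Gn_def)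
  qed
  show "h \<in> ?S \<rightarrow> Dat (Suc k) n"
  proof
   fix y assume "y \<in> ?S"
   then obtain i g m G where y: "y = (i, g, m, G)" "i \<le> n" "g \<in> Gn i" "g ~= (%_. 0)" "(m, G) \<in> Dat k (n - i)"
    by (cases y) auto
   note D = y(5)[unfolded Dat_iff] and E = DatD[OF y(5)]
   have g: "g \<in> Gclass" "sum g T = i" using y(3) by (simp_all add: Gn_def)
   let ?G = "%j z. if j \<le> k then G j z else G k z + g z"
   have "(m, ?G) \<in> Dat (Suc k) n"
    unfolding Dat_iff
   proof (intro conjI allI impI)
    show "m \<in> Hclass" using D by blast
    show "?G j \<in> Gclass" for j using E(2)[of j] E(2)[of k] g(1) by (cases "j \<le> k") (simp_all add: Gclass_def)
    show "?G 0 z = 0" for z using D by simp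
    show "?G j z \<le> ?G (Suc j) z" for j z
    proof (cases "Suc j \<le> k")
     case False
     thus ?thesis by (cases "j = k") auto
    qed (use D in simp)
    show "?G j = ?G (Suc k)" if "Suc k \<le> j" for j using that by auto
    have "sum (?G (Suc k)) T = sum (G k) T + sum g T" by (simp add: sum.distrib)
    thus "sum m T + 2 * sum (?G (Suc k)) T = 2 * n" using E(6) y(2) g(2) by linarith
    show "?G j ~= ?G (Suc j)" if "j < Suc k" for j
    proof (cases "j = k")
     case True
     show ?thesis
     proof
      assume e: "?G j = ?G (Suc j)"
      have "g z = 0" for z using fun_cong[OF e, of z] True by simp
      thus False using y(4) by (auto intro!: ext)
     qed
    next
     case False
     hence "G j ~= G (Suc j)" using D that by simp
     moreover have "?G j = G j" "?G (Suc j) = G (Suc j)" using False that by auto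
     ultimately show ?thesis by simp
    qed
   qed
   thus "h y \<in> Dat (Suc k) n" unfolding y(1) h_def by simp
  qed
 next
  fix x assume "x \<in> Dat (Suc k) n"
  then obtain m G where x: "x = (m, G)" "(m, G) \<in> Dat (Suc k) n" by (cases x) blast
  note D = x(2)[unfolded Dat_iff]
  have le: "G k z \<le> G (Suc k) z" for z using D by blast
  have "(%j z. if j \<le> k then G (min j k) z else G (min k k) z + (G (Suc k) z - G k z)) = G"
  proof (intro ext)
   fix j z
   show "(if j \<le> k then G (min j k) z else G (min k k) z + (G (Suc k) z - G k z)) = G j z"
   proof (cases "j \<le> k")
    case False
    hence "G j = G (Suc k)" using D by (metis not_less_eq_eq)
    thus ?thesis using False le by simp
   qed (simp add: min_def)
  qed
  thus "h (f x) = x" unfolding x(1) f_def h_def prod.case by simp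
 next
  fix y assume "y \<in> ?S"
  then obtain i g m G where y: "y = (i, g, m, G)" "g \<in> Gn i" "(m, G) \<in> Dat k (n - i)"
   by (cases y) auto
  note D = y(3)[unfolded Dat_iff]
  have e: "!!j. k \<le> j ==> G j = G k" using D by blast
  have "(%j z. if min j k \<le> k then G (min j k) z else G k z + g z) = G"
  proof (intro ext)
   fix j z show "(if min j k \<le> k then G (min j k) z else G k z + g z) = G j z"
    using e[of j] by (cases "k \<le> j") (simp_all add: min_def)
  qed
  thus "f (h y) = y" using y(2) unfolding y(1) f_def h_def prod.case by (simp add: Gn_def)
 qed
 have finS: "finite ?S" using fin finite_Gn by (intro finite_SigmaI finite_cartesian_product) auto
 show "finite (Dat (Suc k) n)" using bij_betw_finite[OF bij] finS by simp
 have "card (Dat (Suc k) n) = card ?S" by (rule bij_betw_same_card[OF bij])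
 also have "... = (\<Sum>i\<in>{0..n}. card ((Gn i - {%_. 0}) \<times> Dat k (n - i)))"
  by (rule card_SigmaI) (use fin finite_Gn in auto)
 finally show "card (Dat (Suc k) n) = (\<Sum>i\<in>{0..n}. card (Gn i - {%_. 0}) * card (Dat k (n - i)))"
  by (simp only: card_cartesian_product)
qed

lemma finite_Dat: "finite (Dat k n)"
proof (induction k arbitrary: n)
 case 0
 have "inj_on fst (Dat 0 n)"
 proof (rule inj_onI)
  fix x y assume h: "x \<in> Dat 0 n" "y \<in> Dat 0 n" "fst x = fst y"
  obtain m G m' G' where x: "x = (m, G)" "(m, G) \<in> Dat 0 n" and y: "y = (m', G')" "(m', G') \<in> Dat 0 n"
   using h(1,2) by (cases x, cases y) blast
  have "G = G'" unfolding Dat_0D(2)[OF x(2)] Dat_0D(2)[OF y(2)] ..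
  thus "x = y" using h(3) by (simp add: x(1) y(1))
 qed
 moreover have "fst ` Dat 0 n \<subseteq> Hn n"
 proof
  fix y assume "y \<in> fst ` Dat 0 n"
  then obtain G where "(y, G) \<in> Dat 0 n" by auto
  thus "y \<in> Hn n" by (rule Dat_0D(1))
 qed
 ultimately show ?case using finite_Hn finite_subset finite_imageD by metis
next
 case (Suc k)
 thus ?case by (rule card_Dat_Suc(2))
qed

lemma Dat_gf:
 "Abs_fps (%n. of_nat (card (Dat k n)) :: rat) =
  (Abs_fps (%n. of_nat (card (Gn n))) - 1) ^ k * Abs_fps (%n. of_nat (card (Hn n)))"
proof (induction k)
 case 0
 show ?case by (simp add: card_Dat_0)
next
 case (Suc k)
 let ?G = "Abs_fps (%n. of_nat (card (Gn n))) :: rat fps"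
 have c: "of_nat (card (Gn i - {%_. 0})) = fps_nth (?G - 1) i" for i
 proof (cases "i = 0")
  case True
  thus ?thesis by (simp add: Gn_0)
 next
  case False
  hence "(%_. 0) ~: Gn i" by (auto simp: Gn_def)
  thus ?thesis using False by simp
 qed
 have "Abs_fps (%n. of_nat (card (Dat (Suc k) n)) :: rat) = (?G - 1) * Abs_fps (%n. of_nat (card (Dat k n)))"
  by (rule fps_ext)
   (simp only: fps_nth_Abs_fps card_Dat_Suc(1)[OF finite_Dat] of_nat_sum of_nat_mult c fps_mult_nth)
 thus ?case unfolding Suc by (simp only: power_Suc mult.assoc)
qed

text \<open>Each strict step uses up a positive increment; in terms of series, the k-th power of a
  series without constant term starts at degree k.\<close>

lemma card_Dat_large:
 assumes "n < k"
 shows "card (Dat k n) = 0"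
proof -
 let ?E = "Abs_fps (%n. of_nat (card (Gn n))) - 1 :: rat fps"
 have "fps_nth ?E 0 = 0" by (simp add: Gn_0)
 hence z: "fps_nth (?E ^ k) i = 0" if "i < k" for i using startsby_zero_power_prefix that by blast
 have "(of_nat (card (Dat k n)) :: rat) = fps_nth (?E ^ k * Abs_fps (%n. of_nat (card (Hn n)))) n"
  unfolding Dat_gf[symmetric] by simp
 also have "... = 0" unfolding fps_mult_nth using z assms by (intro sum.neutral) simp
 finally show ?thesis by simp
qed

text \<open>The alternating sum over all flag lengths, cut at k = n because longer flags do not
  exist.\<close>

definition Fc :: "rat fps" where
 "Fc = Abs_fps (%n. \<Sum>k\<le>n. (-1) ^ k * of_nat (card (Dat k n)))"

lemma Fc_nth:
 assumes "n \<le> K"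
 shows "fps_nth Fc n = (\<Sum>k\<le>K. (-1) ^ k * of_nat (card (Dat k n)))"
proof -
 have "(\<Sum>k\<le>n. (-1) ^ k * of_nat (card (Dat k n))) = (\<Sum>k\<le>K. (-1) ^ k * of_nat (card (Dat k n)) :: rat)"
  by (rule sum.mono_neutral_left) (use assms in \<open>auto simp: card_Dat_large\<close>)
 thus ?thesis by (simp add: Fc_def)
qed

text \<open>The geometric series for 1 / G in powers of 1 - G, whose powers beyond n do not reach
  the n-th coefficient.\<close>

lemma Fc_quotient:
 "Fc * Abs_fps (%n. of_nat (card (Gn n))) = Abs_fps (%n. of_nat (card (Hn n)))"
proof (rule fps_ext)
 fix n
 let ?G = "Abs_fps (%n. of_nat (card (Gn n))) :: rat fps" and ?H = "Abs_fps (%n. of_nat (card (Hn n))) :: rat fps"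
 define E where "E = 1 - ?G"
 have Ek: "(- 1) ^ k * (?G - 1) ^ k = E ^ k" for k
  unfolding E_def power_mult_distrib[symmetric] by simp
 have F: "fps_nth Fc i = fps_nth (?H * (\<Sum>k\<le>n. E ^ k)) i" if "i \<le> n" for i
 proof -
  have "fps_nth (?H * (\<Sum>k\<le>n. E ^ k)) i = (\<Sum>k\<le>n. fps_nth ((- 1) ^ k * ((?G - 1) ^ k * ?H)) i)"
   unfolding Ek[symmetric] by (simp add: sum_distrib_left fps_sum_nth mult_ac)
  also have "... = (\<Sum>k\<le>n. (-1) ^ k * of_nat (card (Dat k i)))"
  proof (rule sum.cong[OF refl])
   fix k
   show "fps_nth ((- 1) ^ k * ((?G - 1) ^ k * ?H)) i = (-1) ^ k * of_nat (card (Dat k i))"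
    unfolding Dat_gf[symmetric] by (cases "even k") simp_all
  qed
  finally show ?thesis using Fc_nth[OF that] by simp
 qed
 have geo: "(\<Sum>k\<le>n. E ^ k) * (1 - E) = 1 - E ^ Suc n"
  using sum_gp_basic[of E n] by (simp only: mult.commute)
 have "fps_nth (Fc * ?G) n = (\<Sum>i=0..n. fps_nth Fc i * fps_nth ?G (n - i))" by (rule fps_mult_nth)
 also have "... = (\<Sum>i=0..n. fps_nth (?H * (\<Sum>k\<le>n. E ^ k)) i * fps_nth ?G (n - i))"
  by (rule sum.cong[OF refl]) (simp add: F)
 also have "... = fps_nth (?H * (\<Sum>k\<le>n. E ^ k) * ?G) n" by (rule fps_mult_nth[symmetric])
 also have "?H * (\<Sum>k\<le>n. E ^ k) * ?G = ?H - E ^ Suc n * ?H"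
 proof -
  have "?G = 1 - E" by (simp add: E_def)
  hence "?H * (\<Sum>k\<le>n. E ^ k) * ?G = ?H * (1 - E ^ Suc n)" by (simp only: mult.assoc geo)
  thus ?thesis by (simp only: mult.commute[of ?H] left_diff_distrib mult_1_left)
 qed
 finally have main: "fps_nth (Fc * ?G) n = fps_nth (?H - E ^ Suc n * ?H) n" .
 have "fps_nth (E ^ Suc n * ?H) n = 0"
 proof -
  have "fps_nth E 0 = 0" by (simp add: E_def Gn_0)
  hence "fps_nth (E ^ Suc n) i = 0" if "i \<le> n" for i
   using startsby_zero_power_prefix[of E "Suc n"] that by simp
  thus ?thesis unfolding fps_mult_nth by (intro sum.neutral) simp
 qed
 thus "fps_nth (Fc * ?G) n = fps_nth ?H n" using main by simp
qed

end

subsection \<open>Orbits of tuples and flags\<close>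

definition isoF :: "nat => (nat => 'a :: field) set set" where
 "isoF n = {M. M \<subseteq> FV (2 * n) & 0 \<in> M & (\<forall>f\<in>M. \<forall>g\<in>M. f + g \<in> M) & (ALL c. \<forall>f\<in>M. scf c f \<in> M) &
   M ~= {0} & (\<forall>f\<in>M. \<forall>g\<in>M. omf n f g = 0)}"

definition fixF :: "nat => 'a :: field mat set => (nat => 'a) set set" where
 "fixF n S = {M \<in> isoF n. \<forall>B\<in>S. opm (2 * n) B ` M = M}"

lemma isoFD:
 assumes "M \<in> isoF n"
 shows "M \<subseteq> FV (2 * n)" "0 \<in> M" "f \<in> M ==> g \<in> M ==> f + g \<in> M" "f \<in> M ==> scf c f \<in> M" "M ~= {0}"
  "f \<in> M ==> g \<in> M ==> omf n f g = 0"
 using assms unfolding isoF_def by blast+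

lemma finite_isoF: "finite (isoF n :: (nat => 'a :: {field, finite}) set set)"
 by (rule finite_subset[of _ "Pow (FV (2 * n))"]) (auto simp: isoF_def finite_FV)

lemma subspace_iff:
 "VectorSpace.subspace class_ring W (module_vec TYPE('a :: field) N) \<longleftrightarrow>
  W \<subseteq> carrier_vec N & 0\<^sub>v N \<in> W & (\<forall>u\<in>W. \<forall>v\<in>W. u + v \<in> W) & (ALL c. \<forall>u\<in>W. c \<cdot>\<^sub>v u \<in> W)"
 unfolding VectorSpace.subspace_def LinearCombinations.submodule_def
 using vec_vs[where 'a = 'a and n = N] vec_module[where 'a = 'a and n = N]
 by (auto simp: module_vec_simps class_ring_simps)

lemma isotropic_image:
 fixes W :: "'a :: {field, finite} vec set"
 assumes "W \<in> isotropic_subspaces TYPE('a) n"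
 shows "fv ` W \<in> isoF n" "W \<subseteq> carrier_vec (2 * n)"
proof -
 have W: "W \<subseteq> carrier_vec (2 * n)" "0\<^sub>v (2 * n) \<in> W" "!!u v. u \<in> W ==> v \<in> W ==> u + v \<in> W"
  "!!c u. u \<in> W ==> c \<cdot>\<^sub>v u \<in> W" "W ~= {0\<^sub>v (2 * n)}" "!!u v. u \<in> W ==> v \<in> W ==> sp_form n u v = 0"
  using assms unfolding isotropic_subspaces_def subspace_iff by auto
 show "W \<subseteq> carrier_vec (2 * n)" by (rule W)
 have c: "u \<in> carrier_vec (2 * n)" if "u \<in> W" for u using W(1) that by blast
 have "fv ` W ~= {0}"
 proof
  assume e: "fv ` W = {0}"
  have "u = 0\<^sub>v (2 * n)" if "u \<in> W" for u
  proof -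
   have "fv u = fv (0\<^sub>v (2 * n))" using e that unfolding fv_zero by blast
   thus ?thesis using inj_onD[OF inj_fv _ c[OF that] zero_carrier_vec] by simp
  qed
  thus False using W(2,5) by blast
 qed
 moreover have "0 \<in> fv ` W" using imageI[OF W(2), of fv] unfolding fv_zero .
 moreover have "fv u + fv v \<in> fv ` W" if "u \<in> W" "v \<in> W" for u v
  using imageI[OF W(3)[OF that], of fv] unfolding fv_add[OF c[OF that(1)] c[OF that(2)]] .
 moreover have "scf a (fv u) \<in> fv ` W" if "u \<in> W" for a u
  using imageI[OF W(4)[OF that], of fv] unfolding fv_smult .
 moreover have "omf n (fv u) (fv v) = 0" if "u \<in> W" "v \<in> W" for u v
  using W(6)[OF that] sp_form_omf[OF c[OF that(1)] c[OF that(2)]] by simp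
 moreover have "fv u \<in> FV (2 * n)" if "u \<in> W" for u using fv_FV[OF c[OF that]] .
 ultimately show "fv ` W \<in> isoF n" unfolding isoF_def by blast
qed

lemma isotropic_preimage:
 fixes M :: "(nat => 'a :: {field, finite}) set"
 assumes M: "M \<in> isoF n"
 shows "\<exists>W \<in> isotropic_subspaces TYPE('a) n. fv ` W = M"
proof
 let ?v = "vec (2 * n)"
 note D = isoFD[OF M]
 have fvv: "fv (?v f) = f" if "f \<in> M" for f using D(1) that by (intro fv_vec) blast
 show img: "fv ` ?v ` M = M" using fvv by (force simp: image_iff)
 have add: "?v f + ?v g = ?v (f + g)" for f g by (intro eq_vecI) simp_all
 have sm: "c \<cdot>\<^sub>v ?v f = ?v (scf c f)" for c f by (intro eq_vecI) (simp_all add: scf_def)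
 have z: "?v 0 = 0\<^sub>v (2 * n)" by (intro eq_vecI) simp_all
 have "?v ` M ~= {0\<^sub>v (2 * n)}"
 proof
  assume "?v ` M = {0\<^sub>v (2 * n)}"
  hence "M = {fv (0\<^sub>v (2 * n))}" using img by (metis image_empty image_insert)
  thus False using D(5) by (simp only: fv_zero)
 qed
 \<comment> \<open>If M were the whole space, isotropy and nondegeneracy would make it zero.\<close>
 moreover have "?v ` M ~= carrier_vec (2 * n)"
 proof
  assume e: "?v ` M = carrier_vec (2 * n)"
  have MF: "M = FV (2 * n)" using img unfolding e fv_image by simp
  have "f = 0" if "f \<in> M" for f
   using omf_nondeg[of f n] D(6)[OF that] that unfolding MF by blast
  thus False using D(2,5) by blast
 qed
 moreover have "sp_form n (?v f) (?v g) = 0" if "f \<in> M" "g \<in> M" for f g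
  using sp_form_omf[of "?v f" n "?v g"] D(6)[OF that] fvv[OF that(1)] fvv[OF that(2)] by simp
 moreover have "VectorSpace.subspace class_ring (?v ` M) (module_vec TYPE('a) (2 * n))"
  unfolding subspace_iff
 proof (intro conjI ballI allI)
  show "?v ` M \<subseteq> carrier_vec (2 * n)" by auto
  show "0\<^sub>v (2 * n) \<in> ?v ` M" using imageI[OF D(2), of ?v] unfolding z .
 next
  fix u v assume "u \<in> ?v ` M" "v \<in> ?v ` M"
  then obtain f g where "f \<in> M" "g \<in> M" "u = ?v f" "v = ?v g" by blast
  thus "u + v \<in> ?v ` M" using D(3) by (simp only: add) blast
 next
  fix c u assume "u \<in> ?v ` M"
  then obtain f where "f \<in> M" "u = ?v f" by blast
  thus "c \<cdot>\<^sub>v u \<in> ?v ` M" using D(4) by (simp only: sm) blast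
 qed
 ultimately show "?v ` M \<in> isotropic_subspaces TYPE('a) n" unfolding isotropic_subspaces_def by blast
qed

lemma opm_one_image:
 assumes "M \<subseteq> FV N"
 shows "opm N (1\<^sub>m N) ` M = M"
proof -
 have "opm N (1\<^sub>m N) ` M = (%f. f) ` M" by (rule image_cong[OF refl]) (use assms opm_one in blast)
 thus ?thesis by simp
qed

lemma inj_image_subset_iff:
 assumes "inj_on f C" "A \<subseteq> C" "B \<subseteq> C"
 shows "f ` A \<subseteq> f ` B \<longleftrightarrow> A \<subseteq> B"
proof
 assume h: "f ` A \<subseteq> f ` B"
 show "A \<subseteq> B"
 proof
  fix a assume a: "a \<in> A"
  then obtain b where "b \<in> B" "f a = f b" using h by blast
  thus "a \<in> B" using inj_onD[OF assms(1), of a b] a assms(2,3) by blast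
 qed
qed (rule image_mono)

lemma fixed_subposet_image:
 fixes S :: "'a :: {field, finite} mat set"
 assumes S: "S \<subseteq> carrier (Sp TYPE('a) n)"
 shows "image fv ` fixed_subposet (isotropic_subspaces TYPE('a) n) S = fixF n S"
proof -
 have comm: "fv ` (%v. B *\<^sub>v v) ` W = opm (2 * n) B ` fv ` W"
  if "B \<in> S" "W \<subseteq> carrier_vec (2 * n)" for B W
 proof -
  have B: "B \<in> carrier_mat (2 * n) (2 * n)" using S that(1) by (auto simp: carrier_Sp spm_def)
  show ?thesis unfolding image_image
   by (rule image_cong[OF refl]) (use that(2) in \<open>auto simp: opm_vec[OF _ B]\<close>)
 qed
 have eq: "(%v. B *\<^sub>v v) ` W = W \<longleftrightarrow> opm (2 * n) B ` fv ` W = fv ` W"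
  if "B \<in> S" "W \<subseteq> carrier_vec (2 * n)" for B W
 proof -
  have "B \<in> carrier_mat (2 * n) (2 * n)" using S that(1) by (auto simp: carrier_Sp spm_def)
  hence "(%v. B *\<^sub>v v) ` W \<subseteq> carrier_vec (2 * n)" using that(2) by auto
  thus ?thesis unfolding comm[OF that, symmetric] using inj_on_image_eq_iff[OF inj_fv _ that(2)] by blast
 qed
 show ?thesis
 proof (intro subset_antisym subsetI)
  fix M assume "M \<in> image fv ` fixed_subposet (isotropic_subspaces TYPE('a) n) S"
  then obtain W where W: "W \<in> isotropic_subspaces TYPE('a) n" "!!B. B \<in> S ==> (%v. B *\<^sub>v v) ` W = W" "M = fv ` W"
   unfolding fixed_subposet_def by blast
  thus "M \<in> fixF n S"
   using isotropic_image(1)[OF W(1)] eq[OF _ isotropic_image(2)[OF W(1)]] W(2) unfolding fixF_def W(3) by simp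
 next
  fix M assume "M \<in> fixF n S"
  hence M: "M \<in> isoF n" "!!B. B \<in> S ==> opm (2 * n) B ` M = M" unfolding fixF_def by blast+
  obtain W where W: "W \<in> isotropic_subspaces TYPE('a) n" "fv ` W = M" using isotropic_preimage[OF M(1)] by blast
  hence "W \<in> fixed_subposet (isotropic_subspaces TYPE('a) n) S"
   using M(2) eq[OF _ isotropic_image(2)[OF W(1)]] unfolding fixed_subposet_def W(2) by simp
  thus "M \<in> image fv ` fixed_subposet (isotropic_subspaces TYPE('a) n) S" using W(2) by blast
 qed
qed

lemma fixF_generate:
 fixes S :: "'a :: {field, finite} mat set"
 assumes S: "S \<subseteq> carrier (Sp TYPE('a) n)"
 shows "fixF n (generate (Sp TYPE('a) n) S) = fixF n S"
proof -
 interpret G: group "Sp TYPE('a) n" by (rule group_Sp)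
 have cm: "B \<in> carrier_mat (2 * n) (2 * n)" if "B \<in> carrier (Sp TYPE('a) n)" for B
  using that by (simp add: carrier_Sp spm_def)
 have one: "opm (2 * n) (1\<^sub>m (2 * n)) ` M = M" if "M \<subseteq> FV (2 * n)" for M :: "(nat => 'a) set"
  by (rule opm_one_image[OF that])
 have mult: "opm (2 * n) (A * B) ` M = opm (2 * n) A ` opm (2 * n) B ` M"
  if "A \<in> carrier (Sp TYPE('a) n)" "B \<in> carrier (Sp TYPE('a) n)" for A B and M :: "(nat => 'a) set"
  unfolding image_image by (rule image_cong[OF refl]) (rule opm_mult[OF cm[OF that(1)] cm[OF that(2)]])
 have "opm (2 * n) B ` M = M" if "B \<in> generate (Sp TYPE('a) n) S" "M \<in> isoF n" "!!B. B \<in> S ==> opm (2 * n) B ` M = M" for B M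
  using that(1)
 proof (induction rule: generate.induct)
  case one
  thus ?case using \<open>!!M. M \<subseteq> FV (2 * n) ==> _\<close>[OF isoFD(1)[OF that(2)]] by simp
 next
  case (incl h)
  thus ?case by (rule that(3))
 next
  case (inv h)
  hence h: "h \<in> carrier (Sp TYPE('a) n)" using S by blast
  let ?i = "inv\<^bsub>Sp TYPE('a) n\<^esub> h"
  have "?i * h = 1\<^sub>m (2 * n)" using G.l_inv[OF h] by simp
  hence "opm (2 * n) ?i ` opm (2 * n) h ` M = M"
   using mult[OF G.inv_closed[OF h] h, of M] one[OF isoFD(1)[OF that(2)]] by simp
  thus ?case using that(3)[OF inv] by simp
 next
  case (eng h1 h2)
  hence "h1 \<in> carrier (Sp TYPE('a) n)" "h2 \<in> carrier (Sp TYPE('a) n)"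
   using G.generate_in_carrier[OF S] by blast+
  thus ?case using mult[of h1 h2 M] eng by simp
 qed
 thus ?thesis unfolding fixF_def using generate.incl[of _ S "Sp TYPE('a) n"] by blast
qed

lemma euler_fixF:
 fixes S :: "'a :: {field, finite} mat set"
 assumes S: "S \<subseteq> carrier (Sp TYPE('a) n)"
 shows "reduced_euler_char (fixed_subposet (isotropic_subspaces TYPE('a) n) (generate (Sp TYPE('a) n) S))
  = - chain_sum (fixF n S)"
proof -
 interpret G: group "Sp TYPE('a) n" by (rule group_Sp)
 have gS: "generate (Sp TYPE('a) n) S \<subseteq> carrier (Sp TYPE('a) n)" using G.generate_in_carrier[OF S] by blast
 let ?Q = "fixed_subposet (isotropic_subspaces TYPE('a) n) (generate (Sp TYPE('a) n) S)"
 have sub: "W \<subseteq> carrier_vec (2 * n)" if "W \<in> ?Q" for W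
  using that isotropic_image(2) unfolding fixed_subposet_def by blast
 have img: "image fv ` ?Q = fixF n S"
  using fixed_subposet_image[OF gS] fixF_generate[OF S] by simp
 have mono: "V \<subseteq> W \<longleftrightarrow> fv ` V \<subseteq> fv ` W" if "V \<in> ?Q" "W \<in> ?Q" for V W
  using inj_image_subset_iff[OF inj_fv sub[OF that(1)] sub[OF that(2)]] by blast
 have "finite (fixF n S)" by (rule finite_subset[OF _ finite_isoF]) (auto simp: fixF_def)
 hence "finite (image fv ` ?Q)" unfolding img .
 moreover have "inj_on (image fv) ?Q" using mono by (intro inj_onI) blast
 ultimately have "finite ?Q" by (rule finite_imageD)
 thus ?thesis using reduced_euler_chain_sum[of ?Q] chain_sum_image[of ?Q "image fv"] mono img by simp
qed

section \<open>Tuples with flags under conjugation\<close>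

text \<open>The entries after the first, with p-power order rephrased as the equation Y^P = 1 so
  that the tuple is a representation of (Z/P)^r.\<close>

definition Tup :: "nat => nat => nat => 'a :: {field, finite} mat list set" where
 "Tup n r P = {Ys. length Ys = r & set Ys \<subseteq> carrier (Sp TYPE('a) n) &
   (\<forall>A\<in>set Ys. \<forall>B\<in>set Ys. A * B = B * A) & (\<forall>A\<in>set Ys. A [^]\<^bsub>Sp TYPE('a) n\<^esub> P = 1\<^sub>m (2 * n))}"

definition Om :: "nat => nat => nat => nat => ('a :: {field, finite} mat list \<times> (nat => 'a) set list) set" where
 "Om n r P k = {(Ys, ms). Ys \<in> Tup n r P & ms \<in> flags (fixF n (set Ys)) k}"

definition al :: "nat => 'a :: {field, finite} mat => 'a mat list \<times> (nat => 'a) set list =>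
  'a mat list \<times> (nat => 'a) set list" where
 "al n A w = (map (%Y. A * Y * inv\<^bsub>Sp TYPE('a) n\<^esub> A) (fst w), map (image (opm (2 * n) A)) (snd w))"

lemma inj_opm:
 fixes A :: "'a :: {field, finite} mat"
 assumes "A \<in> carrier (Sp TYPE('a) n)"
 shows "inj_on (opm (2 * n) A) (FV (2 * n))"
proof -
 interpret G: group "Sp TYPE('a) n" by (rule group_Sp)
 let ?i = "inv\<^bsub>Sp TYPE('a) n\<^esub> A"
 have c: "A \<in> carrier_mat (2 * n) (2 * n)" "?i \<in> carrier_mat (2 * n) (2 * n)"
  using assms G.inv_closed[OF assms] by (simp_all add: carrier_Sp spm_def)
 have "?i * A = 1\<^sub>m (2 * n)" using G.l_inv[OF assms] by simp
 hence e: "opm (2 * n) ?i (opm (2 * n) A f) = f" if "f \<in> FV (2 * n)" for f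
  using opm_mult[OF c(2,1), of f] opm_one[OF that] by simp
 show ?thesis by (rule inj_on_inverseI[where g = "opm (2 * n) ?i"]) (rule e)
qed

lemma isoF_opm:
 fixes A :: "'a :: {field, finite} mat"
 assumes A: "A \<in> carrier (Sp TYPE('a) n)" and M: "M \<in> isoF n"
 shows "opm (2 * n) A ` M \<in> isoF n"
proof -
 have c: "A \<in> carrier_mat (2 * n) (2 * n)" and s: "spm n A" using A by (simp_all add: carrier_Sp spm_def)
 note D = isoFD[OF M]
 have z: "opm (2 * n) A 0 = 0" using opm_add[OF c, of 0 0] by (metis add.right_neutral add_left_cancel)
 have "opm (2 * n) A ` M ~= {0}"
 proof
  assume e: "opm (2 * n) A ` M = {0}"
  have "f = 0" if f: "f \<in> M" for f
  proof (rule inj_onD[OF inj_opm[OF A]])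
   have "opm (2 * n) A f \<in> {0}" using imageI[OF f, of "opm (2 * n) A"] unfolding e .
   thus "opm (2 * n) A f = opm (2 * n) A 0" by (simp add: z)
   show "f \<in> FV (2 * n)" using D(1) f by blast
  qed (rule FV_closed)
  thus False using D(2,5) by blast
 qed
 moreover have "0 \<in> opm (2 * n) A ` M" using imageI[OF D(2), of "opm (2 * n) A"] unfolding z .
 moreover have "opm (2 * n) A f + opm (2 * n) A g \<in> opm (2 * n) A ` M" if "f \<in> M" "g \<in> M" for f g
  using imageI[OF D(3)[OF that], of "opm (2 * n) A"] unfolding opm_add[OF c] .
 moreover have "scf a (opm (2 * n) A f) \<in> opm (2 * n) A ` M" if "f \<in> M" for f a
  using imageI[OF D(4)[OF that], of "opm (2 * n) A"] unfolding opm_scf[OF c] .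
 moreover have "omf n (opm (2 * n) A f) (opm (2 * n) A g) = 0" if "f \<in> M" "g \<in> M" for f g
  using s D(6)[OF that] D(1) that unfolding spm_def by (metis subsetD)
 moreover have "opm (2 * n) A f \<in> FV (2 * n)" for f by (rule opm_FV[OF c])
 ultimately show ?thesis unfolding isoF_def by blast
qed

lemma (in group) inv_cancel:
 "g \<in> carrier G ==> y \<in> carrier G ==> inv g \<otimes> (g \<otimes> y) = y"
 using m_assoc[of "inv g" g y] by simp

lemma (in group) conj_mult:
 "g \<in> carrier G ==> h \<in> carrier G ==> y \<in> carrier G ==>
  g \<otimes> h \<otimes> y \<otimes> inv (g \<otimes> h) = g \<otimes> (h \<otimes> y \<otimes> inv h) \<otimes> inv g"
 by (simp add: inv_mult_group m_assoc)

lemma (in group) conj_pow: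
 assumes "g \<in> carrier G" "h \<in> carrier G"
 shows "(g \<otimes> h \<otimes> inv g) [^] (m :: nat) = g \<otimes> h [^] m \<otimes> inv g"
proof (induction m)
 case (Suc m)
 have "(g \<otimes> h \<otimes> inv g) [^] Suc m = (g \<otimes> h [^] m \<otimes> inv g) \<otimes> (g \<otimes> h \<otimes> inv g)" using Suc by simp
 also have "... = g \<otimes> h [^] m \<otimes> (inv g \<otimes> g) \<otimes> h \<otimes> inv g" using assms by (simp add: m_assoc inv_cancel)
 also have "... = g \<otimes> h [^] Suc m \<otimes> inv g" using assms by (simp add: m_assoc)
 finally show ?case .
qed (use assms in simp)

lemma (in group) conj_commute:
 assumes "g \<in> carrier G" "h \<in> carrier G" "h' \<in> carrier G"
 shows "(g \<otimes> h \<otimes> inv g) \<otimes> (g \<otimes> h' \<otimes> inv g) = g \<otimes> (h \<otimes> h') \<otimes> inv g"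
proof -
 have "(g \<otimes> h \<otimes> inv g) \<otimes> (g \<otimes> h' \<otimes> inv g) = g \<otimes> h \<otimes> (inv g \<otimes> g) \<otimes> h' \<otimes> inv g" using assms by (simp add: m_assoc inv_cancel)
 thus ?thesis using assms by (simp add: m_assoc)
qed

lemma (in group) conj_fixed_iff:
 assumes "g \<in> carrier G" "h \<in> carrier G"
 shows "g \<otimes> h \<otimes> inv g = h \<longleftrightarrow> g \<otimes> h = h \<otimes> g"
proof
 assume e: "g \<otimes> h \<otimes> inv g = h"
 have "h \<otimes> g = (g \<otimes> h \<otimes> inv g) \<otimes> g" unfolding e ..
 also have "... = g \<otimes> h" using assms by (simp add: m_assoc)
 finally show "g \<otimes> h = h \<otimes> g" ..
next
 assume "g \<otimes> h = h \<otimes> g"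
 thus "g \<otimes> h \<otimes> inv g = h" using assms by (simp add: m_assoc)
qed

lemma al_Om:
 fixes A :: "'a :: {field, finite} mat"
 assumes A: "A \<in> carrier (Sp TYPE('a) n)" and w: "w \<in> Om n r P k"
 shows "al n A w \<in> Om n r P k"
proof -
 interpret G: group "Sp TYPE('a) n" by (rule group_Sp)
 let ?c = "%Y. A * Y * inv\<^bsub>Sp TYPE('a) n\<^esub> A" and ?o = "opm (2 * n)"
 obtain Ys ms where w': "w = (Ys, ms)" "Ys \<in> Tup n r P" "ms \<in> flags (fixF n (set Ys)) k" using w by (auto simp: Om_def)
 have Y: "Y \<in> carrier (Sp TYPE('a) n)" "Y [^]\<^bsub>Sp TYPE('a) n\<^esub> P = 1\<^sub>m (2 * n)" if "Y \<in> set Ys" for Y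
  using w'(2) that by (auto simp: Tup_def)
 have cY: "?c Y \<in> carrier (Sp TYPE('a) n)" if "Y \<in> set Ys" for Y
  using G.m_closed[OF G.m_closed[OF A Y(1)[OF that]] G.inv_closed[OF A]] by simp
 have cm: "B \<in> carrier_mat (2 * n) (2 * n)" if "B \<in> carrier (Sp TYPE('a) n)" for B
  using that by (simp add: carrier_Sp spm_def)
 have "map ?c Ys \<in> Tup n r P"
 proof -
  have "?c Y * ?c Z = ?c Z * ?c Y" if "Y \<in> set Ys" "Z \<in> set Ys" for Y Z
  proof -
   have "Y * Z = Z * Y" using w'(2) that by (auto simp: Tup_def)
   thus ?thesis
    using G.conj_commute[OF A Y(1)[OF that(1)] Y(1)[OF that(2)]] G.conj_commute[OF A Y(1)[OF that(2)] Y(1)[OF that(1)]]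
    by simp
  qed
  moreover have "?c Y [^]\<^bsub>Sp TYPE('a) n\<^esub> P = 1\<^sub>m (2 * n)" if "Y \<in> set Ys" for Y
   using G.conj_pow[OF A Y(1)[OF that], of P] Y(2)[OF that] G.r_one[OF A] G.r_inv[OF A] by simp
  ultimately show ?thesis using w'(2) cY by (auto simp: Tup_def)
 qed
 moreover have "map (image (?o A)) ms \<in> flags (fixF n (set (map ?c Ys))) k"
 proof -
  have ms: "length ms = k" "set ms \<subseteq> fixF n (set Ys)" "sorted_wrt (\<subset>) ms" using w'(3) by (auto simp: flags_def)
  have iso: "M \<in> isoF n" "!!Y. Y \<in> set Ys ==> ?o Y ` M = M" if "M \<in> set ms" for M
   using ms(2) that by (auto simp: fixF_def)
  have "?o A ` M \<in> fixF n (set (map ?c Ys))" if M: "M \<in> set ms" for M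
  proof -
   have "?o (?c Y) ` ?o A ` M = ?o A ` M" if Yin: "Y \<in> set Ys" for Y
   proof -
    have e: "?c Y * A = A * Y"
     using G.m_assoc[OF G.m_closed[OF A Y(1)[OF Yin]] G.inv_closed[OF A] A] G.l_inv[OF A]
      G.r_one[OF G.m_closed[OF A Y(1)[OF Yin]]] by simp
    have "?o (?c Y) (?o A f) = ?o A (?o Y f)" for f
     using opm_mult[OF cm[OF cY[OF Yin]] cm[OF A], of f] opm_mult[OF cm[OF A] cm[OF Y(1)[OF Yin]], of f] e by simp
    hence "?o (?c Y) ` ?o A ` M = ?o A ` ?o Y ` M" by (simp add: image_image)
    thus ?thesis using iso(2)[OF M Yin] by simp
   qed
   thus ?thesis using isoF_opm[OF A iso(1)[OF M]] by (auto simp: fixF_def)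
  qed
  moreover have "sorted_wrt (\<subset>) (map (image (?o A)) ms)"
   unfolding sorted_wrt_map
  proof (rule sorted_wrt_mono_rel[OF _ ms(3)])
   fix M N assume "M \<in> set ms" "N \<in> set ms" "M \<subset> N"
   moreover have "M \<subseteq> FV (2 * n)" "N \<subseteq> FV (2 * n)" using iso(1) isoFD(1) calculation by blast+
   ultimately show "?o A ` M \<subset> ?o A ` N"
    using inj_image_subset_iff[OF inj_opm[OF A]] by (simp add: psubset_eq inj_on_image_eq_iff[OF inj_opm[OF A]])
  qed
  ultimately show ?thesis using ms(1) by (auto simp: flags_def)
 qed
 ultimately show ?thesis by (simp add: al_def w'(1) Om_def)
qed

lemma al_mult:
 fixes A B :: "'a :: {field, finite} mat"
 assumes "A \<in> carrier (Sp TYPE('a) n)" "B \<in> carrier (Sp TYPE('a) n)" "w \<in> Om n r P k"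
 shows "al n (A * B) w = al n A (al n B w)"
proof -
 interpret G: group "Sp TYPE('a) n" by (rule group_Sp)
 have cm: "B \<in> carrier_mat (2 * n) (2 * n)" if "B \<in> carrier (Sp TYPE('a) n)" for B
  using that by (simp add: carrier_Sp spm_def)
 have "A * B * Y * inv\<^bsub>Sp TYPE('a) n\<^esub> (A * B) = A * (B * Y * inv\<^bsub>Sp TYPE('a) n\<^esub> B) * inv\<^bsub>Sp TYPE('a) n\<^esub> A"
  if Y: "Y \<in> carrier (Sp TYPE('a) n)" for Y
  using G.conj_mult[OF assms(1,2) Y] by simp
 moreover have "set (fst w) \<subseteq> carrier (Sp TYPE('a) n)" using assms(3) by (auto simp: Om_def Tup_def)
 ultimately have "map (%Y. A * B * Y * inv\<^bsub>Sp TYPE('a) n\<^esub> (A * B)) (fst w) =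
  map (%Y. A * (B * Y * inv\<^bsub>Sp TYPE('a) n\<^esub> B) * inv\<^bsub>Sp TYPE('a) n\<^esub> A) (fst w)" by auto
 moreover have "opm (2 * n) (A * B) ` M = opm (2 * n) A ` opm (2 * n) B ` M" for M
  unfolding image_image by (rule image_cong[OF refl]) (rule opm_mult[OF cm[OF assms(1)] cm[OF assms(2)]])
 ultimately show ?thesis by (simp add: al_def)
qed

lemma al_one:
 assumes "w \<in> Om n r P k"
 shows "al n (1\<^sub>m (2 * n)) w = (w :: 'a :: {field, finite} mat list \<times> _)"
proof -
 interpret G: group "Sp TYPE('a) n" by (rule group_Sp)
 have Y: "set (fst w) \<subseteq> carrier (Sp TYPE('a) n)" and ms: "!!M. M \<in> set (snd w) ==> M \<subseteq> FV (2 * n)"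
  using assms isoFD(1) by (auto simp: Om_def Tup_def flags_def fixF_def) blast
 have "inv\<^bsub>Sp TYPE('a) n\<^esub> (1\<^sub>m (2 * n)) = 1\<^sub>m (2 * n)" using G.inv_one by simp
 moreover have "1\<^sub>m (2 * n) * Y * 1\<^sub>m (2 * n) = Y" if "Y \<in> set (fst w)" for Y
  using G.l_one[of Y] G.r_one[of Y] Y that by auto
 moreover have "opm (2 * n) (1\<^sub>m (2 * n)) ` M = M" if "M \<in> set (snd w)" for M
  by (rule opm_one_image[OF ms[OF that]])
 ultimately show ?thesis by (simp add: al_def map_idI prod_eq_iff)
qed

lemma finite_Om: "finite (Om n r P k :: ('a :: {field, finite} mat list \<times> _) set)"
proof (rule finite_subset)
 show "Om n r P k \<subseteq> {Ys. set Ys \<subseteq> carrier (Sp TYPE('a) n) & length Ys = r} \<times> flags (isoF n) k"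
  by (auto simp: Om_def Tup_def flags_def fixF_def)
 show "finite ({Ys. set Ys \<subseteq> carrier (Sp TYPE('a) n) & length Ys = r} \<times> flags (isoF n :: (nat => 'a) set set) k)"
  by (intro finite_cartesian_product finite_lists_length_eq finite_Sp finite_flags finite_isoF)
qed

lemma al_fixed_iff:
 fixes A :: "'a :: {field, finite} mat"
 assumes A: "A \<in> carrier (Sp TYPE('a) n)" and w: "(Ys, ms) \<in> Om n r P k"
 shows "al n A (Ys, ms) = (Ys, ms) \<longleftrightarrow> (\<forall>Y\<in>set Ys. A * Y = Y * A) & (\<forall>M\<in>set ms. opm (2 * n) A ` M = M)"
proof -
 interpret G: group "Sp TYPE('a) n" by (rule group_Sp)
 have Y: "Y \<in> carrier (Sp TYPE('a) n)" if "Y \<in> set Ys" for Y using w that by (auto simp: Om_def Tup_def)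
 have m: "map f xs = xs \<longleftrightarrow> (\<forall>x\<in>set xs. f x = x)" for f :: "'b => 'b" and xs
  by (induction xs) auto
 show ?thesis using G.conj_fixed_iff[OF A Y] by (simp add: al_def m)
qed

text \<open>Each commuting tuple splits off its first entry, which ranges over the stabiliser of the remaining
 tuple and of the flag.\<close>

lemma equivariant_euler_orbits:
 fixes p n r P :: nat and ty :: "'a :: {field, finite} itself"
  and d :: "'a mat list \<times> (nat => 'a) set list => 'd"
 assumes P: "!!A :: 'a mat. A \<in> carrier (Sp TYPE('a) n) ==>
   A [^]\<^bsub>Sp TYPE('a) n\<^esub> P = 1\<^sub>m (2 * n) \<longleftrightarrow> (EX k. group.ord (Sp TYPE('a) n) A = p ^ k)"
  and d: "!!k w w'. w \<in> Om n r P k ==> w' \<in> Om n r P k ==>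
   d w = d w' \<longleftrightarrow> (\<exists>A\<in>carrier (Sp TYPE('a) n). al n A w = w')"
  and K: "card (isoF n :: (nat => 'a) set set) \<le> K"
 shows "equivariant_euler_char TYPE('a) p (r + 1) n = - (\<Sum>k\<le>K. (-1) ^ k * of_nat (card (d ` Om n r P k)))"
proof -
 interpret G: group "Sp TYPE('a) n" by (rule group_Sp)
 let ?C = "carrier (Sp TYPE('a) n)"
 define CT where "CT = commuting_tuples (Sp TYPE('a) n) p (r + 1)"
 have CT: "Xs \<in> CT \<longleftrightarrow> (EX A Ys. Xs = A # Ys & A \<in> ?C & Ys \<in> Tup n r P & (\<forall>Y\<in>set Ys. A * Y = Y * A))" for Xs
 proof
  assume "Xs \<in> CT"
  hence h: "length Xs = r + 1" "set Xs \<subseteq> ?C" "!!A B. A \<in> set Xs ==> B \<in> set Xs ==> A * B = B * A"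
   "!!A. A \<in> set (tl Xs) ==> EX k. group.ord (Sp TYPE('a) n) A = p ^ k"
   by (auto simp: CT_def commuting_tuples_def)
  then obtain A Ys where Xs: "Xs = A # Ys" by (cases Xs) auto
  have "Ys \<in> Tup n r P" using h P unfolding Xs Tup_def by auto
  thus "EX A Ys. Xs = A # Ys & A \<in> ?C & Ys \<in> Tup n r P & (\<forall>Y\<in>set Ys. A * Y = Y * A)"
   using h(2) h(3)[of A] unfolding Xs by (intro exI[of _ A] exI[of _ Ys]) simp
 next
  assume "EX A Ys. Xs = A # Ys & A \<in> ?C & Ys \<in> Tup n r P & (\<forall>Y\<in>set Ys. A * Y = Y * A)"
  then obtain A Ys where h: "Xs = A # Ys" "A \<in> ?C" "Ys \<in> Tup n r P" "!!Y. Y \<in> set Ys ==> A * Y = Y * A" by blast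
  have Y: "Y \<in> ?C" "Y [^]\<^bsub>Sp TYPE('a) n\<^esub> P = 1\<^sub>m (2 * n)" if "Y \<in> set Ys" for Y using h(3) that by (auto simp: Tup_def)
  have "EX k. group.ord (Sp TYPE('a) n) Y = p ^ k" if "Y \<in> set Ys" for Y using P[OF Y(1)[OF that]] Y(2)[OF that] by blast
  moreover have "B * D = D * B" if "B \<in> set Xs" "D \<in> set Xs" for B D
   using that h(3) h(4)[of B] h(4)[of D] unfolding h(1) by (auto simp: Tup_def)
  ultimately show "Xs \<in> CT" using h Y(1) unfolding CT_def commuting_tuples_def by (auto simp: Tup_def)
 qed
 have finCT: "finite CT"
  by (rule finite_subset[OF _ finite_lists_length_eq[OF finite_Sp[of "TYPE('a)" n], of "r + 1"]])
   (auto simp: CT_def commuting_tuples_def)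
 have finF: "finite (fixF n S)" for S :: "'a mat set" by (rule finite_subset[OF _ finite_isoF]) (auto simp: fixF_def)
 have cardF: "card (fixF n S) \<le> K" for S :: "'a mat set"
  by (rule order_trans[OF card_mono[OF finite_isoF] K]) (auto simp: fixF_def)
 have sub: "set Xs \<subseteq> ?C" if "Xs \<in> CT" for Xs using that by (auto simp: CT_def commuting_tuples_def)
 have count: "(\<Sum>Xs\<in>CT. card (flags (fixF n (set Xs)) k)) = card ?C * card (d ` Om n r P k)" for k
 proof -
  have "(\<Sum>Xs\<in>CT. card (flags (fixF n (set Xs)) k)) = card (Sigma CT (%Xs. flags (fixF n (set Xs)) k))"
   by (rule card_SigmaI[symmetric]) (use finCT finite_flags[OF finF] in auto)
  \<comment> \<open>Regrouping: A commutes with the remaining entries and preserves every member of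
    the flag exactly when it fixes the pair (Ys, ms) under \<open>al\<close>.\<close>
  also have "... = card (Sigma (Om n r P k) (%w. {A \<in> ?C. al n A w = w}))"
  proof (rule bij_betw_same_card, rule bij_betwI)
   show "(%(Xs, ms). ((tl Xs, ms), hd Xs)) \<in> Sigma CT (%Xs. flags (fixF n (set Xs)) k) \<rightarrow>
     Sigma (Om n r P k) (%w. {A \<in> ?C. al n A w = w})"
   proof
    fix x assume "x \<in> Sigma CT (%Xs. flags (fixF n (set Xs)) k)"
    then obtain Xs ms where x: "x = (Xs, ms)" "Xs \<in> CT" "ms \<in> flags (fixF n (set Xs)) k" by blast
    obtain A Ys where h: "Xs = A # Ys" "A \<in> ?C" "Ys \<in> Tup n r P" "\<forall>Y\<in>set Ys. A * Y = Y * A" using x(2) CT by blast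
    have f: "length ms = k" "sorted_wrt (\<subset>) ms" using x(3) by (simp_all add: flags_def)
    have f3: "M \<in> fixF n (set Ys) & opm (2 * n) A ` M = M" if "M \<in> set ms" for M
     using x(3) that unfolding h(1) by (simp add: flags_def fixF_def subset_iff)
    hence w: "(Ys, ms) \<in> Om n r P k" using h(3) f by (simp add: Om_def flags_def subset_iff)
    moreover have "al n A (Ys, ms) = (Ys, ms)" using al_fixed_iff[OF h(2) w] h(4) f3 by blast
    ultimately show "(%(Xs, ms). ((tl Xs, ms), hd Xs)) x \<in> Sigma (Om n r P k) (%w. {A \<in> ?C. al n A w = w})"
     unfolding x(1) h(1) using h(2) by simp
   qed
   show "(%((Ys, ms), A). (A # Ys, ms)) \<in> Sigma (Om n r P k) (%w. {A \<in> ?C. al n A w = w}) \<rightarrow>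
     Sigma CT (%Xs. flags (fixF n (set Xs)) k)"
   proof
    fix x assume "x \<in> Sigma (Om n r P k) (%w. {A \<in> ?C. al n A w = w})"
    then obtain Ys ms A where x: "x = ((Ys, ms), A)" "(Ys, ms) \<in> Om n r P k" "A \<in> ?C" "al n A (Ys, ms) = (Ys, ms)"
     by (cases x) auto
    note a = x(4)[unfolded al_fixed_iff[OF x(3,2)]]
    have Ys: "Ys \<in> Tup n r P" "ms \<in> flags (fixF n (set Ys)) k" using x(2) by (auto simp: Om_def)
    have "A # Ys \<in> CT" unfolding CT using a x(3) Ys(1) by simp
    moreover have "ms \<in> flags (fixF n (set (A # Ys))) k" using Ys(2) a by (simp add: flags_def fixF_def subset_iff)
    ultimately show "(%((Ys, ms), A). (A # Ys, ms)) x \<in> Sigma CT (%Xs. flags (fixF n (set Xs)) k)"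
     unfolding x(1) by simp
   qed
  next
   fix x assume "x \<in> Sigma CT (%Xs. flags (fixF n (set Xs)) k)"
   hence "fst x \<in> CT" by auto
   thus "(%((Ys, ms), A). (A # Ys, ms)) ((%(Xs, ms). ((tl Xs, ms), hd Xs)) x) = x"
    unfolding CT by (cases x) auto
  qed auto
  also have "... = (\<Sum>w\<in>Om n r P k. card {A \<in> ?C. al n A w = w})"
   by (rule card_SigmaI) (auto intro: finite_Om finite_subset[OF _ finite_Sp[of "TYPE('a)" n]])
  also have "... = card ?C * card (d ` Om n r P k)"
   by (rule G.weighted_burnside[OF finite_Sp finite_Om])
    (simp_all only: Sp_simps al_mult al_one d al_Om)
  finally show ?thesis .
 qed
 have "?C ~= {}" using G.one_closed by blast
 hence pos: "card ?C ~= 0" by (simp add: finite_Sp)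
 have "(\<Sum>Xs\<in>CT. (of_int (reduced_euler_char (fixed_subposet (isotropic_subspaces TYPE('a) n)
   (generate (Sp TYPE('a) n) (set Xs)))) :: rat)) =
  (\<Sum>Xs\<in>CT. - (\<Sum>k\<le>K. (-1) ^ k * of_nat (card (flags (fixF n (set Xs)) k))))"
  by (rule sum.cong[OF refl])
   (simp only: euler_fixF[OF sub] chain_sum_flags[OF finF cardF] of_int_minus of_int_sum of_int_mult
    of_int_power of_int_1 of_int_of_nat_eq)
 also have "... = - (\<Sum>k\<le>K. (-1) ^ k * of_nat (\<Sum>Xs\<in>CT. card (flags (fixF n (set Xs)) k)))"
  unfolding sum_negf sum.swap[of _ CT] of_nat_sum sum_distrib_left ..
 also have "... = - (\<Sum>k\<le>K. (-1) ^ k * of_nat (card (d ` Om n r P k))) * of_nat (card ?C)"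
  unfolding count by (simp add: sum_distrib_left sum_distrib_right mult_ac)
 finally show ?thesis unfolding equivariant_euler_char_def CT_def[symmetric] order_def using pos by simp
qed

section \<open>The complete invariant of an orbit\<close>

text \<open>The ring acts by linear combinations of operator monomials, so a linear map intertwining
  the generators intertwines the whole ring.\<close>

lemma rep_act_map:
 assumes A: "rep U sc Y P r" and B: "rep U' sc' Y' P r"
  and add: "!!u v. u \<in> U ==> v \<in> U ==> h (u + v) = h u + h v"
  and sc: "!!c u. u \<in> U ==> h (sc c u) = sc' c (h u)"
  and Y: "!!i u. i < r ==> u \<in> U ==> h (Y i u) = Y' i (h u)"
  and u: "u \<in> U"
 shows "h (rep.act sc Y P r w u) = rep.act sc' Y' P r w (h u)"
proof -
 interpret A: rep U sc Y P r by (rule A)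
 interpret B: rep U' sc' Y' P r by (rule B)
 have h0: "h 0 = 0" using add[OF A.zeroU A.zeroU] by (metis add.right_neutral add_left_cancel)
 have hsum: "finite S ==> (!!s. s \<in> S ==> f s \<in> U) ==> h (sum f S) = (\<Sum>s\<in>S. h (f s))" for S :: "(nat => nat) set" and f
  by (induction S rule: finite_induct) (simp_all add: h0 add A.sum_U)
 have fp: "h ((Y i ^^ m) v) = (Y' i ^^ m) (h v)" if "i < r" "v \<in> U" for i m v
  by (induction m) (simp_all add: Y[OF that(1)] A.funpow_Y_U[OF that])
 have yp: "n \<le> r ==> h (A.yp n g u) = B.yp n g (h u)" for n g
 proof (induction n)
  case (Suc n)
  thus ?case using fp[of n "A.yp n g u" "g n"] A.yp_U[of n u g] u by simp
 qed simp
 have "h (A.act w u) = (\<Sum>g\<in>Gexp P r. h (sc (A.hat w g) (A.yp r g u)))"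
  unfolding A.act_def by (rule hsum[OF A.finite_Gexp]) (intro A.sc_U A.yp_U order_refl u)
 also have "... = B.act w (h u)"
  unfolding B.act_def by (rule sum.cong[OF refl]) (simp only: sc[OF A.yp_U[OF order_refl u]] yp[OF order_refl])
 finally show ?thesis .
qed

text \<open>Entry j of the list is step j + 1, since step 0 is the zero space; past the end of the
  list the last entry is repeated.\<close>

definition Wof :: "(nat => 'a :: zero) set list => nat => (nat => 'a) set" where
 "Wof ms i = (if i = 0 \<or> ms = [] then {0} else ms ! (min i (length ms) - 1))"

definition actY :: "nat => nat => nat => 'a :: {field, finite} mat list => ((nat => 'a alg_closure) => 'a alg_closure) =>
  (nat => 'a) => nat => 'a" where
 "actY n r P Ys = rep.act scf (%i. opm (2 * n) (Ys ! i)) P r"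

text \<open>Component sizes of the space and of every flag step. They are set to 0 off T so that
  equality of invariants is plain equality.\<close>

definition inv_dat :: "nat => nat => nat => 'a :: {field, finite} mat list \<times> (nat => 'a) set list =>
  ((nat => 'a alg_closure) => nat) \<times> (nat => (nat => 'a alg_closure) => nat)" where
 "inv_dat n r P w =
   (%z. if z \<in> Tchar P r then card (eqmod.part (phc r) (actY n r P (fst w)) z (FV (2 * n))) else 0,
   %i z. if z \<in> Tchar P r then card (eqmod.part (phc r) (actY n r P (fst w)) z (Wof (snd w) i)) else 0)"

lemma TupD:
 assumes "Ys \<in> Tup n r P" "i < r"
 shows "Ys ! i \<in> carrier (Sp TYPE('a :: {field, finite}) n)" "Ys ! i \<in> carrier_mat (2 * n) (2 * n)"
  "f \<in> FV (2 * n) ==> (opm (2 * n) (Ys ! i) ^^ P) f = f"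
  "f \<in> FV (2 * n) ==> g \<in> FV (2 * n) ==> omf n (opm (2 * n) (Ys ! i) f) (opm (2 * n) (Ys ! i) g) = omf n f g"
  "j < r ==> opm (2 * n) (Ys ! i) (opm (2 * n) (Ys ! j) f) = opm (2 * n) (Ys ! j) (opm (2 * n) (Ys ! i) f)"
proof -
 have len: "length Ys = r" using assms(1) by (simp add: Tup_def)
 hence mem: "j < r ==> Ys ! j \<in> set Ys" for j by simp
 show c: "Ys ! i \<in> carrier (Sp TYPE('a) n)" using assms mem by (auto simp: Tup_def)
 hence s: "spm n (Ys ! i)" by (simp add: carrier_Sp)
 have cm: "Ys ! j \<in> carrier_mat (2 * n) (2 * n)" if "j < r" for j
 proof -
  have "Ys ! j \<in> carrier (Sp TYPE('a) n)" using assms(1) mem[OF that] by (auto simp: Tup_def)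
  thus ?thesis by (simp add: carrier_Sp spm_def)
 qed
 show "Ys ! i \<in> carrier_mat (2 * n) (2 * n)" by (rule cm[OF assms(2)])
 show "(opm (2 * n) (Ys ! i) ^^ P) f = f" if "f \<in> FV (2 * n)"
 proof -
  have "Ys ! i [^]\<^bsub>Sp TYPE('a) n\<^esub> P = 1\<^sub>m (2 * n)" using assms mem[OF assms(2)] by (auto simp: Tup_def)
  thus ?thesis using opm_pow[OF c that, of P] opm_one[OF that] by simp
 qed
 show "omf n (opm (2 * n) (Ys ! i) f) (opm (2 * n) (Ys ! i) g) = omf n f g" if "f \<in> FV (2 * n)" "g \<in> FV (2 * n)"
  using s that by (simp add: spm_def)
 show "opm (2 * n) (Ys ! i) (opm (2 * n) (Ys ! j) f) = opm (2 * n) (Ys ! j) (opm (2 * n) (Ys ! i) f)" if "j < r"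
 proof -
  have "Ys ! i * Ys ! j = Ys ! j * Ys ! i" using assms(1) mem[OF assms(2)] mem[OF that] unfolding Tup_def by blast
  thus ?thesis using opm_mult[OF cm[OF assms(2)] cm[OF that], of f] opm_mult[OF cm[OF that] cm[OF assms(2)], of f] by simp
 qed
qed

lemma rep_Tup:
 assumes "Ys \<in> Tup n r P" "of_nat P ~= (0 :: 'a :: {field, finite})"
 shows "rep (FV (2 * n) :: (nat => 'a) set) scf (%i. opm (2 * n) (Ys ! i)) P r"
proof
 note T = TupD[OF assms(1)]
 fix u v :: "nat => 'a" and c d :: 'a and i j :: nat
 show "finite (FV (2 * n) :: (nat => 'a) set)" by (rule finite_FV)
 show "0 \<in> (FV (2 * n) :: (nat => 'a) set)" by (rule FV_closed)
 show "of_nat P ~= (0 :: 'a)" by (rule assms)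
 show "scf c (u + v) = scf c u + scf c v" by (rule ext) (simp add: scf_def distrib_left)
 show "scf (c + d) u = scf c u + scf d u" by (rule ext) (simp add: scf_def distrib_right)
 show "scf (c * d) u = scf c (scf d u)" by (rule ext) (simp add: scf_def mult.assoc)
 show "scf 1 u = u" by (rule ext) (simp add: scf_def)
 assume u: "u \<in> FV (2 * n)"
 show "scf c u \<in> FV (2 * n)" using u by (rule FV_closed)
 show "v \<in> FV (2 * n) ==> u + v \<in> FV (2 * n)" using u by (rule FV_closed)
 assume i: "i < r"
 show "opm (2 * n) (Ys ! i) u \<in> FV (2 * n)" by (rule opm_FV[OF T(2)[OF i]])
 show "opm (2 * n) (Ys ! i) (u + v) = opm (2 * n) (Ys ! i) u + opm (2 * n) (Ys ! i) v" by (rule opm_add[OF T(2)[OF i]])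
 show "opm (2 * n) (Ys ! i) (scf c u) = scf c (opm (2 * n) (Ys ! i) u)" by (rule opm_scf[OF T(2)[OF i]])
 show "(opm (2 * n) (Ys ! i) ^^ P) u = u" by (rule T(3)[OF i u])
 show "j < r ==> opm (2 * n) (Ys ! i) (opm (2 * n) (Ys ! j) u) = opm (2 * n) (Ys ! j) (opm (2 * n) (Ys ! i) u)"
  by (rule T(5)[OF i])
qed

lemma omf_zero: "omf n 0 g = 0" "omf n g 0 = 0"
 by (simp_all add: omf_def)

lemma Wof_cases:
 assumes "ms \<in> flags Q k"
 shows "Wof ms i = {0} \<or> Wof ms i \<in> Q"
proof (cases "i = 0 \<or> ms = []")
 case False
 hence "min i (length ms) - 1 < length ms" by (cases i; cases ms) auto
 hence "ms ! (min i (length ms) - 1) \<in> Q" using assms nth_mem unfolding flags_def by blast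
 thus ?thesis using False by (simp add: Wof_def)
qed (auto simp: Wof_def)

lemma Wof_nth: "length ms = k ==> j < k ==> Wof ms (Suc j) = ms ! j"
 by (auto simp: Wof_def min_def)

lemma rep_symp_Om:
 assumes w: "(Ys, ms) \<in> Om n r P k" and P: "of_nat P ~= (0 :: 'a :: {field, finite})"
 shows "rep_symp (FV (2 * n) :: (nat => 'a) set) scf (%i. opm (2 * n) (Ys ! i)) P r (omf n) (Wof ms) k"
proof -
 have Ys: "Ys \<in> Tup n r P" and ms: "ms \<in> flags (fixF n (set Ys)) k" using w by (auto simp: Om_def)
 note T = TupD[OF Ys]
 have len: "length ms = k" "sorted_wrt (\<subset>) ms" using ms by (auto simp: flags_def)
 interpret rep "FV (2 * n) :: (nat => 'a) set" scf "%i. opm (2 * n) (Ys ! i)" P r by (rule rep_Tup[OF Ys P])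
 have iso: "M \<in> isoF n" "j < r ==> opm (2 * n) (Ys ! j) ` M = M" if "M \<in> fixF n (set Ys)" for M j
  using that Ys by (auto simp: fixF_def Tup_def)
 have sc0: "scf c 0 = (0 :: nat => 'a)" for c by (rule ext) (simp add: scf_def)
 have Y0: "opm (2 * n) (Ys ! j) 0 = 0" if "j < r" for j using Y_zero[OF that] .
 have cl: "Wof ms i \<subseteq> FV (2 * n) & 0 \<in> Wof ms i & (\<forall>u\<in>Wof ms i. \<forall>v\<in>Wof ms i. u + v \<in> Wof ms i & omf n u v = 0) &
  (ALL c. \<forall>u\<in>Wof ms i. scf c u \<in> Wof ms i) & (\<forall>j<r. \<forall>u\<in>Wof ms i. opm (2 * n) (Ys ! j) u \<in> Wof ms i)" for i
 proof (cases "Wof ms i = {0}")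
  case True
  show ?thesis unfolding True by (simp add: zeroU sc0 Y0 omf_zero)
 next
  case False
  hence M: "Wof ms i \<in> fixF n (set Ys)" using Wof_cases[OF ms, of i] by blast
  note D = isoFD[OF iso(1)[OF M]]
  have "opm (2 * n) (Ys ! j) u \<in> Wof ms i" if "j < r" "u \<in> Wof ms i" for j u
   using imageI[OF that(2), of "opm (2 * n) (Ys ! j)"] unfolding iso(2)[OF M that(1)] .
  thus ?thesis using D by simp
 qed
 show ?thesis
 proof
  fix u v u' :: "nat => 'a" and i j c
  assume uv: "u \<in> FV (2 * n)" "v \<in> FV (2 * n)"
  show "omf n (u + u') v = omf n u v + omf n u' v" by (rule omf_addl)
  show "omf n v u = - omf n u v" by (rule omf_skew)
  show "omf n u u = 0" by (rule omf_self)
  show "omf n (scf c u) v = c * omf n u v" by (rule omf_scf)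
  show "omf n (opm (2 * n) (Ys ! i) u) (opm (2 * n) (Ys ! i) v) = omf n u v" if "i < r" by (rule T(4)[OF that uv])
 next
  fix u :: "nat => 'a"
  assume "u \<in> FV (2 * n)" "!!v. v \<in> FV (2 * n) ==> omf n u v = 0"
  thus "u = 0" by (rule omf_nondeg)
 next
  fix i j :: nat and c :: 'a and u v :: "nat => 'a"
  show "Wof ms i \<subseteq> FV (2 * n)" "0 \<in> Wof ms i" using cl[of i] by simp_all
  show "u \<in> Wof ms i ==> v \<in> Wof ms i ==> u + v \<in> Wof ms i" using cl[of i] by simp
  show "u \<in> Wof ms i ==> scf c u \<in> Wof ms i" using cl[of i] by simp
  show "j < r ==> u \<in> Wof ms i ==> opm (2 * n) (Ys ! j) u \<in> Wof ms i" using cl[of i] by simp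
  show "u \<in> Wof ms i ==> v \<in> Wof ms i ==> omf n u v = 0" using cl[of i] by simp
  show "Wof ms 0 = {0}" by (simp add: Wof_def)
  show "Wof ms i = Wof ms k" if "k \<le> i" using that len(1) by (cases "k = 0") (auto simp: Wof_def min_def)
  show "Wof ms i \<subseteq> Wof ms (Suc i)"
  proof (cases "i = 0 \<or> ms = []")
   case True
   hence "Wof ms i = {0}" by (auto simp: Wof_def)
   thus ?thesis using cl[of "Suc i"] by simp
  next
   case False
   show ?thesis
   proof (cases "i < k")
    case True
    hence e: "Wof ms i = ms ! (i - 1)" "Wof ms (Suc i) = ms ! i"
     using False len(1) by (auto simp: Wof_def min_def)
    have "ms ! (i - 1) \<subset> ms ! i" by (rule sorted_wrt_nth_less[OF len(2)]) (use True False len(1) in auto)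
    thus ?thesis unfolding e by blast
   next
    case i: False
    thus ?thesis using False len(1) by (auto simp: Wof_def min_def)
   qed
  qed
 qed
qed

lemma card_part_image:
 fixes h :: "'v :: ab_group_add => 'w :: ab_group_add"
 assumes A: "rep U sc Y P r" and B: "rep U' sc' Y' P r"
  and add: "!!u v. u \<in> U ==> v \<in> U ==> h (u + v) = h u + h v"
  and sc: "!!c u. u \<in> U ==> h (sc c u) = sc' c (h u)"
  and Y: "!!i u. i < r ==> u \<in> U ==> h (Y i u) = Y' i (h u)"
  and inj: "inj_on h U" and M: "M \<subseteq> U"
 shows "card (eqmod.part (phc r) (rep.act sc' Y' P r) z (h ` M)) = card (eqmod.part (phc r) (rep.act sc Y P r) z M)"
proof -
 interpret A: rep U sc Y P r by (rule A)
 interpret B: rep U' sc' Y' P r by (rule B)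
 have "B.act (A.F.ind z) (h u) = h u \<longleftrightarrow> A.act (A.F.ind z) u = u" if "u \<in> M" for u
 proof -
  have u: "u \<in> U" using M that by blast
  have e: "B.act (A.F.ind z) (h u) = h (A.act (A.F.ind z) u)"
  proof (rule rep_act_map[OF A B, symmetric])
   show "h (u + v) = h u + h v" if "u \<in> U" "v \<in> U" for u v by (rule add[OF that])
   show "h (sc c u) = sc' c (h u)" if "u \<in> U" for c u by (rule sc[OF that])
   show "h (Y i u) = Y' i (h u)" if "i < r" "u \<in> U" for i u by (rule Y[OF that])
  qed (rule u)
  show ?thesis unfolding e by (rule inj_on_eq_iff[OF inj A.act_U[OF u] u])
 qed
 hence "B.E.part z (h ` M) = h ` A.E.part z M" unfolding A.E.part_def B.E.part_def by auto
 moreover have "inj_on h (A.E.part z M)" by (rule inj_on_subset[OF inj]) (use M in \<open>auto simp: A.E.part_def\<close>)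
 ultimately show ?thesis by (simp add: card_image)
qed

lemma inv_dat_al:
 fixes A :: "'a :: {field, finite} mat"
 assumes P: "of_nat P ~= (0 :: 'a)" and A: "A \<in> carrier (Sp TYPE('a) n)" and w: "(Ys, ms) \<in> Om n r P k"
 shows "inv_dat n r P (al n A (Ys, ms)) = inv_dat n r P (Ys, ms)"
proof -
 interpret G: group "Sp TYPE('a) n" by (rule group_Sp)
 let ?c = "%Y. A * Y * inv\<^bsub>Sp TYPE('a) n\<^esub> A" and ?o = "opm (2 * n)" and ?V = "FV (2 * n) :: (nat => 'a) set"
 have w': "(map ?c Ys, map (image (?o A)) ms) \<in> Om n r P k" using al_Om[OF A w] by (simp add: al_def)
 have Ys: "Ys \<in> Tup n r P" and ms: "ms \<in> flags (fixF n (set Ys)) k" and Ys': "map ?c Ys \<in> Tup n r P"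
  using w w' by (auto simp: Om_def)
 note T = TupD[OF Ys] and T' = TupD[OF Ys']
 have len: "length Ys = r" using Ys by (simp add: Tup_def)
 have cA: "A \<in> carrier_mat (2 * n) (2 * n)" using A by (simp add: carrier_Sp spm_def)
 have Y: "?o A (?o (Ys ! i) u) = ?o (map ?c Ys ! i) (?o A u)" if i: "i < r" for i u
 proof -
  have "?c (Ys ! i) * A = A * Ys ! i"
   using G.m_assoc[OF G.m_closed[OF A T(1)[OF i]] G.inv_closed[OF A] A] G.l_inv[OF A]
    G.r_one[OF G.m_closed[OF A T(1)[OF i]]] by simp
  thus ?thesis
   using opm_mult[OF cA T(2)[OF i], of u] opm_mult[OF T'(2)[OF i] cA, of u] len i by simp
 qed
 have part: "card (eqmod.part (phc r) (actY n r P (map ?c Ys)) z (?o A ` M)) = card (eqmod.part (phc r) (actY n r P Ys) z M)"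
  if "M \<subseteq> ?V" for z M
  unfolding actY_def
  by (rule card_part_image[OF rep_Tup[OF Ys P] rep_Tup[OF Ys' P]])
   (use opm_add[OF cA] opm_scf[OF cA] Y inj_opm[OF A] that in auto)
 have V: "?o A ` ?V = ?V" by (rule endo_inj_surj[OF finite_FV _ inj_opm[OF A]]) (use opm_FV[OF cA] in blast)
 have partV: "card (eqmod.part (phc r) (actY n r P (map ?c Ys)) z ?V) = card (eqmod.part (phc r) (actY n r P Ys) z ?V)" for z
  using part[OF order_refl, of z] unfolding V .
 have z: "?o A 0 = 0" using opm_add[OF cA, of 0 0] by (metis add.right_neutral add_left_cancel)
 have W: "Wof (map (image (?o A)) ms) i = ?o A ` Wof ms i" for i
 proof (cases "i = 0 \<or> ms = []")
  case False
  hence "min i (length ms) - 1 < length ms" by (cases i; cases ms) auto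
  thus ?thesis using False by (simp add: Wof_def)
 qed (auto simp: Wof_def z)
 have WV: "Wof ms i \<subseteq> ?V" for i
  using Wof_cases[OF ms, of i]
 proof
  assume "Wof ms i = {0}"
  thus ?thesis by (simp add: FV_closed)
 next
  assume "Wof ms i \<in> fixF n (set Ys)"
  hence "Wof ms i \<in> isoF n" by (simp add: fixF_def)
  thus ?thesis by (rule isoFD(1))
 qed
 show ?thesis
  unfolding inv_dat_def al_def fst_conv snd_conv W by (simp only: partV part[OF WV])
qed

text \<open>Equal component sizes give a flagged isometry of the two modules. As a linear isometry
  it is a matrix D of the group, and compatibility with the coordinate functions says that D
  conjugates one tuple into the other.\<close>

lemma inv_dat_conj:
 fixes w w' :: "'a :: {field, finite} mat list \<times> (nat => 'a) set list"
 assumes P: "of_nat P ~= (0 :: 'a)" and w: "w \<in> Om n r P k" "w' \<in> Om n r P k"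
  and eq: "inv_dat n r P w = inv_dat n r P w'"
 shows "\<exists>A\<in>carrier (Sp TYPE('a) n). al n A w = w'"
proof -
 obtain Ys ms Ys' ms' where ww: "w = (Ys, ms)" "w' = (Ys', ms')" by (cases w, cases w') blast
 let ?V = "FV (2 * n) :: (nat => 'a) set" and ?o = "opm (2 * n)"
 interpret A: rep_symp ?V scf "%i. ?o (Ys ! i)" P r "omf n" "Wof ms" k
  by (rule rep_symp_Om[OF w(1)[unfolded ww] P])
 interpret B: rep_symp ?V scf "%i. ?o (Ys' ! i)" P r "omf n" "Wof ms'" k
  by (rule rep_symp_Om[OF w(2)[unfolded ww] P])
 interpret G: group "Sp TYPE('a) n" by (rule group_Sp)
 have cU: "card (A.E.part z ?V) = card (B.E.part z ?V)" if "z \<in> Tchar P r" for z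
  using fun_cong[OF arg_cong[OF eq, of fst], of z] that by (simp add: inv_dat_def actY_def ww)
 have cW: "card (A.E.part z (Wof ms i)) = card (B.E.part z (Wof ms' i))" if "z \<in> Tchar P r" for z i
  using fun_cong[OF fun_cong[OF arg_cong[OF eq, of snd], of i], of z] that by (simp add: inv_dat_def actY_def ww)
 obtain R where R: "iso_rel A.F.Eq ?V A.act (omf n) (Wof ms) ?V B.act (omf n) (Wof ms') R"
  using A.F.symp_iso_rel[OF A.S.symp_axioms B.S.symp_axioms cU cW] by blast
 obtain f where F: "bij_betw f ?V ?V & (\<forall>x\<in>?V. \<forall>y\<in>?V. f (x + y) = f x + f y & omf n (f x) (f y) = omf n x y) &
  (\<forall>w\<in>A.F.Eq. \<forall>x\<in>?V. f (A.act w x) = B.act w (f x)) & (ALL i. f ` Wof ms i = Wof ms' i)"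
  using two_symp.iso_rel_fun[OF two_symp.intro[OF A.S.symp_axioms B.S.symp_axioms] R] by (rule exE)
 note f = conjunct1[OF F] conjunct1[OF conjunct2[OF F], rule_format]
  conjunct1[OF conjunct2[OF conjunct2[OF F]], rule_format] conjunct2[OF conjunct2[OF conjunct2[OF F]], rule_format]
 have fV: "f x \<in> ?V" if "x \<in> ?V" for x using f(1) that by (auto simp: bij_betw_def)
 have fsc: "f (scf c x) = scf c (f x)" if "x \<in> ?V" for c x
  using f(3)[OF A.F.Eq_closed(3) that, of c] A.act_cst[OF that, of c] B.act_cst[OF fV[OF that], of c] by simp
 have fY: "f (?o (Ys ! i) x) = ?o (Ys' ! i) (f x)" if "i < r" "x \<in> ?V" for i x
  using f(3)[OF A.coord_Eq[OF that(1)] that(2)] A.act_coord[OF that] B.act_coord[OF that(1) fV[OF that(2)]] by simp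
 define D where "D = mat_of (2 * n) f"
 have cD: "D \<in> carrier_mat (2 * n) (2 * n)" by (simp add: D_def mat_of_carrier)
 have oD: "?o D x = f x" if "x \<in> ?V" for x
  unfolding D_def by (rule opm_mat_of[OF that fV conjunct1[OF f(2)] fsc])
 have D: "D \<in> carrier (Sp TYPE('a) n)" using cD f(2) by (simp add: carrier_Sp spm_def oD)
 have Ys: "Ys \<in> Tup n r P" "Ys' \<in> Tup n r P" and ms: "ms \<in> flags (fixF n (set Ys)) k" "ms' \<in> flags (fixF n (set Ys')) k"
  using w by (auto simp: Om_def ww)
 have "map (%Y. D * Y * inv\<^bsub>Sp TYPE('a) n\<^esub> D) Ys = Ys'"
 proof (rule nth_equalityI)
  show "length (map (%Y. D * Y * inv\<^bsub>Sp TYPE('a) n\<^esub> D) Ys) = length Ys'" using Ys by (simp add: Tup_def)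
  fix i assume "i < length (map (%Y. D * Y * inv\<^bsub>Sp TYPE('a) n\<^esub> D) Ys)"
  hence i: "i < r" and il: "i < length Ys" using Ys by (simp_all add: Tup_def)
  note T = TupD[OF Ys(1) i] and T' = TupD[OF Ys(2) i]
  have "D * Ys ! i = Ys' ! i * D"
   by (rule opm_inject[of _ "2 * n"])
    (use cD T(2) T'(2) in \<open>simp_all add: opm_mult oD fY[OF i] opm_FV\<close>)
  hence "D * Ys ! i * inv\<^bsub>Sp TYPE('a) n\<^esub> D = Ys' ! i * D * inv\<^bsub>Sp TYPE('a) n\<^esub> D" by simp
  also have "... = Ys' ! i"
   using G.m_assoc[OF T'(1) D G.inv_closed[OF D]] G.r_inv[OF D] G.r_one[OF T'(1)] by simp
  finally show "map (%Y. D * Y * inv\<^bsub>Sp TYPE('a) n\<^esub> D) Ys ! i = Ys' ! i" using il by simp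
 qed
 moreover have "map (image (?o D)) ms = ms'"
 proof (rule nth_equalityI)
  have len: "length ms = k" "length ms' = k" using ms by (auto simp: flags_def)
  show "length (map (image (?o D)) ms) = length ms'" using len by simp
  fix j assume "j < length (map (image (?o D)) ms)"
  hence j: "j < k" using len by simp
  have e: "ms ! j = Wof ms (Suc j)" "ms' ! j = Wof ms' (Suc j)" using Wof_nth[OF len(1) j] Wof_nth[OF len(2) j] by simp_all
  have "?o D ` Wof ms (Suc j) = f ` Wof ms (Suc j)"
   by (rule image_cong[OF refl]) (use oD A.Wb_sub(1) in blast)
  thus "map (image (?o D)) ms ! j = ms' ! j" using f(4)[of "Suc j"] j len e by simp
 qed
 ultimately show ?thesis using D by (intro bexI[of _ D]) (simp_all add: al_def ww)
qed

lemma inv_dat_iff: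
 fixes w w' :: "'a :: {field, finite} mat list \<times> (nat => 'a) set list"
 assumes P: "of_nat P ~= (0 :: 'a)" and w: "w \<in> Om n r P k" "w' \<in> Om n r P k"
 shows "inv_dat n r P w = inv_dat n r P w' \<longleftrightarrow> (\<exists>A\<in>carrier (Sp TYPE('a) n). al n A w = w')"
proof
 assume "\<exists>A\<in>carrier (Sp TYPE('a) n). al n A w = w'"
 then obtain A where "A \<in> carrier (Sp TYPE('a) n)" "al n A w = w'" by blast
 thus "inv_dat n r P w = inv_dat n r P w'" using inv_dat_al[OF P, of A n "fst w" "snd w"] w(1) by simp
qed (rule inv_dat_conj[OF assms])

lemma card_parts_data:
 assumes "of_nat P ~= (0 :: 'a :: {field, finite})" "z \<in> Tchar P r"
  "CARD('a) ^ (frob_set.per (phc r :: (nat => 'a alg_closure) => _) z * x) = CARD('a) ^ (frob_set.per (phc r) z * y)"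
 shows "x = y"
proof -
 have "P > 0" using assms(1) by (cases P) simp_all
 interpret F: frob_set "Tchar P r :: (nat => 'a alg_closure) set" "phc r" "ioc r" "TYPE('a)"
  by (rule frob_set_Tchar[OF \<open>P > 0\<close>])
 have "F.per z * x = F.per z * y" using assms(3) card_field_gt_1[where 'a = 'a] power_inject_exp by blast
 thus ?thesis using F.per_pos[OF assms(2)] by simp
qed

text \<open>The component sizes that given multiplicities predict, in the shape of
  \<open>inv_dat\<close>.\<close>

definition dcard :: "nat => nat => nat => ((nat => 'a :: {field, finite} alg_closure) => nat) \<times> (nat => (nat => 'a alg_closure) => nat) =>
  ((nat => 'a alg_closure) => nat) \<times> (nat => (nat => 'a alg_closure) => nat)" where
 "dcard r P k d =
   (%z. if z \<in> Tchar P r then CARD('a) ^ (frob_set.per (phc r) z * (fst d z + snd d k z + snd d k (ioc r z))) else 0,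
   %i z. if z \<in> Tchar P r then CARD('a) ^ (frob_set.per (phc r) z * snd d i z) else 0)"

lemma inj_dcard:
 assumes P: "of_nat P ~= (0 :: 'a :: {field, finite})"
 shows "inj_on (dcard r P k) (frob_set.Dat (Tchar P r) (phc r) (ioc r :: (nat => 'a alg_closure) => _) k n)"
proof -
 have "P > 0" using P by (cases P) simp_all
 interpret F: frob_set "Tchar P r :: (nat => 'a alg_closure) set" "phc r" "ioc r" "TYPE('a)"
  by (rule frob_set_Tchar[OF \<open>P > 0\<close>])
 show ?thesis
 proof (rule inj_onI)
  fix d d' assume h: "d \<in> F.Dat k n" "d' \<in> F.Dat k n" "dcard r P k d = dcard r P k d'"
  obtain m G m' G' where d: "d = (m, G)" "d' = (m', G')" by (cases d, cases d') blast
  have o: "m z = 0" "m' z = 0" "G i z = 0" "G' i z = 0" if "z ~: Tchar P r" for i z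
   using h(1,2) that unfolding d F.Dat_def by blast+
  have G: "G i z = G' i z" for i z
  proof (cases "z \<in> Tchar P r")
   case True
   show ?thesis
    by (rule card_parts_data[OF P True])
     (use fun_cong[OF fun_cong[OF arg_cong[OF h(3), of snd], of i], of z] True in \<open>simp add: dcard_def d\<close>)
  qed (simp add: o)
  have "m z = m' z" for z
  proof (cases "z \<in> Tchar P r")
   case True
   have "m z + G k z + G k (ioc r z) = m' z + G' k z + G' k (ioc r z)"
    by (rule card_parts_data[OF P True])
     (use fun_cong[OF arg_cong[OF h(3), of fst], of z] True in \<open>simp add: dcard_def d\<close>)
   thus ?thesis using G by simp
  qed (simp add: o)
  hence "m = m'" by (rule ext)
  moreover have "G = G'" by (intro ext) (rule G)
  ultimately show "d = d'" by (simp only: d)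
 qed
qed

text \<open>Multiplicities exist by splitting into blocks. Their total is 2n by comparison with the
  q^(2n) vectors of the space.\<close>

lemma Om_data:
 fixes w :: "'a :: {field, finite} mat list \<times> (nat => 'a) set list"
 assumes P: "of_nat P ~= (0 :: 'a)" and w: "w \<in> Om n r P k"
 shows "inv_dat n r P w \<in> dcard r P k ` frob_set.Dat (Tchar P r) (phc r) (ioc r) k n"
proof -
 obtain Ys ms where ww: "w = (Ys, ms)" by (cases w)
 let ?V = "FV (2 * n) :: (nat => 'a) set"
 interpret A: rep_symp ?V scf "%i. opm (2 * n) (Ys ! i)" P r "omf n" "Wof ms" k
  by (rule rep_symp_Om[OF w[unfolded ww] P])
 obtain m0 G0 where v: "A.F.valid k m0 G0" and hd: "A.F.has_data ?V A.act (Wof ms) k m0 G0"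
  using A.F.symp_ex_data[OF A.S.symp_axioms] by blast
 define m where "m z = (if z \<in> Tchar P r then m0 z else 0)" for z
 define G where "G i z = (if z \<in> Tchar P r then G0 i z else 0)" for i z
 have mT: "m z = m0 z" "G i z = G0 i z" "G i (ioc r z) = G0 i (ioc r z)" if "z \<in> Tchar P r" for i z
  using that A.F.io_T by (simp_all add: m_def G_def)
 have vD: "A.F.valid k m G"
  unfolding A.F.valid_def
 proof (intro conjI ballI allI impI)
  fix z :: "nat => 'a alg_closure" and i assume z: "z \<in> Tchar P r"
  note d = A.F.validD[OF v z]
  show "m (phc r z) = m z" using d(1) z A.F.ph_T[OF z] by (simp only: m_def if_True)
  show "m (ioc r z) = m z" using d(2) z A.F.io_T[OF z] by (simp only: m_def if_True)
  show "ioc r z = z ==> even (m z)" using d(3) z by (simp only: m_def if_True)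
  show "G i (phc r z) = G i z" using d(4)[of i] z A.F.ph_T[OF z] by (simp only: G_def if_True)
  show "G 0 z = 0" using d(5) z by (simp only: G_def if_True)
  show "G i z \<le> G (Suc i) z" using d(6)[of i] z by (simp only: G_def if_True)
  show "k \<le> i ==> G i z = G k z" using d(7)[of i] z by (simp only: G_def if_True)
 qed
 have q: "CARD('a) > 1" by (rule card_field_gt_1)
 have "CARD('a) ^ (\<Sum>z\<in>Tchar P r. m0 z + G0 k z + G0 k (ioc r z)) = CARD('a) ^ (2 * n)"
  using hd card_FV[of "2 * n", where 'a = 'a] unfolding A.F.has_data_def by simp
 hence "(\<Sum>z\<in>Tchar P r. m0 z + G0 k z + G0 k (ioc r z)) = 2 * n" using q power_inject_exp by blast
 hence tot: "(\<Sum>z\<in>Tchar P r. m z + G k z + G k (ioc r z)) = 2 * n" by (simp add: mT)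
 have ms: "length ms = k" "sorted_wrt (\<subset>) ms" "set ms \<subseteq> isoF n"
  using w by (auto simp: Om_def ww flags_def fixF_def)
 \<comment> \<open>Equal multiplicities would give equal cardinalities, hence equal consecutive
   members of a strict flag.\<close>
 have strict: "G i ~= G (Suc i)" if i: "i < k" for i
 proof
  assume e: "G i = G (Suc i)"
  have "(\<Sum>z\<in>Tchar P r. G0 i z) = (\<Sum>z\<in>Tchar P r. G i z)" by (rule sum.cong[OF refl]) (simp add: mT)
  also have "... = (\<Sum>z\<in>Tchar P r. G0 (Suc i) z)" unfolding e by (rule sum.cong[OF refl]) (simp add: mT)
  finally have c: "card (Wof ms i) = card (Wof ms (Suc i))" using hd unfolding A.F.has_data_def by simp
  have fin: "finite (Wof ms (Suc i))" using A.Wb_sub(1) finite_FV finite_subset by blast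
  have eq: "Wof ms i = Wof ms (Suc i)" by (rule card_subset_eq[OF fin A.Wb_mono c])
  show False
  proof (cases i)
   case 0
   have "ms ! 0 \<in> isoF n" using ms i 0 by (metis nth_mem subsetD)
   thus False using isoFD(5)[of "ms ! 0" n] eq Wof_nth[OF ms(1), of 0] i 0 A.Wb_0 by simp
  next
   case (Suc j)
   hence "ms ! j \<subset> ms ! i" by (intro sorted_wrt_nth_less[OF ms(2)]) (use i ms(1) in auto)
   thus False using eq Wof_nth[OF ms(1), of j] Wof_nth[OF ms(1) i] i Suc by simp
  qed
 qed
 have "(m, G) \<in> A.F.Dat k n"
  unfolding A.F.Dat_def using vD tot strict by (auto simp: m_def G_def)
 moreover have "inv_dat n r P w = dcard r P k (m, G)"
  using hd unfolding A.F.has_data_def inv_dat_def dcard_def actY_def ww by (auto simp: mT fun_eq_iff)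
 ultimately show ?thesis by (rule rev_image_eqI)
qed

text \<open>A symplectic basis, obtained from the Witt theorem itself for the trivial group: with r
  = 0 and P = 1 there is one character, one component, and only the cardinality is left to
  compare.\<close>

lemma (in symp) ex_coordinates:
 assumes card: "card U = CARD('a) ^ (2 * n)"
 shows "EX f. bij_betw f U (FV (2 * n)) & (\<forall>u\<in>U. \<forall>v\<in>U. f (u + v) = f u + f v & omf n (f u) (f v) = om u v) &
  (ALL c. \<forall>u\<in>U. f (act (cst c) u) = scf c (f u))"
proof -
 have c: "cst (x + y) = cst x + cst y" "cst (x * y) = cst x * cst y" "cst 1 = 1" for x y
  by (auto simp: cst_def)
 have "rep_symp U (%c. act (cst c)) (%_ u. u) 1 0 om (%_. {0}) 0"
 proof
  show "finite U" by (rule finite_U)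
  fix u v :: 'v assume uv: "u \<in> U"
  show "act (cst x) u \<in> U" for x using uv by (simp add: act_U)
  show "act (cst (x + y)) u = act (cst x) u + act (cst y) u" for x y unfolding c using uv by (simp add: act_plus)
  show "act (cst (x * y)) u = act (cst x) (act (cst y) u)" for x y unfolding c using uv by (simp add: act_times)
  show "act (cst 1) u = u" unfolding c using uv by (rule act_one)
 qed (auto simp: zero_U add_U act_add act_zero om_addl om_self om_cst om_nondeg intro: om_skew)
 then interpret R: rep_symp U "%c. act (cst c)" "%_ u. u" 1 0 om "%_. {0}" 0 .
 \<comment> \<open>The empty tuple with the empty flag presents the standard symplectic space as a
   module of this trivial kind.\<close>
 have "([], []) \<in> Om n 0 1 0" by (simp add: Om_def Tup_def flags_def)
 from rep_symp_Om[OF this]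
 interpret V: rep_symp "FV (2 * n) :: (nat => 'a) set" scf "%i. opm (2 * n) ([] ! i)" 1 0 "omf n" "Wof []" 0 by simp
 have T0: "z = z'" if "z \<in> Tchar 1 0" "z' \<in> Tchar 1 0" for z z' :: "nat => 'a alg_closure"
  using that by (simp add: Tchar_def)
 have i1: "R.F.ind z z' = 1 z'" if "z \<in> Tchar 1 0" "z' \<in> Tchar 1 0" for z z' :: "nat => 'a alg_closure"
  using T0[OF that] by (simp add: R.F.ind_def)
 have pR: "R.E.part z M = M" if "z \<in> Tchar 1 0" "M \<subseteq> U" for z M
 proof -
  have "R.act (R.F.ind z) u = u" if u: "u \<in> M" for u
  proof -
   have "R.act (R.F.ind z) u = R.act 1 u"
    by (rule R.act_cong) (rule i1[OF \<open>z \<in> Tchar 1 0\<close>])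
   also have "... = u" by (rule R.act_one) (use u \<open>M \<subseteq> U\<close> in blast)
   finally show ?thesis .
  qed
  thus ?thesis unfolding R.E.part_def by auto
 qed
 have pV: "V.E.part z M = M" if "z \<in> Tchar 1 0" "M \<subseteq> FV (2 * n)" for z M
 proof -
  have "V.act (R.F.ind z) u = u" if u: "u \<in> M" for u
  proof -
   have "V.act (R.F.ind z) u = V.act 1 u"
    by (rule V.act_cong) (rule i1[OF \<open>z \<in> Tchar 1 0\<close>])
   also have "... = u" by (rule V.act_one) (use u \<open>M \<subseteq> FV (2 * n)\<close> in blast)
   finally show ?thesis .
  qed
  thus ?thesis unfolding V.E.part_def by auto
 qed
 have W: "Wof [] i = {0}" for i :: nat by (simp add: Wof_def)
 have "EX R. iso_rel R.F.Eq U R.act om (%_. {0}) (FV (2 * n)) V.act (omf n) (Wof []) R"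
 proof (rule R.F.symp_iso_rel[OF R.S.symp_axioms V.S.symp_axioms])
  fix z :: "nat => 'a alg_closure" assume z: "z \<in> Tchar 1 0"
  show "card (R.E.part z U) = card (V.E.part z (FV (2 * n)))"
   unfolding pR[OF z order_refl] pV[OF z order_refl] card card_FV ..
  have 0: "{0} \<subseteq> U" "{0} \<subseteq> (FV (2 * n) :: (nat => 'a) set)" using zero_U FV_closed(1)[of "2 * n"] by auto
  show "card (R.E.part z {0}) = card (V.E.part z (Wof [] i))" for i
   unfolding W pR[OF z 0(1)] pV[OF z 0(2)] by simp
 qed
 then obtain S where S: "iso_rel R.F.Eq U R.act om (%_. {0}) (FV (2 * n)) V.act (omf n) (Wof []) S" by blast
 obtain f where F: "bij_betw f U (FV (2 * n)) & (\<forall>x\<in>U. \<forall>y\<in>U. f (x + y) = f x + f y & omf n (f x) (f y) = om x y) &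
  (\<forall>w\<in>R.F.Eq. \<forall>x\<in>U. f (R.act w x) = V.act w (f x)) & (ALL i. f ` {0} = Wof [] i)"
  using two_symp.iso_rel_fun[OF two_symp.intro[OF R.S.symp_axioms V.S.symp_axioms] S] by (rule exE)
 note f = conjunct1[OF F] conjunct1[OF conjunct2[OF F], rule_format]
  conjunct1[OF conjunct2[OF conjunct2[OF F]], rule_format]
 have sc: "f (act (cst c) u) = scf c (f u)" if "u \<in> U" for c u
 proof -
  have "f u \<in> FV (2 * n)" using f(1) that by (auto simp: bij_betw_def)
  thus ?thesis
   using f(3)[OF R.F.Eq_closed(3) that, of c] R.act_cst[OF that, of c] V.act_cst[of "f u" c] by simp
 qed
 show ?thesis
 proof (intro exI[of _ f] conjI ballI allI)
  show "bij_betw f U (FV (2 * n))" by (rule f(1))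
  show "f (act (cst c) u) = scf c (f u)" if "u \<in> U" for c u by (rule sc[OF that])
  fix u v assume uv: "u \<in> U" "v \<in> U"
  show "f (u + v) = f u + f v" by (rule conjunct1[OF f(2)[OF uv]])
  show "omf n (f u) (f v) = om u v" by (rule conjunct2[OF f(2)[OF uv]])
 qed
qed

text \<open>Symplectic coordinates carry the model module to the standard space. The coordinate
  functions on T become commuting matrices of exponent P, and the flag steps become the
  flag.\<close>

lemma ex_Om:
 assumes P: "of_nat P ~= (0 :: 'a :: {field, finite})"
  and d: "d \<in> frob_set.Dat (Tchar P r) (phc r) (ioc r :: (nat => 'a alg_closure) => _) k n"
 shows "\<exists>w :: 'a mat list \<times> (nat => 'a) set list. w \<in> Om n r P k & inv_dat n r P w = dcard r P k d"
proof -
 have P0: "P > 0" using P by (cases P) simp_all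
 let ?T = "Tchar P r :: (nat => 'a alg_closure) set"
 interpret F: frob_set ?T "phc r" "ioc r" "TYPE('a)" by (rule frob_set_Tchar[OF P0])
 obtain m G where dd: "d = (m, G)" by (cases d)
 have v: "F.valid k m G" and tot: "(\<Sum>z\<in>?T. m z + G k z + G k (ioc r z)) = 2 * n"
  and strict: "!!i. i < k ==> G i ~= G (Suc i)" and out: "!!i z. z ~: ?T ==> G i z = 0"
  using d unfolding dd F.Dat_def by blast+
 obtain U :: "(nat => (nat => 'a alg_closure) => 'a alg_closure) set"
  and act :: "((nat => 'a alg_closure) => 'a alg_closure) => _" and om W
  where model: "symp ?T (phc r) (ioc r) U act om W k &
   (\<forall>z\<in>?T. card (eqmod.part (phc r) act z U) = CARD('a) ^ (F.per z * (m z + G k z + G k (ioc r z)))) &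
   (ALL i. \<forall>z\<in>?T. card (eqmod.part (phc r) act z (W i)) = CARD('a) ^ (F.per z * G i z))"
  using F.ex_model[OF v] by (elim exE) (rule that)
 note sy = conjunct1[OF model] and cU = conjunct1[OF conjunct2[OF model], rule_format]
  and cW = conjunct2[OF conjunct2[OF model], rule_format]
 interpret M: symp ?T "phc r" "ioc r" "TYPE('a)" U act om W k by (rule sy)
 let ?V = "FV (2 * n) :: (nat => 'a) set" and ?o = "opm (2 * n)"
 \<comment> \<open>The block decomposition yields some multiplicities for the model; component sizes
   show that their totals at each point are the prescribed ones.\<close>
 have cardU: "card U = CARD('a) ^ (2 * n)"
 proof -
  obtain m' G' where hd: "F.has_data U act W k m' G'" using F.symp_ex_data[OF sy] by blast
  have "m' z + G' k z + G' k (ioc r z) = m z + G k z + G k (ioc r z)" if z: "z \<in> ?T" for z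
   by (rule card_parts_data[OF P z]) (use hd cU[OF z] z in \<open>simp add: F.has_data_def\<close>)
  hence "(\<Sum>z\<in>?T. m' z + G' k z + G' k (ioc r z)) = 2 * n" using tot by simp
  thus ?thesis using hd by (simp add: F.has_data_def)
 qed
 obtain f where Fc: "bij_betw f U ?V & (\<forall>u\<in>U. \<forall>v\<in>U. f (u + v) = f u + f v & omf n (f u) (f v) = om u v) &
  (ALL c. \<forall>u\<in>U. f (act (F.cst c) u) = scf c (f u))"
  using M.ex_coordinates[OF cardU] by (rule exE)
 note f = conjunct1[OF Fc] conjunct1[OF conjunct2[OF Fc], rule_format] conjunct2[OF conjunct2[OF Fc], rule_format]
 define co :: "nat => (nat => 'a alg_closure) => 'a alg_closure" where "co i z = z i" for i z
 have coE: "co i \<in> F.Eq" if "i < r" for i using that by (auto simp: F.Eq_def phc_def co_def)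
 have c: "F.cst (x + y) = F.cst x + F.cst y" "F.cst (x * y) = F.cst x * F.cst y" "F.cst 1 = 1" for x y
  by (auto simp: F.cst_def)
 have co_pow: "(act (co i) ^^ j) u = act (co i ^ j) u & co i ^ j \<in> F.Eq" if "i < r" "u \<in> U" for i j u
 proof (induction j)
  case 0
  show ?case by (simp only: funpow.simps id_apply power_0 M.act_one[OF that(2)] F.Eq_closed(1) simp_thms)
 next
  case (Suc j)
  thus ?case using M.act_times[OF coE[OF that(1)] _ that(2), of "co i ^ j"] F.Eq_closed(6)[OF coE[OF that(1)], of "co i ^ j"]
   by (simp only: funpow.simps comp_apply power_Suc simp_thms)
 qed
 have co_P: "(act (co i) ^^ P) u = u" if iu: "i < r" "u \<in> U" for i u
 proof -
  have pw: "(co i ^ P) z = z i ^ P" for z by (induction P) (simp_all add: co_def)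
  have "act (co i ^ P) u = act 1 u"
  proof (rule M.act_cong)
   show "co i ^ P \<in> F.Eq" by (rule conjunct2[OF co_pow[OF iu]])
   show "1 \<in> F.Eq" by (rule F.Eq_closed(1))
   show "u \<in> U" by (rule iu(2))
   fix z assume "z \<in> ?T"
   thus "(co i ^ P) z = 1 z" using iu(1) unfolding pw by (auto simp: Tchar_def)
  qed
  thus ?thesis using conjunct1[OF co_pow[OF iu, of P]] M.act_one[OF iu(2)] by (simp only:)
 qed
 have "rep U (%c. act (F.cst c)) (%i. act (co i)) P r"
 proof
  show "finite U" by (rule M.finite_U)
  show "of_nat P ~= (0 :: 'a)" by (rule P)
  fix u and i j assume u: "u \<in> U"
  show "act (F.cst x) u \<in> U" for x using u by (simp add: M.act_U)
  show "act (F.cst (x + y)) u = act (F.cst x) u + act (F.cst y) u" for x y unfolding c using u by (simp add: M.act_plus)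
  show "act (F.cst (x * y)) u = act (F.cst x) (act (F.cst y) u)" for x y unfolding c using u by (simp add: M.act_times)
  show "act (F.cst 1) u = u" unfolding c using u by (rule M.act_one)
  show "i < r ==> (act (co i) ^^ P) u = u" using u by (rule co_P[rotated])
  show "i < r ==> j < r ==> act (co i) (act (co j) u) = act (co j) (act (co i) u)" using u by (intro M.act_comm coE)
  show "i < r ==> act (co i) (act (F.cst x) u) = act (F.cst x) (act (co i) u)" for x using u by (intro M.act_comm coE F.Eq_closed)
 qed (simp_all add: M.zero_U M.add_U M.act_add M.act_U coE)
 then interpret R: rep U "%c. act (F.cst c)" "%i. act (co i)" P r .
 have Rco: "R.co i = co i" for i by (rule ext) (simp add: R.co_def co_def)
 \<comment> \<open>The action built into the model is the one its coordinate operators generate, so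
   its components are those of the tuple.\<close>
 have Ract: "R.act w u = act w u" if "w \<in> F.Eq" "u \<in> U" for w u
  using R.act_unique[OF M.eqmod_axioms refl _ that] by (simp add: Rco)
 have fV: "f u \<in> ?V" if "u \<in> U" for u using f(1) that by (auto simp: bij_betw_def)
 have finj: "inj_on f U" and fim: "f ` U = ?V" using f(1) by (auto simp: bij_betw_def)
 define g where "g = inv_into U f"
 have gU: "g x \<in> U" "f (g x) = x" if "x \<in> ?V" for x
 proof -
  have xi: "x \<in> f ` U" using that by (simp only: fim)
  show "g x \<in> U" "f (g x) = x" unfolding g_def by (rule inv_into_into[OF xi], rule f_inv_into_f[OF xi])
 qed
 have gf: "g (f u) = u" if "u \<in> U" for u unfolding g_def by (rule inv_into_f_f[OF finj that])
 have g_eq: "g x = u" if "u \<in> U" "f u = x" for x u using gf[OF that(1)] that(2) by simp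
 have g_add: "g (x + y) = g x + g y" if "x \<in> ?V" "y \<in> ?V" for x y
  by (rule g_eq) (simp_all add: gU that M.add_U f(2))
 have g_sc: "g (scf a x) = act (F.cst a) (g x)" if "x \<in> ?V" for a x
  by (rule g_eq) (simp_all add: gU that M.act_U f(3))
 define B where "B i = mat_of (2 * n) (%x. f (act (co i) (g x)))" for i
 have cB: "B i \<in> carrier_mat (2 * n) (2 * n)" for i by (simp add: B_def mat_of_carrier)
 have actU: "act (co i) u \<in> U" if "i < r" "u \<in> U" for i u using M.act_U[OF coE[OF that(1)] that(2)] .
 have oB: "?o (B i) x = f (act (co i) (g x))" if i: "i < r" and x: "x \<in> ?V" for i x
  unfolding B_def
 proof (rule opm_mat_of[OF x])
  fix y z :: "nat => 'a" assume y: "y \<in> ?V"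
  show "f (act (co i) (g y)) \<in> ?V" by (rule fV[OF actU[OF i gU(1)[OF y]]])
  show "f (act (co i) (g (scf a y))) = scf a (f (act (co i) (g y)))" for a
   unfolding g_sc[OF y] R.Y_sc[OF i gU(1)[OF y]] by (rule f(3)[OF actU[OF i gU(1)[OF y]]])
  assume z: "z \<in> ?V"
  show "f (act (co i) (g (y + z))) = f (act (co i) (g y)) + f (act (co i) (g z))"
   unfolding g_add[OF y z] R.Y_add[OF i gU(1)[OF y] gU(1)[OF z]]
   using f(2)[OF actU[OF i gU(1)[OF y]] actU[OF i gU(1)[OF z]]] by blast
 qed
 have oBf: "?o (B i) (f u) = f (act (co i) u)" if "i < r" "u \<in> U" for i u
  using oB[OF that(1) fV[OF that(2)]] gf[OF that(2)] by simp
 have om_co: "om (act (co i) u) (act (co i) v) = om u v" if i: "i < r" and uv: "u \<in> U" "v \<in> U" for i u v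
 proof -
  have sE: "F.star (co i) \<in> F.Eq" by (rule F.Eq_closed(8)[OF coE[OF i]])
  have "act (F.star (co i)) (act (co i) v) = act (F.star (co i) * co i) v"
   by (rule M.act_times[OF sE coE[OF i] uv(2), symmetric])
  also have "... = act 1 v"
  proof (rule M.act_cong[OF F.Eq_closed(6)[OF sE coE[OF i]] F.Eq_closed(1) _ uv(2)])
   fix z :: "nat => 'a alg_closure" assume "z \<in> ?T"
   hence "z i ~= 0" by (rule R.Tchar_nz[OF _ i])
   thus "(F.star (co i) * co i) z = 1 z" using i by (simp add: F.star_def co_def ioc_def)
  qed
  finally show ?thesis
   using M.om_act[OF coE[OF i] uv(1) actU[OF i uv(2)]] M.act_one[OF uv(2)] by simp
 qed
 have Bsp: "B i \<in> carrier (Sp TYPE('a) n)" if i: "i < r" for i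
 proof -
  have "omf n (?o (B i) x) (?o (B i) y) = omf n x y" if "x \<in> ?V" "y \<in> ?V" for x y
   using f(2)[OF actU[OF i gU(1)[OF that(1)]] actU[OF i gU(1)[OF that(2)]]] f(2)[OF gU(1)[OF that(1)] gU(1)[OF that(2)]]
    om_co[OF i gU(1)[OF that(1)] gU(1)[OF that(2)]] gU(2)[OF that(1)] gU(2)[OF that(2)]
   by (simp add: oB[OF i that(1)] oB[OF i that(2)])
  thus ?thesis using cB by (simp add: carrier_Sp spm_def)
 qed
 define Ys where "Ys = map B [0..<r]"
 have YsB: "Ys ! i = B i" if "i < r" for i using that by (simp add: Ys_def)
 have setY: "set Ys = B ` {..<r}" by (auto simp: Ys_def)
 have comm: "B i * B j = B j * B i" if ij: "i < r" "j < r" for i j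
 proof (rule opm_inject[of _ "2 * n"])
  fix x :: "nat => 'a" assume x: "x \<in> ?V"
  have e: "?o (B i) (?o (B j) x) = f (act (co i) (act (co j) (g x)))" if "i < r" "j < r" for i j
   using oBf[OF that(1) actU[OF that(2) gU(1)[OF x]]] oB[OF that(2) x] by simp
  show "?o (B i * B j) x = ?o (B j * B i) x"
   unfolding opm_mult[OF cB cB] e[OF ij] e[OF ij(2,1)] R.Y_comm[OF ij gU(1)[OF x]] ..
 qed (rule mult_carrier_mat[OF cB cB])+
 have pow: "B i [^]\<^bsub>Sp TYPE('a) n\<^esub> P = 1\<^sub>m (2 * n)" if i: "i < r" for i
 proof (rule opm_inject[of _ "2 * n"])
  interpret G: group "Sp TYPE('a) n" by (rule group_Sp)
  show "B i [^]\<^bsub>Sp TYPE('a) n\<^esub> P \<in> carrier_mat (2 * n) (2 * n)"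
   using G.nat_pow_closed[OF Bsp[OF i], of P] by (simp add: carrier_Sp spm_def)
  fix x :: "nat => 'a" assume x: "x \<in> ?V"
  have "(?o (B i) ^^ j) x = f ((act (co i) ^^ j) (g x)) & (act (co i) ^^ j) (g x) \<in> U" for j
   by (induction j) (simp_all add: gU x oBf[OF i] actU[OF i])
  thus "?o (B i [^]\<^bsub>Sp TYPE('a) n\<^esub> P) x = ?o (1\<^sub>m (2 * n)) x"
   using opm_pow[OF Bsp[OF i] x, of P] opm_one[OF x] co_P[OF i gU(1)[OF x]] gU(2)[OF x] by simp
 qed simp
 have Ys: "Ys \<in> Tup n r P"
  unfolding Tup_def setY using Bsp comm pow by (auto simp: Ys_def)
 have WU: "W i \<subseteq> U" for i using M.W_sub[of i] unfolding M.eqsub_def by blast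
 have Wlt: "W i \<subset> W (Suc i)" if i: "i < k" for i
 proof -
  have "\<exists>z\<in>?T. G i z ~= G (Suc i) z"
  proof (rule ccontr)
   assume h: "\<not> ?thesis"
   have "G i z = G (Suc i) z" for z using h out[of z] by (cases "z \<in> ?T") auto
   thus False using strict[OF i] by blast
  qed
  then obtain z where z: "z \<in> ?T" "G i z ~= G (Suc i) z" by blast
  have "W i ~= W (Suc i)"
  proof
   assume "W i = W (Suc i)"
   hence "CARD('a) ^ (F.per z * G i z) = CARD('a) ^ (F.per z * G (Suc i) z)"
    using cW[OF z(1), of i] cW[OF z(1), of "Suc i"] by simp
   thus False using card_parts_data[OF P z(1)] z(2) by blast
  qed
  thus ?thesis using M.W_mono[of i] by blast
 qed
 have iso: "f ` W (Suc i) \<in> fixF n (set Ys)" if i: "i < k" for i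
 proof -
  note E = M.eqsubD[OF M.W_sub[of "Suc i"]]
  have f0: "f 0 = 0" using f(2)[OF M.zero_U M.zero_U] by (metis add.right_neutral add_left_cancel)
  have "W (Suc i) ~= {0}"
  proof
   assume e: "W (Suc i) = {0}"
   have "W i \<subset> {0}" using Wlt[OF i] unfolding e .
   thus False using M.eqsubD(2)[OF M.W_sub[of i]] by blast
  qed
  then obtain u where u: "u \<in> W (Suc i)" "u ~= 0" using E(2) by blast
  have "f u ~= 0" using inj_onD[OF finj, of u 0] f0 u E(1)[OF u(1)] M.zero_U by metis
  hence "f ` W (Suc i) ~= {0}" using u(1) by blast
  moreover have "f ` W (Suc i) \<subseteq> ?V" using fV WU by blast
  moreover have "0 \<in> f ` W (Suc i)" using imageI[OF E(2), of f] unfolding f0 .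
  moreover have "f u + f v \<in> f ` W (Suc i)" if "u \<in> W (Suc i)" "v \<in> W (Suc i)" for u v
   using imageI[OF E(3)[OF that], of f] f(2)[OF E(1)[OF that(1)] E(1)[OF that(2)]] by simp
  moreover have "scf a (f u) \<in> f ` W (Suc i)" if "u \<in> W (Suc i)" for a u
   using imageI[OF E(4)[OF F.Eq_closed(3) that], of f a] f(3)[OF E(1)[OF that], of a] by simp
  moreover have "omf n (f u) (f v) = 0" if "u \<in> W (Suc i)" "v \<in> W (Suc i)" for u v
   using f(2)[OF E(1)[OF that(1)] E(1)[OF that(2)]] M.W_iso[OF that] by simp
  ultimately have isoM: "f ` W (Suc i) \<in> isoF n" unfolding isoF_def by blast
  have "?o (B j) ` f ` W (Suc i) = f ` W (Suc i)" if j: "j < r" for j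
  proof (rule endo_inj_surj)
   show "finite (f ` W (Suc i))" using finite_subset[OF WU M.finite_U] by blast
   show "?o (B j) ` f ` W (Suc i) \<subseteq> f ` W (Suc i)"
    using oBf[OF j E(1)] E(4)[OF coE[OF j]] by auto
   show "inj_on (?o (B j)) (f ` W (Suc i))"
    by (rule inj_on_subset[OF inj_opm[OF Bsp[OF j]]]) (use fV WU in blast)
  qed
  thus ?thesis using isoM unfolding fixF_def setY by blast
 qed
 define ms where "ms = map (%i. f ` W (Suc i)) [0..<k]"
 have lt: "W (Suc i) \<subset> W (Suc j)" if "i < j" "j < k" for i j
 proof -
  have "W (Suc i) \<subseteq> W j" using that(1) by (intro M.W_le) simp
  thus ?thesis using Wlt[OF that(2)] by blast
 qed
 have fl: "ms \<in> flags (fixF n (set Ys)) k"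
 proof -
  have "sorted_wrt (\<subset>) ms"
   unfolding sorted_wrt_iff_nth_less
  proof (intro allI impI)
   fix i j assume ij: "i < j" "j < length ms"
   hence k: "i < k" "j < k" by (simp_all add: ms_def)
   have "f ` W (Suc i) \<subset> f ` W (Suc j)"
    using lt[OF ij(1) k(2)] inj_image_subset_iff[OF finj WU WU] by (simp add: less_le_not_le)
   thus "ms ! i \<subset> ms ! j" using k by (simp add: ms_def)
  qed
  thus ?thesis using iso by (auto simp: flags_def ms_def)
 qed
 have w: "(Ys, ms) \<in> Om n r P k" using Ys fl by (simp add: Om_def)
 have Wf: "Wof ms i = f ` W i" for i
 proof -
  have f0: "f 0 = 0" using f(2)[OF M.zero_U M.zero_U] by (metis add.right_neutral add_left_cancel)
  show ?thesis
  proof (cases "i = 0 \<or> k = 0")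
   case True
   hence "W i = {0}" using M.W_0 M.W_top[of i] by auto
   thus ?thesis using True f0 by (auto simp: Wof_def ms_def)
  next
   case False
   hence "min i k - 1 < k" "Suc (min i k - 1) = min i k" by auto
   moreover have "W (min i k) = W i" using M.W_top[of i] by (cases "i \<le> k") (auto simp: min_def)
   ultimately show ?thesis using False by (auto simp: Wof_def ms_def)
  qed
 qed
 have part: "card (eqmod.part (phc r) (actY n r P Ys) z (f ` N)) = card (M.part z N)" if "z \<in> ?T" "N \<subseteq> U" for z N
 proof -
  have "card (eqmod.part (phc r) (actY n r P Ys) z (f ` N)) = card (R.E.part z N)"
   unfolding actY_def
   by (rule card_part_image[OF R.rep_axioms rep_Tup[OF Ys P] _ _ _ finj that(2)])
    (use f(2,3) oBf YsB in auto)
  also have "R.E.part z N = M.part z N"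
   unfolding R.E.part_def M.part_def using Ract[OF F.ind_Eq[OF that(1)]] that(2) by auto
  finally show ?thesis .
 qed
 have "inv_dat n r P (Ys, ms) = dcard r P k d"
  unfolding inv_dat_def dcard_def dd fst_conv snd_conv Wf
  using part[OF _ order_refl] part[OF _ WU] cU cW unfolding fim by (auto simp: fun_eq_iff)
 thus ?thesis using w by blast
qed

lemma card_inv_dat:
 assumes P: "of_nat P ~= (0 :: 'a :: {field, finite})"
 shows "card (inv_dat n r P ` (Om n r P k :: ('a mat list \<times> (nat => 'a) set list) set)) =
  card (frob_set.Dat (Tchar P r) (phc r) (ioc r :: (nat => 'a alg_closure) => _) k n)"
proof -
 let ?D = "frob_set.Dat (Tchar P r) (phc r) (ioc r :: (nat => 'a alg_closure) => _) k n"
 have "inv_dat n r P ` (Om n r P k :: ('a mat list \<times> (nat => 'a) set list) set) = dcard r P k ` ?D"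
 proof (intro subset_antisym subsetI)
  fix x assume "x \<in> inv_dat n r P ` (Om n r P k :: ('a mat list \<times> (nat => 'a) set list) set)"
  thus "x \<in> dcard r P k ` ?D" using Om_data[OF P] by blast
 next
  fix x assume "x \<in> dcard r P k ` ?D"
  then obtain d where "d \<in> ?D" "x = dcard r P k d" by blast
  then obtain w :: "'a mat list \<times> (nat => 'a) set list" where "w \<in> Om n r P k" "inv_dat n r P w = x"
   using ex_Om[OF P] by metis
  thus "x \<in> inv_dat n r P ` (Om n r P k :: ('a mat list \<times> (nat => 'a) set list) set)" by blast
 qed
 thus ?thesis using card_image[OF inj_dcard[OF P]] by simp
qed

section \<open>Comparison of the two series for p prime to q\<close>

lemma main_coprime:
 fixes p q r :: nat
 assumes p: "Factorial_Ring.prime p" and q: "CARD('a :: {field, finite}) = q" and pq: "of_nat p ~= (0 :: 'a)"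
 shows "F_Sp TYPE('a) p (r + 1) =
  exp_fps (Abs_fps (%n. if n = 0 then 0 else of_nat (p_part p (q ^ n + 1) ^ r) / of_nat (2 * n))) /
  exp_fps (Abs_fps (%n. if n = 0 then 0 else of_nat (p_part p (q ^ n - 1) ^ r) / of_nat (2 * n)))"
  (is "_ = ?rhs")
proof (rule fps_ext)
 fix n
 \<comment> \<open>Large enough for two purposes: elements of p-power order, whose order is at most
   that of the group, satisfy A^P = 1; and P bounds q^j + 1 for j up to n, so that gcds with P are
   full p-parts.\<close>
 define N where "N = card (carrier (Sp TYPE('a) n)) + q ^ n + 1"
 define P where "P = p ^ N"
 have p1: "p > 1" by (rule prime_gt_1_nat[OF p])
 have NP: "N \<le> P" unfolding P_def using less_exp[of N] power_mono[of 2 p N] p1 by linarith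
 have Pinv: "of_nat P ~= (0 :: 'a)" using pq by (simp add: P_def)
 have P0: "P > 0" using p1 by (simp add: P_def)
 have q1: "q > 1" using card_field_gt_1[where 'a = 'a] q by simp
 interpret F: frob_set "Tchar P r :: (nat => 'a alg_closure) set" "phc r" "ioc r" "TYPE('a)"
  by (rule frob_set_Tchar[OF P0])
 interpret G: group "Sp TYPE('a) n" by (rule group_Sp)
 have ord: "A [^]\<^bsub>Sp TYPE('a) n\<^esub> P = 1\<^sub>m (2 * n) \<longleftrightarrow> (EX k. G.ord A = p ^ k)"
  if A: "A \<in> carrier (Sp TYPE('a) n)" for A :: "'a mat"
 proof
  assume "A [^]\<^bsub>Sp TYPE('a) n\<^esub> P = 1\<^sub>m (2 * n)"
  hence "G.ord A dvd p ^ N" using G.pow_eq_id[OF A, of P] by (simp add: P_def)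
  thus "EX k. G.ord A = p ^ k" using divides_primepow_nat[OF p] by blast
 next
  assume "EX k. G.ord A = p ^ k"
  then obtain k where k: "G.ord A = p ^ k" by blast
  have "G.ord A \<le> card (carrier (Sp TYPE('a) n))"
  proof (rule dvd_imp_le)
   show "G.ord A dvd card (carrier (Sp TYPE('a) n))" using G.ord_dvd_group_order[OF A] by (simp add: order_def)
   show "0 < card (carrier (Sp TYPE('a) n))" using A finite_Sp[of "TYPE('a)" n] card_gt_0_iff by blast
  qed
  moreover have "k < p ^ k" using power_gt_expt[of p k] p1 by simp
  ultimately have "k \<le> N" using k by (simp add: N_def)
  hence "G.ord A dvd P" unfolding k P_def by (rule le_imp_power_dvd)
  thus "A [^]\<^bsub>Sp TYPE('a) n\<^esub> P = 1\<^sub>m (2 * n)" using G.pow_eq_id[OF A, of P] by simp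
 qed
 \<comment> \<open>At least n, so that the sum equals the coefficient of \<open>Fc\<close>, and at
   least the number of isotropic subspaces, so that no chain is missed.\<close>
 define K where "K = max n (card (isoF n :: (nat => 'a) set set))"
 have lhs: "fps_nth (F_Sp TYPE('a) p (r + 1)) n = fps_nth F.Fc n"
 proof (cases "n = 0")
  case True
  have "fps_nth F.Fc 0 * fps_nth (Abs_fps (%n. of_nat (card (F.Gn n)))) 0 = fps_nth (Abs_fps (%n. of_nat (card (F.Hn n)))) 0"
   using arg_cong[OF F.Fc_quotient, of "%f. fps_nth f 0"] by simp
  thus ?thesis using F.quotient_log_deriv(2)[OF F.Fc_quotient] True by (simp add: F_Sp_def)
 next
  case False
  have "equivariant_euler_char TYPE('a) p (r + 1) n =
    - (\<Sum>k\<le>K. (-1) ^ k * of_nat (card (inv_dat n r P ` (Om n r P k :: ('a mat list \<times> (nat => 'a) set list) set))))"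
   by (rule equivariant_euler_orbits[OF ord inv_dat_iff[OF Pinv]]) (simp_all add: K_def)
  also have "... = - fps_nth F.Fc n"
   unfolding card_inv_dat[OF Pinv] by (subst F.Fc_nth[of n K]) (simp_all add: K_def)
  finally show ?thesis using False by (simp add: F_Sp_def)
 qed
 define a b where "a j = (of_nat (p_part p (q ^ j + 1) ^ r) :: rat)" and "b j = (of_nat (p_part p (q ^ j - 1) ^ r) :: rat)" for j
 note rh = exp_quotient_log_deriv[of a b]
 have "same_upto n F.Fc (exp_fps (Abs_fps (%n. if n = 0 then 0 else a n / of_nat (2 * n))) /
   exp_fps (Abs_fps (%n. if n = 0 then 0 else b n / of_nat (2 * n))))"
 proof (rule log_deriv_determines[OF F.quotient_log_deriv(1)[OF F.Fc_quotient] rh(1)])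
  show "fps_nth F.Fc 0 = fps_nth (exp_fps (Abs_fps (%n. if n = 0 then 0 else a n / of_nat (2 * n))) /
    exp_fps (Abs_fps (%n. if n = 0 then 0 else b n / of_nat (2 * n)))) 0"
   using F.quotient_log_deriv(2)[OF F.Fc_quotient] rh(2) by simp
  show "fps_nth (F.Mf - F.Nf) 0 = 0" by (simp add: F.Mf_def F.Nf_def)
  show "fps_nth (Abs_fps (%n. if n = 0 then 0 else a n - b n)) 0 = 0" by simp
  show "same_upto n (F.Mf - F.Nf) (Abs_fps (%n. if n = 0 then 0 else a n - b n))"
   unfolding same_upto_def
  proof (intro allI impI)
   fix j assume j: "j \<le> n"
   show "fps_nth (F.Mf - F.Nf) j = fps_nth (Abs_fps (%n. if n = 0 then 0 else a n - b n)) j"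
   proof (cases "j = 0")
    case False
    have "q ^ j \<le> q ^ n" using q1 j by (intro power_increasing) auto
    hence le: "q ^ j + 1 \<le> p ^ N" "q ^ j - 1 \<le> p ^ N" using NP by (simp_all add: N_def P_def)
    have pos: "q ^ j - 1 > 0" using False q1 one_less_power[of q j] by simp
    have "gcd P (q ^ j + 1) = p_part p (q ^ j + 1)" "gcd P (q ^ j - 1) = p_part p (q ^ j - 1)"
     unfolding P_def by (rule gcd_prime_power_part[OF p _ le(1)], simp, rule gcd_prime_power_part[OF p pos le(2)])
    thus ?thesis
     using False card_fixed_Tchar[OF Pinv, of r j] by (simp add: F.Mf_def F.Nf_def a_def b_def q)
   qed (simp add: F.Mf_def F.Nf_def)
  qed
 qed
 hence "fps_nth F.Fc n = fps_nth ?rhs n" unfolding same_upto_def a_def b_def by simp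
 thus "fps_nth (F_Sp TYPE('a) p (r + 1)) n = fps_nth ?rhs n" using lhs by simp
qed

subsection \<open>The defining characteristic\<close>

text \<open>Adding or removing m is an involution on the family that changes the parity of the
  size.\<close>

lemma sum_toggle:
 assumes fin: "finite F" "!!C. C \<in> F ==> finite C"
  and tog: "!!C. C \<in> F ==> insert m C \<in> F" "!!C. C \<in> F ==> C - {m} \<in> F"
 shows "(\<Sum>C\<in>F. (-1 :: int) ^ card C) = 0"
proof -
 define t where "t C = (if m \<in> C then C - {m} else insert m C)" for C
 have t: "t C \<in> F" "t (t C) = C" "(-1 :: int) ^ card (t C) = - ((-1) ^ card C)" if "C \<in> F" for C
 proof -
  show "t C \<in> F" using tog that by (simp add: t_def)
  show "t (t C) = C" by (auto simp: t_def)
  show "(-1 :: int) ^ card (t C) = - ((-1) ^ card C)"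
  proof (cases "m \<in> C")
   case True
   have "card C = Suc (card (C - {m}))" using fin(2)[OF that] True by (metis card_Suc_Diff1)
   show ?thesis unfolding t_def if_P[OF True] \<open>card C = _\<close>
    by (simp only: power_Suc mult_minus_left mult_1_left minus_minus)
  next
   case False
   thus ?thesis using fin(2)[OF that] by (simp add: t_def)
  qed
 qed
 have "(\<Sum>C\<in>F. (-1 :: int) ^ card C) = (\<Sum>C\<in>F. (-1) ^ card (t C))"
  by (rule sum.reindex_bij_witness[of _ t t]) (simp_all add: t)
 also have "... = - (\<Sum>C\<in>F. (-1) ^ card C)" by (simp add: t(3) sum_negf)
 finally show ?thesis by simp
qed

lemma chain_insert:
 assumes "subset.chain Q C" "m \<in> Q" "!!x. x \<in> C ==> x \<subseteq> m \<or> m \<subseteq> x"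
 shows "subset.chain Q (insert m C)"
 using assms unfolding subset_chain_def by blast

lemma chain_Diff: "subset.chain Q C ==> subset.chain Q (C - D)"
 unfolding subset_chain_def by blast

lemma chain_sum_cone:
 assumes "finite Q" "m \<in> Q" "!!x. x \<in> Q ==> x \<subseteq> m \<or> m \<subseteq> x"
 shows "chain_sum Q = 0"
 unfolding chain_sum_def
proof (rule sum_toggle[OF finite_chains[OF assms(1)]])
 fix C assume "C \<in> {C. subset.chain Q C}"
 hence C: "subset.chain Q C" by simp
 hence sub: "C \<subseteq> Q" by (simp add: subset_chain_def)
 show "finite C" using sub assms(1) finite_subset by blast
 show "insert m C \<in> {C. subset.chain Q C}" using chain_insert[OF C assms(2)] assms(3) sub by blast
 show "C - {m} \<in> {C. subset.chain Q C}" using chain_Diff[OF C] by simp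
qed

text \<open>Everything comparable with w is comparable with m, so in the chains through w the
  element m can be toggled and their contribution cancels.\<close>

lemma chain_sum_remove:
 assumes Q: "finite Q" "w \<in> Q" "m \<in> Q" "m ~= w"
  and c: "!!x. x \<in> Q ==> x \<subseteq> w \<or> w \<subseteq> x ==> x \<subseteq> m \<or> m \<subseteq> x"
 shows "chain_sum Q = chain_sum (Q - {w})"
proof -
 let ?F = "{C. subset.chain Q C & w \<in> C}"
 have split: "{C. subset.chain Q C} = {C. subset.chain (Q - {w}) C} \<union> ?F"
  unfolding subset_chain_def by blast
 have fin: "finite ?F" by (rule finite_subset[OF _ finite_chains[OF Q(1)]]) blast
 have "(\<Sum>C\<in>?F. (-1 :: int) ^ card C) = 0"
 proof (rule sum_toggle[OF fin])
  fix C assume "C \<in> ?F"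
  hence C: "subset.chain Q C" "w \<in> C" by simp_all
  hence sub: "C \<subseteq> Q" by (simp add: subset_chain_def)
  show "finite C" using sub Q(1) finite_subset by blast
  have "x \<subseteq> m \<or> m \<subseteq> x" if "x \<in> C" for x
  proof -
   have "x \<subseteq> w \<or> w \<subseteq> x" using C that unfolding subset_chain_def by blast
   thus ?thesis using c that sub by blast
  qed
  thus "insert m C \<in> ?F" using chain_insert[OF C(1) Q(3)] C(2) by simp
  show "C - {m} \<in> ?F" using chain_Diff[OF C(1)] C(2) Q(4) by simp
 qed
 moreover have "{C. subset.chain (Q - {w}) C} Int ?F = {}" unfolding subset_chain_def by blast
 moreover have "finite {C. subset.chain (Q - {w}) C}" by (rule finite_chains) (use Q(1) in simp)
 ultimately show ?thesis unfolding chain_sum_def split by (subst sum.union_disjoint) (use fin in simp_all)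
qed

lemma chain_sum_dismantle:
 assumes "finite P" "P0 \<subseteq> P"
  and step: "!!P'. P0 \<subseteq> P' ==> P' \<subseteq> P ==> P' ~= P0 ==>
   \<exists>w\<in>P' - P0. \<exists>m\<in>P'. m ~= w & (\<forall>x\<in>P'. x \<subseteq> w \<or> w \<subseteq> x --> x \<subseteq> m \<or> m \<subseteq> x)"
 shows "chain_sum P = chain_sum P0"
proof -
 have "P0 \<subseteq> P' ==> P' \<subseteq> P ==> chain_sum P' = chain_sum P0" for P'
 proof (induction "card P'" arbitrary: P' rule: less_induct)
  case less
  show ?case
  proof (cases "P' = P0")
   case False
   have fin: "finite P'" using less.prems(2) assms(1) finite_subset by blast
   obtain w m where wm: "w \<in> P' - P0" "m \<in> P'" "m ~= w"
    "\<forall>x\<in>P'. x \<subseteq> w \<or> w \<subseteq> x --> x \<subseteq> m \<or> m \<subseteq> x"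
    using step[OF less.prems False] by blast
   have "chain_sum P' = chain_sum (P' - {w})"
    by (rule chain_sum_remove[OF fin _ wm(2,3)]) (use wm in blast)+
   also have "... = chain_sum P0"
    by (rule less.hyps) (use wm(1) less.prems card_Diff1_less[OF fin] in auto)
   finally show ?thesis .
  qed simp
 qed
 thus ?thesis using assms(2) by blast
qed

text \<open>Points not fixed by h are removed starting from a minimal one, w: whatever is still
  below w is fixed by h and so lies below h w, and whatever is above w contains h w. Thus h w plays
  the part of m in \<open>chain_sum_remove\<close>.\<close>

lemma chain_sum_retract_down:
 assumes fin: "finite Q" and h: "!!W. W \<in> Q ==> h W \<in> Q" "!!W. W \<in> Q ==> h W \<subseteq> W"
  "!!W. W \<in> Q ==> h (h W) = h W" "!!V W. V \<in> Q ==> W \<in> Q ==> V \<subseteq> W ==> h V \<subseteq> h W"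
 shows "chain_sum Q = chain_sum {W \<in> Q. h W = W}"
proof (rule chain_sum_dismantle[OF fin])
 let ?P0 = "{W \<in> Q. h W = W}"
 fix P' assume P': "?P0 \<subseteq> P'" "P' \<subseteq> Q" "P' ~= ?P0"
 hence ne: "P' - ?P0 ~= {}" and f: "finite (P' - ?P0)" using fin finite_subset by blast+
 obtain w where w0: "w \<in> P' - ?P0" "\<forall>b\<in>P' - ?P0. b \<subseteq> w --> w = b"
  using finite_has_minimal[OF f ne] by (rule bexE)
 note w = w0(1) w0(2)[rule_format]
 have wQ: "w \<in> Q" "h w ~= w" using w(1) P'(2) by blast+
 have "h w \<in> P'" using h(1,3)[OF wQ(1)] P'(1) by blast
 moreover have "x \<subseteq> h w \<or> h w \<subseteq> x" if x: "x \<in> P'" "x \<subseteq> w \<or> w \<subseteq> x" for x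
 proof (cases "w \<subseteq> x")
  case True
  thus ?thesis using h(2)[OF wQ(1)] by blast
 next
  case False
  hence "x \<subseteq> w" "x ~= w" using x(2) by blast+
  hence "x \<in> ?P0" using w(2)[of x] x(1) by blast
  hence "x \<in> Q" "h x = x" by blast+
  thus ?thesis using h(4)[OF \<open>x \<in> Q\<close> wQ(1) \<open>x \<subseteq> w\<close>] by simp
 qed
 ultimately show "\<exists>w\<in>P' - ?P0. \<exists>m\<in>P'. m ~= w & (\<forall>x\<in>P'. x \<subseteq> w \<or> w \<subseteq> x --> x \<subseteq> m \<or> m \<subseteq> x)"
  using w(1) wQ(2) by blast
qed blast

lemma chain_sum_retract_up:
 assumes fin: "finite Q" and h: "!!W. W \<in> Q ==> h W \<in> Q" "!!W. W \<in> Q ==> W \<subseteq> h W"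
  "!!W. W \<in> Q ==> h (h W) = h W" "!!V W. V \<in> Q ==> W \<in> Q ==> V \<subseteq> W ==> h V \<subseteq> h W"
 shows "chain_sum Q = chain_sum {W \<in> Q. h W = W}"
proof (rule chain_sum_dismantle[OF fin])
 let ?P0 = "{W \<in> Q. h W = W}"
 fix P' assume P': "?P0 \<subseteq> P'" "P' \<subseteq> Q" "P' ~= ?P0"
 hence ne: "P' - ?P0 ~= {}" and f: "finite (P' - ?P0)" using fin finite_subset by blast+
 obtain w where w0: "w \<in> P' - ?P0" "\<forall>b\<in>P' - ?P0. w \<subseteq> b --> w = b"
  using finite_has_maximal[OF f ne] by (rule bexE)
 note w = w0(1) w0(2)[rule_format]
 have wQ: "w \<in> Q" "h w ~= w" using w(1) P'(2) by blast+
 have "h w \<in> P'" using h(1,3)[OF wQ(1)] P'(1) by blast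
 moreover have "x \<subseteq> h w \<or> h w \<subseteq> x" if x: "x \<in> P'" "x \<subseteq> w \<or> w \<subseteq> x" for x
 proof (cases "x \<subseteq> w")
  case True
  thus ?thesis using h(2)[OF wQ(1)] by blast
 next
  case False
  hence "w \<subseteq> x" "x ~= w" using x(2) by blast+
  hence "x \<in> ?P0" using w(2)[of x] x(1) by blast
  hence "x \<in> Q" "h x = x" by blast+
  thus ?thesis using h(4)[OF wQ(1) \<open>x \<in> Q\<close> \<open>w \<subseteq> x\<close>] by simp
 qed
 ultimately show "\<exists>w\<in>P' - ?P0. \<exists>m\<in>P'. m ~= w & (\<forall>x\<in>P'. x \<subseteq> w \<or> w \<subseteq> x --> x \<subseteq> m \<or> m \<subseteq> x)"
  using w(1) wQ(2) by blast
qed blast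

section \<open>Unipotent elements\<close>

lemma funpow_binomial:
 fixes N T :: "(nat => 'a :: field) => nat => 'a"
 assumes V: "!!u v. u \<in> V ==> v \<in> V ==> u + v \<in> V" "!!v. v \<in> V ==> N v \<in> V"
  and N: "!!u v. u \<in> V ==> v \<in> V ==> N (u + v) = N u + N v" and T: "!!v. v \<in> V ==> T v = v + N v"
 shows "v \<in> V ==> (T ^^ m) v i = (\<Sum>j\<le>m. of_nat (m choose j) * (N ^^ j) v i)"
proof (induction m arbitrary: v)
 case (Suc m)
 define b where "b j = (N ^^ j) v i" for j
 have NV: "(N ^^ j) u \<in> V" if "u \<in> V" for j u using that by (induction j) (simp_all add: V)
 have Nadd: "(N ^^ j) (u + w) = (N ^^ j) u + (N ^^ j) w" if "u \<in> V" "w \<in> V" for j u w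
 proof (induction j)
  case (Suc j)
  show ?case unfolding funpow.simps comp_apply Suc.IH by (rule N[OF NV[OF that(1)] NV[OF that(2)]])
 qed simp
 have "(T ^^ Suc m) v i = (T ^^ m) (v + N v) i" using T[OF Suc.prems] by (simp add: funpow_swap1)
 also have "... = (\<Sum>j\<le>m. of_nat (m choose j) * (N ^^ j) (v + N v) i)"
  by (rule Suc.IH) (intro V Suc.prems)
 also have "... = (\<Sum>j\<le>m. of_nat (m choose j) * b j) + (\<Sum>j\<le>m. of_nat (m choose j) * b (Suc j))"
  unfolding Nadd[OF Suc.prems V(2)[OF Suc.prems]] b_def
  by (simp add: funpow_swap1 distrib_left sum.distrib)
 also have "(\<Sum>j\<le>m. of_nat (m choose j) * b j) = (\<Sum>j\<le>Suc m. of_nat (m choose j) * b j)"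
  by (simp add: binomial_eq_0)
 also have "... = b 0 + (\<Sum>j\<le>m. of_nat (m choose Suc j) * b (Suc j))" by (subst sum.atMost_Suc_shift) simp
 also have "... + (\<Sum>j\<le>m. of_nat (m choose j) * b (Suc j)) = b 0 + (\<Sum>j\<le>m. of_nat (Suc m choose Suc j) * b (Suc j))"
  by (simp add: sum.distrib distrib_right add_ac)
 also have "... = (\<Sum>j\<le>Suc m. of_nat (Suc m choose j) * b j)" by (subst sum.atMost_Suc_shift) simp
 finally show ?case by (simp only: b_def)
qed simp

text \<open>The inner binomial coefficients of q vanish in the field, so (1 + N)^q = 1 + N^q;
  iterating replaces q by its powers.\<close>

lemma funpow_card_field_power:
 fixes N T :: "(nat => 'a :: {field, finite}) => nat => 'a"
 assumes V: "!!u v. u \<in> V ==> v \<in> V ==> u + v \<in> V" "!!v. v \<in> V ==> N v \<in> V"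
  and N: "!!u v. u \<in> V ==> v \<in> V ==> N (u + v) = N u + N v" and T: "!!v. v \<in> V ==> T v = v + N v"
 shows "v \<in> V ==> (T ^^ (CARD('a) ^ k)) v = v + (N ^^ (CARD('a) ^ k)) v"
proof (induction k arbitrary: v)
 case 0
 thus ?case using T by simp
next
 case (Suc k)
 let ?q = "CARD('a)"
 let ?N = "N ^^ (?q ^ k)" and ?T = "T ^^ (?q ^ k)"
 have q: "?q > 1" by (rule card_field_gt_1)
 have NV: "(N ^^ j) u \<in> V" if "u \<in> V" for j u using that by (induction j) (simp_all add: V)
 have Nadd: "(N ^^ j) (u + w) = (N ^^ j) u + (N ^^ j) w" if "u \<in> V" "w \<in> V" for j u w
 proof (induction j)
  case (Suc j)
  show ?case unfolding funpow.simps comp_apply Suc.IH by (rule N[OF NV[OF that(1)] NV[OF that(2)]])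
 qed simp
 have "(?T ^^ ?q) v = v + (?N ^^ ?q) v"
 proof
  fix i
  have "(?T ^^ ?q) v i = (\<Sum>j\<le>?q. of_nat (?q choose j) * (?N ^^ j) v i)"
  proof (rule funpow_binomial[where V = V])
   show "u + w \<in> V" if "u \<in> V" "w \<in> V" for u w by (rule V(1)[OF that])
   show "?N u \<in> V" if "u \<in> V" for u by (rule NV[OF that])
   show "?N (u + w) = ?N u + ?N w" if "u \<in> V" "w \<in> V" for u w by (rule Nadd[OF that])
   show "?T u = u + ?N u" if "u \<in> V" for u by (rule Suc.IH[OF that])
  qed (rule Suc.prems)
  also have "... = (\<Sum>j\<in>{0, ?q}. of_nat (?q choose j) * (?N ^^ j) v i)"
   by (rule sum.mono_neutral_right) (auto simp: of_nat_choose_card_field)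
  also have "... = v i + (?N ^^ ?q) v i" using q by simp
  finally show "(?T ^^ ?q) v i = (v + (?N ^^ ?q) v) i" by simp
 qed
 thus ?case by (simp add: funpow_mult mult.commute)
qed

text \<open>As p^k divides q^k, the power Y^(q^k) is 1, while it also equals 1 + (Y -
  1)^(q^k).\<close>

lemma unipotent_nilpotent:
 fixes Y :: "'a :: {field, finite} mat"
 assumes Y: "Y \<in> carrier (Sp TYPE('a) n)" and pw: "Y [^]\<^bsub>Sp TYPE('a) n\<^esub> (p ^ k) = 1\<^sub>m (2 * n)"
  and p: "p dvd CARD('a)" and v: "v \<in> FV (2 * n)"
 shows "((%f. opm (2 * n) Y f - f) ^^ (CARD('a) ^ k)) v = 0"
proof -
 have c: "Y \<in> carrier_mat (2 * n) (2 * n)" using Y by (simp add: carrier_Sp spm_def)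
 have diff: "f - g \<in> FV (2 * n)" if "f \<in> FV (2 * n)" "g \<in> FV (2 * n)" for f g :: "nat => 'a"
  using that by (auto simp: FV_def)
 interpret G: group "Sp TYPE('a) n" by (rule group_Sp)
 obtain d where d: "CARD('a) ^ k = p ^ k * d" using dvd_power_same[OF p, of k] by (elim dvdE)
 have "Y [^]\<^bsub>Sp TYPE('a) n\<^esub> (CARD('a) ^ k) = (Y [^]\<^bsub>Sp TYPE('a) n\<^esub> (p ^ k)) [^]\<^bsub>Sp TYPE('a) n\<^esub> d"
  unfolding d by (rule G.nat_pow_pow[OF Y, symmetric])
 also have "... = 1\<^sub>m (2 * n)" unfolding pw using G.nat_pow_one[of d] by simp
 finally have "(opm (2 * n) Y ^^ (CARD('a) ^ k)) v = v"
  using opm_pow[OF Y v, of "CARD('a) ^ k"] opm_one[OF v] by simp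
 moreover have "(opm (2 * n) Y ^^ (CARD('a) ^ k)) v = v + ((%f. opm (2 * n) Y f - f) ^^ (CARD('a) ^ k)) v"
  by (rule funpow_card_field_power[where V = "FV (2 * n)"])
   (simp_all add: FV_closed diff opm_FV[OF c] opm_add[OF c] v)
 ultimately show ?thesis by simp
qed

text \<open>Nilpotence of Y - 1 keeps both retractions inside nonzero subspaces, commutation with Y
  keeps them invariant under S, and invariance of the form makes im (Y - 1) orthogonal to K, so that
  adding K Int im (Y - 1) preserves isotropy inside K. Afterwards that subspace is least and the
  poset is a cone.\<close>

lemma chain_sum_unipotent:
 fixes Y :: "'a :: {field, finite} mat"
 assumes S: "S \<subseteq> carrier (Sp TYPE('a) n)" "Y \<in> S" and comm: "!!B. B \<in> S ==> B * Y = Y * B"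
  and pw: "Y [^]\<^bsub>Sp TYPE('a) n\<^esub> (p ^ k) = 1\<^sub>m (2 * n)" and p: "p dvd CARD('a)" and Y1: "Y ~= 1\<^sub>m (2 * n)"
 shows "chain_sum (fixF n S) = 0"
proof -
 let ?V = "FV (2 * n) :: (nat => 'a) set" and ?o = "opm (2 * n)"
 have YC: "Y \<in> carrier (Sp TYPE('a) n)" using S by blast
 have cm: "B \<in> carrier_mat (2 * n) (2 * n)" if "B \<in> S" for B using S(1) that by (auto simp: carrier_Sp spm_def)
 have cY: "Y \<in> carrier_mat (2 * n) (2 * n)" by (rule cm[OF S(2)])
 have isoB: "omf n (?o B f) (?o B g) = omf n f g" if "B \<in> S" "f \<in> ?V" "g \<in> ?V" for B f g
  using S(1) that by (auto simp: carrier_Sp spm_def)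
 define N where "N f = ?o Y f - f" for f
 define K where "K = {f \<in> ?V. N f = 0}"
 define R where "R = {f \<in> K. \<exists>g\<in>?V. f = N g}"
 have neg: "- f = scf (- 1) f" for f :: "nat => 'a" by (rule ext) (simp add: scf_def)
 have diff: "f - g \<in> ?V" if "f \<in> ?V" "g \<in> ?V" for f g using that by (auto simp: FV_def)
 have NV: "N f \<in> ?V" if "f \<in> ?V" for f unfolding N_def by (rule diff[OF opm_FV[OF cY] that])
 have Nadd: "N (f + g) = N f + N g" for f g unfolding N_def opm_add[OF cY] by simp
 have Nsc: "N (scf a f) = scf a (N f)" for a f
  unfolding N_def opm_scf[OF cY] by (rule ext) (simp add: scf_def right_diff_distrib)
 have N0: "N 0 = 0" using Nadd[of 0 0] by (metis add.right_neutral add_left_cancel)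
 have NB: "N (?o B f) = ?o B (N f)" if "B \<in> S" for B f
 proof -
  have "?o Y (?o B f) = ?o B (?o Y f)"
   using opm_mult[OF cY cm[OF that], of f] opm_mult[OF cm[OF that] cY, of f] comm[OF that] by simp
  moreover have "?o B (?o Y f - f) = ?o B (?o Y f) - ?o B f"
   unfolding diff_conv_add_uminus neg opm_add[OF cm[OF that]] opm_scf[OF cm[OF that]] ..
  ultimately show ?thesis by (simp add: N_def)
 qed
 have nil: "(N ^^ (CARD('a) ^ k)) f = 0" if "f \<in> ?V" for f
  using unipotent_nilpotent[OF YC pw p that] unfolding N_def[abs_def] .
 have last: "EX i. (N ^^ i) f ~= 0 & (N ^^ Suc i) f = 0" if f: "f \<in> ?V" "f ~= 0" for f
 proof -
  define j where "j = (LEAST j. (N ^^ j) f = 0)"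
  have j: "(N ^^ j) f = 0" unfolding j_def by (rule LeastI[of _ "CARD('a) ^ k"]) (rule nil[OF f(1)])
  hence "j ~= 0" using f(2) by (intro notI) simp
  then obtain i where i: "j = Suc i" using not0_implies_Suc by blast
  have "(N ^^ i) f ~= 0" using not_less_Least[of i "%j. (N ^^ j) f = 0"] i by (simp add: j_def[symmetric])
  thus ?thesis using j i by blast
 qed
 have NnV: "(N ^^ i) f \<in> ?V" if "f \<in> ?V" for i f using that by (induction i) (simp_all add: NV)
 \<comment> \<open>For g fixed by Y the values om (Y f) g and om f g agree, because the first is om
   (Y f) (Y g).\<close>
 have orth: "omf n (N f) g = 0" if "f \<in> ?V" "g \<in> K" for f g
 proof -
  have g: "g \<in> ?V" "?o Y g = g" using that(2) by (simp_all add: K_def N_def)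
  have "omf n (?o Y f - f) g = omf n (?o Y f) g - omf n f g"
   unfolding diff_conv_add_uminus neg omf_addl omf_scf by simp
  also have "omf n (?o Y f) g = omf n f g" using isoB[OF S(2) that(1) g(1)] g(2) by simp
  finally show ?thesis unfolding N_def by (simp only: diff_self)
 qed
 have KB: "?o B f \<in> K" if "B \<in> S" "f \<in> K" for B f
  using that NB[OF that(1), of f] opm_FV[OF cm[OF that(1)], of f] opm_scf[OF cm[OF that(1)], of 0 0]
  by (auto simp: K_def) (metis add.right_neutral add_left_cancel opm_add[OF cm[OF that(1)]])
 have RE: "\<exists>g\<in>?V. f = N g" "f \<in> K" if "f \<in> R" for f using that unfolding R_def by blast+
 have RI: "N g \<in> R" if "g \<in> ?V" "N g \<in> K" for g using that unfolding R_def by blast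
 have RB: "?o B f \<in> R" if B: "B \<in> S" and f: "f \<in> R" for B f
 proof -
  obtain g where g: "g \<in> ?V" "f = N g" using RE(1)[OF f] by (rule bexE)
  have e: "?o B f = N (?o B g)" using NB[OF B, of g] g(2) by simp
  show ?thesis using RI[OF opm_FV[OF cm[OF B]], of g] KB[OF B RE(2)[OF f]] unfolding e by simp
 qed
 have RK: "R \<subseteq> K" and KV: "K \<subseteq> ?V" by (auto simp: R_def K_def)
 have Kcl: "0 \<in> K" "!!f g. f \<in> K ==> g \<in> K ==> f + g \<in> K" "!!a f. f \<in> K ==> scf a f \<in> K"
 proof -
  show "0 \<in> K" using FV_closed(1)[of "2 * n"] N0 by (simp add: K_def)
  show "f + g \<in> K" if "f \<in> K" "g \<in> K" for f g using that FV_closed(2)[of f "2 * n" g] by (simp add: K_def Nadd)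
  show "scf a f \<in> K" if "f \<in> K" for a f
  proof -
   have "scf a 0 = (0 :: nat => 'a)" by (rule ext) (simp add: scf_def)
   thus ?thesis using that FV_closed(3)[of f "2 * n" a] by (simp add: K_def Nsc)
  qed
 qed
 have Rcl: "0 \<in> R" "!!f g. f \<in> R ==> g \<in> R ==> f + g \<in> R" "!!a f. f \<in> R ==> scf a f \<in> R"
 proof -
  show "0 \<in> R" using RI[OF FV_closed(1)] unfolding N0 using Kcl(1) by simp
  show "f + g \<in> R" if fg: "f \<in> R" "g \<in> R" for f g
  proof -
   obtain f' where f': "f' \<in> ?V" "f = N f'" using RE(1)[OF fg(1)] by (rule bexE)
   obtain g' where g': "g' \<in> ?V" "g = N g'" using RE(1)[OF fg(2)] by (rule bexE)
   have e: "f + g = N (f' + g')" unfolding f'(2) g'(2) by (rule Nadd[symmetric])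
   show ?thesis unfolding e
    by (rule RI[OF FV_closed(2)[OF f'(1) g'(1)]]) (use Kcl(2)[OF RE(2)[OF fg(1)] RE(2)[OF fg(2)]] in \<open>simp only: e\<close>)
  qed
  show "scf a f \<in> R" if f: "f \<in> R" for a f
  proof -
   obtain f' where f': "f' \<in> ?V" "f = N f'" using RE(1)[OF f] by (rule bexE)
   have e: "scf a f = N (scf a f')" unfolding f'(2) by (rule Nsc[symmetric])
   show ?thesis unfolding e
    by (rule RI[OF FV_closed(3)[OF f'(1)]]) (use Kcl(3)[OF RE(2)[OF f], of a] in \<open>simp only: e\<close>)
  qed
 qed
 have fixI: "M \<in> fixF n S"
  if "M \<subseteq> ?V" "0 \<in> M" "!!f g. f \<in> M ==> g \<in> M ==> f + g \<in> M" "!!a f. f \<in> M ==> scf a f \<in> M" "M ~= {0}"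
   "!!f g. f \<in> M ==> g \<in> M ==> omf n f g = 0" "!!B f. B \<in> S ==> f \<in> M ==> ?o B f \<in> M" for M
 proof -
  have "?o B ` M = M" if B: "B \<in> S" for B
  proof (rule endo_inj_surj)
   show "finite M" using \<open>M \<subseteq> ?V\<close> finite_FV finite_subset by blast
   show "?o B ` M \<subseteq> M" using \<open>!!B f. B \<in> S ==> f \<in> M ==> ?o B f \<in> M\<close>[OF B] by blast
   have "B \<in> carrier (Sp TYPE('a) n)" using S(1) B by blast
   thus "inj_on (?o B) M" using inj_on_subset[OF inj_opm \<open>M \<subseteq> ?V\<close>] by blast
  qed
  moreover have "M \<in> isoF n" unfolding isoF_def using that by simp
  ultimately show ?thesis by (simp add: fixF_def)
 qed
 have fixD: "M \<in> isoF n" "!!B f. B \<in> S ==> f \<in> M ==> ?o B f \<in> M" if "M \<in> fixF n S" for M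
  using that unfolding fixF_def by blast+
 have fin: "finite (fixF n S)" by (rule finite_subset[OF _ finite_isoF]) (auto simp: fixF_def)
 define Q1 where "Q1 = {W \<in> fixF n S. W Int K = W}"
 have 1: "chain_sum (fixF n S) = chain_sum Q1"
  unfolding Q1_def
 proof (rule chain_sum_retract_down[OF fin])
  fix W assume W: "W \<in> fixF n S"
  note D = isoFD[OF fixD(1)[OF W]]
  have "N f \<in> W" if "f \<in> W" for f
  proof -
   have "N f = ?o Y f + scf (- 1) f" unfolding N_def neg[symmetric] by simp
   thus ?thesis using D(3)[OF fixD(2)[OF W S(2) that] D(4)[OF that]] by simp
  qed
  hence NW: "(N ^^ i) f \<in> W" if "f \<in> W" for i f using that by (induction i) simp_all
  obtain f where f: "f \<in> W" "f ~= 0" using D(2,5) by blast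
  \<comment> \<open>The last nonzero iterate of N at f stays in W and is killed by N, so W meets
    K.\<close>
  obtain i where i: "(N ^^ i) f ~= 0" "(N ^^ Suc i) f = 0" using last[of f] f D(1) by blast
  have "(N ^^ i) f \<in> W Int K" using NW[OF f(1), of i] i(2) D(1) by (auto simp: K_def)
  hence "W Int K ~= {0}" using i(1) by blast
  show "W Int K \<in> fixF n S"
  proof (rule fixI)
   show "W Int K \<subseteq> ?V" "0 \<in> W Int K" using D(1,2) Kcl(1) by blast+
   show "W Int K ~= {0}" by (rule \<open>W Int K ~= {0}\<close>)
  next
   fix f g assume fg: "f \<in> W Int K" "g \<in> W Int K"
   thus "f + g \<in> W Int K" using D(3)[of f g] Kcl(2)[of f g] by simp
   show "omf n f g = 0" using D(6)[of f g] fg by simp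
  next
   fix a f assume "f \<in> W Int K"
   thus "scf a f \<in> W Int K" using D(4)[of f a] Kcl(3)[of f a] by simp
  next
   fix B f assume "B \<in> S" "f \<in> W Int K"
   thus "?o B f \<in> W Int K" using KB[of B f] fixD(2)[OF W, of B f] by simp
  qed
 qed blast+
 have Q1D: "W \<in> fixF n S" "W \<subseteq> K" if "W \<in> Q1" for W using that by (auto simp: Q1_def)
 define h where "h W = {f + g |f g. f \<in> W & g \<in> R}" for W
 have Riso: "omf n f g = 0" "omf n g f = 0" if fg: "f \<in> R" "g \<in> K" for f g
 proof -
  obtain f' where f': "f' \<in> ?V" "f = N f'" using RE(1)[OF fg(1)] by (rule bexE)
  show "omf n f g = 0" unfolding f'(2) by (rule orth[OF f'(1) fg(2)])
  thus "omf n g f = 0" using omf_skew[of n f g] by simp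
 qed
 \<comment> \<open>The same argument started at some N f with N f not 0: the last nonzero iterate
   lies in the kernel and in the image of N.\<close>
 obtain r where r: "r \<in> R" "r ~= 0"
 proof -
  have "\<exists>f\<in>?V. N f ~= 0"
  proof (rule ccontr)
   assume h: "\<not> ?thesis"
   have "Y = 1\<^sub>m (2 * n)"
   proof (rule opm_inject[of _ "2 * n"])
    fix f :: "nat => 'a" assume f: "f \<in> ?V"
    hence "?o Y f - f = 0" using h unfolding N_def by blast
    thus "?o Y f = ?o (1\<^sub>m (2 * n)) f" using opm_one[OF f] by simp
   qed (use cY in auto)
   thus False using Y1 by blast
  qed
  then obtain f where f: "f \<in> ?V" "N f ~= 0" by blast
  obtain i where i: "(N ^^ i) (N f) ~= 0" "(N ^^ Suc i) (N f) = 0" using last[OF NV[OF f(1)] f(2)] by blast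
  have "(N ^^ i) (N f) = N ((N ^^ i) f)" by (simp add: funpow_swap1)
  moreover have "(N ^^ i) (N f) \<in> K" using i(2) NnV[OF NV[OF f(1)], of i] by (simp add: K_def)
  ultimately have "(N ^^ i) (N f) \<in> R" using NnV[OF f(1), of i] unfolding R_def by blast
  thus ?thesis using that i(1) by blast
 qed
 have RQ: "R \<in> Q1"
 proof -
  have "R \<in> fixF n S"
  proof (rule fixI)
   show "R \<subseteq> ?V" using RK KV by blast
   show "0 \<in> R" by (rule Rcl(1))
   show "R ~= {0}" using r by blast
   show "f + g \<in> R" if "f \<in> R" "g \<in> R" for f g by (rule Rcl(2)[OF that])
   show "scf a f \<in> R" if "f \<in> R" for a f by (rule Rcl(3)[OF that])
   show "omf n f g = 0" if "f \<in> R" "g \<in> R" for f g by (rule Riso(1)[OF that(1) RE(2)[OF that(2)]])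
   show "?o B f \<in> R" if "B \<in> S" "f \<in> R" for B f by (rule RB[OF that])
  qed
  thus ?thesis using RK by (auto simp: Q1_def)
 qed
 have sub: "W \<subseteq> h W" "R \<subseteq> h W" if "W \<in> Q1" for W
 proof -
  have "0 \<in> W" using isoFD(2)[OF fixD(1)[OF Q1D(1)[OF that]]] .
  thus "R \<subseteq> h W" unfolding h_def using add_0_left by (metis (mono_tags, lifting) mem_Collect_eq subsetI)
  show "W \<subseteq> h W" unfolding h_def using Rcl(1) add_0_right by (metis (mono_tags, lifting) mem_Collect_eq subsetI)
 qed
 have finQ1: "finite Q1" using fin unfolding Q1_def by simp
 have fix_iff: "h W = W \<longleftrightarrow> R \<subseteq> W" if W: "W \<in> Q1" for W
 proof
  assume "R \<subseteq> W"
  hence "h W \<subseteq> W" unfolding h_def using isoFD(3)[OF fixD(1)[OF Q1D(1)[OF W]]] by blast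
  thus "h W = W" using sub(1)[OF W] by blast
 qed (use sub(2)[OF W] in blast)
 have hQ: "h W \<in> Q1" if W: "W \<in> Q1" for W
 proof -
  note D = isoFD[OF fixD(1)[OF Q1D(1)[OF W]]] and WK = Q1D(2)[OF W]
  have hK: "h W \<subseteq> K" unfolding h_def using WK RK Kcl(2) by blast
  have "h W \<in> fixF n S"
  proof (rule fixI)
   show "h W \<subseteq> ?V" using hK KV by blast
   show "0 \<in> h W" using sub(1)[OF W] D(2) by blast
   show "h W ~= {0}" using sub(2)[OF W] r by blast
  next
   fix f g assume "f \<in> h W" "g \<in> h W"
   then obtain a b c d where e: "f = a + b" "g = c + d" "a \<in> W" "b \<in> R" "c \<in> W" "d \<in> R" unfolding h_def by blast
   have "f + g = (a + c) + (b + d)" unfolding e by (simp add: add_ac)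
   thus "f + g \<in> h W" unfolding h_def using D(3)[OF e(3,5)] Rcl(2)[OF e(4,6)] by blast
   have "omf n f g = omf n a g + omf n b g" unfolding e(1) by (rule omf_addl)
   also have "omf n b g = 0" using Riso(1)[OF e(4)] hK \<open>g \<in> h W\<close> by blast
   also have "omf n a g = - omf n g a" by (rule omf_skew)
   also have "omf n g a = omf n c a + omf n d a" unfolding e(2) by (rule omf_addl)
   also have "omf n c a = 0" by (rule D(6)[OF e(5,3)])
   also have "omf n d a = 0" using Riso(1)[OF e(6)] WK e(3) by blast
   finally show "omf n f g = 0" by simp
  next
   fix a f assume "f \<in> h W"
   then obtain b c where e: "f = b + c" "b \<in> W" "c \<in> R" unfolding h_def by blast
   have "scf a f = scf a b + scf a c" unfolding e(1) by (rule ext) (simp add: scf_def distrib_left)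
   thus "scf a f \<in> h W" unfolding h_def using D(4)[OF e(2)] Rcl(3)[OF e(3)] by blast
  next
   fix B f assume B: "B \<in> S" and "f \<in> h W"
   then obtain b c where e: "f = b + c" "b \<in> W" "c \<in> R" unfolding h_def by blast
   have "?o B f = ?o B b + ?o B c" unfolding e(1) by (rule opm_add[OF cm[OF B]])
   thus "?o B f \<in> h W" unfolding h_def using fixD(2)[OF Q1D(1)[OF W] B e(2)] RB[OF B e(3)] by blast
  qed
  thus ?thesis using hK unfolding Q1_def by blast
 qed
 have "chain_sum Q1 = chain_sum {W \<in> Q1. h W = W}"
 proof (rule chain_sum_retract_up[OF finQ1 hQ sub(1)])
  show "h (h W) = h W" if "W \<in> Q1" for W using fix_iff[OF hQ[OF that]] sub(2)[OF that] by blast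
  show "h V \<subseteq> h W" if "V \<subseteq> W" for V W using that unfolding h_def by blast
 qed
 also have "... = 0"
 proof (rule chain_sum_cone[where m = R])
  show "finite {W \<in> Q1. h W = W}" using finQ1 by simp
  show "R \<in> {W \<in> Q1. h W = W}" using RQ fix_iff[OF RQ] by blast
  show "W \<subseteq> R \<or> R \<subseteq> W" if "W \<in> {W \<in> Q1. h W = W}" for W using that fix_iff by blast
 qed
 finally show ?thesis using 1 by simp
qed

lemma exp_fps_quotient_self: "exp_fps (Abs_fps (%n. if n = 0 then 0 else a n)) / exp_fps (Abs_fps (%n. if n = 0 then 0 else a n)) = 1"
proof -
 have "fps_nth (exp_fps (Abs_fps (%n. if n = 0 then 0 else a n))) 0 = 1" by (rule exp_fps_deriv(2)) simp
 hence "exp_fps (Abs_fps (%n. if n = 0 then 0 else a n)) ~= 0" by auto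
 thus ?thesis by simp
qed

text \<open>For one-entry tuples no order condition involves p, so p may be replaced by a prime not
  dividing q. For that prime both exponents in the quotient are sums with r = 0 and coincide, and
  the series is 1.\<close>

lemma sum_chain_sum_zero:
 assumes "n > 0"
 shows "(\<Sum>A\<in>carrier (Sp TYPE('a :: {field, finite}) n). chain_sum (fixF n {A})) = 0"
proof -
 have q1: "CARD('a) + 1 ~= 1" by simp
 \<comment> \<open>A prime divisor of q + 1 is invertible in the field, since q + 1 is 1
   there.\<close>
 obtain p where p: "Factorial_Ring.prime p" "p dvd CARD('a) + 1" using prime_factor_nat[OF q1] by blast
 have pinv: "of_nat p ~= (0 :: 'a)"
 proof
  assume z: "of_nat p = (0 :: 'a)"
  obtain m where "CARD('a) + 1 = p * m" using p(2) by (elim dvdE)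
  hence "of_nat (CARD('a) + 1) = (of_nat p * of_nat m :: 'a)" by (metis of_nat_mult)
  thus False using z of_nat_card_field[where 'a = 'a] by simp
 qed
 have "F_Sp TYPE('a) p (0 + 1) = 1"
  unfolding main_coprime[OF p(1) refl pinv] power_0 by (rule exp_fps_quotient_self)
 hence "fps_nth (F_Sp TYPE('a) p 1) n = 0" using assms by simp
 hence e: "equivariant_euler_char TYPE('a) p 1 n = 0" using assms by (simp add: F_Sp_def)
 interpret G: group "Sp TYPE('a) n" by (rule group_Sp)
 let ?C = "carrier (Sp TYPE('a) n)"
 have "commuting_tuples (Sp TYPE('a) n) p 1 = (%A. [A]) ` ?C"
  by (auto simp: commuting_tuples_def length_Suc_conv)
 hence "(\<Sum>Xs\<in>commuting_tuples (Sp TYPE('a) n) p 1. (of_int (reduced_euler_char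
   (fixed_subposet (isotropic_subspaces TYPE('a) n) (generate (Sp TYPE('a) n) (set Xs)))) :: rat)) =
  (\<Sum>A\<in>?C. of_int (reduced_euler_char
   (fixed_subposet (isotropic_subspaces TYPE('a) n) (generate (Sp TYPE('a) n) {A}))))"
  by (simp add: sum.reindex inj_on_def)
 also have "... = (\<Sum>A\<in>?C. of_int (- chain_sum (fixF n {A})))"
  by (rule sum.cong[OF refl]) (simp add: euler_fixF)
 also have "... = of_int (- (\<Sum>A\<in>?C. chain_sum (fixF n {A})))" by (simp add: sum_negf)
 finally have "of_int (- (\<Sum>A\<in>?C. chain_sum (fixF n {A}))) / of_nat (order (Sp TYPE('a) n)) = (0 :: rat)"
  using e unfolding equivariant_euler_char_def by simp
 moreover have "order (Sp TYPE('a) n) ~= 0"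
 proof -
  have "?C ~= {}" using G.one_closed by blast
  thus ?thesis by (simp add: finite_Sp order_def)
 qed
 ultimately have "(of_int (- (\<Sum>A\<in>?C. chain_sum (fixF n {A}))) :: rat) = 0" by simp
 thus ?thesis by (simp only: of_int_eq_0_iff neg_equal_0_iff_equal)
qed

text \<open>In defining characteristic only the tuples with trivial \<open>p\<close>-part contribute, and their sum does not
 depend on \<open>p\<close>.\<close>

lemma equivariant_euler_defining_char:
 assumes p: "Factorial_Ring.prime p" "of_nat p = (0 :: 'a :: {field, finite})" and n: "n > 0"
 shows "equivariant_euler_char TYPE('a) p (r + 1) n = 0"
proof -
 have pq: "p dvd CARD('a)"
 proof (rule ccontr)
  assume "\<not> p dvd CARD('a)"
  \<comment> \<open>Bezout would then express 1 through p and q, both of which are zero in the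
    field.\<close>
  hence "coprime p CARD('a)" using prime_imp_coprime[OF p(1)] by blast
  then obtain x y where "p * x = CARD('a) * y + 1"
   using coprime_bezout_strong[of p "CARD('a)"] card_field_gt_1[where 'a = 'a] by auto
  hence "of_nat p * of_nat x = (of_nat CARD('a) * of_nat y + 1 :: 'a)" by (metis of_nat_1 of_nat_add of_nat_mult)
  thus False using p(2) of_nat_card_field[where 'a = 'a] by simp
 qed
 interpret G: group "Sp TYPE('a) n" by (rule group_Sp)
 let ?G = "Sp TYPE('a) n" and ?I = "1\<^sub>m (2 * n) :: 'a mat"
 define CT where "CT = commuting_tuples ?G p (r + 1)"
 have finCT: "finite CT"
  by (rule finite_subset[OF _ finite_lists_length_eq[OF finite_Sp[of "TYPE('a)" n], of "r + 1"]])
   (auto simp: CT_def commuting_tuples_def)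
 have sub: "set Xs \<subseteq> carrier ?G" if "Xs \<in> CT" for Xs using that by (auto simp: CT_def commuting_tuples_def)
 define E where "E = (%A. A # replicate r ?I) ` carrier ?G"
 have I: "?I \<in> carrier ?G" using G.one_closed by simp
 have E: "E \<subseteq> CT"
 proof
  fix Xs assume "Xs \<in> E"
  then obtain A where A: "A \<in> carrier ?G" "Xs = A # replicate r ?I" by (auto simp: E_def)
  have "A * ?I = ?I * A" using G.l_one[OF A(1)] G.r_one[OF A(1)] by simp
  moreover have "EX k. G.ord ?I = p ^ k"
  proof -
   have "G.ord ?I = p ^ 0" using G.ord_eq_1[OF I] by simp
   thus ?thesis by blast
  qed
  ultimately show "Xs \<in> CT" using A I unfolding CT_def commuting_tuples_def by (auto simp: set_replicate_conv_if)
 qed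
 have zero: "chain_sum (fixF n (set Xs)) = 0" if Xs: "Xs \<in> CT - E" for Xs
 proof -
  have h: "length Xs = r + 1" "!!A B. A \<in> set Xs ==> B \<in> set Xs ==> A * B = B * A"
   "!!A. A \<in> set (tl Xs) ==> EX k. G.ord A = p ^ k"
   using Xs by (auto simp: CT_def commuting_tuples_def)
  have "\<exists>Y\<in>set (tl Xs). Y ~= ?I"
  proof (rule ccontr)
   assume c: "\<not> ?thesis"
   obtain A Ys where X: "Xs = A # Ys" using h(1) by (cases Xs) auto
   have "Ys = replicate r ?I" using c h(1) unfolding X by (intro replicate_eqI) auto
   hence "Xs \<in> E" using sub[of Xs] Xs unfolding E_def X by auto
   thus False using Xs by blast
  qed
  then obtain Y where Y: "Y \<in> set (tl Xs)" "Y ~= ?I" by blast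
  have YX: "Y \<in> set Xs" using Y(1) by (cases Xs) auto
  hence YC: "Y \<in> carrier ?G" using sub Xs by blast
  obtain k where "G.ord Y = p ^ k" using h(3)[OF Y(1)] by blast
  hence pw: "Y [^]\<^bsub>?G\<^esub> (p ^ k) = ?I" using G.pow_ord_eq_1[OF YC] by simp
  have "Xs \<in> CT" using Xs by blast
  thus ?thesis
   by (rule chain_sum_unipotent[OF sub YX h(2)[OF _ YX] pw pq Y(2)])
 qed
 have fixE: "fixF n (set (A # replicate r ?I)) = fixF n {A}" for A
 proof -
  have "(\<forall>B\<in>set (A # replicate r ?I). opm (2 * n) B ` M = M) \<longleftrightarrow> (\<forall>B\<in>{A}. opm (2 * n) B ` M = M)"
   if "M \<in> isoF n" for M
   using opm_one_image[OF isoFD(1)[OF that]] by (simp add: set_replicate_conv_if)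
  thus ?thesis unfolding fixF_def by (intro Collect_cong conj_cong refl)
 qed
 have "(\<Sum>Xs\<in>CT. chain_sum (fixF n (set Xs))) = (\<Sum>Xs\<in>E. chain_sum (fixF n (set Xs)))"
  by (rule sum.mono_neutral_right[OF finCT E]) (use zero in blast)
 also have "... = (\<Sum>A\<in>carrier ?G. chain_sum (fixF n (set (A # replicate r ?I))))"
  unfolding E_def by (subst sum.reindex) (simp_all add: inj_on_def)
 also have "... = 0" unfolding fixE by (rule sum_chain_sum_zero[OF n])
 finally have 0: "(\<Sum>Xs\<in>CT. chain_sum (fixF n (set Xs))) = 0" .
 have "(\<Sum>Xs\<in>CT. (of_int (reduced_euler_char
   (fixed_subposet (isotropic_subspaces TYPE('a) n) (generate ?G (set Xs)))) :: rat)) =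
  (\<Sum>Xs\<in>CT. of_int (- chain_sum (fixF n (set Xs))))"
  by (rule sum.cong[OF refl]) (simp only: euler_fixF[OF sub])
 also have "... = of_int (- (\<Sum>Xs\<in>CT. chain_sum (fixF n (set Xs))))" by (simp add: sum_negf)
 finally show ?thesis unfolding equivariant_euler_char_def CT_def[symmetric] 0 by simp
qed

theorem theorem1p4:
  fixes p q r :: nat
  assumes "Factorial_Ring.prime p"
    and "CARD('a :: {field, finite}) = q"
  shows "F_Sp TYPE('a) p (r + 1) =
    exp_fps (Abs_fps (\<lambda>n. if n = 0 then 0 else of_nat (p_part p (q ^ n + 1) ^ r) / of_nat (2 * n))) /
    exp_fps (Abs_fps (\<lambda>n. if n = 0 then 0 else of_nat (p_part p (q ^ n - 1) ^ r) / of_nat (2 * n)))"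
proof (cases "of_nat p = (0 :: 'a)")
  case False
  then show ?thesis by (rule main_coprime[OF assms])
next
  case True
  have "F_Sp TYPE('a) p (r + 1) = 1"
    using equivariant_euler_defining_char[OF assms(1) True, of _ r] unfolding F_Sp_def
    by (intro fps_ext) (simp add: fps_sub_nth)
  moreover have part: "p_part p m = 1" if "of_nat m \<noteq> (0 :: 'a)" for m
  proof -
    have "\<not> p dvd m"
    proof
      assume "p dvd m"
      then obtain k where "m = p * k" by (elim dvdE)
      then show False using True that by simp
    qed
    then show ?thesis by (simp add: p_part_def not_dvd_imp_multiplicity_0)
  qed
  \<comment> \<open>In the field the two numbers become 1 and -1, so p divides neither of them and
    the two exponents agree term by term.\<close>
  have "p_part p (q ^ n + 1) = 1" "p_part p (q ^ n - 1) = 1" if "n \<noteq> 0" for n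
  proof -
    have qn: "of_nat (q ^ n) = (0 :: 'a)" using of_nat_card_field[where 'a = 'a] assms(2) that by (simp add: zero_power)
    have e1: "of_nat (q ^ n + 1) = (1 :: 'a)" unfolding of_nat_add qn by simp
    show "p_part p (q ^ n + 1) = 1" by (rule part) (unfold e1, simp)
    have "q ^ n \<ge> 1" using assms(2) card_field_gt_1[where 'a = 'a] by simp
    then have e2: "of_nat (q ^ n - 1) = (- 1 :: 'a)" unfolding of_nat_diff[OF \<open>q ^ n \<ge> 1\<close>] qn by simp
    show "p_part p (q ^ n - 1) = 1" by (rule part) (unfold e2, simp)
  qed
  then have "(\<lambda>n. if n = 0 then 0 else of_nat (p_part p (q ^ n + 1) ^ r) / of_nat (2 * n) :: rat) =
      (\<lambda>n. if n = 0 then 0 else of_nat (p_part p (q ^ n - 1) ^ r) / of_nat (2 * n))" by auto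
  ultimately show ?thesis by (simp only: exp_fps_quotient_self)
qed

end
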